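(* Let $n\ge 1$ and let $r$ be an integer with $1\le r<2n$. Let $\rho\in \mathrm{Alg}(M_{r,2n-r})$ and let $\pi=i_{P_{r,2n-r}}^{G_{2n}}(\rho)$ be the normalized parabolically induced representation. Then $\pi_{N,\psi}$ is non-zero if and only if there exists an integer $k$ with $\max\{0,r-n\}\le k\le \lfloor \frac r2\rfloor$ such that $\rho_{N_k',\psi_k'}\ne 0$, where $N_k'$ is the subgroup of $M_{r,2n-r}$ consisting of the matrices $$n'=\begin{pmatrix} I_k & x & y & 0&0&0\\ 0&I_k&0&0&0&0\\ 0&0&I_{r-2k}&0&0&0\\ 0&0&0&I_{r-2k}&0&w\\ 0&0&0&0&I_{n-r+k}&z\\ 0&0&0&0&0&I_{n-r+k}\end{pmatrix}$$ with $x\in\mathcal M_k$, $y\in\mathcal M_{k,r-2k}$, $w\in\mathcal M_{r-2k,n-r+k}$, $z\in\mathcal M_{n-r+k}$, and $\psi_k'$ is the character of $N_k'$ defined by $\psi_k'(n')=\psi_0(\mathrm{tr}(x)+\mathrm{tr}(z))$.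
   Context: $F$ is a non-archimedean local field or a finite field; $\mathcal M_{m,n}$ is the space of $m\times n$ matrices over $F$, $\mathcal M_n=\mathcal M_{n,n}$, $G_n=GL_n(F)$; blocks of size $0$ are omitted. For an $\ell$-group $G$ (a locally compact Hausdorff group with a fundamental system of neighbourhoods of the identity consisting of open compact subgroups), $\mathrm{Alg}(G)$ is the category of smooth complex representations of $G$. $P_{r,2n-r}=M_{r,2n-r}N_{r,2n-r}$ is the standard block upper triangular parabolic subgroup of $G_{2n}$ of type $(r,2n-r)$ with its block diagonal Levi subgroup $M_{r,2n-r}$ and unipotent radical $N_{r,2n-r}$. $N=N_{n,n}=\left\{\begin{pmatrix} I_n&x\\0&I_n\end{pmatrix}:x\in\mathcal M_n\right\}$. $\psi_0$ is a fixed non-trivial additive character of $F$ and $\psi:N\to\mathbb C^\times$ is $\psi\begin{pmatrix} I_n&x\\0&I_n\end{pmatrix}=\psi_0(\mathrm{tr}(x))$. Normalized induction: for a closed subgroup $H$ of $G$ and $(\rho,W)\in\mathrm{Alg}(H)$, $i_H^G(\rho)$ is the right translation representation of $G$ on the smooth functions $f:G\to W$, compactly supported modulo $H$, with $f(hg)=\delta_G^{-1/2}(h)\delta_H^{1/2}(h)\rho(h)f(g)$ for $h\in H,g\in G$, where $\delta_G$ is the modular character: $\int_G f(g^{-1}ug)\,du=\delta_G(g)\int_G f(u)\,du$ (all modular characters are trivial if $F$ is finite). In $i_{P_{r,2n-r}}^{G_{2n}}(\rho)$, $\rho$ is extended to $P_{r,2n-r}$ trivially on $N_{r,2n-r}$.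 Twisted Jacquet module: for $(\pi,V)\in\mathrm{Alg}(G)$, a closed subgroup $U$ of $G$ that is a union of its compact open subgroups, and a character $\theta$ of $U$, $V_{U,\theta}=V/\langle \pi(u)v-\theta(u)v:u\in U,v\in V\rangle$; the resulting representation (of any closed subgroup normalizing $U$ and $\theta$) is denoted $\pi_{U,\theta}$. *)

theory Defs
  imports
    "Jordan_Normal_Form.Matrix"
    "HOL-Analysis.Abstract_Topological_Spaces"
    "HOL-Library.Function_Algebras"
begin

section \<open>The ground field\<close>

definition nonarch_abs :: "('f::field \<Rightarrow> real) \<Rightarrow> bool" where
  "nonarch_abs v \<longleftrightarrow>
     (\<forall>x. 0 \<le> v x) \<and> (\<forall>x. v x = 0 \<longleftrightarrow> x = 0) \<and>
     (\<forall>x y. v (x * y) = v x * v y) \<and> (\<forall>x y. v (x + y) \<le> max (v x) (v y)) \<and>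
     (\<exists>x. x \<noteq> 0 \<and> v x \<noteq> 1)"

definition nonarch_local_field :: "'f::{field,topological_space} itself \<Rightarrow> bool" where
  "nonarch_local_field TYPE('f) \<longleftrightarrow>
     (\<exists>v :: 'f \<Rightarrow> real. nonarch_abs v \<and>
        (\<forall>U :: 'f set. open U \<longleftrightarrow> (\<forall>x\<in>U. \<exists>e>0. \<forall>y. v (y - x) < e \<longrightarrow> y \<in> U))) \<and>
     locally_compact_space (euclidean :: 'f topology)"

definition finite_discrete_field :: "'f::{field,topological_space} itself \<Rightarrow> bool" where
  "finite_discrete_field TYPE('f) \<longleftrightarrow> finite (UNIV :: 'f set) \<and> (\<forall>U :: 'f set. open U)"

definition nontrivial_additive_character ::
    "('f::{field,topological_space} \<Rightarrow> complex) \<Rightarrow> bool" where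
  "nontrivial_additive_character \<psi> \<longleftrightarrow>
     (\<forall>x. \<psi> x \<noteq> 0) \<and> (\<forall>x y. \<psi> (x + y) = \<psi> x * \<psi> y) \<and> continuous_on UNIV \<psi> \<and>
     (\<exists>x. \<psi> x \<noteq> 1)"


section \<open>Haar integral and modular character\<close>

text \<open>A group is a monoid record G together with a topology T on its carrier; the notions below
  are meant for l-groups. Functions on a group are represented by functions on the whole
  element type vanishing outside the carrier.\<close>

definition restrict0 :: "'g set \<Rightarrow> ('g \<Rightarrow> 'v::zero) \<Rightarrow> 'g \<Rightarrow> 'v" where
  "restrict0 A f = (\<lambda>x. if x \<in> A then f x else 0)"

definition test_functions ::
    "('g,'m) monoid_scheme \<Rightarrow> 'g topology \<Rightarrow> ('g \<Rightarrow> real) set" where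
  "test_functions G T = {f.
     (\<forall>x. x \<notin> carrier G \<longrightarrow> f x = 0) \<and>
     (\<forall>x\<in>carrier G. \<exists>U. openin T U \<and> x \<in> U \<and> (\<forall>y\<in>U. f y = f x)) \<and>
     (\<exists>C. compactin T C \<and> (\<forall>x. x \<notin> C \<longrightarrow> f x = 0))}"

text \<open>On an l-group, integration against Haar measure amounts to a nonzero left invariant positive
  linear functional on the locally constant compactly supported functions.\<close>

definition haar_integral ::
    "('g,'m) monoid_scheme \<Rightarrow> 'g topology \<Rightarrow> (('g \<Rightarrow> real) \<Rightarrow> real) \<Rightarrow> bool" where
  "haar_integral G T I \<longleftrightarrow>
     (\<forall>f\<in>test_functions G T. \<forall>f'\<in>test_functions G T. I (\<lambda>x. f x + f' x) = I f + I f') \<and>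
     (\<forall>f\<in>test_functions G T. \<forall>c. I (\<lambda>x. c * f x) = c * I f) \<and>
     (\<forall>f\<in>test_functions G T. (\<forall>x. 0 \<le> f x) \<longrightarrow> 0 \<le> I f) \<and>
     (\<forall>f\<in>test_functions G T. \<forall>g\<in>carrier G.
        I (restrict0 (carrier G) (\<lambda>u. f (g \<otimes>\<^bsub>G\<^esub> u))) = I f) \<and>
     (\<exists>f\<in>test_functions G T. I f \<noteq> 0)"

text \<open>A right Haar integral would give the same character.\<close>

definition modular_char ::
    "('g,'m) monoid_scheme \<Rightarrow> 'g topology \<Rightarrow> 'g \<Rightarrow> real" where
  "modular_char G T g = (THE c. \<forall>I. haar_integral G T I \<longrightarrow>
     (\<forall>f\<in>test_functions G T.
        I (restrict0 (carrier G) (\<lambda>u. f (inv\<^bsub>G\<^esub> g \<otimes>\<^bsub>G\<^esub> u \<otimes>\<^bsub>G\<^esub> g))) = c * I f))"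


section \<open>Smooth representations, induction, twisted Jacquet modules\<close>

text \<open>The representation space is a subspace of an ambient complex vector space.\<close>

record ('g, 'v) rep =
  rep_scale :: "complex \<Rightarrow> 'v \<Rightarrow> 'v"
  rep_space :: "'v set"
  rep_act :: "'g \<Rightarrow> 'v \<Rightarrow> 'v"

definition smooth_rep ::
    "('g,'m) monoid_scheme \<Rightarrow> 'g topology \<Rightarrow> ('g,'v::ab_group_add) rep \<Rightarrow> bool" where
  "smooth_rep G T \<pi> \<longleftrightarrow>
     vector_space (rep_scale \<pi>) \<and> module.subspace (rep_scale \<pi>) (rep_space \<pi>) \<and>
     (\<forall>g\<in>carrier G. \<forall>v\<in>rep_space \<pi>. rep_act \<pi> g v \<in> rep_space \<pi>) \<and>
     (\<forall>g\<in>carrier G. \<forall>v\<in>rep_space \<pi>. \<forall>w\<in>rep_space \<pi>.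
        rep_act \<pi> g (v + w) = rep_act \<pi> g v + rep_act \<pi> g w) \<and>
     (\<forall>g\<in>carrier G. \<forall>c. \<forall>v\<in>rep_space \<pi>.
        rep_act \<pi> g (rep_scale \<pi> c v) = rep_scale \<pi> c (rep_act \<pi> g v)) \<and>
     (\<forall>v\<in>rep_space \<pi>. rep_act \<pi> \<one>\<^bsub>G\<^esub> v = v) \<and>
     (\<forall>g\<in>carrier G. \<forall>h\<in>carrier G. \<forall>v\<in>rep_space \<pi>.
        rep_act \<pi> (g \<otimes>\<^bsub>G\<^esub> h) v = rep_act \<pi> g (rep_act \<pi> h v)) \<and>
     (\<forall>v\<in>rep_space \<pi>. openin T {g \<in> carrier G. rep_act \<pi> g v = v})"

abbreviation subgrp :: "('g,'m) monoid_scheme \<Rightarrow> 'g set \<Rightarrow> ('g,'m) monoid_scheme" where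
  "subgrp G H \<equiv> G\<lparr>carrier := H\<rparr>"

text \<open>Smoothness of a function is right invariance under some open subgroup.\<close>

definition induced_rep ::
    "('g,'m) monoid_scheme \<Rightarrow> 'g topology \<Rightarrow> 'g set \<Rightarrow> ('g,'v::ab_group_add) rep \<Rightarrow>
     ('g, 'g \<Rightarrow> 'v) rep" where
  "induced_rep G T H \<rho> = \<lparr>
     rep_scale = (\<lambda>c f x. rep_scale \<rho> c (f x)),
     rep_space = {f.
        (\<forall>g\<in>carrier G. f g \<in> rep_space \<rho>) \<and> (\<forall>g. g \<notin> carrier G \<longrightarrow> f g = 0) \<and>
        (\<forall>h\<in>H. \<forall>g\<in>carrier G.
           f (h \<otimes>\<^bsub>G\<^esub> g) =
             rep_scale \<rho>
               (of_real (modular_char G T h powr (- 1/2) *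
                         modular_char (subgrp G H) (subtopology T H) h powr (1/2)))
               (rep_act \<rho> h (f g))) \<and>
        (\<exists>K. subgroup K G \<and> openin T K \<and> (\<forall>k\<in>K. \<forall>g\<in>carrier G. f (g \<otimes>\<^bsub>G\<^esub> k) = f g)) \<and>
        (\<exists>C. compactin T C \<and>
           {g \<in> carrier G. f g \<noteq> 0} \<subseteq> {h \<otimes>\<^bsub>G\<^esub> c | h c. h \<in> H \<and> c \<in> C})},
     rep_act = (\<lambda>g f. restrict0 (carrier G) (\<lambda>x. f (x \<otimes>\<^bsub>G\<^esub> g)))\<rparr>"

definition twisted_kernel ::
    "('g,'v::ab_group_add) rep \<Rightarrow> 'g set \<Rightarrow> ('g \<Rightarrow> complex) \<Rightarrow> 'v set" where
  "twisted_kernel \<pi> U \<theta> = module.span (rep_scale \<pi>)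
     {rep_act \<pi> u v - rep_scale \<pi> (\<theta> u) v | u v. u \<in> U \<and> v \<in> rep_space \<pi>}"

text \<open>The underlying space of the twisted Jacquet module, as a set of cosets; its zero element is
  the coset \<^term>\<open>twisted_kernel \<pi> U \<theta>\<close>.\<close>

definition twisted_jacquet ::
    "('g,'v::ab_group_add) rep \<Rightarrow> 'g set \<Rightarrow> ('g \<Rightarrow> complex) \<Rightarrow> 'v set set" where
  "twisted_jacquet \<pi> U \<theta> = (\<lambda>v. {v + x | x. x \<in> twisted_kernel \<pi> U \<theta>}) ` rep_space \<pi>"

definition twisted_jacquet_nonzero ::
    "('g,'v::ab_group_add) rep \<Rightarrow> 'g set \<Rightarrow> ('g \<Rightarrow> complex) \<Rightarrow> bool" where
  "twisted_jacquet_nonzero \<pi> U \<theta> \<longleftrightarrow> twisted_jacquet \<pi> U \<theta> \<noteq> {twisted_kernel \<pi> U \<theta>}"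


section \<open>General linear groups and their subgroups\<close>

abbreviation GL :: "nat \<Rightarrow> 'f::field mat monoid" where
  "GL m \<equiv> units_of (ring_mat TYPE('f) m ())"

text \<open>The topology of \<open>F\<^bsup>m\<times>m\<^esup>\<close> restricted to the invertible matrices.\<close>

definition GL_topology :: "nat \<Rightarrow> 'f::{field,topological_space} mat topology" where
  "GL_topology m = pullback_topology (carrier (GL m))
     (\<lambda>A. restrict (\<lambda>ij. A $$ ij) ({..<m} \<times> {..<m}))
     (product_topology (\<lambda>_. euclidean) ({..<m} \<times> {..<m}))"

definition levi :: "nat \<Rightarrow> nat \<Rightarrow> 'f::field mat set" where
  "levi a b = {four_block_mat A (0\<^sub>m a b) (0\<^sub>m b a) D | A D.
     A \<in> carrier (GL a) \<and> D \<in> carrier (GL b)}"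

definition parabolic :: "nat \<Rightarrow> nat \<Rightarrow> 'f::field mat set" where
  "parabolic a b = {four_block_mat A B (0\<^sub>m b a) D | A B D.
     A \<in> carrier (GL a) \<and> B \<in> carrier_mat a b \<and> D \<in> carrier (GL b)}"

definition unip :: "nat \<Rightarrow> nat \<Rightarrow> 'f::field mat set" where
  "unip a b = {four_block_mat (1\<^sub>m a) B (0\<^sub>m b a) (1\<^sub>m b) | B. B \<in> carrier_mat a b}"

text \<open>The projection of the parabolic subgroup onto its Levi subgroup along the unipotent radical.\<close>

definition levi_part :: "nat \<Rightarrow> nat \<Rightarrow> 'f::field mat \<Rightarrow> 'f mat" where
  "levi_part a b p = (case split_block p a a of (A, B, C, D) \<Rightarrow>
     four_block_mat A (0\<^sub>m a b) (0\<^sub>m b a) D)"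

definition inflate :: "nat \<Rightarrow> nat \<Rightarrow> ('f::field mat, 'v) rep \<Rightarrow> ('f mat, 'v) rep" where
  "inflate a b \<rho> = \<rho>\<lparr>rep_act := (\<lambda>p. rep_act \<rho> (levi_part a b p))\<rparr>"

definition parabolic_induction ::
    "nat \<Rightarrow> nat \<Rightarrow> ('f::{field,topological_space} mat, 'v::ab_group_add) rep \<Rightarrow>
     ('f mat, 'f mat \<Rightarrow> 'v) rep" where
  "parabolic_induction a b \<rho> =
     induced_rep (GL (a + b)) (GL_topology (a + b)) (parabolic a b) (inflate a b \<rho>)"


section \<open>The unipotent subgroups and their characters\<close>

definition mat_trace :: "'f::comm_monoid_add mat \<Rightarrow> 'f" where
  "mat_trace A = (\<Sum>i<dim_row A. A $$ (i, i))"

text \<open>The p by q block of g whose upper left entry is at position (i, j).\<close>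

definition block_at :: "nat \<Rightarrow> nat \<Rightarrow> nat \<Rightarrow> nat \<Rightarrow> 'f mat \<Rightarrow> 'f mat" where
  "block_at i j p q g = Matrix.mat p q (\<lambda>(a, b). g $$ (i + a, j + b))"

definition psi_N :: "('f::field \<Rightarrow> complex) \<Rightarrow> nat \<Rightarrow> 'f mat \<Rightarrow> complex" where
  "psi_N \<psi>\<^sub>0 n g = \<psi>\<^sub>0 (mat_trace (block_at 0 n n n g))"

lemma psi_N_unip:
  assumes "x \<in> carrier_mat n n"
  shows "psi_N \<psi>\<^sub>0 n (four_block_mat (1\<^sub>m n) x (0\<^sub>m n n) (1\<^sub>m n)) = \<psi>\<^sub>0 (mat_trace x)"
proof -
  have "block_at 0 n n n (four_block_mat (1\<^sub>m n) x (0\<^sub>m n n) (1\<^sub>m n)) = x"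
    using assms by (intro eq_matI) (auto simp: block_at_def)
  then show ?thesis by (simp add: psi_N_def)
qed

text \<open>Side by side matrices; the library only has the vertical counterpart \<^const>\<open>append_rows\<close>.\<close>

definition append_cols :: "'f::zero mat \<Rightarrow> 'f mat \<Rightarrow> 'f mat" where
  "append_cols A B = four_block_mat A B (0\<^sub>m 0 (dim_col A)) (0\<^sub>m 0 (dim_col B))"

text \<open>With block sizes k, k, r - 2k in the first and r - 2k, n - r + k, n - r + k in the second
  diagonal block. The size n - r + k is written \<open>n + k - r\<close> so that truncated subtraction does no
  harm when \<open>r - n \<le> k\<close>.\<close>

definition nk_mat :: "nat \<Rightarrow> nat \<Rightarrow> nat \<Rightarrow> 'f::field mat \<Rightarrow> 'f mat \<Rightarrow> 'f mat \<Rightarrow> 'f mat \<Rightarrow> 'f mat" where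
  "nk_mat n r k x y w z = four_block_mat
     (four_block_mat (1\<^sub>m k) (append_cols x y) (0\<^sub>m (r - k) k) (1\<^sub>m (r - k)))
     (0\<^sub>m r (2*n - r)) (0\<^sub>m (2*n - r) r)
     (four_block_mat (1\<^sub>m (n - k)) (append_rows w z) (0\<^sub>m (n + k - r) (n - k)) (1\<^sub>m (n + k - r)))"

definition Nk :: "nat \<Rightarrow> nat \<Rightarrow> nat \<Rightarrow> 'f::field mat set" where
  "Nk n r k = {nk_mat n r k x y w z | x y w z.
     x \<in> carrier_mat k k \<and> y \<in> carrier_mat k (r - 2*k) \<and>
     w \<in> carrier_mat (r - 2*k) (n + k - r) \<and> z \<in> carrier_mat (n + k - r) (n + k - r)}"

definition psi_Nk :: "('f::field \<Rightarrow> complex) \<Rightarrow> nat \<Rightarrow> nat \<Rightarrow> nat \<Rightarrow> 'f mat \<Rightarrow> complex" where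
  "psi_Nk \<psi>\<^sub>0 n r k g = \<psi>\<^sub>0 (mat_trace (block_at 0 k k k g) +
     mat_trace (block_at (2*r - 2*k) (n + r - k) (n + k - r) (n + k - r) g))"

lemma psi_Nk_nk_mat:
  assumes "2*k \<le> r" "r \<le> n + k" "r \<le> 2*n"
    and x: "x \<in> carrier_mat k k" and y: "y \<in> carrier_mat k (r - 2*k)"
    and w: "w \<in> carrier_mat (r - 2*k) (n + k - r)"
    and z: "z \<in> carrier_mat (n + k - r) (n + k - r)"
  shows "psi_Nk \<psi>\<^sub>0 n r k (nk_mat n r k x y w z) = \<psi>\<^sub>0 (mat_trace x + mat_trace z)"
proof -
  have dims: "dim_row x = k" "dim_col x = k" "dim_row y = k" "dim_col y = r - 2*k"
    "dim_row w = r - 2*k" "dim_col w = n + k - r" "dim_row z = n + k - r" "dim_col z = n + k - r"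
    using x y w z by auto
  have "block_at 0 k k k (nk_mat n r k x y w z) = x"
  proof (rule eq_matI)
    fix i j assume "i < dim_row x" "j < dim_col x"
    then have ij: "i < k" "j < k" by (simp_all add: dims)
    have b: "i < r" "k + j < r" "k + j - k = j" using ij assms(1) by linarith+
    show "block_at 0 k k k (nk_mat n r k x y w z) $$ (i, j) = x $$ (i, j)"
      using ij b assms(1) by (simp add: block_at_def nk_mat_def append_cols_def dims)
  qed (simp_all add: block_at_def dims)
  moreover have "block_at (2*r - 2*k) (n + r - k) (n + k - r) (n + k - r) (nk_mat n r k x y w z) = z"
  proof (rule eq_matI)
    fix i j assume "i < dim_row z" "j < dim_col z"
    then have ij: "i < n + k - r" "j < n + k - r" by (simp_all add: dims)
    obtain s t where r: "r = 2*k + s" and n: "n = k + s + t"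
      using assms(1-2) by (metis add.commute add.left_commute le_add_diff_inverse2 mult_2
          add_diff_cancel_left' add_le_cancel_left le_iff_add)
    have "2*r - 2*k + i = r + (s + i)" "n + r - k + j = r + (s + t + j)" "n - k = s + t"
      "n + k - r = t" "r - 2*k = s" "2*n - r = s + t + t"
      using r n by simp_all
    then show "block_at (2*r - 2*k) (n + r - k) (n + k - r) (n + k - r) (nk_mat n r k x y w z) $$ (i, j)
        = z $$ (i, j)"
      using ij r by (simp add: block_at_def nk_mat_def append_rows_def dims)
  qed (simp_all add: block_at_def dims)
  ultimately show ?thesis by (simp add: psi_Nk_def)
qed

end

theory Submission
  imports Defs "HOL-Algebra.Coset" "Jordan_Normal_Form.Determinant"
begin

text \<open>
  Write \<open>P\<close> for the parabolic subgroup and \<open>m = 2n - r\<close>. The rows of g from r on span an m-dimensional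
  space U of row vectors in \<open>F\<^sup>n \<oplus> F\<^sup>n\<close>, and \<open>P g\<close> corresponds to U. The group N acts by
  \<open>(u, w) \<mapsto> (u, u x + w)\<close>, and the N-orbits are separated by the projection A of U to the first summand and
  the intersection B of U with the second one. If \<open>dim A = n - k\<close>, then \<open>dim B = n + k - r\<close>. The stabilizer of U
  in N consists of the x with \<open>A x \<subseteq> B\<close>. It acts on the stalk of the induced representation at U through
  the Levi component, that is, through the maps \<open>A \<rightarrow> B\<close> and \<open>F\<^sup>n/A \<rightarrow> F\<^sup>n/B\<close> induced by x, so that the x with
  \<open>A x = 0\<close> and \<open>F\<^sup>n x \<subseteq> B\<close> act trivially. The character \<open>\<psi>(tr x)\<close> is trivial on these x exactly if
  \<open>B \<subseteq> A\<close>, which requires \<open>2k \<le> r\<close>. Hence only the orbits with \<open>B \<subseteq> A\<close> can contribute. They are conjugate, for fixed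
  k, under the diagonally embedded \<open>GL\<^sub>n\<close>, which preserves \<open>\<psi>\<close>; for the standard A and B the Levi component
  maps the stabilizer onto \<open>N'\<^sub>k\<close> and \<open>\<psi>\<close> to \<open>\<psi>'\<^sub>k\<close> (\<open>Nk_eq\<close>, \<open>psi_Nk_cj\<close>). So each stalk has vanishing twisted
  coinvariants if all the \<open>\<rho>\<close>-modules for \<open>(N'\<^sub>k, \<psi>'\<^sub>k)\<close> vanish (\<open>stalk_vanishes\<close>).

  The passage between stalks and sections uses averages over compact subgroups of N twisted by \<open>\<psi>\<close>
  (the criterion of Jacquet and Langlands): a vector in the twisted kernel is killed by every sufficiently large
  average (\<open>twisted_kernel_average\<close>), while an average is always congruent to a nonzero multiple of the
  vector (\<open>twisted_sum_congruent\<close>).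

  If v is not in the twisted kernel of \<open>\<rho>\<close> for \<open>(N'\<^sub>k, \<psi>'\<^sub>k)\<close>, let f be a section supported on \<open>P g\<^sub>0 K\<close> with
  value v at the base point \<open>g\<^sub>0\<close> of the orbit and K a small congruence subgroup. On the orbit,
  f lives on the stabilizer times \<open>N \<inter> K\<close> (\<open>orbit_near\<close>), so that every average of f at \<open>g\<^sub>0\<close> is a positive
  multiple of v modulo the twisted kernel and f survives (\<open>stalk_imp_nonzero\<close>).

  Conversely, suppose that all the modules for \<open>(N'\<^sub>k, \<psi>'\<^sub>k)\<close> vanish and stratify by \<open>dim A\<close>. Let f vanish where
  \<open>dim A < n - k\<close>. On an orbit with \<open>dim A = n - k\<close> its support is then bounded modulo
  the stabilizer (\<open>orbit_bounded\<close>), so all large averages of f vanish at a given point of the stratum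
  (\<open>avg_zero_of_stalk\<close>) and therefore on its whole orbit (\<open>avg_zero_orbit\<close>). The orbits of the stratum are
  parametrized by a compact set, so one average works for all of them (\<open>uniform_average\<close>). This average vanishes on
  one more stratum and is congruent to a multiple of f. Induction on \<open>dim A\<close> puts f into the twisted kernel
  (\<open>stalks_vanish_imp_vanish\<close>).

  The normalization of the induction enters only through a positive character that is trivial on compact open
  subgroups, which is proved by constructing the Haar integral as a sum over cosets.
\<close>

(* leaves the symbol to left cosets *)
no_notation subset_mset (infix "<#" 50)

section \<open>Sums over cosets\<close>

definition lcos :: "('g,'m) monoid_scheme \<Rightarrow> 'g set \<Rightarrow> 'g set \<Rightarrow> 'g set set" where
  "lcos G H L = (\<lambda>x. x <#\<^bsub>G\<^esub> L) ` H"

definition rep_of :: "'g set \<Rightarrow> 'g" where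
  "rep_of C = (SOME x. x \<in> C)"

definition right_inv :: "('g,'m) monoid_scheme \<Rightarrow> 'g set \<Rightarrow> 'g set \<Rightarrow> ('g \<Rightarrow> 'a) \<Rightarrow> bool" where
  "right_inv G H L h \<longleftrightarrow> (\<forall>x\<in>H. \<forall>l\<in>L. h (x \<otimes>\<^bsub>G\<^esub> l) = h x)"

text \<open>Restricting the sum to the cosets on which h does not vanish also covers functions of finite
  support on infinite coset spaces.\<close>

definition coset_sum ::
    "('g,'m) monoid_scheme \<Rightarrow> 'g set \<Rightarrow> 'g set \<Rightarrow> ('g \<Rightarrow> 'a::comm_monoid_add) \<Rightarrow> 'a" where
  "coset_sum G H L h = (\<Sum>C\<in>{C \<in> lcos G H L. h (rep_of C) \<noteq> 0}. h (rep_of C))"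

lemma coset_sum_finite:
  "finite (lcos G H L) \<Longrightarrow> coset_sum G H L h = (\<Sum>C\<in>lcos G H L. h (rep_of C))"
  unfolding coset_sum_def by (rule sum.mono_neutral_left) auto

lemma coset_sum_superset:
  assumes "finite F" "F \<subseteq> lcos G H L" "\<And>C. C \<in> lcos G H L \<Longrightarrow> h (rep_of C) \<noteq> 0 \<Longrightarrow> C \<in> F"
  shows "coset_sum G H L h = (\<Sum>C\<in>F. h (rep_of C))"
  unfolding coset_sum_def using assms by (intro sum.mono_neutral_left) auto

context group
begin

lemma inv_mult_cancel:
  "x \<in> carrier G \<Longrightarrow> y \<in> carrier G \<Longrightarrow> inv x \<otimes> (x \<otimes> y) = y"
  "x \<in> carrier G \<Longrightarrow> y \<in> carrier G \<Longrightarrow> x \<otimes> (inv x \<otimes> y) = y"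
  by (simp_all add: m_assoc[symmetric])

lemma lcos_self: "subgroup L G \<Longrightarrow> x \<in> carrier G \<Longrightarrow> x \<in> x <# L"
  unfolding l_coset_def using subgroup.one_closed by force

lemma lcos_eq: "subgroup L G \<Longrightarrow> x \<in> carrier G \<Longrightarrow> y \<in> x <# L \<Longrightarrow> y <# L = x <# L"
  using l_repr_independence by blast

lemma rep_of_lcos: "subgroup L G \<Longrightarrow> x \<in> carrier G \<Longrightarrow> rep_of (x <# L) \<in> x <# L"
  unfolding rep_of_def by (rule someI[of _ x]) (rule lcos_self)

lemma rep_of_lcos_eq: "subgroup L G \<Longrightarrow> x \<in> carrier G \<Longrightarrow> rep_of (x <# L) <# L = x <# L"
  by (intro lcos_eq rep_of_lcos)

lemma rep_of_in:
  assumes "subgroup L G" "subgroup H G" "L \<subseteq> H" "C \<in> lcos G H L"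
  shows "rep_of C \<in> H" "rep_of C <# L = C" "rep_of C \<in> C"
proof -
  from assms(4) obtain x where x: "x \<in> H" "C = x <# L" unfolding lcos_def by blast
  with assms(2) have xc: "x \<in> carrier G" using subgroup.subset by auto
  have "rep_of C \<in> x <# L" using rep_of_lcos[OF assms(1) xc] x by simp
  then obtain l where l: "l \<in> L" "rep_of C = x \<otimes> l" unfolding l_coset_def by auto
  then show "rep_of C \<in> H" using subgroup.m_closed[OF assms(2)] assms(3) x by auto
  show "rep_of C <# L = C" "rep_of C \<in> C" using rep_of_lcos_eq[OF assms(1) xc] rep_of_lcos[OF assms(1) xc] x by auto
qed

lemma rep_of_value:
  assumes "subgroup L G" "H \<subseteq> carrier G" "right_inv G H L h" "x \<in> H"
  shows "h (rep_of (x <# L)) = h x"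
proof -
  have "rep_of (x <# L) \<in> x <# L" using rep_of_lcos assms by auto
  then obtain l where "l \<in> L" "rep_of (x <# L) = x \<otimes> l" unfolding l_coset_def by auto
  then show ?thesis using assms unfolding right_inv_def by auto
qed

lemma subgroup_mult_right:
  "subgroup H G \<Longrightarrow> L \<subseteq> H \<Longrightarrow> x \<in> H \<Longrightarrow> l \<in> L \<Longrightarrow> x \<otimes> l \<in> H"
  by (auto intro: subgroup.m_closed)

lemma l_coset_assoc:
  assumes "subgroup L G" "x \<in> carrier G" "y \<in> carrier G"
  shows "x <# (y <# L) = (x \<otimes> y) <# L"
  using assms lcos_m_assoc subgroup.subset by blast

lemma coset_sum_translate:
  assumes H: "subgroup H G" and L: "subgroup L G" "L \<subseteq> H" and h: "right_inv G H L h" and y: "y \<in> H"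
  shows "coset_sum G H L (\<lambda>x. h (y \<otimes> x)) = coset_sum G H L h"
proof -
  have Hc: "H \<subseteq> carrier G" using H subgroup.subset by auto
  have iy: "inv y \<in> H" "y \<in> carrier G" "inv y \<in> carrier G" using H y subgroup.m_inv_closed Hc by auto
  have val: "h (rep_of (z <# C)) = h (z \<otimes> rep_of C)" "z <# C \<in> lcos G H L"
    if "C \<in> lcos G H L" "z \<in> H" for C z
  proof -
    note r = rep_of_in[OF L(1) H L(2) that(1)]
    have "z <# C = (z \<otimes> rep_of C) <# L"
      using r that Hc l_coset_assoc[OF L(1), of z "rep_of C"] by auto
    moreover have "z \<otimes> rep_of C \<in> H" using subgroup.m_closed[OF H that(2)] r by auto
    ultimately show "h (rep_of (z <# C)) = h (z \<otimes> rep_of C)" "z <# C \<in> lcos G H L"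
      using rep_of_value[OF L(1) Hc h] unfolding lcos_def by auto
  qed
  have canc: "inv z <# (z <# C) = C" if C: "C \<in> lcos G H L" and z: "z \<in> H" for C z
  proof -
    obtain x where x: "x \<in> H" "C = x <# L" using C unfolding lcos_def by auto
    then have c: "x \<in> carrier G" "z \<in> carrier G" using z Hc by auto
    then show ?thesis unfolding x(2) by (simp add: l_coset_assoc[OF L(1)] inv_mult_cancel)
  qed
  have canc2: "z <# (inv z <# C) = C" if "C \<in> lcos G H L" "z \<in> H" for C z
    using canc[OF that(1), of "inv z"] that H Hc subgroup.m_inv_closed[OF H, of z] by auto
  have ev: "y \<otimes> rep_of (inv y <# C) \<in> H \<and> h (y \<otimes> rep_of (inv y <# C)) = h (rep_of C)"
    if C: "C \<in> lcos G H L" for C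
  proof -
    have c: "inv y <# C \<in> lcos G H L" using val(2)[OF C iy(1)] .
    have "h (rep_of (y <# (inv y <# C))) = h (y \<otimes> rep_of (inv y <# C))" using val(1)[OF c y] .
    then have "h (y \<otimes> rep_of (inv y <# C)) = h (rep_of C)" using canc2[OF C y] by simp
    moreover have "rep_of (inv y <# C) \<in> H"
      using rep_of_in[OF L(1) H L(2) c] by auto
    ultimately show ?thesis using subgroup.m_closed[OF H y] by auto
  qed
  show ?thesis unfolding coset_sum_def
    by (rule sum.reindex_bij_witness[where i = "\<lambda>C. inv y <# C" and j = "\<lambda>C. y <# C"])
      (use canc[OF _ y] canc2[OF _ y] val[OF _ y] val(2)[OF _ iy(1)] ev in auto)
qed

text \<open>Every coset of L splits into cosets of M, and h has the same value on all of them.\<close>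

lemma coset_sum_refine:
  assumes H: "subgroup H G" and L: "subgroup L G" "L \<subseteq> H" and M: "subgroup M G" "M \<subseteq> L"
    and h: "right_inv G H L h"
  shows "coset_sum G H M h = (\<Sum>D\<in>lcos G L M. coset_sum G H L h)"
proof -
  have Hc: "H \<subseteq> carrier G" using H subgroup.subset by auto
  have Lc: "L \<subseteq> carrier G" using L Hc by auto
  have MH: "M \<subseteq> H" using M L by auto
  have hM: "right_inv G H M h" using h M unfolding right_inv_def by auto
  let ?S = "{C \<in> lcos G H L. h (rep_of C) \<noteq> 0}"
  note rL = rep_of_in[OF L(1) H L(2)]
  note rM = rep_of_in[OF M(1) H MH]
  note rLM = rep_of_in[OF M(1) L(1) M(2)]
  have fwd: "rep_of C <# D \<in> lcos G H M \<and> h (rep_of (rep_of C <# D)) = h (rep_of C) \<and>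
      rep_of (rep_of C <# D) <# L = C \<and> inv (rep_of C) <# (rep_of C <# D) = D"
    if C: "C \<in> lcos G H L" and D: "D \<in> lcos G L M" for C D
  proof -
    let ?x = "rep_of C" and ?l = "rep_of D"
    note c = rL[OF C] and d = rLM[OF D]
    have l: "?l \<in> carrier G" "?l \<in> L" using d Lc by auto
    have x: "?x \<in> carrier G" "?x \<in> H" using c Hc by auto
    have xl: "?x \<otimes> ?l \<in> H" using subgroup_mult_right[OF H L(2)] x l by auto
    have eq: "?x <# D = (?x \<otimes> ?l) <# M" using l_coset_assoc[OF M(1) x(1) l(1)] d by simp
    have "h (?x \<otimes> ?l) = h ?x" using h x(2) l(2) unfolding right_inv_def by blast
    then have 1: "h (rep_of (?x <# D)) = h ?x"
      by (simp only: eq rep_of_value[OF M(1) Hc hM xl])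
    have "rep_of (?x <# D) \<in> (?x \<otimes> ?l) <# M" unfolding eq using rep_of_lcos[OF M(1)] xl Hc by auto
    then obtain m where m: "m \<in> M" "rep_of (?x <# D) = ?x \<otimes> ?l \<otimes> m" unfolding l_coset_def by auto
    have "?l \<otimes> m \<in> L" using subgroup.m_closed[OF L(1) l(2)] m(1) M(2) by auto
    moreover have "m \<in> carrier G" using m(1) M(2) Lc by blast
    then have "rep_of (?x <# D) = ?x \<otimes> (?l \<otimes> m)" using m_assoc[OF x(1) l(1)] m(2) by simp
    ultimately have "rep_of (?x <# D) \<in> ?x <# L" unfolding l_coset_def by blast
    then have 2: "rep_of (?x <# D) <# L = C" using lcos_eq[OF L(1) x(1)] c by auto
    have "inv ?x <# (?x <# D) = (inv ?x \<otimes> (?x \<otimes> ?l)) <# M"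
      unfolding eq using x l xl Hc by (subst l_coset_assoc[OF M(1)]) auto
    then have 3: "inv ?x <# (?x <# D) = D" using d x l by (simp add: inv_mult_cancel)
    show ?thesis using 1 2 3 xl unfolding eq lcos_def by auto
  qed
  have bwd: "rep_of E <# L \<in> lcos G H L \<and> h (rep_of (rep_of E <# L)) = h (rep_of E) \<and>
      inv (rep_of (rep_of E <# L)) <# E \<in> lcos G L M \<and>
      rep_of (rep_of E <# L) <# (inv (rep_of (rep_of E <# L)) <# E) = E"
    if E: "E \<in> lcos G H M" for E
  proof -
    let ?e = "rep_of E" and ?x = "rep_of (rep_of E <# L)"
    note e = rM[OF E]
    have ec: "?e \<in> carrier G" using e Hc by auto
    have xm: "?x \<in> ?e <# L" using rep_of_lcos[OF L(1) ec] .
    then obtain l where l: "l \<in> L" "?x = ?e \<otimes> l" unfolding l_coset_def by auto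
    have lc: "l \<in> carrier G" using l Lc by auto
    have x: "?x \<in> carrier G" using l ec lc by auto
    have "inv ?x \<otimes> ?e = inv l" using l lc ec by (simp add: inv_mult_group m_assoc)
    then have i: "inv ?x \<otimes> ?e \<in> L" using l L subgroup.m_inv_closed by auto
    have eq: "inv ?x <# E = (inv ?x \<otimes> ?e) <# M" using l_coset_assoc[OF M(1), of "inv ?x" ?e] x ec e by simp
    have "?x <# (inv ?x <# E) = (?x \<otimes> (inv ?x \<otimes> ?e)) <# M" unfolding eq
      using x ec by (subst l_coset_assoc[OF M(1)]) auto
    also have "\<dots> = E" using x ec e by (simp add: m_assoc[symmetric])
    finally have 1: "?x <# (inv ?x <# E) = E" .
    show ?thesis using 1 i eq e rep_of_value[OF L(1) Hc h e(1)] unfolding lcos_def by auto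
  qed
  have "(\<Sum>D\<in>lcos G L M. coset_sum G H L h) = (\<Sum>D\<in>lcos G L M. \<Sum>C\<in>?S. h (rep_of C))"
    unfolding coset_sum_def ..
  also have "\<dots> = (\<Sum>C\<in>?S. \<Sum>D\<in>lcos G L M. h (rep_of C))" by (rule sum.swap)
  also have "\<dots> = (\<Sum>(C,D)\<in>?S \<times> lcos G L M. h (rep_of C))" by (rule sum.cartesian_product)
  also have "\<dots> = coset_sum G H M h" unfolding coset_sum_def
    by (rule sum.reindex_bij_witness[where
          i = "\<lambda>E. (rep_of E <# L, inv (rep_of (rep_of E <# L)) <# E)" and
          j = "\<lambda>(C, D). rep_of C <# D"]) (use fwd bwd in auto)
  finally show ?thesis ..
qed

text \<open>If the sums of h over all translates of a subgroup Z vanish, then so does its sum over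
  H, up to the factor that counts Z: average the translation invariance over Z and exchange the
  two sums.\<close>

lemma coset_sum_subgroup_zero:
  assumes H: "subgroup H G" and L: "subgroup L G" "L \<subseteq> H" "finite (lcos G H L)"
    and h: "right_inv G H L h"
    and Z: "subgroup Z G" "Z \<subseteq> H" "subgroup M G" "M \<subseteq> Z" "finite (lcos G Z M)"
    and zero: "\<And>y. y \<in> H \<Longrightarrow> coset_sum G Z M (\<lambda>z. h (z \<otimes> y)) = 0"
  shows "(\<Sum>D\<in>lcos G Z M. coset_sum G H L h) = 0"
proof -
  have Hc: "H \<subseteq> carrier G" using H subgroup.subset by auto
  have Zc: "Z \<subseteq> carrier G" using Z Hc by auto
  have "(\<Sum>D\<in>lcos G Z M. coset_sum G H L h)
      = (\<Sum>D\<in>lcos G Z M. coset_sum G H L (\<lambda>x. h (rep_of D \<otimes> x)))"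
    using rep_of_in(1)[OF Z(3) Z(1) Z(4)] Z(2)
    by (intro sum.cong refl coset_sum_translate[OF H L(1,2) h, symmetric]) auto
  also have "\<dots> = (\<Sum>D\<in>lcos G Z M. \<Sum>C\<in>lcos G H L. h (rep_of D \<otimes> rep_of C))"
    by (simp add: coset_sum_finite[OF L(3)])
  also have "\<dots> = (\<Sum>C\<in>lcos G H L. \<Sum>D\<in>lcos G Z M. h (rep_of D \<otimes> rep_of C))" by (rule sum.swap)
  also have "\<dots> = (\<Sum>C\<in>lcos G H L. coset_sum G Z M (\<lambda>z. h (z \<otimes> rep_of C)))"
    by (simp add: coset_sum_finite[OF Z(5)])
  also have "\<dots> = 0"
    using rep_of_in(1)[OF L(1) H L(2)] zero by simp
  finally show ?thesis .
qed

lemma lcos_nonempty: "subgroup H G \<Longrightarrow> lcos G H L \<noteq> {}"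
  unfolding lcos_def using subgroup.one_closed by auto

text \<open>Two powers of the element lie in the same coset of L.\<close>

lemma finite_index_power:
  assumes H: "subgroup H G" and L: "subgroup L G" "finite (lcos G H L)" and s: "s \<in> H"
  shows "\<exists>m::nat. 0 < m \<and> s [^] m \<in> L"
proof -
  have Hc: "H \<subseteq> carrier G" using H subgroup.subset by auto
  have p: "s [^] i \<in> H" for i :: nat
    using H s by (induction i) (auto intro: subgroup.m_closed subgroup.one_closed)
  have "range (\<lambda>i::nat. s [^] i <# L) \<subseteq> lcos G H L" using p unfolding lcos_def by auto
  then have "\<not> inj (\<lambda>i::nat. s [^] i <# L)" using L(2) finite_subset range_inj_infinite by blast
  then obtain i j where "i \<noteq> j" "s [^] (i::nat) <# L = s [^] (j::nat) <# L" unfolding inj_def by blast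
  then obtain i j where ij: "i < j" "s [^] (i::nat) <# L = s [^] (j::nat) <# L"
    by (metis linorder_neqE_nat)
  have sc: "s \<in> carrier G" using s Hc by auto
  have "s [^] j \<in> s [^] i <# L" using lcos_self[OF L(1), of "s [^] j"] ij sc by simp
  then obtain l where l: "l \<in> L" "s [^] j = s [^] i \<otimes> l" unfolding l_coset_def by auto
  have "s [^] j = s [^] i \<otimes> s [^] (j - i)" using ij sc by (simp add: nat_pow_mult)
  moreover have "l \<in> carrier G" using l L(1) subgroup.subset by auto
  ultimately have "s [^] (j - i) = l"
    using l sc inv_mult_cancel(1)[of "s [^] i" l] inv_mult_cancel(1)[of "s [^] i" "s [^] (j - i)"] by simp
  then show ?thesis using l ij by (intro exI[of _ "j - i"]) auto
qed

end

section \<open>Groups with a basis of compact open subgroups\<close>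

text \<open>The structure on which the Haar functional depends: continuous translations and a basis at one of
  compact open subgroups.\<close>

locale lgroup = group G for G (structure) +
  fixes T
  assumes topspace_eq: "topspace T = carrier G"
    and left_open: "openin T U \<Longrightarrow> g \<in> carrier G \<Longrightarrow> openin T (g <# U)"
    and right_open: "openin T U \<Longrightarrow> g \<in> carrier G \<Longrightarrow> openin T (U #> g)"
    and basis: "openin T U \<Longrightarrow> \<one> \<in> U \<Longrightarrow>
      \<exists>K. subgroup K G \<and> openin T K \<and> compactin T K \<and> K \<subseteq> U"
begin

lemma open_subset: "openin T U \<Longrightarrow> U \<subseteq> carrier G"
  using openin_subset topspace_eq by blast

lemma compact_subset: "compactin T C \<Longrightarrow> C \<subseteq> carrier G"
  using compactin_subset_topspace topspace_eq by blast

lemma left_continuous: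
  assumes "g \<in> carrier G" shows "continuous_map T T (\<lambda>x. g \<otimes> x)"
  unfolding continuous_map_def
proof (intro conjI allI impI)
  fix U assume U: "openin T U"
  have "{x \<in> topspace T. g \<otimes> x \<in> U} = inv g <# U"
  proof (intro equalityI subsetI)
    fix x assume x: "x \<in> {x \<in> topspace T. g \<otimes> x \<in> U}"
    then have "x = inv g \<otimes> (g \<otimes> x)" using assms topspace_eq by (simp add: m_assoc[symmetric])
    then show "x \<in> inv g <# U" using x unfolding l_coset_def by auto
  next
    fix x assume "x \<in> inv g <# U"
    then obtain y where "y \<in> U" "x = inv g \<otimes> y" unfolding l_coset_def by auto
    then show "x \<in> {x \<in> topspace T. g \<otimes> x \<in> U}"
      using assms open_subset[OF U] topspace_eq by (auto simp: m_assoc[symmetric])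
  qed
  then show "openin T {x \<in> topspace T. g \<otimes> x \<in> U}" using left_open[OF U, of "inv g"] assms by simp
qed (use assms topspace_eq in auto)

lemma right_continuous:
  assumes "g \<in> carrier G" shows "continuous_map T T (\<lambda>x. x \<otimes> g)"
  unfolding continuous_map_def
proof (intro conjI allI impI)
  fix U assume U: "openin T U"
  have "{x \<in> topspace T. x \<otimes> g \<in> U} = U #> inv g"
  proof (intro equalityI subsetI)
    fix x assume x: "x \<in> {x \<in> topspace T. x \<otimes> g \<in> U}"
    then have "x = (x \<otimes> g) \<otimes> inv g" using assms topspace_eq by (simp add: m_assoc)
    then show "x \<in> U #> inv g" using x unfolding r_coset_def by auto
  next
    fix x assume "x \<in> U #> inv g"
    then obtain y where "y \<in> U" "x = y \<otimes> inv g" unfolding r_coset_def by auto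
    then show "x \<in> {x \<in> topspace T. x \<otimes> g \<in> U}"
      using assms open_subset[OF U] topspace_eq by (auto simp: m_assoc subset_iff)
  qed
  then show "openin T {x \<in> topspace T. x \<otimes> g \<in> U}" using right_open[OF U, of "inv g"] assms by simp
qed (use assms topspace_eq in auto)

lemma compact_left: "compactin T C \<Longrightarrow> g \<in> carrier G \<Longrightarrow> compactin T ((\<lambda>x. g \<otimes> x) ` C)"
  by (rule image_compactin[OF _ left_continuous])

lemma compact_right: "compactin T C \<Longrightarrow> g \<in> carrier G \<Longrightarrow> compactin T ((\<lambda>x. x \<otimes> g) ` C)"
  by (rule image_compactin[OF _ right_continuous])

lemma open_conj:
  assumes "openin T K" "subgroup K G" "g \<in> carrier G"
  shows "openin T ((\<lambda>k. g \<otimes> k \<otimes> inv g) ` K)" "subgroup ((\<lambda>k. g \<otimes> k \<otimes> inv g) ` K) G"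
proof -
  have Kc: "K \<subseteq> carrier G" using assms(2) subgroup.subset by auto
  have "(\<lambda>k. g \<otimes> k \<otimes> inv g) ` K = (g <# K) #> inv g" unfolding l_coset_def r_coset_def by auto
  then show "openin T ((\<lambda>k. g \<otimes> k \<otimes> inv g) ` K)"
    using left_open[OF assms(1,3)] right_open[of "g <# K" "inv g"] assms(3) by simp
  show "subgroup ((\<lambda>k. g \<otimes> k \<otimes> inv g) ` K) G"
  proof (rule subgroupI)
    show "(\<lambda>k. g \<otimes> k \<otimes> inv g) ` K \<subseteq> carrier G" using Kc assms(3) by auto
    show "(\<lambda>k. g \<otimes> k \<otimes> inv g) ` K \<noteq> {}" using subgroup.one_closed[OF assms(2)] by auto
    fix a assume "a \<in> (\<lambda>k. g \<otimes> k \<otimes> inv g) ` K"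
    then obtain k where k: "k \<in> K" "a = g \<otimes> k \<otimes> inv g" by auto
    have kc: "k \<in> carrier G" using k Kc by auto
    have "inv a = g \<otimes> inv k \<otimes> inv g" using k kc assms(3) by (simp add: inv_mult_group m_assoc)
    then show "inv a \<in> (\<lambda>k. g \<otimes> k \<otimes> inv g) ` K" using subgroup.m_inv_closed[OF assms(2) k(1)] by auto
    fix b assume "b \<in> (\<lambda>k. g \<otimes> k \<otimes> inv g) ` K"
    then obtain l where l: "l \<in> K" "b = g \<otimes> l \<otimes> inv g" by auto
    have lc: "l \<in> carrier G" using l Kc by auto
    have "inv g \<otimes> (g \<otimes> (l \<otimes> inv g)) = l \<otimes> inv g" using lc assms(3) by (simp add: m_assoc[symmetric])
    then have "a \<otimes> b = g \<otimes> (k \<otimes> l) \<otimes> inv g" using k kc l lc assms(3) by (simp add: m_assoc)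
    then show "a \<otimes> b \<in> (\<lambda>k. g \<otimes> k \<otimes> inv g) ` K" using subgroup.m_closed[OF assms(2) k(1) l(1)] by auto
  qed
qed

lemma finite_lcos_compact:
  assumes C: "compactin T C" and K: "openin T K" "subgroup K G"
  shows "finite (lcos G C K)"
proof -
  have Cc: "C \<subseteq> carrier G" using compact_subset[OF C] .
  have "\<exists>\<F>. finite \<F> \<and> \<F> \<subseteq> lcos G C K \<and> C \<subseteq> \<Union>\<F>"
  proof (rule compactinD[OF C])
    show "openin T U" if "U \<in> lcos G C K" for U
      using that left_open[OF K(1)] Cc unfolding lcos_def by auto
    show "C \<subseteq> \<Union>(lcos G C K)" using lcos_self[OF K(2)] Cc unfolding lcos_def by auto
  qed
  then obtain \<F> where F: "finite \<F>" "\<F> \<subseteq> lcos G C K" "C \<subseteq> \<Union>\<F>" by blast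
  have "x <# K \<in> \<F>" if xC: "x \<in> C" for x
  proof -
    obtain D where D: "D \<in> \<F>" "x \<in> D" using F(3) xC by blast
    then obtain y where y: "y \<in> C" "D = y <# K" using F unfolding lcos_def by auto
    then show ?thesis using lcos_eq[OF K(2), of y x] D Cc by auto
  qed
  then have "lcos G C K \<subseteq> \<F>" unfolding lcos_def by auto
  then show ?thesis using F finite_subset by blast
qed

lemma open_subgroup_Int:
  assumes "openin T U" "openin T V" "\<one> \<in> U" "\<one> \<in> V"
  shows "\<exists>K. subgroup K G \<and> openin T K \<and> compactin T K \<and> K \<subseteq> U \<and> K \<subseteq> V"
  using basis[of "U \<inter> V"] assms by auto

text \<open>Finitely many cosets on which f is constant cover C, and a subgroup contained in all the corresponding
  subgroups works on C. Outside C, where f vanishes, one applies this to inverses.\<close>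

lemma locally_constant_uniform:
  assumes C: "compactin T C" and vanish: "\<And>x. x \<notin> C \<Longrightarrow> f x = (0::'v::zero)"
    and lc: "\<And>x. x \<in> carrier G \<Longrightarrow> \<exists>U. openin T U \<and> x \<in> U \<and> (\<forall>y\<in>U. f y = f x)"
  shows "\<exists>K. subgroup K G \<and> openin T K \<and> compactin T K \<and> right_inv G (carrier G) K f"
proof -
  have Cc: "C \<subseteq> carrier G" using compact_subset[OF C] .
  have "\<exists>K. subgroup K G \<and> openin T K \<and> (\<forall>k\<in>K. f (x \<otimes> k) = f x)" if x: "x \<in> carrier G" for x
  proof -
    obtain U where U: "openin T U" "x \<in> U" "\<forall>y\<in>U. f y = f x" using lc[OF x] by blast
    have "openin T {y \<in> topspace T. x \<otimes> y \<in> U}"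
      using left_continuous[OF x] U(1) unfolding continuous_map_def by blast
    moreover have "\<one> \<in> {y \<in> topspace T. x \<otimes> y \<in> U}" using x U topspace_eq by auto
    ultimately obtain K where "subgroup K G" "openin T K" "K \<subseteq> {y \<in> topspace T. x \<otimes> y \<in> U}"
      using basis by blast
    then show ?thesis using U by blast
  qed
  then obtain K where K: "\<And>x. x \<in> carrier G \<Longrightarrow> subgroup (K x) G \<and> openin T (K x) \<and> (\<forall>k\<in>K x. f (x \<otimes> k) = f x)"
    by metis
  have "\<exists>\<F>. finite \<F> \<and> \<F> \<subseteq> (\<lambda>x. x <# K x) ` C \<and> C \<subseteq> \<Union>\<F>"
  proof (rule compactinD[OF C])
    show "openin T U" if "U \<in> (\<lambda>x. x <# K x) ` C" for U using that K left_open Cc by auto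
    show "C \<subseteq> \<Union>((\<lambda>x. x <# K x) ` C)"
    proof
      fix x assume "x \<in> C"
      then show "x \<in> \<Union>((\<lambda>x. x <# K x) ` C)" using lcos_self[of "K x" x] K Cc by auto
    qed
  qed
  then obtain S where S: "finite S" "S \<subseteq> C" "C \<subseteq> (\<Union>x\<in>S. x <# K x)"
    by (metis (no_types, lifting) finite_subset_image)
  have "openin T ((\<Inter>x\<in>S. K x) \<inter> topspace T)"
    using S K Cc by (intro openin_INT) auto
  then have o: "openin T (topspace T \<inter> \<Inter>(K ` S))" by (simp add: Int_commute)
  have "\<one> \<in> topspace T \<inter> \<Inter>(K ` S)"
  proof -
    have "\<one> \<in> K x" if "x \<in> S" for x
      using subgroup.one_closed[of "K x" G] K[of x] S(2) Cc that by auto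
    then show ?thesis using topspace_eq by auto
  qed
  then obtain L where L: "subgroup L G" "openin T L" "compactin T L" "L \<subseteq> topspace T \<inter> \<Inter>(K ` S)"
    using basis[OF o] by blast
  have Lc: "L \<subseteq> carrier G" using L compact_subset by auto
  have main: "f (y \<otimes> l) = f y" if y: "y \<in> C" and l: "l \<in> L" for y l
  proof -
    obtain x where x: "x \<in> S" "y \<in> x <# K x" using S y by blast
    then obtain k where k: "k \<in> K x" "y = x \<otimes> k" unfolding l_coset_def by auto
    have xc: "x \<in> carrier G" using x S Cc by auto
    have sx: "subgroup (K x) G" and fx: "\<And>k. k \<in> K x \<Longrightarrow> f (x \<otimes> k) = f x" using K[OF xc] by auto
    have kc: "k \<in> carrier G" using subgroup.subset[OF sx] k(1) by auto
    have lc: "l \<in> carrier G" using l Lc by auto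
    have "l \<in> K x" using l L(4) x(1) by auto
    then have "f (x \<otimes> (k \<otimes> l)) = f x" by (rule fx[OF subgroup.m_closed[OF sx k(1)]])
    moreover have "f y = f x" using fx[OF k(1)] k(2) by simp
    ultimately show ?thesis using k(2) m_assoc[OF xc kc lc] by simp
  qed
  have "right_inv G (carrier G) L f" unfolding right_inv_def
  proof (intro ballI)
    fix x l assume x: "x \<in> carrier G" and l: "l \<in> L"
    have il: "inv l \<in> L" "l \<in> carrier G" using l L Lc subgroup.m_inv_closed by auto
    have xl: "(x \<otimes> l) \<otimes> inv l = x" using x il by (simp add: m_assoc)
    show "f (x \<otimes> l) = f x"
    proof (cases "x \<in> C")
      case False
      then show ?thesis
      proof (cases "x \<otimes> l \<in> C")
        case True then show ?thesis using main[OF True il(1)] xl by simp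
      qed (simp add: vanish)
    qed (use main l in auto)
  qed
  then show ?thesis using L by blast
qed

end

section \<open>Haar integral and modular character of an l-group\<close>

context lgroup
begin

lemma haar_integralD:
  assumes "haar_integral G T I" "f \<in> test_functions G T"
  shows "f' \<in> test_functions G T \<Longrightarrow> I (\<lambda>x. f x + f' x) = I f + I f'"
    "I (\<lambda>x. c * f x) = c * I f" "(\<And>x. 0 \<le> f x) \<Longrightarrow> 0 \<le> I f"
    "g \<in> carrier G \<Longrightarrow> I (restrict0 (carrier G) (\<lambda>u. f (g \<otimes> u))) = I f"
  using assms unfolding haar_integral_def by blast+

definition ind :: "'a set \<Rightarrow> 'a \<Rightarrow> real" where "ind A = (\<lambda>x. if x \<in> A then 1 else 0)"

definition uniform_for :: "'a set \<Rightarrow> ('a \<Rightarrow> real) \<Rightarrow> 'a set \<Rightarrow> bool" where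
  "uniform_for K0 f K \<longleftrightarrow> subgroup K G \<and> openin T K \<and> K \<subseteq> K0 \<and> right_inv G (carrier G) K f"

lemma test_functions_D:
  assumes "f \<in> test_functions G T"
  obtains C where "compactin T C" "\<And>x. x \<notin> C \<Longrightarrow> f x = 0"
  using assms unfolding test_functions_def by blast

lemma test_uniform:
  assumes f: "f \<in> test_functions G T" and K0: "openin T K0" "\<one> \<in> K0"
  shows "\<exists>K. uniform_for K0 f K"
proof -
  obtain C where C: "compactin T C" "\<And>x. x \<notin> C \<Longrightarrow> f x = 0" using test_functions_D[OF f] by blast
  have "\<exists>K. subgroup K G \<and> openin T K \<and> compactin T K \<and> right_inv G (carrier G) K f"
    using f by (intro locally_constant_uniform[OF C]) (auto simp: test_functions_def)
  then obtain K where K: "subgroup K G" "openin T K" "right_inv G (carrier G) K f" by blast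
  obtain M where M: "subgroup M G" "openin T M" "M \<subseteq> K" "M \<subseteq> K0"
    using open_subgroup_Int[OF K(2) K0(1) _ K0(2)] K(1) subgroup.one_closed by blast
  have "right_inv G (carrier G) M f" using K(3) M(3) unfolding right_inv_def by auto
  then show ?thesis using M unfolding uniform_for_def by blast
qed

lemma test_finite_support:
  assumes f: "f \<in> test_functions G T" and K: "subgroup K G" "openin T K"
  shows "finite {C \<in> lcos G (carrier G) K. f (rep_of C) \<noteq> 0}"
proof -
  obtain C where C: "compactin T C" "\<And>x. x \<notin> C \<Longrightarrow> f x = 0" using test_functions_D[OF f] by blast
  have "{C \<in> lcos G (carrier G) K. f (rep_of C) \<noteq> 0} \<subseteq> lcos G C K"
  proof
    fix D assume D: "D \<in> {C \<in> lcos G (carrier G) K. f (rep_of C) \<noteq> 0}"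
    then have "rep_of D \<in> C" using C(2) by blast
    moreover have "rep_of D <# K = D"
      using rep_of_in(2)[OF K(1) subgroup_self, of D] D subgroup.subset[OF K(1)] by auto
    ultimately show "D \<in> lcos G C K" unfolding lcos_def by blast
  qed
  then show ?thesis using finite_lcos_compact[OF C(1) K(2,1)] finite_subset by blast
qed

lemma uniform_refine:
  fixes f :: "'a \<Rightarrow> real"
  assumes "f \<in> test_functions G T" "uniform_for K0 f K" "uniform_for K0 f M" "M \<subseteq> K"
  shows "coset_sum G (carrier G) M f = card (lcos G K M) * coset_sum G (carrier G) K f"
proof -
  have K: "subgroup K G" "openin T K" "right_inv G (carrier G) K f" and M: "subgroup M G"
    using assms unfolding uniform_for_def by auto
  show ?thesis
    using coset_sum_refine[OF subgroup_self K(1) subgroup.subset[OF K(1)] M assms(4) K(3)] by simp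
qed

lemma card_lcos_mult:
  assumes K0: "subgroup K0 G" "compactin T K0" and K: "subgroup K G" "openin T K" "K \<subseteq> K0"
    and M: "subgroup M G" "openin T M" "M \<subseteq> K"
  shows "real (card (lcos G K0 M)) = card (lcos G K M) * card (lcos G K0 K)"
    "0 < card (lcos G K0 K)"
proof -
  have f: "finite (lcos G K0 K)" "finite (lcos G K0 M)"
    using finite_lcos_compact[OF K0(2)] K M by auto
  have "coset_sum G K0 M (\<lambda>_. 1::real) = (\<Sum>D\<in>lcos G K M. coset_sum G K0 K (\<lambda>_. 1::real))"
    using f by (intro coset_sum_refine[OF K0(1) K(1,3) M(1,3)]) (auto simp: right_inv_def)
  then show "real (card (lcos G K0 M)) = card (lcos G K M) * card (lcos G K0 K)"
    using f by (simp add: coset_sum_finite)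
  show "0 < card (lcos G K0 K)" using f lcos_nonempty[OF K0(1)] by (simp add: card_gt_0_iff)
qed

text \<open>The value of the Haar integral that gives the compact open subgroup K0 measure one.\<close>

definition haar :: "'a set \<Rightarrow> ('a \<Rightarrow> real) \<Rightarrow> real" where
  "haar K0 f = (let K = SOME K. uniform_for K0 f K in
     coset_sum G (carrier G) K f / card (lcos G K0 K))"

context
  fixes K0 assumes K0: "subgroup K0 G" "openin T K0" "compactin T K0"
begin

text \<open>Two admissible subgroups K have a common refinement, and passing to it multiplies the numerator and
  the denominator by the same index.\<close>

lemma haar_eq:
  assumes f: "f \<in> test_functions G T" and K: "uniform_for K0 f K"
  shows "haar K0 f = coset_sum G (carrier G) K f / card (lcos G K0 K)"
proof -
  define J where "J = (SOME K. uniform_for K0 f K)"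
  have J: "uniform_for K0 f J" unfolding J_def using someI[of "uniform_for K0 f", OF K] .
  have sJ: "subgroup J G" "openin T J" "J \<subseteq> K0" "right_inv G (carrier G) J f"
    and sK: "subgroup K G" "openin T K" "K \<subseteq> K0" using J K unfolding uniform_for_def by auto
  obtain M where M: "subgroup M G" "openin T M" "M \<subseteq> J" "M \<subseteq> K"
    using open_subgroup_Int[OF sJ(2) sK(2)] subgroup.one_closed[OF sJ(1)] subgroup.one_closed[OF sK(1)]
    by blast
  have uM: "uniform_for K0 f M" using M sJ unfolding uniform_for_def right_inv_def by auto
  have *: "coset_sum G (carrier G) L f / card (lcos G K0 L) = coset_sum G (carrier G) M f / card (lcos G K0 M)"
    if L: "uniform_for K0 f L" "M \<subseteq> L" for L
  proof -
    have sL: "subgroup L G" "openin T L" "L \<subseteq> K0" using L unfolding uniform_for_def by auto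
    note c = card_lcos_mult[OF K0(1,3) sL M(1,2) L(2)]
    have "finite (lcos G L M)"
    proof -
      have "lcos G L M \<subseteq> lcos G K0 M" using sL(3) unfolding lcos_def by auto
      then show ?thesis using finite_lcos_compact[OF K0(3) M(2,1)] finite_subset by blast
    qed
    then have "0 < card (lcos G L M)" using lcos_nonempty[OF sL(1)] by (simp add: card_gt_0_iff)
    then show ?thesis unfolding c(1) uniform_refine[OF f L(1) uM L(2)] using c(2) by simp
  qed
  show ?thesis unfolding haar_def J_def[symmetric] Let_def using *[OF J M(3)] *[OF K M(4)] by simp
qed

lemma uniform_common:
  assumes "uniform_for K0 f K" "uniform_for K0 g M"
  shows "\<exists>J. uniform_for K0 f J \<and> uniform_for K0 g J"
proof -
  have s: "subgroup K G" "openin T K" "K \<subseteq> K0" "subgroup M G" "openin T M"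
    using assms unfolding uniform_for_def by auto
  obtain J where "subgroup J G" "openin T J" "J \<subseteq> K" "J \<subseteq> M"
    using open_subgroup_Int[OF s(2,5)] subgroup.one_closed[OF s(1)] subgroup.one_closed[OF s(4)] by blast
  then have "uniform_for K0 f J \<and> uniform_for K0 g J"
    using assms unfolding uniform_for_def right_inv_def by blast
  then show ?thesis ..
qed

lemma haar_add:
  assumes f: "f \<in> test_functions G T" and g: "g \<in> test_functions G T"
  shows "haar K0 (\<lambda>x. f x + g x) = haar K0 f + haar K0 g"
    "(\<lambda>x. f x + g x) \<in> test_functions G T"
proof -
  obtain C where C: "compactin T C" "\<And>x. x \<notin> C \<Longrightarrow> f x = 0" using test_functions_D[OF f] by blast
  obtain C' where C': "compactin T C'" "\<And>x. x \<notin> C' \<Longrightarrow> g x = 0" using test_functions_D[OF g] by blast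
  show fg: "(\<lambda>x. f x + g x) \<in> test_functions G T"
    unfolding test_functions_def
  proof (intro CollectI conjI allI impI ballI)
    fix x assume x: "x \<in> carrier G"
    obtain U where U: "openin T U" "x \<in> U" "\<forall>y\<in>U. f y = f x"
      using f x unfolding test_functions_def by blast
    obtain V where V: "openin T V" "x \<in> V" "\<forall>y\<in>V. g y = g x"
      using g x unfolding test_functions_def by blast
    show "\<exists>U. openin T U \<and> x \<in> U \<and> (\<forall>y\<in>U. f y + g y = f x + g x)"
    proof (intro exI[of _ "U \<inter> V"] conjI ballI)
      fix y assume "y \<in> U \<inter> V"
      then have "f y = f x" "g y = g x" using bspec[OF U(3)] bspec[OF V(3)] by blast+
      then show "f y + g y = f x + g x" by (simp only:)
    qed (use U(1,2) V(1,2) in auto)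
  next
    show "\<exists>C. compactin T C \<and> (\<forall>x. x \<notin> C \<longrightarrow> f x + g x = 0)"
      using C C' by (intro exI[of _ "C \<union> C'"]) (auto intro: compactin_Un)
  qed (use f g in \<open>auto simp: test_functions_def\<close>)
  obtain J where J: "uniform_for K0 f J" "uniform_for K0 g J"
    using uniform_common test_uniform[OF f K0(2)] test_uniform[OF g K0(2)] subgroup.one_closed[OF K0(1)]
    by meson
  have Jfg: "uniform_for K0 (\<lambda>x. f x + g x) J" using J unfolding uniform_for_def right_inv_def by auto
  have sJ: "subgroup J G" "openin T J" using J unfolding uniform_for_def by auto
  let ?F = "{C \<in> lcos G (carrier G) J. f (rep_of C) \<noteq> 0} \<union> {C \<in> lcos G (carrier G) J. g (rep_of C) \<noteq> 0}"
  have fin: "finite ?F" using test_finite_support[OF f sJ] test_finite_support[OF g sJ] by simp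
  have "coset_sum G (carrier G) J h = (\<Sum>C\<in>?F. h (rep_of C))"
    if "\<And>x. f x = 0 \<Longrightarrow> g x = 0 \<Longrightarrow> h x = 0" for h :: "'a \<Rightarrow> real"
    using that by (intro coset_sum_superset fin) auto
  note e = this[of f] this[of g] this[of "\<lambda>x. f x + g x"]
  show "haar K0 (\<lambda>x. f x + g x) = haar K0 f + haar K0 g"
    unfolding haar_eq[OF f J(1)] haar_eq[OF g J(2)] haar_eq[OF fg Jfg]
    by (simp add: e sum.distrib add_divide_distrib)
qed

lemma haar_scale:
  assumes f: "f \<in> test_functions G T"
  shows "haar K0 (\<lambda>x. c * f x) = c * haar K0 f"
    "(\<lambda>x. c * f x) \<in> test_functions G T"
proof -
  obtain C where C: "compactin T C" "\<And>x. x \<notin> C \<Longrightarrow> f x = 0" using test_functions_D[OF f] by blast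
  show cf: "(\<lambda>x. c * f x) \<in> test_functions G T"
    unfolding test_functions_def
  proof (intro CollectI conjI allI impI ballI)
    fix x assume x: "x \<in> carrier G"
    obtain U where U: "openin T U" "x \<in> U" "\<forall>y\<in>U. f y = f x"
      using f x unfolding test_functions_def by blast
    then show "\<exists>U. openin T U \<and> x \<in> U \<and> (\<forall>y\<in>U. c * f y = c * f x)" by metis
  next
    show "\<exists>C. compactin T C \<and> (\<forall>x. x \<notin> C \<longrightarrow> c * f x = 0)" using C by auto
  qed (use f in \<open>auto simp: test_functions_def\<close>)
  obtain J where J: "uniform_for K0 f J"
    using test_uniform[OF f K0(2)] subgroup.one_closed[OF K0(1)] by meson
  have Jc: "uniform_for K0 (\<lambda>x. c * f x) J" using J unfolding uniform_for_def right_inv_def by auto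
  have sJ: "subgroup J G" "openin T J" using J unfolding uniform_for_def by auto
  have "coset_sum G (carrier G) J (\<lambda>x. c * f x)
      = (\<Sum>C\<in>{C \<in> lcos G (carrier G) J. f (rep_of C) \<noteq> 0}. c * f (rep_of C))"
    by (intro coset_sum_superset test_finite_support f sJ) auto
  also have "\<dots> = c * coset_sum G (carrier G) J f" unfolding coset_sum_def sum_distrib_left ..
  finally show "haar K0 (\<lambda>x. c * f x) = c * haar K0 f"
    unfolding haar_eq[OF f J] haar_eq[OF cf Jc] by simp
qed

lemma haar_nonneg:
  assumes f: "f \<in> test_functions G T" "\<And>x. 0 \<le> f x"
  shows "0 \<le> haar K0 f"
proof -
  obtain J where J: "uniform_for K0 f J"
    using test_uniform[OF f(1) K0(2)] subgroup.one_closed[OF K0(1)] by meson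
  show ?thesis unfolding haar_eq[OF f(1) J] coset_sum_def using f(2) by (simp add: sum_nonneg)
qed

lemma translate_test:
  assumes f: "f \<in> test_functions G T" and g: "g \<in> carrier G"
  shows "restrict0 (carrier G) (\<lambda>u. f (g \<otimes> u)) \<in> test_functions G T"
    "restrict0 (carrier G) (\<lambda>u. f (u \<otimes> g)) \<in> test_functions G T"
proof -
  obtain C where C: "compactin T C" "\<And>x. x \<notin> C \<Longrightarrow> f x = 0" using test_functions_D[OF f] by blast
  have Cc: "C \<subseteq> carrier G" using compact_subset[OF C(1)] .
  have loc: "\<exists>U. openin T U \<and> x \<in> U \<and> (\<forall>y\<in>U. restrict0 (carrier G) (\<lambda>u. f (m u)) y
      = restrict0 (carrier G) (\<lambda>u. f (m u)) x)"
    if m: "continuous_map T T m" and x: "x \<in> carrier G" for m x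
  proof -
    have "m x \<in> carrier G" using m x topspace_eq unfolding continuous_map_def by auto
    then obtain U where U: "openin T U" "m x \<in> U" "\<forall>y\<in>U. f y = f (m x)"
      using f unfolding test_functions_def by blast
    have "openin T {y \<in> topspace T. m y \<in> U}" using m U(1) unfolding continuous_map_def by blast
    then show ?thesis
    proof (intro exI[of _ "{y \<in> topspace T. m y \<in> U}"] conjI ballI)
      fix y assume "y \<in> {y \<in> topspace T. m y \<in> U}"
      then have "y \<in> carrier G" "f (m y) = f (m x)" using bspec[OF U(3)] topspace_eq by blast+
      then show "restrict0 (carrier G) (\<lambda>u. f (m u)) y = restrict0 (carrier G) (\<lambda>u. f (m u)) x"
        using x unfolding restrict0_def by (simp only: if_True)
    qed (use U(1,2) x topspace_eq in auto)
  qed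
  have "\<exists>C. compactin T C \<and> (\<forall>x. x \<notin> C \<longrightarrow> restrict0 (carrier G) (\<lambda>u. f (g \<otimes> u)) x = 0)"
  proof (intro exI[of _ "(\<lambda>x. inv g \<otimes> x) ` C"] conjI allI impI)
    fix x assume x: "x \<notin> (\<lambda>x. inv g \<otimes> x) ` C"
    have "g \<otimes> x \<notin> C" if xc: "x \<in> carrier G"
    proof
      assume "g \<otimes> x \<in> C"
      moreover have "inv g \<otimes> (g \<otimes> x) = x" using inv_mult_cancel g xc by simp
      ultimately show False using x by (metis imageI)
    qed
    then show "restrict0 (carrier G) (\<lambda>u. f (g \<otimes> u)) x = 0" using C(2) by (simp add: restrict0_def)
  qed (use compact_left[OF C(1)] g in auto)
  then show "restrict0 (carrier G) (\<lambda>u. f (g \<otimes> u)) \<in> test_functions G T"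
    using loc[OF left_continuous[OF g]] unfolding test_functions_def by (auto simp: restrict0_def)
  have "\<exists>C. compactin T C \<and> (\<forall>x. x \<notin> C \<longrightarrow> restrict0 (carrier G) (\<lambda>u. f (u \<otimes> g)) x = 0)"
  proof (intro exI[of _ "(\<lambda>x. x \<otimes> inv g) ` C"] conjI allI impI)
    fix x assume x: "x \<notin> (\<lambda>x. x \<otimes> inv g) ` C"
    have "x \<otimes> g \<notin> C" if xc: "x \<in> carrier G"
    proof
      assume "x \<otimes> g \<in> C"
      moreover have "(x \<otimes> g) \<otimes> inv g = x" using g xc by (simp add: m_assoc)
      ultimately show False using x by (metis (no_types, lifting) image_eqI)
    qed
    then show "restrict0 (carrier G) (\<lambda>u. f (u \<otimes> g)) x = 0" using C(2) by (simp add: restrict0_def)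
  qed (use compact_right[OF C(1)] g in auto)
  then show "restrict0 (carrier G) (\<lambda>u. f (u \<otimes> g)) \<in> test_functions G T"
    using loc[OF right_continuous[OF g]] unfolding test_functions_def by (auto simp: restrict0_def)
qed

lemma conj_test:
  assumes f: "f \<in> test_functions G T" and g: "g \<in> carrier G"
  shows "restrict0 (carrier G) (\<lambda>u. f (inv g \<otimes> u \<otimes> g)) \<in> test_functions G T"
proof -
  have "restrict0 (carrier G) (\<lambda>u. f (inv g \<otimes> u \<otimes> g))
      = restrict0 (carrier G) (\<lambda>u. restrict0 (carrier G) (\<lambda>u. f (u \<otimes> g)) (inv g \<otimes> u))"
    using g by (auto simp: restrict0_def)
  then show ?thesis using translate_test(1)[OF translate_test(2)[OF f g], of "inv g"] g by simp
qed

lemma haar_left_inv: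
  assumes f: "f \<in> test_functions G T" and g: "g \<in> carrier G"
  shows "haar K0 (restrict0 (carrier G) (\<lambda>u. f (g \<otimes> u))) = haar K0 f"
proof -
  note tf = translate_test(1)[OF f g]
  obtain J where J: "uniform_for K0 f J"
    using test_uniform[OF f K0(2)] subgroup.one_closed[OF K0(1)] by meson
  have sJ: "subgroup J G" "right_inv G (carrier G) J f" using J unfolding uniform_for_def by auto
  have Jc: "J \<subseteq> carrier G" using sJ subgroup.subset by auto
  have "right_inv G (carrier G) J (restrict0 (carrier G) (\<lambda>u. f (g \<otimes> u)))"
    using sJ Jc g unfolding right_inv_def restrict0_def by (auto simp: m_assoc[symmetric])
  then have J': "uniform_for K0 (restrict0 (carrier G) (\<lambda>u. f (g \<otimes> u))) J"
    using J unfolding uniform_for_def by auto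
  have "coset_sum G (carrier G) J (restrict0 (carrier G) (\<lambda>u. f (g \<otimes> u)))
      = coset_sum G (carrier G) J (\<lambda>u. f (g \<otimes> u))"
    using rep_of_in(1)[OF sJ(1) subgroup_self Jc] unfolding coset_sum_def
    by (intro sum.cong) (auto simp: restrict0_def)
  also have "\<dots> = coset_sum G (carrier G) J f"
    by (rule coset_sum_translate[OF subgroup_self sJ(1) Jc sJ(2) g])
  finally show ?thesis unfolding haar_eq[OF f J] haar_eq[OF tf J'] by simp
qed

lemma ind_test:
  assumes K: "subgroup K G" "openin T K" "compactin T K" and x: "x \<in> carrier G"
  shows "ind (x <# K) \<in> test_functions G T"
proof -
  have eq: "x <# K = (\<lambda>y. x \<otimes> y) ` K" unfolding l_coset_def by auto
  have Kc: "K \<subseteq> carrier G" using K subgroup.subset by auto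
  have xK: "compactin T (x <# K)" using compact_left[OF K(3) x] eq by simp
  have "\<exists>U. openin T U \<and> y \<in> U \<and> (\<forall>z\<in>U. ind (x <# K) z = ind (x <# K) y)" if y: "y \<in> carrier G" for y
  proof (intro exI[of _ "y <# K"] conjI ballI)
    fix z assume z: "z \<in> y <# K"
    have zc: "z \<in> carrier G" using z y Kc unfolding l_coset_def by auto
    have e: "z <# K = y <# K" using lcos_eq[OF K(1) y z] .
    have "w \<in> x <# K \<longleftrightarrow> w <# K = x <# K" if "w \<in> carrier G" for w
      using lcos_eq[OF K(1) x] lcos_self[OF K(1) that] by auto
    then show "ind (x <# K) z = ind (x <# K) y" using e y zc unfolding ind_def by auto
  qed (use left_open[OF K(2) y] lcos_self[OF K(1) y] in auto)
  then show ?thesis using xK compact_subset[OF xK] unfolding test_functions_def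
    by (auto simp: ind_def)
qed

lemma test_sum:
  "finite S \<Longrightarrow> (\<And>s. s \<in> S \<Longrightarrow> F s \<in> test_functions G T) \<Longrightarrow>
    (\<lambda>x. \<Sum>s\<in>S. F s x :: real) \<in> test_functions G T"
proof (induction rule: finite_induct)
  case empty
  have "openin T (carrier G)" using openin_topspace[of T] topspace_eq by simp
  then show ?case unfolding test_functions_def by auto
next
  case (insert s S)
  then show ?case using haar_add(2)[of "F s" "\<lambda>x. \<Sum>s\<in>S. F s x"] by simp
qed

lemma haar_integral_sum:
  assumes I: "haar_integral G T I" and S: "finite S" "\<And>s. s \<in> S \<Longrightarrow> F s \<in> test_functions G T"
  shows "I (\<lambda>x. \<Sum>s\<in>S. F s x) = (\<Sum>s\<in>S. I (F s))"
  using S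
proof (induction rule: finite_induct)
  case empty
  have "(\<lambda>x. 0) \<in> test_functions G T" using test_sum[of "{}"] by simp
  then have "I (\<lambda>x. 0 * 0) = 0 * I (\<lambda>x. 0)" by (rule haar_integralD(2)[OF I])
  then show ?case by simp
next
  case (insert s S)
  have "I (\<lambda>x. F s x + (\<Sum>s\<in>S. F s x)) = I (F s) + I (\<lambda>x. \<Sum>s\<in>S. F s x)"
    using insert test_sum[of S F] by (intro haar_integralD(1)[OF I]) auto
  then show ?case using insert by simp
qed

lemma haar_integral_ind_coset:
  assumes I: "haar_integral G T I" and K: "subgroup K G" "openin T K" "compactin T K" and x: "x \<in> carrier G"
  shows "I (ind (x <# K)) = I (ind K)"
proof -
  have Kc: "K \<subseteq> carrier G" using K subgroup.subset by auto
  have "restrict0 (carrier G) (\<lambda>u. ind (x <# K) (x \<otimes> u)) = ind K"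
  proof
    fix u show "restrict0 (carrier G) (\<lambda>u. ind (x <# K) (x \<otimes> u)) u = ind K u"
    proof (cases "u \<in> carrier G")
      case True
      have "x \<otimes> u \<in> x <# K \<longleftrightarrow> u \<in> K"
      proof
        assume "x \<otimes> u \<in> x <# K"
        then obtain k where k: "k \<in> K" "x \<otimes> u = x \<otimes> k" unfolding l_coset_def by auto
        then have "u = k" using inv_mult_cancel(1)[OF x True] inv_mult_cancel(1)[OF x, of k] Kc by auto
        then show "u \<in> K" using k by simp
      qed (auto simp: l_coset_def)
      then show ?thesis using True by (simp add: restrict0_def ind_def)
    qed (use Kc in \<open>auto simp: restrict0_def ind_def\<close>)
  qed
  moreover have "I (restrict0 (carrier G) (\<lambda>u. ind (x <# K) (x \<otimes> u))) = I (ind (x <# K))"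
    using haar_integralD(4)[OF I ind_test[OF K x] x] .
  ultimately show ?thesis by simp
qed

lemma lcoset_one: "\<one> <# K0 = K0"
proof -
  have "K0 \<subseteq> carrier G" using subgroup.subset[OF K0(1)] .
  then show ?thesis by (force simp: l_coset_def)
qed

lemma ind_K0_test: "ind K0 \<in> test_functions G T"
  using ind_test[OF K0 one_closed] lcoset_one by simp

text \<open>A test function is a combination of indicators of cosets of a small subgroup, all of which
  have the same integral.\<close>

lemma haar_unique:
  assumes I: "haar_integral G T I" and f: "f \<in> test_functions G T"
  shows "I f = I (ind K0) * haar K0 f"
proof -
  have main: "I f = I (ind K) * coset_sum G (carrier G) K f"
    if f: "f \<in> test_functions G T" and K: "subgroup K G" "openin T K" "compactin T K" "right_inv G (carrier G) K f" for f K
  proof -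
    have Kc: "K \<subseteq> carrier G" using K subgroup.subset by auto
    let ?S = "{C \<in> lcos G (carrier G) K. f (rep_of C) \<noteq> 0}"
    have S: "finite ?S" using test_finite_support[OF f K(1,2)] .
    have r: "rep_of C \<in> carrier G" "rep_of C <# K = C" if "C \<in> ?S" for C
      using rep_of_in[OF K(1) subgroup_self Kc, of C] that by auto
    have t: "(\<lambda>x. f (rep_of C) * ind C x) \<in> test_functions G T" "ind C \<in> test_functions G T"
      "I (\<lambda>x. f (rep_of C) * ind C x) = f (rep_of C) * I (ind K)" if C: "C \<in> ?S" for C
    proof -
      show 1: "ind C \<in> test_functions G T" using ind_test[OF K(1-3) r(1)[OF C]] r(2)[OF C] by simp
      then show "(\<lambda>x. f (rep_of C) * ind C x) \<in> test_functions G T" by (rule haar_scale(2))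
      have "I (\<lambda>x. f (rep_of C) * ind C x) = f (rep_of C) * I (ind C)"
        using haar_integralD(2)[OF I 1] .
      then show "I (\<lambda>x. f (rep_of C) * ind C x) = f (rep_of C) * I (ind K)"
        using haar_integral_ind_coset[OF I K(1-3) r(1)[OF C]] r(2)[OF C] by simp
    qed
    have "f = (\<lambda>x. \<Sum>C\<in>?S. f (rep_of C) * ind C x)"
    proof
      fix x
      show "f x = (\<Sum>C\<in>?S. f (rep_of C) * ind C x)"
      proof (cases "x \<in> carrier G")
        case False
        then have "ind C x = 0" if "C \<in> ?S" for C
        proof -
          have "C \<subseteq> carrier G" using r[OF that] l_coset_subset_G[OF Kc] by metis
          then show ?thesis using False unfolding ind_def by auto
        qed
        then show ?thesis using False f by (simp add: test_functions_def)
      next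
        case True
        have u: "C = x <# K" if "C \<in> ?S" "x \<in> C" for C
          using r[OF that(1)] that(2) lcos_eq[OF K(1), of "rep_of C" x] by simp
        have v: "f (rep_of (x <# K)) = f x" using rep_of_value[OF K(1) subset_refl K(4) True] .
        have "(\<Sum>C\<in>?S. f (rep_of C) * ind C x) = (\<Sum>C\<in>?S \<inter> {x <# K}. f (rep_of C) * ind C x)"
          using S u by (intro sum.mono_neutral_right) (auto simp: ind_def)
        also have "\<dots> = f x"
        proof (cases "f x = 0")
          case True then show ?thesis using v by (auto intro!: sum.neutral)
        next
          case False
          then have "?S \<inter> {x <# K} = {x <# K}" using v True unfolding lcos_def by auto
          then show ?thesis using v lcos_self[OF K(1) True] by (simp add: ind_def)
        qed
        finally show ?thesis by simp
      qed
    qed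
    then have "I f = I (\<lambda>x. \<Sum>C\<in>?S. f (rep_of C) * ind C x)" by simp
    also have "\<dots> = (\<Sum>C\<in>?S. f (rep_of C) * I (ind K))"
      using haar_integral_sum[OF I S, of "\<lambda>C x. f (rep_of C) * ind C x"] t by simp
    also have "\<dots> = I (ind K) * coset_sum G (carrier G) K f"
      unfolding coset_sum_def by (simp add: sum_distrib_left mult.commute)
    finally show ?thesis .
  qed
  obtain J where J: "uniform_for K0 f J"
    using test_uniform[OF f K0(2)] subgroup.one_closed[OF K0(1)] by meson
  then have oJ: "openin T J" "subgroup J G" unfolding uniform_for_def by auto
  obtain K where K: "subgroup K G" "openin T K" "compactin T K" "K \<subseteq> J"
    using basis[OF oJ(1)] subgroup.one_closed[OF oJ(2)] by blast
  have uK: "uniform_for K0 f K" using J K unfolding uniform_for_def right_inv_def by blast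
  then have rK: "right_inv G (carrier G) K f" "K \<subseteq> K0" unfolding uniform_for_def by auto
  have K0c: "K0 \<subseteq> carrier G" using K0 subgroup.subset by auto
  have mem: "x \<otimes> k \<in> K0 \<longleftrightarrow> x \<in> K0" if "x \<in> carrier G" "k \<in> K0" for x k
    using subgroup_mult_right[OF K0(1) subset_refl, of "x \<otimes> k" "inv k"] that K0c
      subgroup.m_inv_closed[OF K0(1)] subgroup_mult_right[OF K0(1) subset_refl, of x k]
    by (auto simp: m_assoc subset_iff)
  have r0: "right_inv G (carrier G) K0 (ind K0)"
    unfolding right_inv_def ind_def using mem by auto
  have r1: "right_inv G (carrier G) K (ind K0)" using r0 rK(2) unfolding right_inv_def by auto
  have fin: "finite (lcos G K0 K)" using finite_lcos_compact[OF K0(3) K(2,1)] .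
  have "coset_sum G (carrier G) K (ind K0) = (\<Sum>C\<in>lcos G K0 K. ind K0 (rep_of C))"
  proof (rule coset_sum_superset[OF fin])
    show "lcos G K0 K \<subseteq> lcos G (carrier G) K" using K0c unfolding lcos_def by auto
    fix C assume C: "C \<in> lcos G (carrier G) K" "ind K0 (rep_of C) \<noteq> 0"
    then have "rep_of C \<in> K0" by (simp add: ind_def split: if_splits)
    then show "C \<in> lcos G K0 K"
      using rep_of_in(2)[OF K(1) subgroup_self subgroup.subset[OF K(1)] C(1)] unfolding lcos_def by blast
  qed
  also have "\<dots> = (\<Sum>C\<in>lcos G K0 K. 1)"
    using rep_of_in(1)[OF K(1) K0(1) rK(2)] by (intro sum.cong) (auto simp: ind_def)
  finally have "I (ind K0) = I (ind K) * card (lcos G K0 K)" using main[OF ind_K0_test K(1-3) r1] by simp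
  moreover have "0 < card (lcos G K0 K)" using card_lcos_mult(2)[OF K0(1,3) K(1,2) rK(2) K(1,2) subset_refl] .
  ultimately show ?thesis using main[OF f K(1-3) rK(1)] haar_eq[OF f uK] by simp
qed

lemma haar_K0: "haar K0 (ind K0) = 1"
proof -
  have K0c: "K0 \<subseteq> carrier G" using K0 subgroup.subset by auto
  have u: "uniform_for K0 (ind K0) K0"
  proof -
    have "x \<otimes> k \<in> K0 \<longleftrightarrow> x \<in> K0" if "x \<in> carrier G" "k \<in> K0" for x k
      using subgroup_mult_right[OF K0(1) subset_refl, of "x \<otimes> k" "inv k"] that K0c
        subgroup.m_inv_closed[OF K0(1)] subgroup_mult_right[OF K0(1) subset_refl, of x k]
      by (auto simp: m_assoc subset_iff)
    then show ?thesis using K0 unfolding uniform_for_def right_inv_def ind_def by auto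
  qed
  have l: "lcos G K0 K0 = {K0}"
  proof -
    have "x <# K0 = K0" if "x \<in> K0" for x
      using lcos_eq[OF K0(1) one_closed, of x] lcoset_one that by simp
    then show ?thesis using subgroup.one_closed[OF K0(1)] unfolding lcos_def by auto
  qed
  have r: "rep_of K0 \<in> K0" using rep_of_lcos[OF K0(1) one_closed] lcoset_one by simp
  have "coset_sum G (carrier G) K0 (ind K0) = (\<Sum>C\<in>{K0}. ind K0 (rep_of C))"
  proof (rule coset_sum_superset)
    show "{K0} \<subseteq> lcos G (carrier G) K0"
      using imageI[OF one_closed, of "\<lambda>x. x <# K0"] unfolding lcos_def lcoset_one by simp
    fix C assume C: "C \<in> lcos G (carrier G) K0" "ind K0 (rep_of C) \<noteq> 0"
    then have "rep_of C \<in> K0" by (simp add: ind_def split: if_splits)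
    then have "rep_of C <# K0 = K0" using lcos_eq[OF K0(1) one_closed, of "rep_of C"] lcoset_one by simp
    then show "C \<in> {K0}"
      using rep_of_in(2)[OF K0(1) subgroup_self K0c C(1)] by simp
  qed simp
  then show ?thesis unfolding haar_eq[OF ind_K0_test u] l using r by (simp add: ind_def)
qed

lemma haar_is_integral: "haar_integral G T (haar K0)"
  unfolding haar_integral_def using haar_add haar_scale haar_nonneg haar_left_inv ind_K0_test haar_K0
  by (auto intro!: bexI[of _ "ind K0"])

text \<open>Conjugation preserves left invariance. By uniqueness it multiplies the integral by a constant, which
  is the modular character.\<close>

lemma haar_conj_integral:
  assumes g: "g \<in> carrier G" and I: "haar_integral G T I"
  shows "haar_integral G T (\<lambda>f. I (restrict0 (carrier G) (\<lambda>u. f (inv g \<otimes> u \<otimes> g))))"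
proof -
  define c where "c = (\<lambda>f::'a \<Rightarrow> real. restrict0 (carrier G) (\<lambda>u. f (inv g \<otimes> u \<otimes> g)))"
  have ct: "c f \<in> test_functions G T" if "f \<in> test_functions G T" for f
    using conj_test[OF that g] unfolding c_def .
  have 1: "c (\<lambda>x. f x + f' x) = (\<lambda>x. c f x + c f' x)" for f f' unfolding c_def restrict0_def by auto
  have 2: "c (\<lambda>x. a * f x) = (\<lambda>x. a * c f x)" for f a unfolding c_def restrict0_def by auto
  have 3: "c (restrict0 (carrier G) (\<lambda>u. f (h \<otimes> u))) = restrict0 (carrier G) (\<lambda>u. c f ((g \<otimes> h \<otimes> inv g) \<otimes> u))"
    if h: "h \<in> carrier G" for f h
  proof
    fix u
    have "inv g \<otimes> (g \<otimes> h \<otimes> inv g \<otimes> u) \<otimes> g = h \<otimes> (inv g \<otimes> u \<otimes> g)" if "u \<in> carrier G"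
      using that g h by (simp add: m_assoc inv_mult_cancel)
    then show "c (restrict0 (carrier G) (\<lambda>u. f (h \<otimes> u))) u
        = restrict0 (carrier G) (\<lambda>u. c f ((g \<otimes> h \<otimes> inv g) \<otimes> u)) u"
      using g h unfolding c_def restrict0_def by auto
  qed
  have inv: "I (c (restrict0 (carrier G) (\<lambda>u. f (h \<otimes> u)))) = I (c f)"
    if "f \<in> test_functions G T" "h \<in> carrier G" for f h
    unfolding 3[OF that(2)] using that(2) g by (intro haar_integralD(4)[OF I ct[OF that(1)]]) auto
  obtain f where f: "f \<in> test_functions G T" "I f \<noteq> 0" using I unfolding haar_integral_def by blast
  define f' where "f' = restrict0 (carrier G) (\<lambda>u. f (g \<otimes> u \<otimes> inv g))"
  have f': "f' \<in> test_functions G T" using conj_test[OF f(1), of "inv g"] g unfolding f'_def by simp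
  have "c f' = f"
  proof
    fix u show "c f' u = f u"
    proof (cases "u \<in> carrier G")
      case True
      have "g \<otimes> (inv g \<otimes> u \<otimes> g) \<otimes> inv g = u" using True g by (simp add: m_assoc inv_mult_cancel)
      then show ?thesis using True g unfolding c_def f'_def restrict0_def by auto
    next
      case False then show ?thesis using f(1) unfolding c_def restrict0_def test_functions_def by auto
    qed
  qed
  then have nz: "\<exists>f\<in>test_functions G T. I (c f) \<noteq> 0" using f f' by auto
  have nn: "0 \<le> I (c f)" if "f \<in> test_functions G T" "\<forall>x. 0 \<le> f x" for f
  proof -
    have "\<forall>x. 0 \<le> c f x" using that(2) unfolding c_def restrict0_def by auto
    then show ?thesis using haar_integralD(3)[OF I ct[OF that(1)]] by blast
  qed
  have "haar_integral G T (\<lambda>f. I (c f))"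
    unfolding haar_integral_def
    using ct nn inv nz I unfolding 1 2 by (simp add: haar_integral_def) 
  then show ?thesis unfolding c_def .
qed

lemma modular_char_works:
  assumes g: "g \<in> carrier G"
  shows "0 < modular_char G T g"
    "haar_integral G T I \<Longrightarrow> f \<in> test_functions G T \<Longrightarrow>
      I (restrict0 (carrier G) (\<lambda>u. f (inv g \<otimes> u \<otimes> g))) = modular_char G T g * I f"
proof -
  define P where "P c \<longleftrightarrow> (\<forall>I. haar_integral G T I \<longrightarrow> (\<forall>f\<in>test_functions G T.
        I (restrict0 (carrier G) (\<lambda>u. f (inv g \<otimes> u \<otimes> g))) = c * I f))" for c
  define J where "J f = haar K0 (restrict0 (carrier G) (\<lambda>u. f (inv g \<otimes> u \<otimes> g)))" for f
  have J: "haar_integral G T J" using haar_conj_integral[OF g haar_is_integral] unfolding J_def .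
  define c where "c = J (ind K0)"
  have Jc: "J f = c * haar K0 f" if "f \<in> test_functions G T" for f
    using haar_unique[OF J that] unfolding c_def .
  obtain f0 where f0: "f0 \<in> test_functions G T" "J f0 \<noteq> 0" using J unfolding haar_integral_def by blast
  then have "c \<noteq> 0" using Jc[OF f0(1)] by auto
  moreover have "0 \<le> c" unfolding c_def using J ind_K0_test unfolding haar_integral_def
    by (auto simp: ind_def)
  ultimately have cpos: "0 < c" by simp
  have Pc: "P c" unfolding P_def
  proof (intro allI impI ballI)
    fix I f assume I: "haar_integral G T I" and f: "f \<in> test_functions G T"
    have "I (restrict0 (carrier G) (\<lambda>u. f (inv g \<otimes> u \<otimes> g))) = I (ind K0) * J f"
      using haar_unique[OF I conj_test[OF f g]] unfolding J_def .
    then show "I (restrict0 (carrier G) (\<lambda>u. f (inv g \<otimes> u \<otimes> g))) = c * I f"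
      using Jc[OF f] haar_unique[OF I f] by simp
  qed
  have "d = c" if "P d" for d
  proof -
    have "J (ind K0) = d * haar K0 (ind K0)"
      using that haar_is_integral ind_K0_test unfolding P_def J_def by blast
    then show ?thesis using haar_K0 unfolding c_def by simp
  qed
  then have "modular_char G T g = c"
    unfolding modular_char_def P_def[symmetric] using Pc by (intro the_equality)
  then show "0 < modular_char G T g" "haar_integral G T I \<Longrightarrow> f \<in> test_functions G T \<Longrightarrow>
      I (restrict0 (carrier G) (\<lambda>u. f (inv g \<otimes> u \<otimes> g))) = modular_char G T g * I f"
    using cpos Pc unfolding P_def by auto
qed

text \<open>Conjugation by an element of K0 fixes the indicator of K0, whose integral is one.\<close>

lemma modular_char_K0:
  assumes g: "g \<in> K0" shows "modular_char G T g = 1"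
proof -
  have K0c: "K0 \<subseteq> carrier G" using K0 subgroup.subset by auto
  have gc: "g \<in> carrier G" using g K0c by auto
  have ig: "inv g \<in> K0" using subgroup.m_inv_closed[OF K0(1) g] .
  have "inv g \<otimes> u \<otimes> g \<in> K0 \<longleftrightarrow> u \<in> K0" if u: "u \<in> carrier G" for u
  proof
    assume a: "inv g \<otimes> u \<otimes> g \<in> K0"
    have "g \<otimes> (inv g \<otimes> u \<otimes> g) \<otimes> inv g = u" using u gc by (simp add: m_assoc inv_mult_cancel)
    then show "u \<in> K0" using subgroup.m_closed[OF K0(1) subgroup.m_closed[OF K0(1) g a] ig] by simp
  next
    assume a: "u \<in> K0"
    show "inv g \<otimes> u \<otimes> g \<in> K0" using subgroup.m_closed[OF K0(1) subgroup.m_closed[OF K0(1) ig a] g] .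
  qed
  then have "restrict0 (carrier G) (\<lambda>u. ind K0 (inv g \<otimes> u \<otimes> g)) = ind K0"
    using K0c unfolding restrict0_def ind_def by (auto simp: fun_eq_iff)
  then have "haar K0 (ind K0) = modular_char G T g * haar K0 (ind K0)"
    using modular_char_works(2)[OF gc haar_is_integral ind_K0_test] by simp
  then show ?thesis using haar_K0 by simp
qed

end

lemma ex_compact_open: "\<exists>K0. subgroup K0 G \<and> openin T K0 \<and> compactin T K0"
  using basis[of "topspace T"] topspace_eq openin_topspace[of T] by auto

lemma modular_char_pos: "g \<in> carrier G \<Longrightarrow> 0 < modular_char G T g"
  using ex_compact_open modular_char_works(1) by blast

lemma modular_char_mult:
  assumes "g \<in> carrier G" "h \<in> carrier G"
  shows "modular_char G T (g \<otimes> h) = modular_char G T g * modular_char G T h"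
proof -
  obtain K0 where K0: "subgroup K0 G" "openin T K0" "compactin T K0" using ex_compact_open by blast
  let ?f = "ind K0"
  let ?fh = "restrict0 (carrier G) (\<lambda>u. ?f (inv h \<otimes> u \<otimes> h))"
  note I = haar_is_integral[OF K0] and t = ind_K0_test[OF K0]
  have "restrict0 (carrier G) (\<lambda>u. ?f (inv (g \<otimes> h) \<otimes> u \<otimes> (g \<otimes> h)))
      = restrict0 (carrier G) (\<lambda>u. ?fh (inv g \<otimes> u \<otimes> g))"
    using assms by (auto simp: restrict0_def fun_eq_iff inv_mult_group m_assoc)
  then have "modular_char G T (g \<otimes> h) * haar K0 ?f = modular_char G T g * (modular_char G T h * haar K0 ?f)"
    using modular_char_works(2)[OF K0 _ I t, of "g \<otimes> h"] modular_char_works(2)[OF K0 _ I t, of h]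
      modular_char_works(2)[OF K0 _ I conj_test[OF K0 t], of g h] assms haar_K0[OF K0] by simp
  then show ?thesis using haar_K0[OF K0] by simp
qed

end

section \<open>Closed subgroups and the character of normalized induction\<close>

context lgroup
begin

lemma closed_subgroup_lgroup:
  assumes H: "subgroup H G" "closedin T H"
  shows "lgroup (subgrp G H) (subtopology T H)"
proof -
  have Hc: "H \<subseteq> carrier G" using subgroup.subset[OF H(1)] .
  interpret H: group "subgrp G H" using subgroup.subgroup_is_group[OF H(1) is_group] .
  show ?thesis
  proof unfold_locales
    show "topspace (subtopology T H) = carrier (subgrp G H)" using topspace_eq Hc by auto
  next
    fix U g assume U: "openin (subtopology T H) U" and g: "g \<in> carrier (subgrp G H)"
    from U obtain W where W: "openin T W" "U = W \<inter> H" unfolding openin_subtopology by blast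
    have gH: "g \<in> H" "g \<in> carrier G" "inv g \<in> H" using g Hc subgroup.m_inv_closed[OF H(1)] by auto
    have Wc: "W \<subseteq> carrier G" using open_subset[OF W(1)] .
    have "g <#\<^bsub>subgrp G H\<^esub> U = (g <# W) \<inter> H"
    proof (intro equalityI subsetI)
      fix x assume "x \<in> (g <# W) \<inter> H"
      then obtain w where w: "w \<in> W" "x = g \<otimes> w" "x \<in> H" unfolding l_coset_def by auto
      have "inv g \<otimes> x = w" using w gH Wc by (simp add: inv_mult_cancel subset_iff)
      then have "w \<in> H" using subgroup.m_closed[OF H(1) gH(3) w(3)] by simp
      then show "x \<in> g <#\<^bsub>subgrp G H\<^esub> U" using w W unfolding l_coset_def by auto
    qed (use W subgroup.m_closed[OF H(1) gH(1)] in \<open>auto simp: l_coset_def\<close>)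
    then show "openin (subtopology T H) (g <#\<^bsub>subgrp G H\<^esub> U)"
      using left_open[OF W(1) gH(2)] unfolding openin_subtopology by blast
    have "U #>\<^bsub>subgrp G H\<^esub> g = (W #> g) \<inter> H"
    proof (intro equalityI subsetI)
      fix x assume "x \<in> (W #> g) \<inter> H"
      then obtain w where w: "w \<in> W" "x = w \<otimes> g" "x \<in> H" unfolding r_coset_def by auto
      have "x \<otimes> inv g = w" using w gH Wc by (simp add: m_assoc subset_iff)
      then have "w \<in> H" using subgroup.m_closed[OF H(1) w(3) gH(3)] by simp
      then show "x \<in> U #>\<^bsub>subgrp G H\<^esub> g" using w W unfolding r_coset_def by auto
    qed (use W subgroup.m_closed[OF H(1) _ gH(1)] in \<open>auto simp: r_coset_def\<close>)
    then show "openin (subtopology T H) (U #>\<^bsub>subgrp G H\<^esub> g)"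
      using right_open[OF W(1) gH(2)] unfolding openin_subtopology by blast
  next
    fix U assume U: "openin (subtopology T H) U" and 1: "\<one>\<^bsub>subgrp G H\<^esub> \<in> U"
    from U obtain W where W: "openin T W" "U = W \<inter> H" unfolding openin_subtopology by blast
    have "\<one> \<in> W" using 1 W by simp
    from basis[OF W(1) this] obtain K where
      K: "subgroup K G" "openin T K" "compactin T K" "K \<subseteq> W" by blast
    have KH: "subgroup (K \<inter> H) G" using subgroups_Inter_pair[OF K(1) H(1)] .
    have "subgroup (K \<inter> H) (subgrp G H)"
      using subgroup_incl[OF KH H(1)] by blast
    moreover have "openin (subtopology T H) (K \<inter> H)" using K(2) unfolding openin_subtopology by blast
    moreover have "compactin (subtopology T H) (K \<inter> H)"
      unfolding compactin_subtopology using compact_Int_closedin[OF K(3) H(2)] by auto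
    ultimately show "\<exists>K. subgroup K (subgrp G H) \<and> openin (subtopology T H) K \<and>
        compactin (subtopology T H) K \<and> K \<subseteq> U" using K(4) W(2) by blast
  qed
qed

text \<open>The positive factor in the transformation law of normalized induction.\<close>

definition ind_char :: "'a set \<Rightarrow> 'a \<Rightarrow> real" where
  "ind_char H h = modular_char G T h powr (- 1/2) *
     modular_char (subgrp G H) (subtopology T H) h powr (1/2)"

lemma ind_char:
  assumes H: "subgroup H G" "closedin T H"
  shows ind_char_pos: "h \<in> H \<Longrightarrow> 0 < ind_char H h"
    and ind_char_mult: "h \<in> H \<Longrightarrow> h' \<in> H \<Longrightarrow> ind_char H (h \<otimes> h') = ind_char H h * ind_char H h'"
    and ind_char_compact_open: "subgroup K G \<Longrightarrow> openin T K \<Longrightarrow> compactin T K \<Longrightarrow> h \<in> K \<Longrightarrow> h \<in> H \<Longrightarrow> ind_char H h = 1"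
proof -
  interpret H: lgroup "subgrp G H" "subtopology T H" using closed_subgroup_lgroup[OF H] .
  have Hc: "H \<subseteq> carrier G" using subgroup.subset[OF H(1)] .
  show "0 < ind_char H h" if "h \<in> H"
    unfolding ind_char_def using modular_char_pos[of h] H.modular_char_pos[of h] that Hc by auto
  show "ind_char H (h \<otimes> h') = ind_char H h * ind_char H h'" if "h \<in> H" "h' \<in> H"
  proof -
    have hc: "h \<in> carrier G" "h' \<in> carrier G" using that Hc by auto
    have p: "0 < modular_char (subgrp G H) (subtopology T H) h" "0 < modular_char (subgrp G H) (subtopology T H) h'"
      using H.modular_char_pos that by auto
    have "modular_char (subgrp G H) (subtopology T H) (h \<otimes> h')
      = modular_char (subgrp G H) (subtopology T H) h * modular_char (subgrp G H) (subtopology T H) h'"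
      using H.modular_char_mult[of h h'] that by simp
    then show ?thesis unfolding ind_char_def
      using modular_char_mult[OF hc] modular_char_pos[OF hc(1)] modular_char_pos[OF hc(2)] p
      by (simp add: powr_mult mult_ac)
  qed
  show "ind_char H h = 1" if K: "subgroup K G" "openin T K" "compactin T K" and h: "h \<in> K" "h \<in> H"
  proof -
    have KH: "subgroup (K \<inter> H) G" using subgroups_Inter_pair[OF K(1) H(1)] .
    have 1: "subgroup (K \<inter> H) (subgrp G H)"
      using subgroup_incl[OF KH H(1)] by blast
    have 2: "openin (subtopology T H) (K \<inter> H)" using K(2) unfolding openin_subtopology by blast
    have 3: "compactin (subtopology T H) (K \<inter> H)"
      unfolding compactin_subtopology using compact_Int_closedin[OF K(3) H(2)] by auto
    show ?thesis unfolding ind_char_def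
      using modular_char_K0[OF K h(1)] H.modular_char_K0[OF 1 2 3, of h] h by simp
  qed
qed

end

section \<open>Linear representations and averaging\<close>

text \<open>The algebraic part of \<^const>\<open>smooth_rep\<close>.\<close>

definition linear_rep :: "('g,'m) monoid_scheme \<Rightarrow> ('g,'v::ab_group_add) rep \<Rightarrow> bool" where
  "linear_rep G \<pi> \<longleftrightarrow>
     vector_space (rep_scale \<pi>) \<and> module.subspace (rep_scale \<pi>) (rep_space \<pi>) \<and>
     (\<forall>g\<in>carrier G. \<forall>v\<in>rep_space \<pi>. rep_act \<pi> g v \<in> rep_space \<pi>) \<and>
     (\<forall>g\<in>carrier G. \<forall>v\<in>rep_space \<pi>. \<forall>w\<in>rep_space \<pi>.
        rep_act \<pi> g (v + w) = rep_act \<pi> g v + rep_act \<pi> g w) \<and>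
     (\<forall>g\<in>carrier G. \<forall>c. \<forall>v\<in>rep_space \<pi>.
        rep_act \<pi> g (rep_scale \<pi> c v) = rep_scale \<pi> c (rep_act \<pi> g v)) \<and>
     (\<forall>v\<in>rep_space \<pi>. rep_act \<pi> \<one>\<^bsub>G\<^esub> v = v) \<and>
     (\<forall>g\<in>carrier G. \<forall>h\<in>carrier G. \<forall>v\<in>rep_space \<pi>.
        rep_act \<pi> (g \<otimes>\<^bsub>G\<^esub> h) v = rep_act \<pi> g (rep_act \<pi> h v))"

lemma smooth_rep_linear: "smooth_rep G T \<pi> \<Longrightarrow> linear_rep G \<pi>"
  unfolding smooth_rep_def linear_rep_def by blast

lemma linear_repD:
  assumes "linear_rep G \<pi>"
  shows "vector_space (rep_scale \<pi>)" "Modules.module (rep_scale \<pi>)"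
    "module.subspace (rep_scale \<pi>) (rep_space \<pi>)"
    "g \<in> carrier G \<Longrightarrow> v \<in> rep_space \<pi> \<Longrightarrow> rep_act \<pi> g v \<in> rep_space \<pi>"
    "g \<in> carrier G \<Longrightarrow> v \<in> rep_space \<pi> \<Longrightarrow> w \<in> rep_space \<pi> \<Longrightarrow>
      rep_act \<pi> g (v + w) = rep_act \<pi> g v + rep_act \<pi> g w"
    "g \<in> carrier G \<Longrightarrow> v \<in> rep_space \<pi> \<Longrightarrow>
      rep_act \<pi> g (rep_scale \<pi> c v) = rep_scale \<pi> c (rep_act \<pi> g v)"
    "v \<in> rep_space \<pi> \<Longrightarrow> rep_act \<pi> \<one>\<^bsub>G\<^esub> v = v"
    "g \<in> carrier G \<Longrightarrow> h \<in> carrier G \<Longrightarrow> v \<in> rep_space \<pi> \<Longrightarrow>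
      rep_act \<pi> (g \<otimes>\<^bsub>G\<^esub> h) v = rep_act \<pi> g (rep_act \<pi> h v)"
proof -
  show "vector_space (rep_scale \<pi>)" using assms unfolding linear_rep_def by (elim conjE)
  then show "Modules.module (rep_scale \<pi>)" by (simp add: vector_space_def Modules.module_def)
qed (use assms in \<open>unfold linear_rep_def, blast+\<close>)

lemma linear_rep_subspace:
  assumes "linear_rep G \<pi>"
  shows "0 \<in> rep_space \<pi>" "v \<in> rep_space \<pi> \<Longrightarrow> rep_scale \<pi> c v \<in> rep_space \<pi>"
    "v \<in> rep_space \<pi> \<Longrightarrow> w \<in> rep_space \<pi> \<Longrightarrow> v + w \<in> rep_space \<pi>"
    "v \<in> rep_space \<pi> \<Longrightarrow> w \<in> rep_space \<pi> \<Longrightarrow> v - w \<in> rep_space \<pi>"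
    "(\<And>i. i \<in> I \<Longrightarrow> F i \<in> rep_space \<pi>) \<Longrightarrow> sum F I \<in> rep_space \<pi>"
proof -
  interpret Modules.module "rep_scale \<pi>" using linear_repD(2)[OF assms] .
  have s: "subspace (rep_space \<pi>)" using linear_repD(3)[OF assms] .
  show "0 \<in> rep_space \<pi>" "v \<in> rep_space \<pi> \<Longrightarrow> rep_scale \<pi> c v \<in> rep_space \<pi>"
    "v \<in> rep_space \<pi> \<Longrightarrow> w \<in> rep_space \<pi> \<Longrightarrow> v + w \<in> rep_space \<pi>"
    "v \<in> rep_space \<pi> \<Longrightarrow> w \<in> rep_space \<pi> \<Longrightarrow> v - w \<in> rep_space \<pi>"
    "(\<And>i. i \<in> I \<Longrightarrow> F i \<in> rep_space \<pi>) \<Longrightarrow> sum F I \<in> rep_space \<pi>"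
    using s by (simp_all add: subspace_0 subspace_scale subspace_add subspace_diff subspace_sum)
qed

lemma linear_rep_subgrp:
  assumes "linear_rep G \<pi>" "H \<subseteq> carrier G"
  shows "linear_rep (subgrp G H) \<pi>"
proof -
  have c: "\<And>g. g \<in> H \<Longrightarrow> g \<in> carrier G" using assms(2) by auto
  show ?thesis
    unfolding linear_rep_def using linear_repD[OF assms(1)] by (intro conjI ballI allI) (simp_all add: c)
qed

lemma twisted_kernel_subspace:
  assumes "linear_rep (subgrp G U) \<pi>"
  shows "module.subspace (rep_scale \<pi>) (twisted_kernel \<pi> U \<theta>)"
    "twisted_kernel \<pi> U \<theta> \<subseteq> rep_space \<pi>"
    "u \<in> U \<Longrightarrow> v \<in> rep_space \<pi> \<Longrightarrow> rep_act \<pi> u v - rep_scale \<pi> (\<theta> u) v \<in> twisted_kernel \<pi> U \<theta>"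
proof -
  interpret Modules.module "rep_scale \<pi>" using linear_repD(2)[OF assms] .
  show "subspace (twisted_kernel \<pi> U \<theta>)" unfolding twisted_kernel_def by (rule subspace_span)
  show "twisted_kernel \<pi> U \<theta> \<subseteq> rep_space \<pi>" unfolding twisted_kernel_def
  proof (rule span_minimal[OF _ linear_repD(3)[OF assms]])
    show "{rep_act \<pi> u v - rep_scale \<pi> (\<theta> u) v |u v. u \<in> U \<and> v \<in> rep_space \<pi>} \<subseteq> rep_space \<pi>"
      using linear_repD(4)[OF assms] linear_rep_subspace(2,4)[OF assms] by auto
  qed
  show "u \<in> U \<Longrightarrow> v \<in> rep_space \<pi> \<Longrightarrow> rep_act \<pi> u v - rep_scale \<pi> (\<theta> u) v \<in> twisted_kernel \<pi> U \<theta>"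
    unfolding twisted_kernel_def by (rule span_base) auto
qed

lemma image_constant_conv':
  "A \<noteq> {} \<Longrightarrow> \<forall>x\<in>A. f x = c \<Longrightarrow> f ` A = {c}"
  by force

lemma twisted_jacquet_nonzero_iff:
  assumes "linear_rep (subgrp G U) \<pi>"
  shows "twisted_jacquet_nonzero \<pi> U \<theta> \<longleftrightarrow> (\<exists>v\<in>rep_space \<pi>. v \<notin> twisted_kernel \<pi> U \<theta>)"
proof -
  interpret Modules.module "rep_scale \<pi>" using linear_repD(2)[OF assms] .
  let ?K = "twisted_kernel \<pi> U \<theta>"
  note K = twisted_kernel_subspace(1)[OF assms]
  have *: "{v + x | x. x \<in> ?K} = ?K \<longleftrightarrow> v \<in> ?K" for v
  proof
    assume "{v + x | x. x \<in> ?K} = ?K"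
    moreover have "\<exists>x. v = v + x \<and> x \<in> ?K" using subspace_0[OF K] by (intro exI[of _ 0]) simp
    then have "v \<in> {v + x | x. x \<in> ?K}" by simp
    ultimately show "v \<in> ?K" by simp
  next
    assume v: "v \<in> ?K"
    show "{v + x | x. x \<in> ?K} = ?K"
    proof (intro equalityI subsetI)
      fix y assume y: "y \<in> ?K"
      have "y = v + (y - v) \<and> y - v \<in> ?K" using subspace_diff[OF K y v] by simp
      then show "y \<in> {v + x | x. x \<in> ?K}" by (intro CollectI exI)
    next
      fix y assume "y \<in> {v + x | x. x \<in> ?K}"
      then obtain x where "y = v + x" "x \<in> ?K" by (elim CollectE exE conjE)
      then show "y \<in> ?K" using subspace_add[OF K v] by simp
    qed
  qed
  have ne: "rep_space \<pi> \<noteq> {}" using linear_rep_subspace(1)[OF assms] by auto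
  have "(\<lambda>v. {v + x | x. x \<in> ?K}) ` rep_space \<pi> = {?K} \<longleftrightarrow> (\<forall>v\<in>rep_space \<pi>. {v + x | x. x \<in> ?K} = ?K)"
    by (rule iffI[OF _ image_constant_conv'[OF ne]]) (metis (no_types, lifting) imageI singletonD)
  then have "twisted_jacquet \<pi> U \<theta> = {?K} \<longleftrightarrow> (\<forall>v\<in>rep_space \<pi>. v \<in> ?K)"
    unfolding twisted_jacquet_def * .
  then show ?thesis unfolding twisted_jacquet_nonzero_def by simp
qed

text \<open>Up to a scalar, the projection of v to the \<open>\<theta>\<close>-eigenspace of H, if L fixes v and \<open>\<theta>\<close> is trivial on L.\<close>

definition twisted_sum ::
    "('g,'m) monoid_scheme \<Rightarrow> ('g,'v::ab_group_add) rep \<Rightarrow> ('g \<Rightarrow> complex) \<Rightarrow> 'g set \<Rightarrow> 'g set \<Rightarrow> 'v \<Rightarrow> 'v" where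
  "twisted_sum G \<pi> \<theta> H L v =
     coset_sum G H L (\<lambda>h. rep_scale \<pi> (inverse (\<theta> h)) (rep_act \<pi> h v))"

context group
begin

text \<open>Each summand is congruent to v modulo the twisted kernel.\<close>

lemma twisted_sum_congruent:
  assumes \<pi>: "linear_rep (subgrp G U) \<pi>" and H: "subgroup H G" "H \<subseteq> U" and L: "subgroup L G" "L \<subseteq> H" "finite (lcos G H L)"
    and \<theta>: "\<And>u. u \<in> U \<Longrightarrow> \<theta> u \<noteq> 0" and v: "v \<in> rep_space \<pi>"
  shows "twisted_sum G \<pi> \<theta> H L v - rep_scale \<pi> (of_nat (card (lcos G H L))) v \<in> twisted_kernel \<pi> U \<theta>"
    "twisted_sum G \<pi> \<theta> H L v \<in> rep_space \<pi>"
proof -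
  interpret vector_space "rep_scale \<pi>" using linear_repD(1)[OF \<pi>] .
  note K = twisted_kernel_subspace(1)[OF \<pi>]
  have r: "rep_of C \<in> U" if "C \<in> lcos G H L" for C using rep_of_in(1)[OF L(1) H(1) L(2) that] H by auto
  have e: "twisted_sum G \<pi> \<theta> H L v = (\<Sum>C\<in>lcos G H L. rep_scale \<pi> (inverse (\<theta> (rep_of C))) (rep_act \<pi> (rep_of C) v))"
    unfolding twisted_sum_def by (rule coset_sum_finite[OF L(3)])
  have "rep_scale \<pi> (of_nat (card (lcos G H L))) v = (\<Sum>C\<in>lcos G H L. v)" by (simp add: sum_constant_scale)
  then have "twisted_sum G \<pi> \<theta> H L v - rep_scale \<pi> (of_nat (card (lcos G H L))) v
     = (\<Sum>C\<in>lcos G H L. rep_scale \<pi> (inverse (\<theta> (rep_of C))) (rep_act \<pi> (rep_of C) v) - v)"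
    unfolding e by (simp add: sum_subtractf)
  also have "\<dots> = (\<Sum>C\<in>lcos G H L. rep_scale \<pi> (inverse (\<theta> (rep_of C)))
      (rep_act \<pi> (rep_of C) v - rep_scale \<pi> (\<theta> (rep_of C)) v))"
    by (intro sum.cong refl) (simp add: scale_right_diff_distrib r \<theta>)
  also have "\<dots> \<in> twisted_kernel \<pi> U \<theta>"
    by (intro subspace_sum[OF K] subspace_scale[OF K] twisted_kernel_subspace(3)[OF \<pi>] r v)
  finally show "twisted_sum G \<pi> \<theta> H L v - rep_scale \<pi> (of_nat (card (lcos G H L))) v \<in> twisted_kernel \<pi> U \<theta>" .
  show "twisted_sum G \<pi> \<theta> H L v \<in> rep_space \<pi>" unfolding e
    using r v by (intro linear_rep_subspace(5)[OF \<pi>] linear_rep_subspace(2)[OF \<pi>] linear_repD(4)[OF \<pi>]) auto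
qed

text \<open>The twisted average over H of a generator \<open>\<pi>(u) w - \<theta>(u) w\<close> vanishes as soon as H contains u, by
  translation invariance.\<close>

lemma twisted_kernel_average:
  assumes \<pi>: "linear_rep (subgrp G U) \<pi>" and U: "subgroup U G"
    and comm: "\<And>x y. x \<in> U \<Longrightarrow> y \<in> U \<Longrightarrow> x \<otimes> y = y \<otimes> x"
    and \<theta>: "\<And>x y. x \<in> U \<Longrightarrow> y \<in> U \<Longrightarrow> \<theta> (x \<otimes> y) = \<theta> x * \<theta> y" "\<And>u. u \<in> U \<Longrightarrow> \<theta> u \<noteq> 0"
    and v: "v \<in> twisted_kernel \<pi> U \<theta>"
  shows "\<exists>S W. finite S \<and> S \<subseteq> U \<and> finite W \<and> W \<subseteq> rep_space \<pi> \<and>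
    (\<forall>H L. subgroup H G \<and> H \<subseteq> U \<and> S \<subseteq> H \<and> subgroup L G \<and> L \<subseteq> H \<and> finite (lcos G H L) \<and>
      (\<forall>l\<in>L. \<theta> l = 1) \<and> (\<forall>l\<in>L. \<forall>w\<in>W. rep_act \<pi> l w = w) \<longrightarrow> twisted_sum G \<pi> \<theta> H L v = 0)"
proof -
  interpret vector_space "rep_scale \<pi>" using linear_repD(1)[OF \<pi>] .
  define good where "good H L S W \<longleftrightarrow> subgroup H G \<and> H \<subseteq> U \<and> S \<subseteq> H \<and> subgroup L G \<and> L \<subseteq> H \<and> finite (lcos G H L) \<and>
      (\<forall>l\<in>L. \<theta> l = 1) \<and> (\<forall>l\<in>L. \<forall>w\<in>W. rep_act \<pi> l w = w)" for H L S W
  define P where "P v \<longleftrightarrow> v \<in> rep_space \<pi> \<and> (\<exists>S W. finite S \<and> S \<subseteq> U \<and> finite W \<and> W \<subseteq> rep_space \<pi> \<and>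
    (\<forall>H L. good H L S W \<longrightarrow> twisted_sum G \<pi> \<theta> H L v = 0))" for v
  have goodD: "good H L S W" if "good H L (S \<union> S') (W \<union> W')" for H L S W S' W'
    using that unfolding good_def by blast
  have goodD': "good H L S' W'" if "good H L (S \<union> S') (W \<union> W')" for H L S W S' W'
    using that unfolding good_def by blast
  have ts: "twisted_sum G \<pi> \<theta> H L v = (\<Sum>C\<in>lcos G H L. rep_scale \<pi> (inverse (\<theta> (rep_of C))) (rep_act \<pi> (rep_of C) v))"
    if "good H L S W" for H L S W v
    using that unfolding good_def twisted_sum_def by (intro coset_sum_finite) auto
  have rr: "rep_of C \<in> H \<and> rep_of C \<in> U" if "good H L S W" "C \<in> lcos G H L" for H L S W C
    using that rep_of_in(1)[of L H C] unfolding good_def by blast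
  have sub: "subspace {v. P v}"
  proof (rule subspaceI)
    have "twisted_sum G \<pi> \<theta> H L 0 = 0" if g: "good H L {} {}" for H L
    proof -
      have "rep_act \<pi> u 0 = 0" if "u \<in> U" for u
        using linear_repD(6)[OF \<pi>, of u 0 0] linear_rep_subspace(1)[OF \<pi>] that by simp
      then show ?thesis unfolding ts[OF g] using rr[OF g] by simp
    qed
    then have "P 0" unfolding P_def using linear_rep_subspace(1)[OF \<pi>] by blast
    then show "0 \<in> {v. P v}" by simp
  next
    fix x y assume "x \<in> {v. P v}" "y \<in> {v. P v}"
    then have xy: "x \<in> rep_space \<pi>" "y \<in> rep_space \<pi>" "P x" "P y" unfolding P_def by auto
    obtain S W where SW: "finite S" "S \<subseteq> U" "finite W" "W \<subseteq> rep_space \<pi>"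
      "\<And>H L. good H L S W \<Longrightarrow> twisted_sum G \<pi> \<theta> H L x = 0" using xy(3) unfolding P_def by blast
    obtain S' W' where SW': "finite S'" "S' \<subseteq> U" "finite W'" "W' \<subseteq> rep_space \<pi>"
      "\<And>H L. good H L S' W' \<Longrightarrow> twisted_sum G \<pi> \<theta> H L y = 0" using xy(4) unfolding P_def by blast
    have "twisted_sum G \<pi> \<theta> H L (x + y) = 0" if g: "good H L (S \<union> S') (W \<union> W')" for H L
    proof -
      have "twisted_sum G \<pi> \<theta> H L (x + y) = twisted_sum G \<pi> \<theta> H L x + twisted_sum G \<pi> \<theta> H L y"
        unfolding ts[OF g] sum.distrib[symmetric]
        using rr[OF g] linear_repD(5)[OF \<pi> _ xy(1,2)]
        by (intro sum.cong refl) (simp add: scale_right_distrib)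
      then show ?thesis using SW(5)[OF goodD[OF g]] SW'(5)[OF goodD'[OF g]] by simp
    qed
    then have "P (x + y)" unfolding P_def using SW SW' linear_rep_subspace(3)[OF \<pi> xy(1,2)]
      by (intro conjI exI[of _ "S \<union> S'"] exI[of _ "W \<union> W'"]) auto
    then show "x + y \<in> {v. P v}" by simp
  next
    fix c x assume "x \<in> {v. P v}"
    then have x: "x \<in> rep_space \<pi>" "P x" unfolding P_def by auto
    obtain S W where SW: "finite S" "S \<subseteq> U" "finite W" "W \<subseteq> rep_space \<pi>"
      "\<And>H L. good H L S W \<Longrightarrow> twisted_sum G \<pi> \<theta> H L x = 0" using x(2) unfolding P_def by blast
    have "twisted_sum G \<pi> \<theta> H L (rep_scale \<pi> c x) = 0" if g: "good H L S W" for H L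
    proof -
      have "twisted_sum G \<pi> \<theta> H L (rep_scale \<pi> c x) = rep_scale \<pi> c (twisted_sum G \<pi> \<theta> H L x)"
        unfolding ts[OF g] scale_sum_right
        using rr[OF g] linear_repD(6)[OF \<pi> _ x(1)]
        by (intro sum.cong refl) (simp add: mult.commute)
      then show ?thesis using SW(5)[OF g] by simp
    qed
    then have "P (rep_scale \<pi> c x)" unfolding P_def using SW linear_rep_subspace(2)[OF \<pi> x(1)]
      by blast
    then show "rep_scale \<pi> c x \<in> {v. P v}" by simp
  qed
  have gen: "P (rep_act \<pi> u w - rep_scale \<pi> (\<theta> u) w)" if u: "u \<in> U" and w: "w \<in> rep_space \<pi>" for u w
  proof -
    let ?g = "rep_act \<pi> u w - rep_scale \<pi> (\<theta> u) w"
    have uw: "rep_act \<pi> u w \<in> rep_space \<pi>" using linear_repD(4)[OF \<pi> _ w] u by simp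
    have "twisted_sum G \<pi> \<theta> H L ?g = 0" if g: "good H L {u} {w}" for H L
    proof -
      have H: "subgroup H G" "H \<subseteq> U" "u \<in> H" "subgroup L G" "L \<subseteq> H" "finite (lcos G H L)"
        and L: "\<And>l. l \<in> L \<Longrightarrow> \<theta> l = 1" "\<And>l. l \<in> L \<Longrightarrow> rep_act \<pi> l w = w"
        using g unfolding good_def by auto
      define F where "F h = rep_scale \<pi> (inverse (\<theta> h)) (rep_act \<pi> h w)" for h
      have inv: "right_inv G H L F" unfolding right_inv_def
      proof (intro ballI)
        fix x l assume xl: "x \<in> H" "l \<in> L"
        then have xU: "x \<in> U" "l \<in> U" using H by auto
        have "rep_act \<pi> (x \<otimes> l) w = rep_act \<pi> x w"
          using linear_repD(8)[OF \<pi>, of x l w] xU w L(2)[OF xl(2)] by simp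
        then show "F (x \<otimes> l) = F x" unfolding F_def using \<theta>(1)[OF xU] L(1)[OF xl(2)] by simp
      qed
      have F1: "F (u \<otimes> h) = rep_scale \<pi> (inverse (\<theta> u)) (rep_scale \<pi> (inverse (\<theta> h)) (rep_act \<pi> h (rep_act \<pi> u w)))"
        if "h \<in> U" for h
        unfolding F_def comm[OF u that] using linear_repD(8)[OF \<pi>, of h u w] \<theta>(1)[OF that u] that u w
        by (simp add: mult.commute)
      have "twisted_sum G \<pi> \<theta> H L ?g = rep_scale \<pi> (\<theta> u) (coset_sum G H L (\<lambda>h. F (u \<otimes> h)) - coset_sum G H L F)"
        unfolding ts[OF g] coset_sum_finite[OF H(6)] sum_subtractf[symmetric] scale_sum_right
      proof (intro sum.cong refl)
        fix C assume C: "C \<in> lcos G H L"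
        let ?h = "rep_of C"
        have h: "?h \<in> U" using rr[OF g C] by simp
        have "rep_act \<pi> ?h ?g = rep_act \<pi> ?h (rep_act \<pi> u w + rep_scale \<pi> (- \<theta> u) w)" by simp
        also have "\<dots> = rep_act \<pi> ?h (rep_act \<pi> u w) - rep_scale \<pi> (\<theta> u) (rep_act \<pi> ?h w)"
          using linear_repD(5)[OF \<pi>, of ?h "rep_act \<pi> u w" "rep_scale \<pi> (- \<theta> u) w"] h uw
            linear_rep_subspace(2)[OF \<pi> w, of "- \<theta> u"] linear_repD(6)[OF \<pi> _ w, of ?h "- \<theta> u"] by simp
        finally show "rep_scale \<pi> (inverse (\<theta> ?h)) (rep_act \<pi> ?h ?g) = rep_scale \<pi> (\<theta> u) (F (u \<otimes> ?h) - F ?h)"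
          unfolding F1[OF h] using \<theta>(2)[OF u] by (simp add: scale_right_diff_distrib F_def mult.commute)
      qed
      then show ?thesis using coset_sum_translate[OF H(1,4,5) inv H(3)] by simp
    qed
    moreover have "?g \<in> rep_space \<pi>" using linear_rep_subspace(4)[OF \<pi> uw linear_rep_subspace(2)[OF \<pi> w]] .
    ultimately show ?thesis unfolding P_def using u w
      by (intro conjI exI[of _ "{u}"] exI[of _ "{w}"]) auto
  qed
  have "P v"
    using v unfolding twisted_kernel_def
  proof (rule span_induct)
    show "subspace (Collect P)" using sub .
  qed (use gen in blast)
  then show ?thesis unfolding P_def good_def by blast
qed

end

section \<open>Induced representations of l-groups\<close>

lemma sum_apply: "(\<Sum>i\<in>I. F i) x = (\<Sum>i\<in>I. F i x)" for F :: "'i \<Rightarrow> 'a \<Rightarrow> 'b::comm_monoid_add"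
  by (induction I rule: infinite_finite_induct) auto

context lgroup
begin

lemma finite_lcos_Int:
  assumes Z: "subgroup Z G" "Z \<subseteq> C" and C: "compactin T C" and K: "openin T K" "subgroup K G"
  shows "finite (lcos G Z (Z \<inter> K))"
proof -
  have Zc: "Z \<subseteq> carrier G" using subgroup.subset[OF Z(1)] .
  have "x <# (Z \<inter> K) = (x <# K) \<inter> Z" if x: "x \<in> Z" for x
  proof (intro equalityI subsetI)
    fix y assume "y \<in> x <# (Z \<inter> K)"
    then show "y \<in> (x <# K) \<inter> Z" using subgroup.m_closed[OF Z(1) x]
      unfolding l_coset_def by auto
  next
    fix y assume "y \<in> (x <# K) \<inter> Z"
    then obtain k where k: "k \<in> K" "y = x \<otimes> k" "y \<in> Z" unfolding l_coset_def by auto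
    have kc: "k \<in> carrier G" using k subgroup.subset[OF K(2)] by auto
    have "inv x \<otimes> y = k" using k kc x Zc by (auto simp: inv_mult_cancel)
    then have "k \<in> Z" using subgroup.m_closed[OF Z(1) subgroup.m_inv_closed[OF Z(1) x] k(3)] by simp
    then show "y \<in> x <# (Z \<inter> K)" using k unfolding l_coset_def by auto
  qed
  then have "lcos G Z (Z \<inter> K) = (\<lambda>D. D \<inter> Z) ` lcos G Z K" unfolding lcos_def image_image by (rule image_cong[OF refl])
  also have "\<dots> \<subseteq> (\<lambda>D. D \<inter> Z) ` lcos G C K" using Z(2) unfolding lcos_def by (intro image_mono)
  finally have "lcos G Z (Z \<inter> K) \<subseteq> (\<lambda>D. D \<inter> Z) ` lcos G C K" .
  then show ?thesis using finite_lcos_compact[OF C K] finite_surj by blast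
qed

end

locale induction_datum = lgroup G T for G (structure) and T +
  fixes H and \<sigma> :: "('a, 'v::ab_group_add) rep"
  assumes H: "subgroup H G" "closedin T H"
    and \<sigma>: "linear_rep (subgrp G H) \<sigma>"
begin

abbreviation V where "V \<equiv> induced_rep G T H \<sigma>"

abbreviation chi where "chi \<equiv> ind_char H"

lemma Hc: "H \<subseteq> carrier G" using subgroup.subset[OF H(1)] .

lemma V_scale [simp]: "rep_scale V c f = (\<lambda>x. rep_scale \<sigma> c (f x))"
  and V_act: "rep_act V g f = restrict0 (carrier G) (\<lambda>x. f (x \<otimes> g))"
  unfolding induced_rep_def by auto

lemma V_space:
  "f \<in> rep_space V \<longleftrightarrow> (\<forall>g\<in>carrier G. f g \<in> rep_space \<sigma>) \<and> (\<forall>g. g \<notin> carrier G \<longrightarrow> f g = 0) \<and>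
    (\<forall>h\<in>H. \<forall>g\<in>carrier G. f (h \<otimes> g) = rep_scale \<sigma> (of_real (chi h)) (rep_act \<sigma> h (f g))) \<and>
    (\<exists>K. subgroup K G \<and> openin T K \<and> (\<forall>k\<in>K. \<forall>g\<in>carrier G. f (g \<otimes> k) = f g)) \<and>
    (\<exists>C. compactin T C \<and> {g \<in> carrier G. f g \<noteq> 0} \<subseteq> {h \<otimes> c | h c. h \<in> H \<and> c \<in> C})"
  unfolding induced_rep_def ind_char_def by simp

lemma V_D:
  assumes "f \<in> rep_space V"
  shows "g \<in> carrier G \<Longrightarrow> f g \<in> rep_space \<sigma>" "g \<notin> carrier G \<Longrightarrow> f g = 0"
    "h \<in> H \<Longrightarrow> g \<in> carrier G \<Longrightarrow> f (h \<otimes> g) = rep_scale \<sigma> (of_real (chi h)) (rep_act \<sigma> h (f g))"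
    "\<exists>K. subgroup K G \<and> openin T K \<and> (\<forall>k\<in>K. \<forall>g\<in>carrier G. f (g \<otimes> k) = f g)"
    "\<exists>C. compactin T C \<and> {g \<in> carrier G. f g \<noteq> 0} \<subseteq> {h \<otimes> c | h c. h \<in> H \<and> c \<in> C}"
  using assms unfolding V_space by (elim conjE; simp)+

lemma V_I:
  assumes "\<And>g. g \<in> carrier G \<Longrightarrow> f g \<in> rep_space \<sigma>" "\<And>g. g \<notin> carrier G \<Longrightarrow> f g = 0"
    "\<And>h g. h \<in> H \<Longrightarrow> g \<in> carrier G \<Longrightarrow> f (h \<otimes> g) = rep_scale \<sigma> (of_real (chi h)) (rep_act \<sigma> h (f g))"
    "subgroup K G" "openin T K" "\<And>k g. k \<in> K \<Longrightarrow> g \<in> carrier G \<Longrightarrow> f (g \<otimes> k) = f g"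
    "compactin T C" "\<And>g. g \<in> carrier G \<Longrightarrow> f g \<noteq> 0 \<Longrightarrow> \<exists>h\<in>H. \<exists>c\<in>C. g = h \<otimes> c"
  shows "f \<in> rep_space V"
proof -
  have "{g \<in> carrier G. f g \<noteq> 0} \<subseteq> {h \<otimes> c | h c. h \<in> H \<and> c \<in> C}"
  proof
    fix g assume "g \<in> {g \<in> carrier G. f g \<noteq> 0}"
    then obtain h c where "h \<in> H" "c \<in> C" "g = h \<otimes> c" using assms(8) by blast
    then show "g \<in> {h \<otimes> c | h c. h \<in> H \<and> c \<in> C}" by blast
  qed
  then show ?thesis unfolding V_space
    using assms(1-3,6) by (intro conjI exI[of _ K] exI[of _ C] assms(4,5,7)) auto
qed

sublocale sc: vector_space "rep_scale \<sigma>" using linear_repD(1)[OF \<sigma>] .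

lemma H_act: "h \<in> H \<Longrightarrow> v \<in> rep_space \<sigma> \<Longrightarrow> rep_act \<sigma> h v \<in> rep_space \<sigma>"
  "h \<in> H \<Longrightarrow> h' \<in> H \<Longrightarrow> v \<in> rep_space \<sigma> \<Longrightarrow> rep_act \<sigma> (h \<otimes> h') v = rep_act \<sigma> h (rep_act \<sigma> h' v)"
  "h \<in> H \<Longrightarrow> v \<in> rep_space \<sigma> \<Longrightarrow> w \<in> rep_space \<sigma> \<Longrightarrow> rep_act \<sigma> h (v + w) = rep_act \<sigma> h v + rep_act \<sigma> h w"
  "h \<in> H \<Longrightarrow> v \<in> rep_space \<sigma> \<Longrightarrow> rep_act \<sigma> h (rep_scale \<sigma> c v) = rep_scale \<sigma> c (rep_act \<sigma> h v)"
  "h \<in> H \<Longrightarrow> rep_act \<sigma> h 0 = 0"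
  "v \<in> rep_space \<sigma> \<Longrightarrow> rep_act \<sigma> \<one> v = v"
proof -
  show "h \<in> H \<Longrightarrow> rep_act \<sigma> h 0 = 0"
    using linear_repD(6)[OF \<sigma>, of h 0 0] linear_rep_subspace(1)[OF \<sigma>] by simp
qed (use linear_repD(4-8)[OF \<sigma>] in simp_all)

lemma V_vector_space: "vector_space (rep_scale V)"
proof
qed (auto simp: fun_eq_iff sc.scale_right_distrib sc.scale_left_distrib)

lemma V_subspace: "module.subspace (rep_scale V) (rep_space V)"
proof -
  interpret VS: vector_space "rep_scale V" by (rule V_vector_space)
  show ?thesis
  proof (rule VS.subspaceI)
    show "0 \<in> rep_space V"
    proof (rule V_I)
      show "subgroup (carrier G) G" by (rule subgroup_self)
      show "openin T (carrier G)" using openin_topspace[of T] topspace_eq by simp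
      show "compactin T {}" by simp
    qed (use linear_rep_subspace(1)[OF \<sigma>] H_act(5) in auto)
  next
    fix x y assume x: "x \<in> rep_space V" and y: "y \<in> rep_space V"
    obtain K where K: "subgroup K G" "openin T K" "\<forall>k\<in>K. \<forall>g\<in>carrier G. x (g \<otimes> k) = x g" using V_D(4)[OF x] by blast
    obtain K' where K': "subgroup K' G" "openin T K'" "\<forall>k\<in>K'. \<forall>g\<in>carrier G. y (g \<otimes> k) = y g" using V_D(4)[OF y] by blast
    obtain C where C: "compactin T C" "{g \<in> carrier G. x g \<noteq> 0} \<subseteq> {h \<otimes> c | h c. h \<in> H \<and> c \<in> C}" using V_D(5)[OF x] by blast
    obtain C' where C': "compactin T C'" "{g \<in> carrier G. y g \<noteq> 0} \<subseteq> {h \<otimes> c | h c. h \<in> H \<and> c \<in> C'}" using V_D(5)[OF y] by blast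
    show "x + y \<in> rep_space V"
    proof (rule V_I)
      show "subgroup (K \<inter> K') G" using subgroups_Inter_pair[OF K(1) K'(1)] .
      show "openin T (K \<inter> K')" using K(2) K'(2) by blast
      show "compactin T (C \<union> C')" using compactin_Un[OF C(1) C'(1)] .
      show "(x + y) (g \<otimes> k) = (x + y) g" if "k \<in> K \<inter> K'" "g \<in> carrier G" for k g
        using K(3) K'(3) that by simp
      show "(x + y) (h \<otimes> g) = rep_scale \<sigma> (of_real (chi h)) (rep_act \<sigma> h ((x + y) g))" if "h \<in> H" "g \<in> carrier G" for h g
        using that V_D(1,3)[OF x] V_D(1,3)[OF y] H_act(3) by (simp add: sc.scale_right_distrib)
      show "\<exists>h\<in>H. \<exists>c\<in>C \<union> C'. g = h \<otimes> c" if "g \<in> carrier G" "(x + y) g \<noteq> 0" for g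
      proof -
        have "x g \<noteq> 0 \<or> y g \<noteq> 0" using that(2) by auto
        then show ?thesis using C(2) C'(2) that(1) by blast
      qed
    qed (use V_D(1,2)[OF x] V_D(1,2)[OF y] linear_rep_subspace(3)[OF \<sigma>] in auto)
  next
    fix c x assume x: "x \<in> rep_space V"
    obtain K where K: "subgroup K G" "openin T K" "\<forall>k\<in>K. \<forall>g\<in>carrier G. x (g \<otimes> k) = x g" using V_D(4)[OF x] by blast
    obtain C where C: "compactin T C" "{g \<in> carrier G. x g \<noteq> 0} \<subseteq> {h \<otimes> c | h c. h \<in> H \<and> c \<in> C}" using V_D(5)[OF x] by blast
    show "rep_scale V c x \<in> rep_space V"
    proof (rule V_I[OF _ _ _ K(1,2) _ C(1)])
      show "rep_scale V c x (h \<otimes> g) = rep_scale \<sigma> (of_real (chi h)) (rep_act \<sigma> h (rep_scale V c x g))" if "h \<in> H" "g \<in> carrier G" for h g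
        using that V_D(1,3)[OF x] H_act(4) by (simp add: mult.commute)
      show "\<exists>h\<in>H. \<exists>c\<in>C. g = h \<otimes> c" if "g \<in> carrier G" "rep_scale V c x g \<noteq> 0" for g
      proof -
        have "x g \<noteq> 0" using that(2) by auto
        then show ?thesis using C(2) that(1) by blast
      qed
    qed (use V_D(1,2)[OF x] linear_rep_subspace(2)[OF \<sigma>] K(3) in auto)
  qed
qed

lemma V_act_closed:
  assumes f: "f \<in> rep_space V" and g: "g \<in> carrier G"
  shows "rep_act V g f \<in> rep_space V"
proof -
  obtain K where K: "subgroup K G" "openin T K" "\<forall>k\<in>K. \<forall>g\<in>carrier G. f (g \<otimes> k) = f g" using V_D(4)[OF f] by blast
  obtain C where C: "compactin T C" "{g \<in> carrier G. f g \<noteq> 0} \<subseteq> {h \<otimes> c | h c. h \<in> H \<and> c \<in> C}" using V_D(5)[OF f] by blast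
  have Kc: "K \<subseteq> carrier G" using subgroup.subset[OF K(1)] .
  have Cc: "C \<subseteq> carrier G" using compact_subset[OF C(1)] .
  have eq: "rep_act V g f x = f (x \<otimes> g)" if "x \<in> carrier G" for x
    using that by (simp add: V_act restrict0_def)
  show ?thesis
  proof (rule V_I)
    show "subgroup ((\<lambda>k. g \<otimes> k \<otimes> inv g) ` K) G" "openin T ((\<lambda>k. g \<otimes> k \<otimes> inv g) ` K)"
      using open_conj[OF K(2,1) g] by auto
    show "rep_act V g f (x \<otimes> k') = rep_act V g f x" if k': "k' \<in> (\<lambda>k. g \<otimes> k \<otimes> inv g) ` K" and that: "x \<in> carrier G" for k' x
    proof -
      obtain k where k: "k \<in> K" "k' = g \<otimes> k \<otimes> inv g" using k' by auto
      have kc: "k \<in> carrier G" using k Kc by auto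
      have "x \<otimes> k' \<otimes> g = (x \<otimes> g) \<otimes> k" using k kc that g by (simp add: m_assoc)
      moreover have "f ((x \<otimes> g) \<otimes> k) = f (x \<otimes> g)" using K(3) k(1) that g by simp
      moreover have "x \<otimes> k' \<in> carrier G" using k kc that g by simp
      ultimately show ?thesis using eq[of x] eq[of "x \<otimes> k'"] that by simp
    qed
    show "compactin T ((\<lambda>x. x \<otimes> inv g) ` C)" using compact_right[OF C(1), of "inv g"] g by simp
    show "\<exists>h\<in>H. \<exists>c\<in>(\<lambda>x. x \<otimes> inv g) ` C. x = h \<otimes> c" if x: "x \<in> carrier G" "rep_act V g f x \<noteq> 0" for x
    proof -
      have "f (x \<otimes> g) \<noteq> 0" "x \<otimes> g \<in> carrier G" using x eq[OF x(1)] g by auto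
      then obtain h c where hc: "x \<otimes> g = h \<otimes> c" "h \<in> H" "c \<in> C" using C(2) by blast
      have c: "h \<in> carrier G" "c \<in> carrier G" using hc Hc Cc by auto
      have "x = (x \<otimes> g) \<otimes> inv g" using x(1) g by (simp add: m_assoc)
      then have "x = h \<otimes> (c \<otimes> inv g)" using c g unfolding hc(1) by (simp add: m_assoc)
      then show ?thesis using hc by blast
    qed
    show "rep_act V g f (h \<otimes> x) = rep_scale \<sigma> (of_real (chi h)) (rep_act \<sigma> h (rep_act V g f x))"
      if "h \<in> H" "x \<in> carrier G" for h x
    proof -
      have hc: "h \<in> carrier G" using that Hc by auto
      then show ?thesis using V_D(3)[OF f that(1), of "x \<otimes> g"] that g by (simp add: eq m_assoc)
    qed
    show "rep_act V g f x \<in> rep_space \<sigma>" if "x \<in> carrier G" for x using eq[OF that] V_D(1)[OF f, of "x \<otimes> g"] that g by simp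
    show "rep_act V g f x = 0" if "x \<notin> carrier G" for x using that by (simp add: V_act restrict0_def)
  qed
qed

lemma V_linear_rep: "linear_rep G V"
  unfolding linear_rep_def
proof (intro conjI ballI allI)
  fix f assume f: "f \<in> rep_space V"
  show "rep_act V \<one> f = f" using V_D(2)[OF f] by (auto simp: V_act restrict0_def fun_eq_iff)
  fix g assume g: "g \<in> carrier G"
  show "rep_act V g (rep_scale V c f) = rep_scale V c (rep_act V g f)" for c
    by (auto simp: V_act restrict0_def fun_eq_iff)
  show "rep_act V g (f + f') = rep_act V g f + rep_act V g f'" for f'
    by (auto simp: V_act restrict0_def fun_eq_iff)
  show "rep_act V (g \<otimes> h) f = rep_act V g (rep_act V h f)" if "h \<in> carrier G" for h
    using g that by (auto simp: V_act restrict0_def fun_eq_iff m_assoc)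
qed (use V_vector_space V_subspace V_act_closed in auto)

lemma chi_pos: "h \<in> H \<Longrightarrow> 0 < chi h" and chi_mult: "h \<in> H \<Longrightarrow> h' \<in> H \<Longrightarrow> chi (h \<otimes> h') = chi h * chi h'"
  and chi_compact_open: "subgroup K G \<Longrightarrow> openin T K \<Longrightarrow> compactin T K \<Longrightarrow> h \<in> K \<Longrightarrow> h \<in> H \<Longrightarrow> chi h = 1"
  using ind_char[OF H] by auto

lemma H_conj_zero:
  assumes f: "f \<in> rep_space V" and h: "h \<in> H" and g: "g \<in> carrier G" and z: "f g = 0"
  shows "f (h \<otimes> g) = 0"
  using V_D(3)[OF f h g] z H_act(5)[OF h] by simp

text \<open>Some power of s lies in a compact open subgroup, where the character is trivial; a positive number with
  a power equal to one is one.\<close>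

lemma chi_compact:
  assumes A: "subgroup A G" "A \<subseteq> C" "compactin T C" and s: "s \<in> A" and g: "g \<in> carrier G"
    and gH: "g \<otimes> s \<otimes> inv g \<in> H"
  shows "chi (g \<otimes> s \<otimes> inv g) = 1"
proof -
  obtain K where K: "subgroup K G" "openin T K" "compactin T K" using ex_compact_open by blast
  have Kc: "K \<subseteq> carrier G" using subgroup.subset[OF K(1)] .
  have ig: "inv g \<in> carrier G" using g by simp
  note K' = open_conj[OF K(2,1) ig]
  let ?K' = "(\<lambda>k. inv g \<otimes> k \<otimes> inv (inv g)) ` K"
  have sc: "s \<in> carrier G" using s subgroup.subset[OF A(1)] by auto
  have AK': "subgroup (A \<inter> ?K') G" using subgroups_Inter_pair[OF A(1) K'(2)] .
  obtain m :: nat where m: "0 < m" "s [^] m \<in> A \<inter> ?K'"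
    using finite_index_power[OF A(1) AK' finite_lcos_Int[OF A(1,2,3) K'(1,2)] s] by blast
  then obtain k where k: "k \<in> K" "s [^] m = inv g \<otimes> k \<otimes> g" using g by auto
  have kc: "k \<in> carrier G" using k Kc by auto
  have pow: "(g \<otimes> s \<otimes> inv g) [^] i = g \<otimes> s [^] i \<otimes> inv g" for i :: nat
  proof (induction i)
    case 0 then show ?case using g by simp
  next
    case (Suc i)
    have "inv g \<otimes> (g \<otimes> (s \<otimes> inv g)) = s \<otimes> inv g" using g sc by (simp add: inv_mult_cancel)
    then show ?case using Suc g sc by (simp add: m_assoc)
  qed
  have inH: "(g \<otimes> s \<otimes> inv g) [^] i \<in> H" for i :: nat
    by (induction i) (auto intro: subgroup.one_closed[OF H(1)] subgroup.m_closed[OF H(1)] gH)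
  have chi_pow: "chi ((g \<otimes> s \<otimes> inv g) [^] i) = chi (g \<otimes> s \<otimes> inv g) ^ i" for i :: nat
  proof (induction i)
    case 0
    show ?case using chi_compact_open[OF K subgroup.one_closed[OF K(1)] subgroup.one_closed[OF H(1)]] by simp
  next
    case (Suc i) then show ?case using chi_mult[OF inH[of i] gH] by simp
  qed
  have "g \<otimes> (s [^] m) \<otimes> inv g = k" unfolding k(2) using g kc by (simp add: m_assoc inv_mult_cancel)
  then have "(g \<otimes> s \<otimes> inv g) [^] m = k" using pow by simp
  then have "chi (g \<otimes> s \<otimes> inv g) ^ m = 1"
    using chi_pow[of m] chi_compact_open[OF K k(1)] inH[of m] by simp
  then have "chi (g \<otimes> s \<otimes> inv g) ^ m = 1 ^ m" by simp
  then show ?thesis using m(1) chi_pos[OF gH] by (elim power_eq_imp_eq_base) auto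
qed

text \<open>Extending v by the transformation law to \<open>H g\<^sub>0 K\<close> is consistent because the elements of H conjugate
  into K fix v and have trivial character.\<close>

lemma ex_section:
  assumes K: "subgroup K G" "openin T K" "compactin T K" and g0: "g0 \<in> carrier G"
    and v: "v \<in> rep_space \<sigma>"
    and fix_v: "\<And>p k. p \<in> H \<Longrightarrow> k \<in> K \<Longrightarrow> p = g0 \<otimes> k \<otimes> inv g0 \<Longrightarrow> rep_act \<sigma> p v = v"
  shows "\<exists>f\<in>rep_space V. (\<forall>p\<in>H. \<forall>k\<in>K. f (p \<otimes> g0 \<otimes> k) = rep_scale \<sigma> (of_real (chi p)) (rep_act \<sigma> p v)) \<and>
    (\<forall>g. f g \<noteq> 0 \<longrightarrow> (\<exists>p\<in>H. \<exists>k\<in>K. g = p \<otimes> g0 \<otimes> k))"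
proof -
  have Kc: "K \<subseteq> carrier G" using subgroup.subset[OF K(1)] .
  define F where "F p = rep_scale \<sigma> (of_real (chi p)) (rep_act \<sigma> p v)" for p
  define f where "f g = (if \<exists>p\<in>H. \<exists>k\<in>K. g = p \<otimes> g0 \<otimes> k
     then F (SOME p. p \<in> H \<and> (\<exists>k\<in>K. g = p \<otimes> g0 \<otimes> k)) else 0)" for g
  note K' = open_conj[OF K(2,1) g0]
  have cK': "compactin T ((\<lambda>k. g0 \<otimes> k \<otimes> inv g0) ` K)"
  proof -
    have "(\<lambda>k. g0 \<otimes> k \<otimes> inv g0) ` K = (\<lambda>x. x \<otimes> inv g0) ` (\<lambda>x. g0 \<otimes> x) ` K" by auto
    then show ?thesis using compact_right[OF compact_left[OF K(3) g0], of "inv g0"] g0 by simp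
  qed
  have wd: "F p = F p'" if p: "p \<in> H" "k \<in> K" "p' \<in> H" "k' \<in> K" "p \<otimes> g0 \<otimes> k = p' \<otimes> g0 \<otimes> k'" for p k p' k'
  proof -
    have c: "p \<in> carrier G" "p' \<in> carrier G" "k \<in> carrier G" "k' \<in> carrier G" using p Hc Kc by auto
    let ?q = "inv p' \<otimes> p"
    have q: "?q \<in> H" using subgroup.m_closed[OF H(1) subgroup.m_inv_closed[OF H(1) p(3)] p(1)] .
    have kk: "k' \<otimes> inv k \<in> K" using subgroup.m_closed[OF K(1) p(4) subgroup.m_inv_closed[OF K(1) p(2)]] .
    have "p = (p \<otimes> g0 \<otimes> k) \<otimes> inv k \<otimes> inv g0" using c g0 by (simp add: m_assoc inv_mult_cancel)
    then have "p = (p' \<otimes> g0 \<otimes> k') \<otimes> inv k \<otimes> inv g0" unfolding p(5) .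
    then have "?q = inv p' \<otimes> ((p' \<otimes> g0 \<otimes> k') \<otimes> inv k \<otimes> inv g0)" by simp
    also have "\<dots> = g0 \<otimes> (k' \<otimes> inv k) \<otimes> inv g0" using c g0 by (simp add: m_assoc inv_mult_cancel)
    finally have qe: "?q = g0 \<otimes> (k' \<otimes> inv k) \<otimes> inv g0" .
    have fx: "rep_act \<sigma> ?q v = v" using fix_v[OF q kk qe] .
    have chi: "chi ?q = 1" using chi_compact_open[OF K'(2,1) cK' _ q] kk qe by blast
    have pe: "p = p' \<otimes> ?q" using c by (simp add: inv_mult_cancel)
    have "chi (p' \<otimes> ?q) = chi p'" using chi_mult[OF p(3) q] chi by simp
    moreover have "rep_act \<sigma> (p' \<otimes> ?q) v = rep_act \<sigma> p' v" using H_act(2)[OF p(3) q v] fx by simp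
    ultimately have "F (p' \<otimes> ?q) = F p'" unfolding F_def by simp
    then show ?thesis using pe by simp
  qed
  have fF: "f (p \<otimes> g0 \<otimes> k) = F p" if p: "p \<in> H" "k \<in> K" for p k
  proof -
    let ?p' = "SOME p'. p' \<in> H \<and> (\<exists>k'\<in>K. p \<otimes> g0 \<otimes> k = p' \<otimes> g0 \<otimes> k')"
    have "?p' \<in> H \<and> (\<exists>k'\<in>K. p \<otimes> g0 \<otimes> k = ?p' \<otimes> g0 \<otimes> k')"
      by (rule someI[of _ p]) (use p in blast)
    then obtain k' where k': "k' \<in> K" "p \<otimes> g0 \<otimes> k = ?p' \<otimes> g0 \<otimes> k'" and p': "?p' \<in> H" by blast
    have "f (p \<otimes> g0 \<otimes> k) = F ?p'" unfolding f_def using p by auto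
    also have "\<dots> = F p" using wd[OF p p' k'] by simp
    finally show ?thesis .
  qed
  have supp: "\<exists>p\<in>H. \<exists>k\<in>K. g = p \<otimes> g0 \<otimes> k" if "f g \<noteq> 0" for g
    using that unfolding f_def by meson
  have FW: "F p \<in> rep_space \<sigma>" if "p \<in> H" for p
    unfolding F_def using linear_rep_subspace(2)[OF \<sigma>] H_act(1)[OF that v] by simp
  have closed: "\<exists>p\<in>H. \<exists>k\<in>K. g = p \<otimes> g0 \<otimes> k" if hg: "h \<in> H" "g \<in> carrier G" "k' \<in> K" "p \<in> H" "k \<in> K" "h \<otimes> g \<otimes> k' = p \<otimes> g0 \<otimes> k" for h g k' p k
  proof -
    have c: "p \<in> carrier G" "h \<in> carrier G" "k \<in> carrier G" "k' \<in> carrier G" using hg Hc Kc by auto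
    have "g = inv h \<otimes> (h \<otimes> g \<otimes> k') \<otimes> inv k'" using c hg(2) by (simp add: m_assoc inv_mult_cancel)
    also have "\<dots> = (inv h \<otimes> p) \<otimes> g0 \<otimes> (k \<otimes> inv k')" unfolding hg(6) using c g0 by (simp add: m_assoc)
    finally show ?thesis
      using subgroup.m_closed[OF H(1) subgroup.m_inv_closed[OF H(1) hg(1)] hg(4)]
        subgroup.m_closed[OF K(1) hg(5) subgroup.m_inv_closed[OF K(1) hg(3)]] by blast
  qed
  have "f \<in> rep_space V"
  proof (rule V_I[OF _ _ _ K(1,2)])
    show "f g \<in> rep_space \<sigma>" for g
    proof (cases "f g = 0")
      case True then show ?thesis using linear_rep_subspace(1)[OF \<sigma>] by simp
    next
      case False
      then obtain p k where pk: "p \<in> H" "k \<in> K" "g = p \<otimes> g0 \<otimes> k" using supp by blast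
      then show ?thesis using fF FW by simp
    qed
    show "f g = 0" if "g \<notin> carrier G" for g using supp[of g] that Hc Kc g0 by blast
    show "f (h \<otimes> g) = rep_scale \<sigma> (of_real (chi h)) (rep_act \<sigma> h (f g))" if hg: "h \<in> H" "g \<in> carrier G" for h g
    proof (cases "\<exists>p\<in>H. \<exists>k\<in>K. g = p \<otimes> g0 \<otimes> k")
      case True
      then obtain p k where pk: "p \<in> H" "k \<in> K" "g = p \<otimes> g0 \<otimes> k" by blast
      have c: "p \<in> carrier G" "k \<in> carrier G" "h \<in> carrier G" using pk hg Hc Kc by auto
      have "h \<otimes> g = (h \<otimes> p) \<otimes> g0 \<otimes> k" unfolding pk(3) using c g0 by (simp add: m_assoc)
      then have "f (h \<otimes> g) = F (h \<otimes> p)" using fF[OF subgroup.m_closed[OF H(1) hg(1) pk(1)] pk(2)] by simp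
      also have "\<dots> = rep_scale \<sigma> (of_real (chi h)) (rep_act \<sigma> h (F p))"
        unfolding F_def using chi_mult[OF hg(1) pk(1)] H_act(2)[OF hg(1) pk(1) v] H_act(4)[OF hg(1) H_act(1)[OF pk(1) v]]
        by simp
      finally show ?thesis using fF[OF pk(1,2)] pk(3) by simp
    next
      case False
      have "f (h \<otimes> g) = 0"
      proof (rule ccontr)
        assume "f (h \<otimes> g) \<noteq> 0"
        then obtain p k where pk: "p \<in> H" "k \<in> K" "h \<otimes> g = p \<otimes> g0 \<otimes> k" using supp by blast
        have "h \<otimes> g \<otimes> \<one> = h \<otimes> g" using hg Hc by auto
        then have "h \<otimes> g \<otimes> \<one> = p \<otimes> g0 \<otimes> k" using pk(3) by simp
        then show False using closed[OF hg subgroup.one_closed[OF K(1)] pk(1,2)] False by blast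
      qed
      moreover have "f g = 0" using supp False by blast
      ultimately show ?thesis using H_act(5)[OF hg(1)] by simp
    qed
    show "f (g \<otimes> k) = f g" if kg: "k \<in> K" "g \<in> carrier G" for k g
    proof (cases "\<exists>p\<in>H. \<exists>k\<in>K. g = p \<otimes> g0 \<otimes> k")
      case True
      then obtain p l where pk: "p \<in> H" "l \<in> K" "g = p \<otimes> g0 \<otimes> l" by blast
      have c: "p \<in> carrier G" "k \<in> carrier G" "l \<in> carrier G" using pk kg Hc Kc by auto
      have "g \<otimes> k = p \<otimes> g0 \<otimes> (l \<otimes> k)" unfolding pk(3) using c g0 by (simp add: m_assoc)
      then have "f (g \<otimes> k) = F p" using fF[OF pk(1) subgroup.m_closed[OF K(1) pk(2) kg(1)]] by simp
      then show ?thesis using fF[OF pk(1,2)] pk(3) by simp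
    next
      case False
      have "f (g \<otimes> k) = 0"
      proof (rule ccontr)
        assume "f (g \<otimes> k) \<noteq> 0"
        then obtain p l where pk: "p \<in> H" "l \<in> K" "g \<otimes> k = p \<otimes> g0 \<otimes> l" using supp by blast
        have "\<one> \<otimes> g \<otimes> k = p \<otimes> g0 \<otimes> l" using pk(3) kg Hc by auto
        then show False using closed[OF subgroup.one_closed[OF H(1)] kg(2,1) pk(1,2)] False by blast
      qed
      moreover have "f g = 0" using supp False by blast
      ultimately show ?thesis by simp
    qed
    show "compactin T ((\<lambda>x. g0 \<otimes> x) ` K)" using compact_left[OF K(3) g0] .
    show "\<exists>h\<in>H. \<exists>c\<in>(\<lambda>x. g0 \<otimes> x) ` K. g = h \<otimes> c" if "f g \<noteq> 0" for g
    proof -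
      obtain p k where pk: "p \<in> H" "k \<in> K" "g = p \<otimes> g0 \<otimes> k" using supp[OF \<open>f g \<noteq> 0\<close>] by blast
      have "g = p \<otimes> (g0 \<otimes> k)" unfolding pk(3) using pk(1,2) Hc Kc g0 by (auto simp: m_assoc subset_iff)
      then show ?thesis using pk by blast
    qed
  qed
  then show ?thesis using fF supp unfolding F_def by blast
qed

end

section \<open>Twisted averages on an orbit\<close>

text \<open>The action of the stabilizer of the coset of g on the stalk at g.\<close>

definition conj_rep :: "('g,'m) monoid_scheme \<Rightarrow> 'g \<Rightarrow> ('g,'v) rep \<Rightarrow> ('g,'v) rep" where
  "conj_rep G g \<sigma> = \<sigma>\<lparr>rep_act := (\<lambda>s. rep_act \<sigma> (g \<otimes>\<^bsub>G\<^esub> s \<otimes>\<^bsub>G\<^esub> inv\<^bsub>G\<^esub> g))\<rparr>"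

lemma conj_rep_simps [simp]:
  "rep_scale (conj_rep G g \<sigma>) = rep_scale \<sigma>" "rep_space (conj_rep G g \<sigma>) = rep_space \<sigma>"
  "rep_act (conj_rep G g \<sigma>) s = rep_act \<sigma> (g \<otimes>\<^bsub>G\<^esub> s \<otimes>\<^bsub>G\<^esub> inv\<^bsub>G\<^esub> g)"
  unfolding conj_rep_def by simp_all

text \<open>A commutative group N exhausted by compact subgroups, as unipotent radicals are, and a character \<open>\<theta>\<close>
  of N, acting on sections of an induced representation.\<close>

locale twisted_datum = induction_datum G T H \<sigma> for G (structure) and T and H and \<sigma> :: "('a, 'v::ab_group_add) rep" +
  fixes N :: "'a set" and \<theta> :: "'a \<Rightarrow> complex"
  assumes N: "subgroup N G"
    and N_comm: "\<And>x y. x \<in> N \<Longrightarrow> y \<in> N \<Longrightarrow> x \<otimes> y = y \<otimes> x"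
    and N_compact: "\<And>S. finite S \<Longrightarrow> S \<subseteq> N \<Longrightarrow> \<exists>A. subgroup A G \<and> compactin T A \<and> S \<subseteq> A \<and> A \<subseteq> N"
    and \<theta>_mult: "\<And>x y. x \<in> N \<Longrightarrow> y \<in> N \<Longrightarrow> \<theta> (x \<otimes> y) = \<theta> x * \<theta> y"
    and \<theta>_nz: "\<And>x. x \<in> N \<Longrightarrow> \<theta> x \<noteq> 0"
    and \<theta>_open: "\<exists>K. subgroup K G \<and> openin T K \<and> (\<forall>x\<in>N \<inter> K. \<theta> x = 1)"
    and \<sigma>_smooth: "\<And>v. v \<in> rep_space \<sigma> \<Longrightarrow> \<exists>K. subgroup K G \<and> openin T K \<and> (\<forall>p\<in>H \<inter> K. rep_act \<sigma> p v = v)"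
begin

definition Stab :: "'a \<Rightarrow> 'a set" where
  "Stab g = {s \<in> N. g \<otimes> s \<otimes> inv g \<in> H}"

lemma Nc: "N \<subseteq> carrier G" using subgroup.subset[OF N] .

lemma conj_mult:
  assumes "g \<in> carrier G" "s \<in> carrier G" "t \<in> carrier G"
  shows "g \<otimes> (s \<otimes> t) \<otimes> inv g = (g \<otimes> s \<otimes> inv g) \<otimes> (g \<otimes> t \<otimes> inv g)"
proof -
  have "inv g \<otimes> (g \<otimes> (t \<otimes> inv g)) = t \<otimes> inv g" using assms by (simp add: inv_mult_cancel)
  then show ?thesis using assms by (simp add: m_assoc)
qed

lemma Stab_subgroup:
  assumes g: "g \<in> carrier G" shows "subgroup (Stab g) G"
proof (rule subgroupI)
  show "Stab g \<subseteq> carrier G" unfolding Stab_def using Nc by auto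
  have "\<one> \<in> Stab g" unfolding Stab_def using g subgroup.one_closed[OF N] subgroup.one_closed[OF H(1)] by simp
  then show "Stab g \<noteq> {}" by auto
  fix a assume a: "a \<in> Stab g"
  have ac: "a \<in> carrier G" "a \<in> N" "g \<otimes> a \<otimes> inv g \<in> H" using a Nc unfolding Stab_def by auto
  have "inv (g \<otimes> a \<otimes> inv g) = g \<otimes> inv a \<otimes> inv g" using ac g by (simp add: inv_mult_group m_assoc)
  then show "inv a \<in> Stab g" unfolding Stab_def
    using subgroup.m_inv_closed[OF N ac(2)] subgroup.m_inv_closed[OF H(1) ac(3)] by simp
  fix b assume b: "b \<in> Stab g"
  have bc: "b \<in> carrier G" "b \<in> N" "g \<otimes> b \<otimes> inv g \<in> H" using b Nc unfolding Stab_def by auto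
  show "a \<otimes> b \<in> Stab g" unfolding Stab_def
    using subgroup.m_closed[OF N ac(2) bc(2)] subgroup.m_closed[OF H(1) ac(3) bc(3)] conj_mult[OF g ac(1) bc(1)] by simp
qed

lemma conj_linear_rep:
  assumes g: "g \<in> carrier G"
  shows "linear_rep (subgrp G (Stab g)) (conj_rep G g \<sigma>)"
proof -
  have h: "s \<in> Stab g \<Longrightarrow> g \<otimes> s \<otimes> inv g \<in> H" for s unfolding Stab_def by auto
  have c: "s \<in> Stab g \<Longrightarrow> s \<in> carrier G" for s using Nc unfolding Stab_def by auto
  show ?thesis unfolding linear_rep_def
    using linear_repD(1,3)[OF \<sigma>] H_act h g by (auto simp: conj_mult c)
qed

lemma V_N: "linear_rep (subgrp G N) V"
  using linear_rep_subgrp[OF V_linear_rep Nc] .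

lemma twisted_sum_V:
  assumes f: "f \<in> rep_space V" and A: "finite (lcos G A L)" and g: "g \<in> carrier G"
  shows "twisted_sum G V \<theta> A L f g = coset_sum G A L (\<lambda>u. rep_scale \<sigma> (inverse (\<theta> u)) (f (g \<otimes> u)))"
  unfolding twisted_sum_def coset_sum_finite[OF A] sum_apply
  using g by (simp add: V_act restrict0_def)

lemma finite_index:
  assumes "subgroup A G" "A \<subseteq> C" "compactin T C" "subgroup K G" "openin T K"
  shows "finite (lcos G A (A \<inter> K))" "subgroup (A \<inter> K) G" "A \<inter> K \<subseteq> A"
  using finite_lcos_Int[OF assms(1-3,5,4)] subgroups_Inter_pair[OF assms(1,4)] by auto

text \<open>If a section is supported near \<open>g\<^sub>0\<close>, its twisted average at \<open>g\<^sub>0\<close> only sees the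
  stabilizer, and modulo the twisted kernel of the stalk every term is a positive multiple of v.
  So no averaging kills the section.\<close>

lemma stalk_nonzero_imp_nonzero:
  assumes g0: "g0 \<in> carrier G"
    and K: "subgroup K G" "openin T K" "compactin T K"
    and v: "v \<in> rep_space \<sigma>" "v \<notin> twisted_kernel (conj_rep G g0 \<sigma>) (Stab g0) \<theta>"
    and fix_v: "\<And>p k. p \<in> H \<Longrightarrow> k \<in> K \<Longrightarrow> p = g0 \<otimes> k \<otimes> inv g0 \<Longrightarrow> rep_act \<sigma> p v = v"
    and \<theta>K: "\<And>x. x \<in> N \<Longrightarrow> x \<in> K \<Longrightarrow> \<theta> x = 1"
    and orbit: "\<And>u p k. u \<in> N \<Longrightarrow> p \<in> H \<Longrightarrow> k \<in> K \<Longrightarrow> g0 \<otimes> u = p \<otimes> g0 \<otimes> k \<Longrightarrow> \<exists>s\<in>Stab g0. \<exists>n\<in>N \<inter> K. u = s \<otimes> n"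
  shows "twisted_jacquet_nonzero V N \<theta>"
proof -
  obtain f where f: "f \<in> rep_space V"
    and fval: "\<And>p k. p \<in> H \<Longrightarrow> k \<in> K \<Longrightarrow> f (p \<otimes> g0 \<otimes> k) = rep_scale \<sigma> (of_real (chi p)) (rep_act \<sigma> p v)"
    and fsupp: "\<And>g. f g \<noteq> 0 \<Longrightarrow> \<exists>p\<in>H. \<exists>k\<in>K. g = p \<otimes> g0 \<otimes> k"
    using ex_section[OF K g0 v(1)] fix_v by blast
  let ?\<tau> = "conj_rep G g0 \<sigma>" and ?S = "Stab g0"
  let ?ker = "twisted_kernel ?\<tau> ?S \<theta>"
  note kersub = twisted_kernel_subspace[OF conj_linear_rep[OF g0], where \<theta> = \<theta>]
  have ks: "sc.subspace ?ker" using kersub(1) by simp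
  have "f \<notin> twisted_kernel V N \<theta>"
  proof
    assume "f \<in> twisted_kernel V N \<theta>"
    from twisted_kernel_average[OF V_N N N_comm \<theta>_mult \<theta>_nz this]
    obtain S W where SW: "finite S" "S \<subseteq> N" "finite W" "W \<subseteq> rep_space V"
      and kill: "\<And>A L. subgroup A G \<Longrightarrow> A \<subseteq> N \<Longrightarrow> S \<subseteq> A \<Longrightarrow> subgroup L G \<Longrightarrow> L \<subseteq> A \<Longrightarrow> finite (lcos G A L) \<Longrightarrow>
        (\<forall>l\<in>L. \<theta> l = 1) \<Longrightarrow> (\<forall>l\<in>L. \<forall>w\<in>W. rep_act V l w = w) \<Longrightarrow> twisted_sum G V \<theta> A L f = 0" by metis
    obtain A where A: "subgroup A G" "compactin T A" "S \<subseteq> A" "A \<subseteq> N" using N_compact[OF SW(1,2)] by blast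
    have "\<exists>J. subgroup J G \<and> openin T J \<and> J \<subseteq> K \<and> (\<forall>l\<in>J. \<forall>w\<in>W. rep_act V l w = w)"
      using SW(3,4)
    proof (induction rule: finite_induct)
      case empty then show ?case using K by blast
    next
      case (insert w W)
      then obtain J where J: "subgroup J G" "openin T J" "J \<subseteq> K" "\<forall>l\<in>J. \<forall>w\<in>W. rep_act V l w = w" by auto
      have w: "w \<in> rep_space V" using insert by auto
      obtain J' where J': "subgroup J' G" "openin T J'" "\<forall>k\<in>J'. \<forall>g\<in>carrier G. w (g \<otimes> k) = w g" using V_D(4)[OF w] by blast
      have "rep_act V l w = w" if "l \<in> J'" for l
        using J'(3) that V_D(2)[OF w] by (auto simp: V_act restrict0_def fun_eq_iff)
      then have "\<forall>l\<in>J \<inter> J'. \<forall>w\<in>insert w W. rep_act V l w = w" using J(4) by blast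
      moreover have "J \<inter> J' \<subseteq> K" using J(3) by blast
      ultimately show ?case using subgroups_Inter_pair[OF J(1) J'(1)] openin_Int[OF J(2) J'(2)] by blast
    qed
    then obtain J where J: "subgroup J G" "openin T J" "J \<subseteq> K" "\<forall>l\<in>J. \<forall>w\<in>W. rep_act V l w = w" by blast
    let ?L = "A \<inter> J"
    note L = finite_index[OF A(1) subset_refl A(2) J(1,2)]
    have L1: "\<forall>l\<in>?L. \<theta> l = 1" using \<theta>K A(4) J(3) by blast
    have L2: "\<forall>l\<in>?L. \<forall>w\<in>W. rep_act V l w = w" using J(4) by blast
    have "twisted_sum G V \<theta> A ?L f g0 = 0" using kill[OF A(1,4,3) L(2,3,1) L1 L2] by simp
    then have zero: "(\<Sum>C\<in>lcos G A ?L. rep_scale \<sigma> (inverse (\<theta> (rep_of C))) (f (g0 \<otimes> rep_of C))) = 0"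
      unfolding twisted_sum_V[OF f L(1) g0] coset_sum_finite[OF L(1)] .
    have summand: "\<exists>c\<ge>0. (f (g0 \<otimes> u) \<noteq> 0 \<longrightarrow> 0 < c) \<and>
        rep_scale \<sigma> (inverse (\<theta> u)) (f (g0 \<otimes> u)) - rep_scale \<sigma> (of_real c) v \<in> ?ker" if u: "u \<in> N" for u
    proof (cases "f (g0 \<otimes> u) = 0")
      case True
      then show ?thesis using sc.subspace_0[OF ks] by (intro exI[of _ 0]) simp
    next
      case False
      then obtain p k where pk: "p \<in> H" "k \<in> K" "g0 \<otimes> u = p \<otimes> g0 \<otimes> k" using fsupp by blast
      obtain s n where sn: "s \<in> ?S" "n \<in> N" "n \<in> K" "u = s \<otimes> n" using orbit[OF u pk] by blast
      have c: "s \<in> carrier G" "n \<in> carrier G" and sN: "s \<in> N" and gs: "g0 \<otimes> s \<otimes> inv g0 \<in> H"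
        using sn Nc unfolding Stab_def by auto
      let ?q = "g0 \<otimes> s \<otimes> inv g0"
      have "g0 \<otimes> u = ?q \<otimes> g0 \<otimes> n" unfolding sn(4) using c g0 by (simp add: m_assoc inv_mult_cancel)
      then have fv: "f (g0 \<otimes> u) = rep_scale \<sigma> (of_real (chi ?q)) (rep_act \<sigma> ?q v)"
        using fval[OF gs sn(3)] by simp
      have th: "\<theta> u = \<theta> s" unfolding sn(4) using \<theta>_mult[OF sN sn(2)] \<theta>K[OF sn(2,3)] by simp
      have gen: "rep_act \<sigma> ?q v - rep_scale \<sigma> (\<theta> s) v \<in> ?ker" using kersub(3)[OF sn(1)] v(1) by simp
      have "rep_scale \<sigma> (inverse (\<theta> u)) (f (g0 \<otimes> u)) - rep_scale \<sigma> (of_real (chi ?q)) v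
        = rep_scale \<sigma> (of_real (chi ?q) * inverse (\<theta> s)) (rep_act \<sigma> ?q v - rep_scale \<sigma> (\<theta> s) v)"
        unfolding fv th using \<theta>_nz[OF sN] by (simp add: sc.scale_right_diff_distrib mult.commute)
      also have "\<dots> \<in> ?ker" using sc.subspace_scale[OF ks gen] .
      finally show ?thesis using chi_pos[OF gs] by (intro exI[of _ "chi ?q"]) auto
    qed
    then obtain c where c: "\<And>u. u \<in> N \<Longrightarrow> 0 \<le> c u" "\<And>u. u \<in> N \<Longrightarrow> f (g0 \<otimes> u) \<noteq> 0 \<Longrightarrow> 0 < c u"
      "\<And>u. u \<in> N \<Longrightarrow> rep_scale \<sigma> (inverse (\<theta> u)) (f (g0 \<otimes> u)) - rep_scale \<sigma> (of_real (c u)) v \<in> ?ker"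
      by metis
    have rN: "rep_of C \<in> N" if "C \<in> lcos G A ?L" for C using rep_of_in(1)[OF L(2) A(1) L(3) that] A(4) by auto
    let ?c = "\<Sum>C\<in>lcos G A ?L. c (rep_of C)"
    have "(\<Sum>C\<in>lcos G A ?L. rep_scale \<sigma> (inverse (\<theta> (rep_of C))) (f (g0 \<otimes> rep_of C)) - rep_scale \<sigma> (of_real (c (rep_of C))) v) \<in> ?ker"
      using c(3) rN by (intro sc.subspace_sum[OF ks]) auto
    then have "- rep_scale \<sigma> (of_real ?c) v \<in> ?ker"
      unfolding sum_subtractf zero by (simp add: sc.scale_sum_left)
    then have cv: "rep_scale \<sigma> (of_real ?c) v \<in> ?ker" using sc.subspace_neg[OF ks] by fastforce
    have cpos: "0 < ?c"
    proof (rule sum_pos2[OF L(1)])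
      let ?C1 = "\<one> <# ?L"
      show C1: "?C1 \<in> lcos G A ?L" unfolding lcos_def using subgroup.one_closed[OF A(1)] by blast
      have "rep_of ?C1 \<in> ?C1" using rep_of_lcos[OF L(2) one_closed] .
      then obtain l where l: "l \<in> ?L" "rep_of ?C1 = \<one> \<otimes> l" unfolding l_coset_def by auto
      have lc: "l \<in> carrier G" "l \<in> K" using l(1) A(4) Nc J(3) by auto
      have "f (g0 \<otimes> rep_of ?C1) = f (\<one> \<otimes> g0 \<otimes> l)" unfolding l(2) using g0 lc by simp
      also have "\<dots> = v" using fval[OF subgroup.one_closed[OF H(1)] lc(2)]
          chi_compact_open[OF K subgroup.one_closed[OF K(1)] subgroup.one_closed[OF H(1)]] H_act(6)[OF v(1)] by simp
      finally have "f (g0 \<otimes> rep_of ?C1) \<noteq> 0" using v(2) sc.subspace_0[OF ks] by auto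
      then show "0 < c (rep_of ?C1)" using c(2)[OF rN[OF C1]] by simp
      show "0 \<le> c (rep_of C)" if "C \<in> lcos G A ?L" for C using c(1)[OF rN[OF that]] .
    qed
    have "rep_scale \<sigma> (inverse (of_real ?c)) (rep_scale \<sigma> (of_real ?c) v) \<in> ?ker"
      using sc.subspace_scale[OF ks cv] .
    moreover have "complex_of_real ?c \<noteq> 0" using cpos by (metis less_irrefl of_real_eq_0_iff)
    ultimately show False using v(2) by simp
  qed
  then show ?thesis using twisted_jacquet_nonzero_iff[OF V_N] f by blast
qed

lemma averaged_term_inv:
  assumes f: "f \<in> rep_space V" and K: "\<And>k g. k \<in> K \<Longrightarrow> g \<in> carrier G \<Longrightarrow> f (g \<otimes> k) = f g"
    and \<theta>K: "\<And>x. x \<in> N \<Longrightarrow> x \<in> K \<Longrightarrow> \<theta> x = 1" and A: "A \<subseteq> N" and g: "g \<in> carrier G"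
  shows "right_inv G A (A \<inter> K) (\<lambda>u. rep_scale \<sigma> (inverse (\<theta> u)) (f (g \<otimes> u)))"
  unfolding right_inv_def
proof (intro ballI)
  fix x l assume x: "x \<in> A" and l: "l \<in> A \<inter> K"
  have c: "x \<in> carrier G" "l \<in> carrier G" "x \<in> N" "l \<in> N" using x l A Nc by auto
  have "f (g \<otimes> (x \<otimes> l)) = f (g \<otimes> x)" using K[of l "g \<otimes> x"] l c g by (simp add: m_assoc)
  moreover have "\<theta> (x \<otimes> l) = \<theta> x" using \<theta>_mult[OF c(3,4)] \<theta>K[OF c(4)] l by simp
  ultimately show "rep_scale \<sigma> (inverse (\<theta> (x \<otimes> l))) (f (g \<otimes> (x \<otimes> l))) = rep_scale \<sigma> (inverse (\<theta> x)) (f (g \<otimes> x))"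
    by simp
qed

context
  fixes f K assumes f: "f \<in> rep_space V"
    and K: "subgroup K G" "openin T K" "\<And>k g. k \<in> K \<Longrightarrow> g \<in> carrier G \<Longrightarrow> f (g \<otimes> k) = f g"
    and \<theta>K: "\<And>x. x \<in> N \<Longrightarrow> x \<in> K \<Longrightarrow> \<theta> x = 1"
begin

abbreviation avg where "avg A \<equiv> twisted_sum G V \<theta> A (A \<inter> K) f"

lemma avg_V:
  assumes A: "subgroup A G" "compactin T A" "A \<subseteq> N"
  shows "avg A \<in> rep_space V" "avg A \<in> twisted_kernel V N \<theta> \<Longrightarrow> f \<in> twisted_kernel V N \<theta>"
proof -
  note L = finite_index[OF A(1) subset_refl A(2) K(1,2)]
  note c = twisted_sum_congruent[OF V_N A(1,3) L(2,3,1) \<theta>_nz f]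
  show "avg A \<in> rep_space V" using c(2) .
  assume a: "avg A \<in> twisted_kernel V N \<theta>"
  interpret VS: vector_space "rep_scale V" by (rule V_vector_space)
  note s = twisted_kernel_subspace(1)[OF V_N, where \<theta> = \<theta>]
  let ?m = "of_nat (card (lcos G A (A \<inter> K))) :: complex"
  have "rep_scale V ?m f \<in> twisted_kernel V N \<theta>"
    using VS.subspace_diff[OF s a c(1)] by simp
  then have "rep_scale V (inverse ?m) (rep_scale V ?m f) \<in> twisted_kernel V N \<theta>"
    by (rule VS.subspace_scale[OF s])
  moreover have "?m \<noteq> 0" using L(1) lcos_nonempty[OF A(1)] by simp
  ultimately show "f \<in> twisted_kernel V N \<theta>" by (simp add: fun_eq_iff del: V_scale)
qed

lemma avg_eval:
  assumes A: "subgroup A G" "compactin T A" "A \<subseteq> N" and g: "g \<in> carrier G"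
  shows "avg A g = coset_sum G A (A \<inter> K) (\<lambda>u. rep_scale \<sigma> (inverse (\<theta> u)) (f (g \<otimes> u)))"
  using twisted_sum_V[OF f finite_index(1)[OF A(1) subset_refl A(2) K(1,2)] g] .

lemma avg_translate:
  assumes A: "subgroup A G" "compactin T A" "A \<subseteq> N" and g: "g \<in> carrier G" and u: "u \<in> A"
  shows "avg A (g \<otimes> u) = rep_scale \<sigma> (\<theta> u) (avg A g)"
proof -
  note L = finite_index[OF A(1) subset_refl A(2) K(1,2)]
  have uc: "u \<in> carrier G" "u \<in> N" using u A(3) Nc by auto
  let ?F = "\<lambda>x. rep_scale \<sigma> (inverse (\<theta> x)) (f (g \<otimes> x))"
  have "rep_scale \<sigma> (inverse (\<theta> x)) (f (g \<otimes> u \<otimes> x)) = rep_scale \<sigma> (\<theta> u) (?F (u \<otimes> x))" if x: "x \<in> N" for x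
    using \<theta>_mult[OF uc(2) x] \<theta>_nz[OF uc(2)] g uc x Nc by (auto simp: m_assoc subset_iff)
  then have "avg A (g \<otimes> u) = (\<Sum>C\<in>lcos G A (A \<inter> K). rep_scale \<sigma> (\<theta> u) (?F (u \<otimes> rep_of C)))"
    using avg_eval[OF A, of "g \<otimes> u"] g uc rep_of_in(1)[OF L(2) A(1) L(3)] A(3)
    unfolding coset_sum_finite[OF L(1)] by (auto intro!: sum.cong)
  also have "\<dots> = rep_scale \<sigma> (\<theta> u) (coset_sum G A (A \<inter> K) (\<lambda>x. ?F (u \<otimes> x)))"
    unfolding coset_sum_finite[OF L(1)] sc.scale_sum_right ..
  also have "\<dots> = rep_scale \<sigma> (\<theta> u) (avg A g)"
    using coset_sum_translate[OF A(1) L(2,3) averaged_term_inv[OF f K(3) \<theta>K A(3) g] u] avg_eval[OF A g] by simp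
  finally show ?thesis .
qed

lemma avg_zero_at_supp:
  assumes A: "subgroup A G" "compactin T A" "A \<subseteq> N" and g: "g \<in> carrier G" and nz: "avg A g \<noteq> 0"
  shows "\<exists>u\<in>A. f (g \<otimes> u) \<noteq> 0"
proof (rule ccontr)
  assume *: "\<not> (\<exists>u\<in>A. f (g \<otimes> u) \<noteq> 0)"
  note L = finite_index[OF A(1) subset_refl A(2) K(1,2)]
  have "avg A g = 0" unfolding avg_eval[OF A g] coset_sum_finite[OF L(1)]
    using rep_of_in(1)[OF L(2) A(1) L(3)] * by simp
  then show False using nz by simp
qed

text \<open>Averages are equivariant under the averaging group, which contains the set B carrying f along the orbit of
  g. So the vanishing at g spreads over the orbit, and then to larger groups by summing in stages.\<close>

lemma avg_zero_orbit:
  assumes A: "subgroup A G" "compactin T A" "A \<subseteq> N" and g: "g \<in> carrier G"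
    and B: "B \<subseteq> A" "\<And>u. u \<in> N \<Longrightarrow> f (g \<otimes> u) \<noteq> 0 \<Longrightarrow> \<exists>s\<in>Stab g. \<exists>b\<in>B. u = s \<otimes> b"
    and z: "avg A g = 0"
  shows "u \<in> N \<Longrightarrow> avg A (g \<otimes> u) = 0"
    "subgroup A' G \<Longrightarrow> compactin T A' \<Longrightarrow> A' \<subseteq> N \<Longrightarrow> A \<subseteq> A' \<Longrightarrow> avg A' g = 0"
proof -
  note L = finite_index[OF A(1) subset_refl A(2) K(1,2)]
  show orb: "avg A (g \<otimes> u) = 0" if u: "u \<in> N" for u
  proof (rule ccontr)
    assume nz: "avg A (g \<otimes> u) \<noteq> 0"
    have uc: "u \<in> carrier G" using u Nc by auto
    obtain a where a: "a \<in> A" "f (g \<otimes> u \<otimes> a) \<noteq> 0" using avg_zero_at_supp[OF A _ nz] g uc by auto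
    have ac: "a \<in> carrier G" "a \<in> N" using a A(3) Nc by auto
    have uaN: "u \<otimes> a \<in> N" using subgroup.m_closed[OF N u ac(2)] .
    have "f (g \<otimes> (u \<otimes> a)) \<noteq> 0" using a(2) g uc ac by (simp add: m_assoc)
    then obtain s b where sb: "s \<in> Stab g" "b \<in> B" "u \<otimes> a = s \<otimes> b" using B(2)[OF uaN] by blast
    have c: "s \<in> carrier G" "b \<in> carrier G" "b \<in> A" and gs: "g \<otimes> s \<otimes> inv g \<in> H"
      using sb B(1) A(3) Nc unfolding Stab_def by auto
    have "avg A (g \<otimes> u \<otimes> a) = rep_scale \<sigma> (\<theta> a) (avg A (g \<otimes> u))"
      using avg_translate[OF A _ a(1)] g uc by simp
    then have "avg A (g \<otimes> u \<otimes> a) \<noteq> 0" using nz \<theta>_nz[OF ac(2)] by simp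
    moreover have "g \<otimes> u \<otimes> a = (g \<otimes> s \<otimes> inv g) \<otimes> (g \<otimes> b)"
      using sb(3) g uc ac c by (simp add: m_assoc inv_mult_cancel)
    moreover have "avg A (g \<otimes> b) = 0" using avg_translate[OF A g c(3)] z by simp
    ultimately show False using H_conj_zero[OF avg_V(1)[OF A] gs, of "g \<otimes> b"] g c by simp
  qed
  assume A': "subgroup A' G" "compactin T A'" "A' \<subseteq> N" "A \<subseteq> A'"
  note L' = finite_index[OF A'(1) subset_refl A'(2) K(1,2)]
  let ?F = "\<lambda>x. rep_scale \<sigma> (inverse (\<theta> x)) (f (g \<otimes> x))"
  have "(\<Sum>D\<in>lcos G A (A \<inter> K). coset_sum G A' (A' \<inter> K) ?F) = 0"
  proof (rule coset_sum_subgroup_zero[OF A'(1) L'(2,3,1) averaged_term_inv[OF f K(3) \<theta>K A'(3) g] A(1) A'(4) L(2,3,1)])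
    fix y assume y: "y \<in> A'"
    have yN: "y \<in> N" "y \<in> carrier G" using y A'(3) Nc by auto
    have e: "?F (x \<otimes> y) = rep_scale \<sigma> (inverse (\<theta> y)) (rep_scale \<sigma> (inverse (\<theta> x)) (f (g \<otimes> y \<otimes> x)))" if x: "x \<in> N" for x
    proof -
      have "g \<otimes> (x \<otimes> y) = g \<otimes> y \<otimes> x" using N_comm[OF x yN(1)] g yN x Nc by (auto simp: m_assoc subset_iff)
      then show ?thesis using \<theta>_mult[OF x yN(1)] by (simp add: mult.commute)
    qed
    have gy: "g \<otimes> y \<in> carrier G" using g yN by simp
    have "coset_sum G A (A \<inter> K) (\<lambda>z. ?F (z \<otimes> y)) = rep_scale \<sigma> (inverse (\<theta> y)) (avg A (g \<otimes> y))"
      unfolding avg_eval[OF A gy] coset_sum_finite[OF L(1)] sc.scale_sum_right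
      using rep_of_in(1)[OF L(2) A(1) L(3)] A(3) e by (intro sum.cong refl) blast
    then show "coset_sum G A (A \<inter> K) (\<lambda>z. ?F (z \<otimes> y)) = 0" using orb[OF yN(1)] by simp
  qed
  then have "rep_scale \<sigma> (of_nat (card (lcos G A (A \<inter> K)))) (avg A' g) = 0"
    unfolding avg_eval[OF A'(1-3) g] by (simp add: sc.sum_constant_scale)
  then show "avg A' g = 0" using L(1) lcos_nonempty[OF A(1)] by simp
qed

text \<open>Up to the stabilizer, f takes only the finitely many values on \<open>g B\<close> along the orbit, and the vanishing of
  the stalk lets a sufficiently large part of the stabilizer average all of them to zero.\<close>

lemma avg_zero_of_stalk:
  assumes g: "g \<in> carrier G"
    and B: "subgroup B G" "compactin T B" "B \<subseteq> N" "\<And>u. u \<in> N \<Longrightarrow> f (g \<otimes> u) \<noteq> 0 \<Longrightarrow> \<exists>s\<in>Stab g. \<exists>b\<in>B. u = s \<otimes> b"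
    and stalk: "rep_space \<sigma> \<subseteq> twisted_kernel (conj_rep G g \<sigma>) (Stab g) \<theta>"
  shows "\<exists>S. finite S \<and> S \<subseteq> N \<and> (\<forall>A. subgroup A G \<longrightarrow> compactin T A \<longrightarrow> A \<subseteq> N \<longrightarrow> B \<subseteq> A \<longrightarrow> S \<subseteq> A \<longrightarrow> avg A g = 0)"
proof -
  let ?\<tau> = "conj_rep G g \<sigma>" and ?St = "Stab g"
  note St = Stab_subgroup[OF g]
  have StN: "?St \<subseteq> N" unfolding Stab_def by auto
  note LB = finite_index[OF B(1) subset_refl B(2) K(1,2)]
  define vals where "vals = (\<lambda>C. f (g \<otimes> rep_of C)) ` lcos G B (B \<inter> K)"
  have vals_fin: "finite vals" unfolding vals_def using LB(1) by simp
  have vals_sp: "vals \<subseteq> rep_space \<sigma>"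
    unfolding vals_def using V_D(1)[OF f] rep_of_in(1)[OF LB(2) B(1) LB(3)] g B(3) Nc by blast
  have vals: "f (g \<otimes> b) \<in> vals" if b: "b \<in> B" for b
  proof -
    have "right_inv G B (B \<inter> K) (\<lambda>u. f (g \<otimes> u))" unfolding right_inv_def
    proof (intro ballI)
      fix x l assume xl: "x \<in> B" "l \<in> B \<inter> K"
      then have "x \<in> carrier G" "l \<in> carrier G" using B(3) Nc by auto
      then show "f (g \<otimes> (x \<otimes> l)) = f (g \<otimes> x)" using K(3)[of l "g \<otimes> x"] xl g by (simp add: m_assoc)
    qed
    from rep_of_value[OF LB(2) subgroup.subset[OF B(1)] this b]
    have "f (g \<otimes> b) = f (g \<otimes> rep_of (b <# (B \<inter> K)))" by simp
    then show ?thesis unfolding vals_def lcos_def using b by blast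
  qed
  have "\<exists>S W. finite S \<and> S \<subseteq> ?St \<and> finite W \<and> W \<subseteq> rep_space \<sigma> \<and>
    (\<forall>A L. subgroup A G \<and> A \<subseteq> ?St \<and> S \<subseteq> A \<and> subgroup L G \<and> L \<subseteq> A \<and> finite (lcos G A L) \<and>
      (\<forall>l\<in>L. \<theta> l = 1) \<and> (\<forall>l\<in>L. \<forall>w\<in>W. rep_act ?\<tau> l w = w) \<longrightarrow> twisted_sum G ?\<tau> \<theta> A L w = 0)"
    if "w \<in> vals" for w
    using twisted_kernel_average[OF conj_linear_rep[OF g] St, where \<theta> = \<theta> and v = w] StN N_comm \<theta>_mult \<theta>_nz stalk vals_sp that
    by (simp add: subset_iff)
  then obtain S W where SW: "\<And>w. w \<in> vals \<Longrightarrow> finite (S w) \<and> S w \<subseteq> ?St \<and> finite (W w) \<and> W w \<subseteq> rep_space \<sigma>"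
    and kill: "\<And>w A L. w \<in> vals \<Longrightarrow> subgroup A G \<Longrightarrow> A \<subseteq> ?St \<Longrightarrow> S w \<subseteq> A \<Longrightarrow> subgroup L G \<Longrightarrow> L \<subseteq> A \<Longrightarrow> finite (lcos G A L) \<Longrightarrow>
      (\<forall>l\<in>L. \<theta> l = 1) \<Longrightarrow> (\<forall>l\<in>L. \<forall>w\<in>W w. rep_act ?\<tau> l w = w) \<Longrightarrow> twisted_sum G ?\<tau> \<theta> A L w = 0"
    by metis
  define S1 where "S1 = \<Union>(S ` vals)"
  define W1 where "W1 = \<Union>(W ` vals) \<union> vals"
  have S1: "finite S1" "S1 \<subseteq> ?St" and W1: "finite W1" "W1 \<subseteq> rep_space \<sigma>"
    unfolding S1_def W1_def using SW vals_fin vals_sp by auto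
  have "\<exists>J. subgroup J G \<and> openin T J \<and> J \<subseteq> K \<and> (\<forall>l\<in>J \<inter> ?St. \<forall>w\<in>W1. rep_act ?\<tau> l w = w)"
    using W1
  proof (induction rule: finite_induct)
    case empty then show ?case using K by blast
  next
    case (insert w W)
    then obtain J where J: "subgroup J G" "openin T J" "J \<subseteq> K" "\<forall>l\<in>J \<inter> ?St. \<forall>w\<in>W. rep_act ?\<tau> l w = w" by auto
    have "w \<in> rep_space \<sigma>" using insert by auto
    from \<sigma>_smooth[OF this]
    obtain J' where J': "subgroup J' G" "openin T J'" "\<forall>p\<in>H \<inter> J'. rep_act \<sigma> p w = w" by blast
    have ig: "inv g \<in> carrier G" using g by simp
    note J'' = open_conj[OF J'(2,1) ig]
    let ?J = "(\<lambda>k. inv g \<otimes> k \<otimes> inv (inv g)) ` J'"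
    have "rep_act ?\<tau> l w = w" if l: "l \<in> ?J" "l \<in> ?St" for l
    proof -
      obtain k where k: "k \<in> J'" "l = inv g \<otimes> k \<otimes> g" using l(1) g by auto
      have kc: "k \<in> carrier G" using k(1) subgroup.subset[OF J'(1)] by auto
      have "g \<otimes> l \<otimes> inv g = k" unfolding k(2) using g kc by (simp add: m_assoc inv_mult_cancel)
      moreover have "g \<otimes> l \<otimes> inv g \<in> H" using l(2) unfolding Stab_def by auto
      ultimately show ?thesis using J'(3) k(1) by auto
    qed
    then have "\<forall>l\<in>(J \<inter> ?J) \<inter> ?St. \<forall>w\<in>insert w W. rep_act ?\<tau> l w = w" using J(4) by blast
    moreover have "J \<inter> ?J \<subseteq> K" using J(3) by blast
    ultimately show ?case using subgroups_Inter_pair[OF J(1) J''(2)] openin_Int[OF J(2) J''(1)] by blast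
  qed
  then obtain J where J: "subgroup J G" "openin T J" "J \<subseteq> K" "\<forall>l\<in>J \<inter> ?St. \<forall>w\<in>W1. rep_act ?\<tau> l w = w" by blast
  have "avg A g = 0" if A: "subgroup A G" "compactin T A" "A \<subseteq> N" "B \<subseteq> A" "S1 \<subseteq> A" for A
  proof -
    note L = finite_index[OF A(1) subset_refl A(2) K(1,2)]
    define Z where "Z = ?St \<inter> A"
    have Z: "subgroup Z G" "Z \<subseteq> A" "Z \<subseteq> ?St" "Z \<subseteq> N" "S1 \<subseteq> Z"
      unfolding Z_def using subgroups_Inter_pair[OF St A(1)] StN S1(2) A(5) by auto
    note M = finite_index[OF Z(1,2) A(2) J(1,2)]
    have Zc: "Z \<subseteq> carrier G" using subgroup.subset[OF Z(1)] .
    let ?F = "\<lambda>x. rep_scale \<sigma> (inverse (\<theta> x)) (f (g \<otimes> x))"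
    have "(\<Sum>D\<in>lcos G Z (Z \<inter> J). coset_sum G A (A \<inter> K) ?F) = 0"
    proof (rule coset_sum_subgroup_zero[OF A(1) L(2,3,1) averaged_term_inv[OF f K(3) \<theta>K A(3) g] Z(1,2) M(2,3,1)])
      fix y assume y: "y \<in> A"
      have yN: "y \<in> N" "y \<in> carrier G" using y A(3) Nc by auto
      note rZ = rep_of_in(1)[OF M(2) Z(1) M(3)]
      show "coset_sum G Z (Z \<inter> J) (\<lambda>z. ?F (z \<otimes> y)) = 0"
      proof (cases "\<exists>z\<in>Z. f (g \<otimes> (z \<otimes> y)) \<noteq> 0")
        case False
        then show ?thesis unfolding coset_sum_finite[OF M(1)] using rZ by simp
      next
        case True
        then obtain z where z: "z \<in> Z" "f (g \<otimes> (z \<otimes> y)) \<noteq> 0" by blast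
        have zN: "z \<in> N" "z \<in> carrier G" "z \<in> A" using z(1) Z Nc by auto
        have "z \<otimes> y \<in> N" using subgroup.m_closed[OF N zN(1) yN(1)] .
        then obtain s b where sb: "s \<in> ?St" "b \<in> B" "z \<otimes> y = s \<otimes> b" using B(4) z(2) by blast
        have bc: "b \<in> A" "b \<in> N" "b \<in> carrier G" using sb(2) A(4) B(3) Nc by auto
        have sc': "s \<in> carrier G" using sb(1) StN Nc by auto
        have "(z \<otimes> y) \<otimes> inv b = s" unfolding sb(3) using sc' bc by (simp add: m_assoc)
        then have sA: "s \<in> A"
          using subgroup.m_closed[OF A(1) subgroup.m_closed[OF A(1) zN(3) y] subgroup.m_inv_closed[OF A(1) bc(1)]] by simp
        define s' where "s' = inv z \<otimes> s"
        have sZ: "s \<in> Z" using sb(1) sA unfolding Z_def by simp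
        have s': "s' \<in> Z" unfolding s'_def using subgroup.m_closed[OF Z(1) subgroup.m_inv_closed[OF Z(1) z(1)] sZ] .
        have s'c: "s' \<in> carrier G" "s' \<in> N" using s' Z Nc by auto
        have "y = inv z \<otimes> (z \<otimes> y)" using zN yN by (simp add: inv_mult_cancel)
        then have ye: "y = s' \<otimes> b" unfolding sb(3) s'_def using zN sc' bc by (simp add: m_assoc)
        let ?w = "f (g \<otimes> b)"
        have w: "?w \<in> vals" "?w \<in> rep_space \<sigma>" using vals[OF sb(2)] vals_sp by auto
        let ?Q = "\<lambda>x. rep_scale \<sigma> (inverse (\<theta> x)) (rep_act ?\<tau> x ?w)"
        have e: "?F (x \<otimes> y) = rep_scale \<sigma> (inverse (\<theta> b)) (?Q (s' \<otimes> x))" if x: "x \<in> Z" for x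
        proof -
          have xc: "x \<in> carrier G" "x \<in> N" using x Z Nc by auto
          have sx: "s' \<otimes> x \<in> Z" using subgroup.m_closed[OF Z(1) s' x] .
          then have sxc: "s' \<otimes> x \<in> carrier G" "s' \<otimes> x \<in> N" "s' \<otimes> x \<in> A"
            and gH: "g \<otimes> (s' \<otimes> x) \<otimes> inv g \<in> H" using Z Nc unfolding Stab_def by auto
          have xy: "x \<otimes> y = (s' \<otimes> x) \<otimes> b" unfolding ye using N_comm[OF xc(2) s'c(2)] xc s'c bc by (simp add: m_assoc[symmetric])
          have "g \<otimes> (x \<otimes> y) = (g \<otimes> (s' \<otimes> x) \<otimes> inv g) \<otimes> (g \<otimes> b)"
            unfolding xy using g sxc bc by (simp only: m_assoc inv_mult_cancel m_closed inv_closed)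
          then have "f (g \<otimes> (x \<otimes> y)) = rep_act ?\<tau> (s' \<otimes> x) ?w"
            using V_D(3)[OF f gH, of "g \<otimes> b"] g bc chi_compact[OF A(1) subset_refl A(2) sxc(3) g gH] by simp
          moreover have "\<theta> (x \<otimes> y) = \<theta> (s' \<otimes> x) * \<theta> b" unfolding xy using \<theta>_mult[OF sxc(2) bc(2)] .
          ultimately show ?thesis by (simp add: mult.commute)
        qed
        have Jw: "rep_act ?\<tau> l w' = w'" if "l \<in> Z \<inter> J" "w' \<in> W1" for l w' using J(4) that Z(3) by blast
        have th1: "\<forall>l\<in>Z \<inter> J. \<theta> l = 1" using \<theta>K J(3) Z(4) by blast
        have "twisted_sum G ?\<tau> \<theta> Z (Z \<inter> J) ?w = 0"
        proof (rule kill[OF w(1) Z(1,3) _ M(2,3,1) th1])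
          show "S ?w \<subseteq> Z" using Z(5) w(1) unfolding S1_def by blast
          show "\<forall>l\<in>Z \<inter> J. \<forall>w\<in>W ?w. rep_act ?\<tau> l w = w" using Jw w(1) unfolding W1_def by blast
        qed
        then have q0: "coset_sum G Z (Z \<inter> J) ?Q = 0" unfolding twisted_sum_def by simp
        have KZ: "right_inv G Z (Z \<inter> J) ?Q"
          unfolding right_inv_def
        proof (intro ballI)
          fix x l assume x: "x \<in> Z" and l: "l \<in> Z \<inter> J"
          have c: "x \<in> ?St" "l \<in> ?St" "x \<in> N" "l \<in> N" using x l Z(3,4) by auto
          have "rep_act ?\<tau> (x \<otimes> l) ?w = rep_act ?\<tau> x (rep_act ?\<tau> l ?w)"
            using linear_repD(8)[OF conj_linear_rep[OF g], of x l ?w] c w(2) by simp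
          moreover have "rep_act ?\<tau> l ?w = ?w" using Jw[OF l] w(1) unfolding W1_def by blast
          moreover have "\<theta> (x \<otimes> l) = \<theta> x" using \<theta>_mult[OF c(3,4)] th1 l by simp
          ultimately show "?Q (x \<otimes> l) = ?Q x" by simp
        qed
        have "coset_sum G Z (Z \<inter> J) (\<lambda>z. ?F (z \<otimes> y))
            = rep_scale \<sigma> (inverse (\<theta> b)) (coset_sum G Z (Z \<inter> J) (\<lambda>x. ?Q (s' \<otimes> x)))"
          unfolding coset_sum_finite[OF M(1)] sc.scale_sum_right
          using rZ e by (intro sum.cong refl) blast
        then show ?thesis using coset_sum_translate[OF Z(1) M(2,3) KZ s'] q0 by simp
      qed
    qed
    then have "rep_scale \<sigma> (of_nat (card (lcos G Z (Z \<inter> J)))) (avg A g) = 0"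
      unfolding avg_eval[OF A(1-3) g] by (simp add: sc.sum_constant_scale)
    then show "avg A g = 0" using M(1) lcos_nonempty[OF Z(1)] by simp
  qed
  then show ?thesis using S1 StN by blast
qed

end

end

section \<open>The absolute value of the ground field and bounded matrices\<close>

text \<open>The trivial absolute value makes a finite discrete field satisfy these axioms as well, so both
  kinds of ground field are treated alike.\<close>

locale abs_field =
  fixes v :: "'f::{field,topological_space} \<Rightarrow> real"
  assumes nonneg [simp]: "0 \<le> v x"
    and zero_iff [simp]: "v x = 0 \<longleftrightarrow> x = 0"
    and mult: "v (x * y) = v x * v y"
    and ultra: "v (x + y) \<le> max (v x) (v y)"
    and open_iff: "open U \<longleftrightarrow> (\<forall>x\<in>U. \<exists>e>0. \<forall>y. v (y - x) < e \<longrightarrow> y \<in> U)"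
    and compact_ball: "compact {x. v x \<le> R}"

text \<open>In the local case the closed balls are compact because local compactness gives one compact ball, and
  multiplication by powers of an element of absolute value greater than one gives the others.\<close>

lemma ex_abs_field:
  assumes "nonarch_local_field TYPE('f::{field,topological_space}) \<or> finite_discrete_field TYPE('f)"
  shows "\<exists>v :: 'f \<Rightarrow> real. abs_field v"
  using assms
proof
  assume "finite_discrete_field TYPE('f)"
  then have fin: "finite (UNIV :: 'f set)" and op: "\<And>U :: 'f set. open U" unfolding finite_discrete_field_def by auto
  define v where "v x = (if x = 0 then 0 else 1 :: real)" for x :: 'f
  have "abs_field v"
  proof
    show "open U \<longleftrightarrow> (\<forall>x\<in>U. \<exists>e>0. \<forall>y. v (y - x) < e \<longrightarrow> y \<in> U)" for U
    proof -
      have "\<forall>x\<in>U. \<exists>e>0. \<forall>y. v (y - x) < e \<longrightarrow> y \<in> U"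
        by (intro ballI exI[of _ 1]) (auto simp: v_def split: if_splits)
      then show ?thesis using op by simp
    qed
    show "compact {x. v x \<le> R}" for R
      by (intro finite_imp_compact finite_subset[OF subset_UNIV fin])
  qed (auto simp: v_def)
  then show ?thesis using exI[of abs_field v] by simp
next
  assume a: "nonarch_local_field TYPE('f)"
  then obtain v :: "'f \<Rightarrow> real" where v: "nonarch_abs v"
    and op: "\<And>U :: 'f set. open U \<longleftrightarrow> (\<forall>x\<in>U. \<exists>e>0. \<forall>y. v (y - x) < e \<longrightarrow> y \<in> U)"
    and lc: "locally_compact_space (euclidean :: 'f topology)"
    unfolding nonarch_local_field_def by blast
  have v0: "\<And>x. 0 \<le> v x" and vz: "\<And>x. v x = 0 \<longleftrightarrow> x = 0" and vm: "\<And>x y. v (x * y) = v x * v y"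
    and vu: "\<And>x y. v (x + y) \<le> max (v x) (v y)" and vn: "\<exists>x. x \<noteq> 0 \<and> v x \<noteq> 1"
    using v unfolding nonarch_abs_def by blast+
  have v1: "v 1 = 1" using vm[of 1 1] vz[of 1] by simp
  have "v (-1) * v (-1) = 1" using vm[of "-1" "-1"] v1 by simp
  then have vm1: "v (-1) = 1" using v0[of "-1"] by (metis abs_of_nonneg abs_square_eq_1 power2_eq_square)
  have vneg: "v (- x) = v x" for x using vm[of "-1" x] vm1 by simp
  have vd: "v (x - y) \<le> max (v x) (v y)" for x y using vu[of x "- y"] vneg by simp
  obtain U K :: "'f set" where UK: "open U" "compact K" "0 \<in> U" "U \<subseteq> K"
    using lc unfolding locally_compact_space_def by (auto dest: spec[of _ 0])
  obtain e where e: "e > 0" "\<And>y. v y < e \<Longrightarrow> y \<in> U" using op[of U] UK(1,3) by force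
  have cl: "closed {x. v x \<le> d}" if "d > 0" for d
    unfolding closed_def op
  proof (intro ballI exI[of _ d] conjI allI impI that)
    fix x y assume x: "x \<in> - {x. v x \<le> d}" and y: "v (y - x) < d"
    have "v x \<le> max (v y) (v (y - x))" using vd[of y "y - x"] by simp
    then show "y \<in> - {x. v x \<le> d}" using x y by auto
  qed
  have small: "compact {x. v x \<le> e / 2}"
  proof -
    have "{x. v x \<le> e / 2} \<subseteq> K" using e UK(4) by fastforce
    then have "{x. v x \<le> e / 2} = K \<inter> {x. v x \<le> e / 2}" by auto
    then show ?thesis using compact_Int_closed[OF UK(2) cl[of "e / 2"]] e(1) by simp
  qed
  obtain t where t: "v t > 1"
  proof -
    obtain x where x: "x \<noteq> 0" "v x \<noteq> 1" using vn by blast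
    have p: "0 < v x" using x(1) v0[of x] vz[of x] by linarith
    have "v x * v (inverse x) = 1" using vm[of x "inverse x"] x(1) v1 by simp
    then have "v (inverse x) = 1 / v x" using p by (simp add: field_simps)
    moreover have "1 < 1 / v x" if "\<not> v x > 1" using that x(2) p by (simp add: less_divide_eq)
    ultimately have "v x > 1 \<or> v (inverse x) > 1" by auto
    then show ?thesis using that by blast
  qed
  have "abs_field v"
  proof
    fix R
    obtain n where n: "R / (e / 2) < v t ^ n" using real_arch_pow[OF t] by blast
    have vp: "v (t ^ n) = v t ^ n" by (induction n) (simp_all add: v1 vm)
    have tn: "t ^ n \<noteq> 0" using t vz[of t] by auto
    have tp: "v (t ^ n) > 0" using tn v0[of "t ^ n"] vz[of "t ^ n"] by linarith
    have cont: "continuous_on UNIV (\<lambda>x. t ^ n * x)"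
      unfolding continuous_on_open_vimage[OF open_UNIV]
    proof (intro allI impI)
      fix B :: "'f set" assume B: "open B"
      show "open ((\<lambda>x. t ^ n * x) -` B \<inter> UNIV)" unfolding op
      proof
        fix x assume "x \<in> (\<lambda>x. t ^ n * x) -` B \<inter> UNIV"
        then obtain d where d: "d > 0" "\<And>y. v (y - t ^ n * x) < d \<Longrightarrow> y \<in> B" using B unfolding op by auto
        show "\<exists>e>0. \<forall>y. v (y - x) < e \<longrightarrow> y \<in> (\<lambda>x. t ^ n * x) -` B \<inter> UNIV"
        proof (intro exI[of _ "d / v (t ^ n)"] conjI allI impI)
          fix y assume "v (y - x) < d / v (t ^ n)"
          then have "v (t ^ n) * v (y - x) < d" using tp by (simp add: less_divide_eq mult.commute)
          then have "v (t ^ n * (y - x)) < d" by (simp only: vm)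
          then show "y \<in> (\<lambda>x. t ^ n * x) -` B \<inter> UNIV" using d(2) by (simp add: right_diff_distrib)
        qed (use d(1) tp in simp)
      qed
    qed
    have cimg: "compact ((\<lambda>x. t ^ n * x) ` {x. v x \<le> e / 2})"
      using compact_continuous_image[OF continuous_on_subset[OF cont] small] by simp
    have "{x. v x \<le> R} \<subseteq> (\<lambda>x. t ^ n * x) ` {x. v x \<le> e / 2}"
    proof
      fix x assume x: "x \<in> {x. v x \<le> R}"
      let ?y = "x / t ^ n"
      have xy: "x = t ^ n * ?y" using tn by simp
      then have "v x = v (t ^ n) * v ?y" using vm by metis
      moreover have "v x \<le> v (t ^ n) * (e / 2)" using x n e(1) vp by (simp add: field_simps)
      ultimately have "v ?y \<le> e / 2" using tp by simp
      then show "x \<in> (\<lambda>x. t ^ n * x) ` {x. v x \<le> e / 2}" using xy by blast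
    qed
    then have "compact {x. v x \<le> R}" if "R > 0"
      using compact_Int_closed[OF cimg cl[OF that]] by (metis inf.absorb_iff2)
    moreover have "compact {x. v x \<le> R}" if "\<not> R > 0"
    proof -
      have "{x. v x \<le> R} \<subseteq> {0}"
      proof
        fix x assume "x \<in> {x. v x \<le> R}"
        then have "v x = 0" using that v0[of x] by simp
        then show "x \<in> {0}" using vz by simp
      qed
      then show ?thesis using finite_subset[of _ "{0 :: 'f}"] by (intro finite_imp_compact) simp
    qed
    ultimately show "compact {x. v x \<le> R}" by blast
  qed (use v0 vz vm vu op in auto)
  then show ?thesis using exI[of abs_field v] by simp
qed

context abs_field
begin

lemma one [simp]: "v 1 = 1"
  using mult[of 1 1] zero_iff[of 1] by simp

lemma neg_one [simp]: "v (-1) = 1"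
proof -
  have "v (-1) * v (-1) = 1" using mult[of "-1" "-1"] by simp
  then show ?thesis using nonneg[of "-1"] by (metis abs_of_nonneg abs_square_eq_1 power2_eq_square)
qed

lemma neg [simp]: "v (- x) = v x" using mult[of "-1" x] by simp

lemma zero [simp]: "v 0 = 0" by simp

lemma diff_le: "v (x - y) \<le> max (v x) (v y)" using ultra[of x "- y"] by simp

lemma add_bound: "v x \<le> R \<Longrightarrow> v y \<le> R \<Longrightarrow> v (x + y) \<le> R"
  using ultra[of x y] by simp

lemma pos: "x \<noteq> 0 \<Longrightarrow> 0 < v x"
  using nonneg[of x] zero_iff[of x] by linarith

lemma inverse_eq: "x \<noteq> 0 \<Longrightarrow> v (inverse x) = 1 / v x"
  using mult[of x "inverse x"] pos[of x] by (simp add: field_simps)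

lemma sum_bound: "0 \<le> R \<Longrightarrow> (\<And>i. i \<in> I \<Longrightarrow> v (F i) \<le> R) \<Longrightarrow> v (sum F I) \<le> R"
  by (induction I rule: infinite_finite_induct) (auto intro: add_bound)

lemma prod_eq: "v (prod F I) = (\<Prod>i\<in>I. v (F i))"
  by (induction I rule: infinite_finite_induct) (auto simp: mult)

lemma unit_near_one:
  assumes "v (x - 1) \<le> e" "e < 1" shows "v x = 1"
proof -
  have "v x \<le> max (v (x - 1)) (v 1)" using ultra[of "x - 1" 1] by simp
  moreover have "v 1 \<le> max (v x) (v (x - 1))" using diff_le[of x "x - 1"] by simp
  ultimately show ?thesis using assms by simp
qed

text \<open>A quantitative form of the continuity of products, which yields that of the determinant.\<close>

lemma prod_diff_bound:
  assumes "finite I" "1 \<le> B" "0 \<le> \<eta>" "\<And>i. i \<in> I \<Longrightarrow> v (F i) \<le> B" "\<And>i. i \<in> I \<Longrightarrow> v (F' i) \<le> B"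
    "\<And>i. i \<in> I \<Longrightarrow> v (F i - F' i) \<le> \<eta>"
  shows "v (prod F I) \<le> B ^ card I \<and> v (prod F' I) \<le> B ^ card I \<and> v (prod F I - prod F' I) \<le> \<eta> * B ^ card I"
  using assms(1,4-)
proof (induction rule: finite_induct)
  case empty then show ?case using assms(3) by simp
next
  case (insert i I)
  have IH: "v (prod F I) \<le> B ^ card I" "v (prod F' I) \<le> B ^ card I" "v (prod F I - prod F' I) \<le> \<eta> * B ^ card I"
    using insert by auto
  have B: "0 \<le> B" "0 \<le> B ^ card I" using assms(2) by auto
  have i: "v (F i) \<le> B" "v (F' i) \<le> B" "v (F i - F' i) \<le> \<eta>" using insert by auto
  have 1: "v (F i * prod F I) \<le> B * B ^ card I" "v (F' i * prod F' I) \<le> B * B ^ card I"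
    unfolding mult using i IH B by (auto intro!: mult_mono)
  have e: "F i * prod F I - F' i * prod F' I = F i * (prod F I - prod F' I) + (F i - F' i) * prod F' I"
    by (simp add: algebra_simps)
  have "v (F i * (prod F I - prod F' I)) \<le> B * (\<eta> * B ^ card I)" unfolding mult using i IH B by (intro mult_mono) auto
  moreover have "v ((F i - F' i) * prod F' I) \<le> \<eta> * B ^ card I"
    unfolding mult using i IH assms(3) by (intro mult_mono) auto
  moreover have "\<eta> * B ^ card I \<le> B * (\<eta> * B ^ card I)"
    using mult_right_mono[OF assms(2), of "\<eta> * B ^ card I"] assms(3) B by simp
  ultimately have 2: "v (F i * prod F I - F' i * prod F' I) \<le> B * (\<eta> * B ^ card I)"
    unfolding e by (intro add_bound) auto
  show ?case using 1 2 insert(1,2) by (simp add: mult_ac)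
qed

definition entries_le :: "real \<Rightarrow> 'f mat \<Rightarrow> bool" where
  "entries_le R A \<longleftrightarrow> (\<forall>i<dim_row A. \<forall>j<dim_col A. v (A $$ (i, j)) \<le> R)"

lemma entries_leD: "entries_le R A \<Longrightarrow> A \<in> carrier_mat m n \<Longrightarrow> i < m \<Longrightarrow> j < n \<Longrightarrow> v (A $$ (i, j)) \<le> R"
  unfolding entries_le_def by auto

lemma entries_leI: "A \<in> carrier_mat m n \<Longrightarrow> (\<And>i j. i < m \<Longrightarrow> j < n \<Longrightarrow> v (A $$ (i, j)) \<le> R) \<Longrightarrow> entries_le R A"
  unfolding entries_le_def by auto

lemma entries_le_mono: "entries_le R A \<Longrightarrow> R \<le> S \<Longrightarrow> entries_le S A"
  unfolding entries_le_def by fastforce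

lemma entries_le_one: "entries_le 1 (1\<^sub>m n)" unfolding entries_le_def by auto

lemma entries_le_add: "entries_le R A \<Longrightarrow> entries_le R B \<Longrightarrow> A \<in> carrier_mat m n \<Longrightarrow> B \<in> carrier_mat m n \<Longrightarrow> entries_le R (A + B)"
  by (rule entries_leI[of _ m n]) (auto intro: add_bound entries_leD)

lemma entries_le_uminus: "entries_le R A \<Longrightarrow> entries_le R (- A)"
  unfolding entries_le_def by auto

end

lemma mult_entry:
  assumes "A \<in> carrier_mat m k" "B \<in> carrier_mat k n" "i < m" "j < n"
  shows "(A * B) $$ (i, j) = (\<Sum>t<k. A $$ (i, t) * B $$ (t, j))"
  using assms by (auto simp: scalar_prod_def atLeast0LessThan intro!: sum.cong)

context abs_field
begin

lemma entries_le_mult: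
  assumes "entries_le R A" "entries_le S B" "A \<in> carrier_mat m k" "B \<in> carrier_mat k n" "0 \<le> R" "0 \<le> S"
  shows "entries_le (R * S) (A * B)"
proof (rule entries_leI)
  show "A * B \<in> carrier_mat m n" using assms by simp
  fix i j assume ij: "i < m" "j < n"
  show "v ((A * B) $$ (i, j)) \<le> R * S"
    unfolding mult_entry[OF assms(3,4) ij]
    using assms ij by (intro sum_bound) (auto simp: mult intro!: mult_mono entries_leD)
qed

lemma entries_le_integral_mult:
  assumes "entries_le 1 A" "entries_le 1 B" "A \<in> carrier_mat m k" "B \<in> carrier_mat k n"
  shows "entries_le 1 (A * B)"
  using entries_le_mult[OF assms] by simp

lemma ex_entries_le: "\<exists>R\<ge>1. entries_le R A"
proof (intro exI conjI)
  let ?R = "1 + (\<Sum>i<dim_row A. \<Sum>j<dim_col A. v (A $$ (i, j)))"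
  show "1 \<le> ?R" by (simp add: sum_nonneg)
  show "entries_le ?R A" unfolding entries_le_def
  proof (intro allI impI)
    fix i j assume "i < dim_row A" "j < dim_col A"
    then have "v (A $$ (i, j)) \<le> (\<Sum>j<dim_col A. v (A $$ (i, j)))" "(\<Sum>j<dim_col A. v (A $$ (i, j))) \<le> (\<Sum>i<dim_row A. \<Sum>j<dim_col A. v (A $$ (i, j)))"
      by (auto intro!: member_le_sum sum_nonneg)
    then show "v (A $$ (i, j)) \<le> ?R" by simp
  qed
qed

lemma sign_abs: "v (of_int (sign p)) = 1"
  by (simp add: sign_def)

lemma det_diff_bound:
  assumes "A \<in> carrier_mat n n" "B \<in> carrier_mat n n" "entries_le C A" "entries_le C B" "1 \<le> C" "entries_le \<eta> (A - B)" "0 \<le> \<eta>"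
  shows "v (det A - det B) \<le> \<eta> * C ^ n"
proof -
  have "v (\<Sum>p\<in>{p. p permutes {0..<n}}. of_int (sign p) * ((\<Prod>i = 0..<n. A $$ (i, p i)) - (\<Prod>i = 0..<n. B $$ (i, p i))))
      \<le> \<eta> * C ^ n"
  proof (rule sum_bound)
    show "0 \<le> \<eta> * C ^ n" using assms by simp
    fix p assume "p \<in> {p. p permutes {0..<n}}"
    then have p: "p i < n" if "i < n" for i using permutes_in_image[of p "{0..<n}" i] that by auto
    have d: "v (A $$ (i, p i) - B $$ (i, p i)) \<le> \<eta>" if "i < n" for i
      using entries_leD[OF assms(6) minus_carrier_mat[OF assms(2)], of i "p i"] p[OF that] that assms(1,2) by auto
    have "v ((\<Prod>i = 0..<n. A $$ (i, p i)) - (\<Prod>i = 0..<n. B $$ (i, p i))) \<le> \<eta> * C ^ card {0..<n}"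
      using prod_diff_bound[of "{0..<n}" C \<eta> "\<lambda>i. A $$ (i, p i)" "\<lambda>i. B $$ (i, p i)"] assms p d
      by (auto intro: entries_leD)
    then show "v (of_int (sign p) * ((\<Prod>i = 0..<n. A $$ (i, p i)) - (\<Prod>i = 0..<n. B $$ (i, p i)))) \<le> \<eta> * C ^ n"
      by (simp add: mult sign_abs)
  qed
  then show ?thesis unfolding det_def'[OF assms(1)] det_def'[OF assms(2)]
    by (simp add: sum_subtractf right_diff_distrib)
qed

lemma det_bound:
  assumes "A \<in> carrier_mat n n" "entries_le 1 A" shows "v (det A) \<le> 1"
  unfolding det_def'[OF assms(1)]
proof (rule sum_bound)
  fix p assume "p \<in> {p. p permutes {0..<n}}"
  then have p: "p i < n" if "i < n" for i using permutes_in_image[of p "{0..<n}" i] that by auto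
  have "(\<Prod>i = 0..<n. v (A $$ (i, p i))) \<le> (\<Prod>i = 0..<n. 1)"
    using assms p by (intro prod_mono) (auto intro: entries_leD)
  then show "v (of_int (sign p) * (\<Prod>i = 0..<n. A $$ (i, p i))) \<le> 1"
    by (simp add: mult sign_abs prod_eq)
qed simp

text \<open>\<open>GL\<^sub>n\<close> of the ring of integers.\<close>

definition GLO :: "nat \<Rightarrow> 'f mat set" where
  "GLO n = {A \<in> carrier_mat n n. entries_le 1 A \<and> v (det A) = 1}"

lemma GLO_inverse:
  assumes "A \<in> GLO n"
  shows "\<exists>B\<in>GLO n. A * B = 1\<^sub>m n \<and> B * A = 1\<^sub>m n"
proof -
  have A: "A \<in> carrier_mat n n" "entries_le 1 A" "v (det A) = 1" using assms unfolding GLO_def by auto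
  have d0: "det A \<noteq> 0" using A(3) by auto
  note adj = adj_mat[OF A(1)]
  let ?B = "inverse (det A) \<cdot>\<^sub>m adj_mat A"
  have B: "?B \<in> carrier_mat n n" using adj by simp
  have AB: "A * ?B = 1\<^sub>m n" using mult_smult_distrib[OF A(1) adj(1)] adj(2) d0 by (simp, intro eq_matI) auto
  have BA: "?B * A = 1\<^sub>m n" using mult_smult_assoc_mat[OF adj(1) A(1)] adj(3) d0 by (simp, intro eq_matI) auto
  have "entries_le 1 ?B"
  proof (rule entries_leI[OF B])
    fix i j assume ij: "i < n" "j < n"
    have e: "?B $$ (i, j) = inverse (det A) * ((-1) ^ (j + i) * det (mat_delete A j i))"
      using ij A(1) adj(1) unfolding adj_mat_def cofactor_def by auto
    have dc: "mat_delete A j i \<in> carrier_mat (n - 1) (n - 1)" using mat_delete_carrier[OF A(1)] .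
    have "entries_le 1 (mat_delete A j i)"
      using A(1,2) ij unfolding entries_le_def mat_delete_def by auto
    then have "v (det (mat_delete A j i)) \<le> 1" using det_bound[OF dc] by simp
    moreover have "v ((-1) ^ (j + i)) = 1" using prod_eq[of "\<lambda>_. -1" "{..<j + i}"] by simp
    ultimately show "v (?B $$ (i, j)) \<le> 1" unfolding e using inverse_eq[OF d0] A(3) by (simp add: mult)
  qed
  moreover have "v (det ?B) = 1"
  proof -
    have "v (det A) * v (det ?B) = 1" using det_mult[OF A(1) B] AB mult[of "det A" "det ?B"] by simp
    then show ?thesis using A(3) by simp
  qed
  ultimately show ?thesis using B AB BA unfolding GLO_def by blast
qed

lemma GLO_mult: "A \<in> GLO n \<Longrightarrow> B \<in> GLO n \<Longrightarrow> A * B \<in> GLO n"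
  unfolding GLO_def by (auto intro: entries_le_integral_mult simp: det_mult mult)

lemma GLO_one: "1\<^sub>m n \<in> GLO n"
  unfolding GLO_def using entries_le_one by simp

lemma GLO_I:
  assumes "A \<in> carrier_mat n n" "B \<in> carrier_mat n n" "entries_le 1 A" "entries_le 1 B" "A * B = 1\<^sub>m n"
  shows "A \<in> GLO n"
proof -
  have "v (det A) * v (det B) = 1" using det_mult[OF assms(1,2)] assms(5) mult[of "det A" "det B"] by simp
  moreover have "v (det A) \<le> 1" "v (det B) \<le> 1" using det_bound assms by auto
  ultimately have "v (det A) = 1" by (metis antisym mult.commute mult_left_le nonneg)
  then show ?thesis using assms unfolding GLO_def by simp
qed

text \<open>The principal congruence neighbourhood of the identity.\<close>

definition Congr :: "real \<Rightarrow> nat \<Rightarrow> 'f mat set" where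
  "Congr e n = {A \<in> carrier_mat n n. entries_le e (A - 1\<^sub>m n)}"

lemma Congr_GLO:
  assumes "0 \<le> e" "e < 1" shows "Congr e n \<subseteq> GLO n"
proof
  fix A assume "A \<in> Congr e n"
  then have A: "A \<in> carrier_mat n n" "entries_le e (A - 1\<^sub>m n)" unfolding Congr_def by auto
  have m: "entries_le 1 ((A - 1\<^sub>m n) + 1\<^sub>m n)"
    using A entries_le_mono[OF A(2)] assms(2) by (intro entries_le_add[of _ _ _ n n] entries_le_one) auto
  have "(A - 1\<^sub>m n) + 1\<^sub>m n = A" using A(1) by (intro eq_matI) auto
  then have 1: "entries_le 1 A" using m by simp
  have "v (det A - det (1\<^sub>m n)) \<le> e * 1 ^ n"
    using A 1 assms entries_le_one by (intro det_diff_bound) auto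
  then have "v (det A) = 1" using unit_near_one[of "det A" e] assms(2) by simp
  then show "A \<in> GLO n" unfolding GLO_def using A 1 by simp
qed

lemma Congr_one: "0 \<le> e \<Longrightarrow> 1\<^sub>m n \<in> Congr e n"
  unfolding Congr_def entries_le_def by auto

lemma Congr_mult:
  assumes "0 \<le> e" "e < 1" "A \<in> Congr e n" "B \<in> Congr e n"
  shows "A * B \<in> Congr e n"
proof -
  have A: "A \<in> carrier_mat n n" "entries_le e (A - 1\<^sub>m n)" and B: "B \<in> carrier_mat n n" "entries_le e (B - 1\<^sub>m n)"
    using assms unfolding Congr_def by auto
  have B1: "entries_le 1 B" using Congr_GLO[OF assms(1,2)] assms(4) unfolding GLO_def by auto
  have "A * B - 1\<^sub>m n = (A - 1\<^sub>m n) * B + (B - 1\<^sub>m n)"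
    using A(1) B(1) by (simp add: minus_mult_distrib_mat[of _ n n]) (intro eq_matI; simp)
  moreover have "entries_le (e * 1) ((A - 1\<^sub>m n) * B)" using entries_le_mult[OF A(2) B1 minus_carrier_mat[OF one_carrier_mat]] assms(1) A(1) B(1) by simp
  ultimately have "entries_le e (A * B - 1\<^sub>m n)" 
    using entries_le_add[of e "(A - 1\<^sub>m n) * B" "B - 1\<^sub>m n" n n] A B
    by (simp add: minus_carrier_mat mult_carrier_mat[OF minus_carrier_mat[OF one_carrier_mat] B(1)])
  then show ?thesis unfolding Congr_def using A B by simp
qed

lemma Congr_inverse:
  assumes "0 \<le> e" "e < 1" "A \<in> Congr e n" "B \<in> carrier_mat n n" "A * B = 1\<^sub>m n"
  shows "B \<in> Congr e n"
proof -
  have A: "A \<in> carrier_mat n n" "entries_le e (A - 1\<^sub>m n)" "A \<in> GLO n"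
    using assms Congr_GLO[OF assms(1,2)] unfolding Congr_def by auto
  obtain B' where B': "B' \<in> GLO n" "B' * A = 1\<^sub>m n" using GLO_inverse[OF A(3)] by blast
  have B'c: "B' \<in> carrier_mat n n" "entries_le 1 B'" using B' unfolding GLO_def by auto
  have "B' = B' * (A * B)" using assms(5) B'c by simp
  also have "\<dots> = B" using B' B'c A(1) assms(4) by (simp add: assoc_mult_mat[symmetric, of _ n n _ n _ n])
  finally have BB: "B' = B" .
  have "B - 1\<^sub>m n = - ((A - 1\<^sub>m n) * B)"
    using A(1) assms(4,5) by (simp add: minus_mult_distrib_mat[of _ n n]) (intro eq_matI; simp)
  moreover have "entries_le (e * 1) ((A - 1\<^sub>m n) * B)"
    using entries_le_mult[OF A(2) _ minus_carrier_mat[OF one_carrier_mat], of 1 B n] B'c(2) BB assms(1,4) A(1) by simp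
  ultimately show ?thesis unfolding Congr_def using entries_le_uminus assms(4) by simp
qed

lemma Congr_conj:
  assumes "0 \<le> e" "k \<in> Congr e n" "A \<in> GLO n" "B \<in> GLO n" "A * B = 1\<^sub>m n"
  shows "A * k * B \<in> Congr e n"
proof -
  have A: "A \<in> carrier_mat n n" "entries_le 1 A" and B: "B \<in> carrier_mat n n" "entries_le 1 B"
    and k: "k \<in> carrier_mat n n" "entries_le e (k - 1\<^sub>m n)"
    using assms unfolding GLO_def Congr_def by auto
  have "A * k * B - 1\<^sub>m n = A * (k - 1\<^sub>m n) * B"
    using A B k assms(5) by (simp add: mult_minus_distrib_mat[of _ n n] minus_mult_distrib_mat[of _ n n])
  moreover have "entries_le (1 * e) (A * (k - 1\<^sub>m n))" using entries_le_mult[OF A(2) k(2) A(1) minus_carrier_mat[OF one_carrier_mat]] assms(1) by simp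
  then have "entries_le (1 * e * 1) (A * (k - 1\<^sub>m n) * B)" 
    using entries_le_mult[OF _ B(2) mult_carrier_mat[OF A(1) minus_carrier_mat[OF one_carrier_mat]] B(1), of "1 * e" k] assms(1) by simp
  ultimately show ?thesis unfolding Congr_def using A B k by simp
qed

end

section \<open>The general linear group as an l-group\<close>

lemma GL_carrier: "A \<in> carrier (GL m) \<longleftrightarrow> A \<in> carrier_mat m m \<and> det A \<noteq> (0 :: 'f::field)"
proof
  assume "A \<in> carrier (GL m)"
  then have u: "A \<in> Units (ring_mat TYPE('f) m ())" unfolding units_of_def by simp
  then show "A \<in> carrier_mat m m \<and> det A \<noteq> 0"
    using unit_imp_det_non_zero[OF u] unfolding Units_def ring_mat_def by simp
next
  assume "A \<in> carrier_mat m m \<and> det A \<noteq> 0"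
  then show "A \<in> carrier (GL m)" using det_non_zero_imp_unit[of A m "()"] unfolding units_of_def by simp
qed

lemma GL_simps [simp]: "x \<otimes>\<^bsub>GL m\<^esub> y = x * y" "\<one>\<^bsub>GL m\<^esub> = 1\<^sub>m m"
  unfolding units_of_def ring_mat_def by simp_all

lemma GL_group: "group (GL m :: 'f::field mat monoid)"
proof -
  interpret ring "ring_mat TYPE('f) m ()" by (rule ring_mat)
  show ?thesis by (rule units_group)
qed

lemma GL_mat: "A \<in> carrier (GL m) \<Longrightarrow> A \<in> carrier_mat m m" by (simp add: GL_carrier)

lemma GL_I:
  fixes A :: "'f::field mat"
  assumes "A \<in> carrier_mat m m" "B \<in> carrier_mat m m" "A * B = 1\<^sub>m m"
  shows "A \<in> carrier (GL m)" "inv\<^bsub>GL m\<^esub> A = B"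
proof -
  have "det A * det B = 1" using det_mult[OF assms(1,2)] assms(3) by simp
  then have d: "det A \<noteq> 0" "det B \<noteq> 0" by auto
  then show A: "A \<in> carrier (GL m)" using assms by (simp add: GL_carrier)
  interpret group "GL m :: 'f mat monoid" by (rule GL_group)
  have "B \<in> carrier (GL m)" using d assms by (simp add: GL_carrier)
  then show "inv\<^bsub>GL m\<^esub> A = B"
    using mat_mult_left_right_inverse[OF assms] A by (intro inv_equality) auto
qed

lemma GL_inv:
  fixes A :: "'f::field mat"
  assumes "A \<in> carrier (GL m)"
  shows "inv\<^bsub>GL m\<^esub> A \<in> carrier_mat m m" "A * inv\<^bsub>GL m\<^esub> A = 1\<^sub>m m" "inv\<^bsub>GL m\<^esub> A * A = 1\<^sub>m m"
    "inv\<^bsub>GL m\<^esub> A \<in> carrier (GL m)"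
proof -
  interpret group "GL m :: 'f mat monoid" by (rule GL_group)
  show "inv\<^bsub>GL m\<^esub> A \<in> carrier (GL m)" using assms by simp
  then show "inv\<^bsub>GL m\<^esub> A \<in> carrier_mat m m" by (rule GL_mat)
  show "A * inv\<^bsub>GL m\<^esub> A = 1\<^sub>m m" "inv\<^bsub>GL m\<^esub> A * A = 1\<^sub>m m"
    using r_inv[OF assms] l_inv[OF assms] by auto
qed

context abs_field
begin

lemma GLO_GL: "GLO m \<subseteq> carrier (GL m)"
  unfolding GLO_def using zero by (force simp: GL_carrier)

definition entries :: "nat \<Rightarrow> 'f mat \<Rightarrow> nat \<times> nat \<Rightarrow> 'f" where
  "entries m = (\<lambda>A. restrict (\<lambda>ij. A $$ ij) ({..<m} \<times> {..<m}))"

lemma GL_topology_eq: "GL_topology m = pullback_topology (carrier (GL m)) (entries m)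
     (product_topology (\<lambda>_. euclidean) ({..<m} \<times> {..<m}))"
  unfolding GL_topology_def entries_def ..

lemma open_ball: "open {y. v (y - x) < e}"
  unfolding open_iff
proof
  fix y assume y: "y \<in> {y. v (y - x) < e}"
  show "\<exists>e'>0. \<forall>z. v (z - y) < e' \<longrightarrow> z \<in> {y. v (y - x) < e}"
  proof (intro exI[of _ e] conjI allI impI)
    show "0 < e" using le_less_trans[OF nonneg[of "y - x"], of e] y by simp
    fix z assume "v (z - y) < e"
    then show "z \<in> {y. v (y - x) < e}" using ultra[of "z - y" "y - x"] y by auto
  qed
qed

lemma GL_topology_open:
  "openin (GL_topology m) U \<longleftrightarrow> U \<subseteq> carrier (GL m) \<and>
    (\<forall>g\<in>U. \<exists>e>0. \<forall>h\<in>carrier (GL m). entries_le e (h - g) \<longrightarrow> h \<in> U)"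
proof
  assume "openin (GL_topology m) U"
  then obtain W where W: "openin (product_topology (\<lambda>_. euclidean) ({..<m} \<times> {..<m})) W"
    and U: "U = entries m -` W \<inter> carrier (GL m)"
    unfolding GL_topology_eq openin_pullback_topology by blast
  have "\<exists>e>0. \<forall>h\<in>carrier (GL m). entries_le e (h - g) \<longrightarrow> h \<in> U" if g: "g \<in> U" for g
  proof -
    have "entries m g \<in> W" using g U by auto
    then obtain X where X: "\<And>i. i \<in> {..<m} \<times> {..<m} \<Longrightarrow> open (X i)" "entries m g \<in> Pi\<^sub>E ({..<m} \<times> {..<m}) X"
      "Pi\<^sub>E ({..<m} \<times> {..<m}) X \<subseteq> W"
      using W unfolding openin_product_topology_alt by (metis (no_types, lifting) open_openin)
    have "\<exists>e>0. \<forall>y. v (y - g $$ ij) < e \<longrightarrow> y \<in> X ij" if ij: "ij \<in> {..<m} \<times> {..<m}" for ij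
    proof -
      have "g $$ ij \<in> X ij" using X(2) ij unfolding entries_def by (auto simp: PiE_iff)
      then show ?thesis using X(1)[OF ij] unfolding open_iff by blast
    qed
    then obtain e where e: "\<And>ij. ij \<in> {..<m} \<times> {..<m} \<Longrightarrow> 0 < e ij"
      "\<And>ij y. ij \<in> {..<m} \<times> {..<m} \<Longrightarrow> v (y - g $$ ij) < e ij \<Longrightarrow> y \<in> X ij" by metis
    define d where "d = Min (insert 1 (e ` ({..<m} \<times> {..<m}))) / 2"
    have dpos: "0 < d" unfolding d_def using e(1) by (auto simp: Min_gr_iff)
    have dle: "d < e ij" if "ij \<in> {..<m} \<times> {..<m}" for ij
    proof -
      have "Min (insert 1 (e ` ({..<m} \<times> {..<m}))) \<le> e ij" using that by (intro Min_le) auto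
      then show ?thesis using e(1)[OF that] dpos unfolding d_def by linarith
    qed
    have "h \<in> U" if h: "h \<in> carrier (GL m)" "entries_le d (h - g)" for h
    proof -
      have c: "h \<in> carrier_mat m m" "g \<in> carrier_mat m m" using h g U GL_mat by auto
      have "entries m h \<in> Pi\<^sub>E ({..<m} \<times> {..<m}) X"
      proof (rule PiE_I)
        fix ij assume ij: "ij \<in> {..<m} \<times> {..<m}"
        then obtain i j where e': "ij = (i, j)" "i < m" "j < m" by auto
        have "v (h $$ ij - g $$ ij) \<le> d" using entries_leD[OF h(2) minus_carrier_mat[OF c(2)], of i j] c e' by simp
        then show "entries m h ij \<in> X ij" using e(2)[OF ij] dle[OF ij] ij unfolding entries_def by simp
      qed (auto simp: entries_def)
      then show ?thesis using X(3) U h(1) by auto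
    qed
    then show ?thesis using dpos by blast
  qed
  then show "U \<subseteq> carrier (GL m) \<and> (\<forall>g\<in>U. \<exists>e>0. \<forall>h\<in>carrier (GL m). entries_le e (h - g) \<longrightarrow> h \<in> U)"
    using U by auto
next
  assume a: "U \<subseteq> carrier (GL m) \<and> (\<forall>g\<in>U. \<exists>e>0. \<forall>h\<in>carrier (GL m). entries_le e (h - g) \<longrightarrow> h \<in> U)"
  then obtain e where e: "\<And>g. g \<in> U \<Longrightarrow> 0 < e g"
    "\<And>g h. g \<in> U \<Longrightarrow> h \<in> carrier (GL m) \<Longrightarrow> entries_le (e g) (h - g) \<Longrightarrow> h \<in> U" by metis
  define B where "B g = Pi\<^sub>E ({..<m} \<times> {..<m}) (\<lambda>ij. {y. v (y - g $$ ij) < e g})" for g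
  have B: "openin (product_topology (\<lambda>_. euclidean) ({..<m} \<times> {..<m})) (B g)" for g
    unfolding B_def by (subst openin_PiE) (auto simp: open_ball open_openin[symmetric])
  have "U = entries m -` (\<Union>g\<in>U. B g) \<inter> carrier (GL m)"
  proof (intro equalityI subsetI)
    fix g assume g: "g \<in> U"
    have "entries m g \<in> B g" unfolding B_def entries_def using e(1)[OF g] by auto
    then show "g \<in> entries m -` (\<Union>g\<in>U. B g) \<inter> carrier (GL m)" using g a by auto
  next
    fix h assume "h \<in> entries m -` (\<Union>g\<in>U. B g) \<inter> carrier (GL m)"
    then obtain g where g: "g \<in> U" "entries m h \<in> B g" "h \<in> carrier (GL m)" by auto
    have c: "h \<in> carrier_mat m m" "g \<in> carrier_mat m m" using g a GL_mat by auto
    have "entries_le (e g) (h - g)"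
    proof (rule entries_leI[OF minus_carrier_mat[OF c(2)]])
      fix i j assume ij: "i < m" "j < m"
      then have "entries m h (i, j) \<in> {y. v (y - g $$ (i, j)) < e g}" using g(2) unfolding B_def by (auto simp: PiE_iff)
      then show "v ((h - g) $$ (i, j)) \<le> e g" using ij c unfolding entries_def by simp
    qed
    then show "h \<in> U" using e(2)[OF g(1,3)] by simp
  qed
  moreover have "openin (product_topology (\<lambda>_. euclidean) ({..<m} \<times> {..<m})) (\<Union>g\<in>U. B g)"
    by (rule openin_Union) (auto simp: B)
  ultimately show "openin (GL_topology m) U"
    unfolding GL_topology_eq openin_pullback_topology by (intro exI conjI)
qed

lemma GL_topspace: "topspace (GL_topology m :: 'f mat topology) = carrier (GL m)"
proof -
  have "openin (GL_topology m) (carrier (GL m :: 'f mat monoid))" unfolding GL_topology_open by (auto intro: exI[of _ 1])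
  moreover have "topspace (GL_topology m :: 'f mat topology) \<subseteq> carrier (GL m)"
    using openin_topspace[of "GL_topology m :: 'f mat topology"] unfolding GL_topology_open by blast
  ultimately show ?thesis using openin_subset by blast
qed

text \<open>Compactness: the matrices with entries in prescribed balls form a product of compact sets, and
  the condition on the determinant cuts out a closed subset that stays away from the singular
  matrices.\<close>

lemma compact_pattern:
  assumes c: "c \<in> carrier_mat m m"
  shows "compactin (GL_topology m)
    {g \<in> carrier_mat m m. (\<forall>i<m. \<forall>j<m. v (g $$ (i, j) - c $$ (i, j)) \<le> E i j) \<and> v (det g) = 1}"
    (is "compactin _ ?S")
proof -
  let ?I = "{..<m} \<times> {..<m}"
  let ?T = "product_topology (\<lambda>_. euclidean :: 'f topology) ?I"
  define X where "X = (\<lambda>(i, j). {y. v (y - c $$ (i, j)) \<le> E i j})"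
  have cX: "compact (X ij)" for ij
  proof -
    obtain i j where ij: "ij = (i, j)" by force
    have "X ij = (\<lambda>x. x + c $$ (i, j)) ` {x. v x \<le> E i j}"
    proof (intro equalityI subsetI)
      fix y assume "y \<in> X ij"
      then have "y = (y - c $$ (i, j)) + c $$ (i, j)" "v (y - c $$ (i, j)) \<le> E i j" unfolding X_def ij by auto
      then show "y \<in> (\<lambda>x. x + c $$ (i, j)) ` {x. v x \<le> E i j}" by blast
    qed (auto simp: X_def ij)
    moreover have "continuous_on UNIV (\<lambda>x. x + c $$ (i, j))"
      unfolding continuous_on_open_vimage[OF open_UNIV]
    proof (intro allI impI)
      fix B :: "'f set" assume B: "open B"
      show "open ((\<lambda>x. x + c $$ (i, j)) -` B \<inter> UNIV)" unfolding open_iff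
      proof
        fix x assume "x \<in> (\<lambda>x. x + c $$ (i, j)) -` B \<inter> UNIV"
        then obtain d where d: "d > 0" "\<And>y. v (y - (x + c $$ (i, j))) < d \<Longrightarrow> y \<in> B" using B unfolding open_iff by auto
        show "\<exists>e>0. \<forall>y. v (y - x) < e \<longrightarrow> y \<in> (\<lambda>x. x + c $$ (i, j)) -` B \<inter> UNIV"
          using d by (intro exI[of _ d]) auto
      qed
    qed
    ultimately show ?thesis
      using compact_continuous_image[OF continuous_on_subset compact_ball, of UNIV "\<lambda>x. x + c $$ (i, j)"] by simp
  qed
  have cPi: "compactin ?T (Pi\<^sub>E ?I X)"
    unfolding compactin_PiE using cX by (simp add: compactin_euclidean_iff)
  define mt where "mt f = Matrix.mat m m f" for f :: "nat \<times> nat \<Rightarrow> 'f"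
  define Y where "Y = {f \<in> Pi\<^sub>E ?I X. v (det (mt f)) = 1}"
  have mtc: "mt f \<in> carrier_mat m m" for f unfolding mt_def by simp
  have near: "\<exists>W. openin ?T W \<and> f \<in> W \<and> (\<forall>f'\<in>W. v (det (mt f') - det (mt f)) \<le> e)"
    if f: "f \<in> extensional ?I" and e: "e > 0" for f e
  proof -
    obtain C where C: "1 \<le> C" "entries_le C (mt f)" using ex_entries_le by blast
    define d where "d = min 1 (e / C ^ m)"
    have Cm: "0 < C ^ m" using C(1) by simp
    have d: "0 < d" "d \<le> 1" "d * C ^ m \<le> e"
    proof -
      have "d * C ^ m \<le> (e / C ^ m) * C ^ m" unfolding d_def using Cm by (intro mult_right_mono) auto
      moreover have "(e / D) * D = e" if "0 < D" for D using that by simp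
      from this[OF Cm] have "(e / C ^ m) * C ^ m = e" .
      ultimately show "d * C ^ m \<le> e" by simp
    qed (use e Cm in \<open>auto simp: d_def\<close>)
    let ?W = "Pi\<^sub>E ?I (\<lambda>ij. {y. v (y - f ij) < d})"
    have "openin ?T ?W"
      by (subst openin_PiE) (auto simp: open_ball open_openin[symmetric])
    moreover have "f \<in> ?W" using f d(1) by (auto simp: PiE_iff)
    moreover have "v (det (mt f') - det (mt f)) \<le> e" if f': "f' \<in> ?W" for f'
    proof -
      have m1: "entries_le d (mt f' - mt f)"
      proof (rule entries_leI[OF minus_carrier_mat[OF mtc]])
        fix i j assume ij: "i < m" "j < m"
        then have "v (f' (i, j) - f (i, j)) < d" using f' by (auto simp: PiE_iff)
        then show "v ((mt f' - mt f) $$ (i, j)) \<le> d" using ij unfolding mt_def by simp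
      qed
      have "entries_le C ((mt f' - mt f) + mt f)"
        using entries_le_mono[OF m1, of C] C d(2) mtc minus_carrier_mat[OF mtc] by (intro entries_le_add[of _ _ _ m m]) auto
      moreover have "(mt f' - mt f) + mt f = mt f'" unfolding mt_def by (intro eq_matI) auto
      ultimately have "entries_le C (mt f')" by simp
      then have "v (det (mt f') - det (mt f)) \<le> d * C ^ m"
        using det_diff_bound[OF mtc mtc _ C(2,1) m1] d(1) by simp
      then show ?thesis using d(3) by simp
    qed
    ultimately show ?thesis by blast
  qed
  have cl: "closedin ?T {f \<in> topspace ?T. v (det (mt f)) = 1}"
    unfolding closedin_def
  proof (intro conjI)
    show "openin ?T (topspace ?T - {f \<in> topspace ?T. v (det (mt f)) = 1})"
    proof (subst openin_subopen, intro ballI)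
      fix f assume f: "f \<in> topspace ?T - {f \<in> topspace ?T. v (det (mt f)) = 1}"
      then have fe: "f \<in> extensional ?I" by (auto simp: PiE_iff)
      define e where "e = (if det (mt f) = 0 then 1 / 2 else v (det (mt f)) / 2)"
      have "e > 0" unfolding e_def using pos by simp
      then obtain W' where W': "openin ?T W'" "f \<in> W'" "\<forall>f'\<in>W'. v (det (mt f') - det (mt f)) \<le> e"
        using near[OF fe] by blast
      have "v (det (mt f')) \<noteq> 1" if "f' \<in> W'" for f'
      proof -
        let ?a = "det (mt f)" and ?b = "det (mt f')"
        have a1: "v ?a \<noteq> 1" using f by auto
        have h: "v (?b - ?a) \<le> (if ?a = 0 then 1 / 2 else v ?a / 2)" using W'(3) that unfolding e_def by blast
        show ?thesis
        proof (cases "?a = 0")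
          case True then show ?thesis using h by auto
        next
          case False
          have "v ?a \<le> max (v ?b) (v (?b - ?a))" using diff_le[of ?b "?b - ?a"] by simp
          moreover have "v ?b \<le> max (v (?b - ?a)) (v ?a)" using ultra[of "?b - ?a" ?a] by simp
          ultimately have "v ?b = v ?a" using h False pos[OF False] by auto
          then show ?thesis using a1 by simp
        qed
      qed
      then show "\<exists>T. openin ?T T \<and> f \<in> T \<and> T \<subseteq> topspace ?T - {f \<in> topspace ?T. v (det (mt f)) = 1}"
        using W'(1,2) openin_subset[OF W'(1)] by blast
    qed
  qed auto
  have "Y = Pi\<^sub>E ?I X \<inter> {f \<in> topspace ?T. v (det (mt f)) = 1}"
  proof -
    have "Pi\<^sub>E ?I X \<subseteq> topspace ?T" unfolding topspace_product_topology by (rule PiE_mono) simp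
    then show ?thesis unfolding Y_def by blast
  qed
  then have cY: "compactin ?T Y" using compact_Int_closedin[OF cPi cl] by simp
  have SY: "entries m g \<in> Y" if "g \<in> ?S" for g
  proof -
    have "mt (entries m g) = g" using that unfolding mt_def entries_def by (intro eq_matI) auto
    then show ?thesis using that unfolding Y_def X_def entries_def by (auto simp: PiE_iff)
  qed
  have YS: "mt f \<in> ?S \<and> entries m (mt f) = f" if "f \<in> Y" for f
  proof -
    have f: "f \<in> extensional ?I" "\<And>i j. i < m \<Longrightarrow> j < m \<Longrightarrow> v (f (i, j) - c $$ (i, j)) \<le> E i j" "v (det (mt f)) = 1"
      using that unfolding Y_def X_def by (auto simp: PiE_iff)
    have "entries m (mt f) = f"
      using f(1) unfolding entries_def mt_def by (auto simp: fun_eq_iff extensional_def restrict_def)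
    then show ?thesis using f(2,3) mtc unfolding mt_def by auto
  qed
  have S_GL: "?S \<subseteq> carrier (GL m)" using zero by (auto simp: GL_carrier)
  show ?thesis unfolding compactin_def
  proof (intro conjI allI impI)
    show "?S \<subseteq> topspace (GL_topology m)" using S_GL GL_topspace by simp
    fix \<U> assume U: "Ball \<U> (openin (GL_topology m)) \<and> ?S \<subseteq> \<Union>\<U>"
    then have "\<forall>U\<in>\<U>. \<exists>W. openin ?T W \<and> U = entries m -` W \<inter> carrier (GL m)"
      unfolding GL_topology_eq openin_pullback_topology by blast
    then obtain W where W: "\<And>U. U \<in> \<U> \<Longrightarrow> openin ?T (W U) \<and> U = entries m -` (W U) \<inter> carrier (GL m)" by metis
    have "\<exists>\<F>. finite \<F> \<and> \<F> \<subseteq> W ` \<U> \<and> Y \<subseteq> \<Union>\<F>"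
    proof (rule compactinD[OF cY])
      show "openin ?T U" if "U \<in> W ` \<U>" for U using that W by auto
      show "Y \<subseteq> \<Union>(W ` \<U>)"
      proof
        fix f assume f: "f \<in> Y"
        obtain U where U': "U \<in> \<U>" "mt f \<in> U" using YS[OF f] U by blast
        have "mt f \<in> entries m -` W U \<inter> carrier (GL m)" by (rule subst[OF conjunct2[OF W[OF U'(1)]], of "\<lambda>A. mt f \<in> A"]) (rule U'(2))
        then have "f \<in> W U" using YS[OF f] by simp
        then show "f \<in> \<Union>(W ` \<U>)" using U'(1) by blast
      qed
    qed
    then obtain \<F> where F: "finite \<F>" "\<F> \<subseteq> \<U>" "Y \<subseteq> \<Union>(W ` \<F>)" by (metis finite_subset_image)
    have "?S \<subseteq> \<Union>\<F>"
    proof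
      fix g assume g: "g \<in> ?S"
      then obtain U where U': "U \<in> \<F>" "entries m g \<in> W U" using F(3) SY by blast
      have "g \<in> entries m -` W U \<inter> carrier (GL m)" using U'(2) g S_GL by blast
      moreover have "U \<in> \<U>" using U'(1) F(2) by blast
      then have "U = entries m -` W U \<inter> carrier (GL m)" by (rule conjunct2[OF W])
      ultimately have "g \<in> U" by (elim ssubst)
      then show "g \<in> \<Union>\<F>" using U'(1) by blast
    qed
    then show "\<exists>\<F>. finite \<F> \<and> \<F> \<subseteq> \<U> \<and> ?S \<subseteq> \<Union>\<F>" using F by blast
  qed
qed

lemma Congr_eq_pattern:
  assumes "0 \<le> e" "e < 1"
  shows "Congr e m = {g \<in> carrier_mat m m. (\<forall>i<m. \<forall>j<m. v (g $$ (i, j) - 1\<^sub>m m $$ (i, j)) \<le> e) \<and> v (det g) = 1}"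
  using Congr_GLO[OF assms, of m] unfolding Congr_def GLO_def entries_le_def by auto

lemma Congr_compact: "0 \<le> e \<Longrightarrow> e < 1 \<Longrightarrow> compactin (GL_topology m) (Congr e m)"
  unfolding Congr_eq_pattern by (rule compact_pattern) simp

lemma Congr_open:
  assumes "0 < e" "e < 1" shows "openin (GL_topology m) (Congr e m)"
  unfolding GL_topology_open
proof (intro conjI ballI exI[of _ e])
  show "Congr e m \<subseteq> carrier (GL m)" using Congr_GLO[of e m] GLO_GL assms by auto
  fix g h :: "'f mat" assume g: "g \<in> Congr e m" and h0: "h \<in> carrier (GL m)"
  show "entries_le e (h - g) \<longrightarrow> h \<in> Congr e m"
  proof
    assume "entries_le e (h - g)"
    with h0 have h: "h \<in> carrier (GL m)" "entries_le e (h - g)" by auto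
    have c: "h \<in> carrier_mat m m" "g \<in> carrier_mat m m" "entries_le e (g - 1\<^sub>m m)" using g h GL_mat unfolding Congr_def by auto
    have "entries_le e ((h - g) + (g - 1\<^sub>m m))"
      using h c minus_carrier_mat[OF c(2)] minus_carrier_mat[OF one_carrier_mat] by (intro entries_le_add[of _ _ _ m m]) auto
    moreover have "(h - g) + (g - 1\<^sub>m m) = h - 1\<^sub>m m" using c by (intro eq_matI) auto
    ultimately show "h \<in> Congr e m" using c unfolding Congr_def by simp
  qed
qed (use assms in simp)

lemma Congr_subgroup:
  assumes "0 \<le> e" "e < 1" shows "subgroup (Congr e m) (GL m)"
proof -
  interpret group "GL m :: 'f mat monoid" by (rule GL_group)
  show ?thesis
  proof (rule subgroupI)
    show "Congr e m \<subseteq> carrier (GL m)" using Congr_GLO[OF assms] GLO_GL by auto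
    then show "inv\<^bsub>GL m\<^esub> a \<in> Congr e m" if "a \<in> Congr e m" for a
      using Congr_inverse[OF assms that] GL_inv[of a m] that by auto
    show "Congr e m \<noteq> {}" using Congr_one[OF assms(1)] by auto
  qed (use Congr_mult[OF assms] in auto)
qed

lemma Congr_small:
  assumes "openin (GL_topology m) U" "1\<^sub>m m \<in> U"
  shows "\<exists>e. 0 < e \<and> e < 1 \<and> Congr e m \<subseteq> U"
proof -
  obtain d where d: "d > 0" "\<And>h. h \<in> carrier (GL m) \<Longrightarrow> entries_le d (h - 1\<^sub>m m) \<Longrightarrow> h \<in> U"
    using assms unfolding GL_topology_open by blast
  define e where "e = min d (1 / 2)"
  have e: "0 < e" "e < 1" "e \<le> d" using d(1) unfolding e_def by auto
  have "h \<in> U" if "h \<in> Congr e m" for h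
    using d(2)[of h] that Congr_GLO[of e m] GLO_GL e entries_le_mono[of e "h - 1\<^sub>m m" d] unfolding Congr_def by auto
  then show ?thesis using e by blast
qed

lemma Congr_mono: "e \<le> d \<Longrightarrow> Congr e m \<subseteq> Congr d m"
  unfolding Congr_def using entries_le_mono by auto

lemma GL_lgroup: "lgroup (GL m) (GL_topology m :: 'f mat topology)"
proof -
  interpret group "GL m :: 'f mat monoid" by (rule GL_group)
  show ?thesis
  proof
    show "topspace (GL_topology m :: 'f mat topology) = carrier (GL m)" by (rule GL_topspace)
  next
    fix U :: "'f mat set" and g :: "'f mat" assume U: "openin (GL_topology m) U" and g: "g \<in> carrier (GL m)"
    have Uc: "U \<subseteq> carrier (GL m)" using U unfolding GL_topology_open by auto
    note gi = GL_inv[OF g]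
    have gc: "g \<in> carrier_mat m m" using GL_mat[OF g] .
    obtain R where R: "1 \<le> R" "entries_le R (inv\<^bsub>GL m\<^esub> g)" using ex_entries_le by blast
    show "openin (GL_topology m) (g <#\<^bsub>GL m\<^esub> U)" unfolding GL_topology_open
    proof (intro conjI ballI)
      show "g <#\<^bsub>GL m\<^esub> U \<subseteq> carrier (GL m)" using l_coset_subset_G[OF Uc g] .
      fix x assume "x \<in> g <#\<^bsub>GL m\<^esub> U"
      then obtain u where u: "u \<in> U" "x = g * u" unfolding l_coset_def by auto
      have uc: "u \<in> carrier_mat m m" using u Uc GL_mat by auto
      obtain d where d: "d > 0" "\<And>h. h \<in> carrier (GL m) \<Longrightarrow> entries_le d (h - u) \<Longrightarrow> h \<in> U"
        using U u(1) unfolding GL_topology_open by blast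
      show "\<exists>e>0. \<forall>h\<in>carrier (GL m). entries_le e (h - x) \<longrightarrow> h \<in> g <#\<^bsub>GL m\<^esub> U"
      proof (intro exI[of _ "d / R"] conjI ballI impI)
        fix h assume h: "h \<in> carrier (GL m)" "entries_le (d / R) (h - x)"
        have hc: "h \<in> carrier_mat m m" using GL_mat[OF h(1)] .
        have xc: "x \<in> carrier_mat m m" using u gc uc by simp
        let ?w = "inv\<^bsub>GL m\<^esub> g * h"
        have "entries_le (R * (d / R)) (inv\<^bsub>GL m\<^esub> g * (h - x))"
          using entries_le_mult[OF R(2) h(2) gi(1) minus_carrier_mat[OF xc]] R(1) d(1) by simp
        moreover have "inv\<^bsub>GL m\<^esub> g * (h - x) = ?w - u"
          using gi gc uc hc xc u(2) by (simp add: mult_minus_distrib_mat[of _ m m] assoc_mult_mat[symmetric, of _ m m _ m _ m])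
        ultimately have "entries_le d (?w - u)" using R(1) by simp
        moreover have "?w \<in> carrier (GL m)" using m_closed[OF gi(4) h(1)] by simp
        ultimately have "?w \<in> U" using d(2) by simp
        moreover have "g * ?w = h" using gi gc hc by (simp add: assoc_mult_mat[symmetric, of _ m m _ m _ m])
        ultimately show "h \<in> g <#\<^bsub>GL m\<^esub> U" unfolding l_coset_def by (intro UN_I[of ?w]) simp_all
      qed (use d R in simp)
    qed
    show "openin (GL_topology m) (U #>\<^bsub>GL m\<^esub> g)" unfolding GL_topology_open
    proof (intro conjI ballI)
      show "U #>\<^bsub>GL m\<^esub> g \<subseteq> carrier (GL m)" using r_coset_subset_G[OF Uc g] .
      fix x assume "x \<in> U #>\<^bsub>GL m\<^esub> g"
      then obtain u where u: "u \<in> U" "x = u * g" unfolding r_coset_def by auto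
      have uc: "u \<in> carrier_mat m m" using u Uc GL_mat by auto
      obtain d where d: "d > 0" "\<And>h. h \<in> carrier (GL m) \<Longrightarrow> entries_le d (h - u) \<Longrightarrow> h \<in> U"
        using U u(1) unfolding GL_topology_open by blast
      show "\<exists>e>0. \<forall>h\<in>carrier (GL m). entries_le e (h - x) \<longrightarrow> h \<in> U #>\<^bsub>GL m\<^esub> g"
      proof (intro exI[of _ "d / R"] conjI ballI impI)
        fix h assume h: "h \<in> carrier (GL m)" "entries_le (d / R) (h - x)"
        have hc: "h \<in> carrier_mat m m" using GL_mat[OF h(1)] .
        have xc: "x \<in> carrier_mat m m" using u gc uc by simp
        let ?w = "h * inv\<^bsub>GL m\<^esub> g"
        have "entries_le ((d / R) * R) ((h - x) * inv\<^bsub>GL m\<^esub> g)"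
          using entries_le_mult[OF h(2) R(2) minus_carrier_mat[OF xc] gi(1)] R(1) d(1) by simp
        moreover have "(h - x) * inv\<^bsub>GL m\<^esub> g = ?w - u"
          using gi gc uc hc xc u(2) by (simp add: minus_mult_distrib_mat[of _ m m] assoc_mult_mat[of _ m m _ m _ m])
        ultimately have "entries_le d (?w - u)" using R(1) by simp
        moreover have "?w \<in> carrier (GL m)" using m_closed[OF h(1) gi(4)] by simp
        ultimately have "?w \<in> U" using d(2) by simp
        moreover have "?w * g = h" using gi gc hc by (simp add: assoc_mult_mat[of _ m m _ m _ m])
        ultimately show "h \<in> U #>\<^bsub>GL m\<^esub> g" unfolding r_coset_def by (intro UN_I[of ?w]) simp_all
      qed (use d R in simp)
    qed
  next
    fix U :: "'f mat set" assume U: "openin (GL_topology m) U" "\<one>\<^bsub>GL m\<^esub> \<in> U"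
    then obtain e where "0 < e" "e < 1" "Congr e m \<subseteq> U" using Congr_small[of m U] by auto
    then show "\<exists>K. subgroup K (GL m) \<and> openin (GL_topology m) K \<and> compactin (GL_topology m) K \<and> K \<subseteq> U"
      using Congr_subgroup[of e m] Congr_open[of e m] Congr_compact[of e m] by auto
  qed
qed

lemma closed_entries_zero:
  "closedin (GL_topology m) {g \<in> carrier (GL m). \<forall>i<m. \<forall>j<m. Q i j \<longrightarrow> g $$ (i, j) = (0::'f)}"
  unfolding closedin_def
proof (intro conjI)
  show "openin (GL_topology m) (topspace (GL_topology m :: 'f mat topology) - {g \<in> carrier (GL m). \<forall>i<m. \<forall>j<m. Q i j \<longrightarrow> g $$ (i, j) = 0})"
    unfolding GL_topology_open GL_topspace
  proof (intro conjI ballI)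
    fix g assume "g \<in> carrier (GL m) - {g \<in> carrier (GL m). \<forall>i<m. \<forall>j<m. Q i j \<longrightarrow> g $$ (i, j) = (0::'f)}"
    then obtain i j where g: "g \<in> carrier (GL m)" "i < m" "j < m" "Q i j" "g $$ (i, j) \<noteq> 0" by auto
    have gc: "g \<in> carrier_mat m m" using GL_mat[OF g(1)] .
    have "h \<in> carrier (GL m) - {g \<in> carrier (GL m). \<forall>i<m. \<forall>j<m. Q i j \<longrightarrow> g $$ (i, j) = 0}"
      if h: "h \<in> carrier (GL m)" "entries_le (v (g $$ (i, j)) / 2) (h - g)" for h
    proof -
      have "v ((h - g) $$ (i, j)) \<le> v (g $$ (i, j)) / 2" using entries_leD[OF h(2) minus_carrier_mat[OF gc] g(2,3)] .
      then have "v (h $$ (i, j) - g $$ (i, j)) \<le> v (g $$ (i, j)) / 2" using g gc GL_mat[OF h(1)] by simp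
      then have "h $$ (i, j) \<noteq> 0" using pos[OF g(5)] by auto
      then show ?thesis using g h by auto
    qed
    then show "\<exists>e>0. \<forall>h\<in>carrier (GL m). entries_le e (h - g) \<longrightarrow> h \<in> carrier (GL m) - {g \<in> carrier (GL m). \<forall>i<m. \<forall>j<m. Q i j \<longrightarrow> g $$ (i, j) = 0}"
      using pos[OF g(5)] by (intro exI[of _ "v (g $$ (i, j)) / 2"]) auto
  qed auto
qed (auto simp: GL_topspace)

end

section \<open>Permutation matrices and rank normal form\<close>

definition perm_mat :: "nat \<Rightarrow> (nat \<Rightarrow> nat) \<Rightarrow> 'f::field mat" where
  "perm_mat M s = Matrix.mat M M (\<lambda>(i, j). if j = s i then 1 else 0)"

definition inv_pair :: "nat \<Rightarrow> (nat \<Rightarrow> nat) \<Rightarrow> (nat \<Rightarrow> nat) \<Rightarrow> bool" where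
  "inv_pair M s t \<longleftrightarrow> (\<forall>i<M. s i < M \<and> t i < M \<and> t (s i) = i \<and> s (t i) = i)"

lemma perm_mat_carrier [simp]: "perm_mat M s \<in> carrier_mat M M"
  unfolding perm_mat_def by simp

lemma perm_mat_dim [simp]: "dim_row (perm_mat M s) = M" "dim_col (perm_mat M s) = M"
  unfolding perm_mat_def by simp_all

lemma inv_pair_sym: "inv_pair M s t \<Longrightarrow> inv_pair M t s"
  unfolding inv_pair_def by blast

lemma perm_mult_left:
  assumes "X \<in> carrier_mat M n" "inv_pair M s t"
  shows "perm_mat M s * X = Matrix.mat M n (\<lambda>(i, j). X $$ (s i, j))"
proof (rule eq_matI)
  fix i j assume "i < dim_row (Matrix.mat M n (\<lambda>(i, j). X $$ (s i, j)))" "j < dim_col (Matrix.mat M n (\<lambda>(i, j). X $$ (s i, j)))"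
  then have ij: "i < M" "j < n" by auto
  have "(perm_mat M s * X) $$ (i, j) = (\<Sum>k<M. (if k = s i then X $$ (k, j) else 0))"
    by (rule trans[OF mult_entry[OF perm_mat_carrier assms(1) ij] sum.cong[OF refl]]) (use ij in \<open>auto simp: perm_mat_def\<close>)
  also have "\<dots> = X $$ (s i, j)" using assms(2) ij unfolding inv_pair_def by (simp add: sum.delta)
  finally show "(perm_mat M s * X) $$ (i, j) = Matrix.mat M n (\<lambda>(i, j). X $$ (s i, j)) $$ (i, j)" using ij by simp
qed (use assms in auto)

lemma perm_mult_right:
  assumes "X \<in> carrier_mat m M" "inv_pair M s t"
  shows "X * perm_mat M s = Matrix.mat m M (\<lambda>(i, j). X $$ (i, t j))"
proof (rule eq_matI)
  fix i j assume "i < dim_row (Matrix.mat m M (\<lambda>(i, j). X $$ (i, t j)))" "j < dim_col (Matrix.mat m M (\<lambda>(i, j). X $$ (i, t j)))"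
  then have ij: "i < m" "j < M" by auto
  have e: "j = s k \<longleftrightarrow> k = t j" if "k < M" for k
    using assms(2) ij(2) that unfolding inv_pair_def by metis
  have "(X * perm_mat M s) $$ (i, j) = (\<Sum>k<M. (if k = t j then X $$ (i, k) else 0))"
    by (rule trans[OF mult_entry[OF assms(1) perm_mat_carrier ij] sum.cong[OF refl]]) (use ij e in \<open>auto simp: perm_mat_def\<close>)
  also have "\<dots> = X $$ (i, t j)" using assms(2) ij unfolding inv_pair_def by (simp add: sum.delta)
  finally show "(X * perm_mat M s) $$ (i, j) = Matrix.mat m M (\<lambda>(i, j). X $$ (i, t j)) $$ (i, j)" using ij by simp
qed (use assms in auto)

lemma perm_mat_inverse:
  assumes "inv_pair M s t" shows "perm_mat M s * perm_mat M t = (1\<^sub>m M :: 'f::field mat)"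
  unfolding perm_mult_left[OF perm_mat_carrier assms]
  by (rule eq_matI) (use assms in \<open>auto simp: perm_mat_def inv_pair_def\<close>)

lemma (in abs_field) perm_mat_GLO: "inv_pair M s t \<Longrightarrow> perm_mat M s \<in> GLO M"
  by (rule GLO_I[OF _ _ _ _ perm_mat_inverse]) (auto simp: entries_le_def perm_mat_def)

text \<open>The rank a normal form with the identity block at the right end of the first a rows.\<close>

definition norm_form :: "nat \<Rightarrow> nat \<Rightarrow> nat \<Rightarrow> 'f::field mat" where
  "norm_form m n a = Matrix.mat m n (\<lambda>(i, j). if i < a \<and> j = n - a + i then 1 else 0)"

definition stack :: "'f::field mat \<Rightarrow> 'f mat \<Rightarrow> 'f mat" where
  "stack R S = Matrix.mat (dim_row R + dim_row S) (dim_col R) (\<lambda>(i, j). if i < dim_row R then R $$ (i, j) else S $$ (i - dim_row R, j))"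

lemma nat_zero_less_one: "(0::nat) < 1" by simp

lemma stack_carrier: "R \<in> carrier_mat p n \<Longrightarrow> S \<in> carrier_mat q n \<Longrightarrow> stack R S \<in> carrier_mat (p + q) n"
  unfolding stack_def by auto

lemma stack_mult_right:
  assumes "R \<in> carrier_mat p n" "S \<in> carrier_mat q n" "A \<in> carrier_mat n n'"
  shows "stack R S * A = stack (R * A) (S * A)"
proof (rule eq_matI)
  fix i j assume "i < dim_row (stack (R * A) (S * A))" "j < dim_col (stack (R * A) (S * A))"
  then have ij: "i < p + q" "j < n'" using assms unfolding stack_def by auto
  show "(stack R S * A) $$ (i, j) = stack (R * A) (S * A) $$ (i, j)"
  proof (cases "i < p")
    case True
    have "(stack R S * A) $$ (i, j) = (\<Sum>k<n. R $$ (i, k) * A $$ (k, j))"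
      unfolding mult_entry[OF stack_carrier[OF assms(1,2)] assms(3) ij]
      using True assms by (intro sum.cong) (auto simp: stack_def)
    also have "\<dots> = (R * A) $$ (i, j)" using mult_entry[OF assms(1,3) True ij(2)] by simp
    finally show ?thesis using True ij assms by (simp add: stack_def)
  next
    case False
    then have i': "i - p < q" using ij by auto
    have "(stack R S * A) $$ (i, j) = (\<Sum>k<n. S $$ (i - p, k) * A $$ (k, j))"
      unfolding mult_entry[OF stack_carrier[OF assms(1,2)] assms(3) ij]
      using False ij assms by (intro sum.cong) (auto simp: stack_def)
    also have "\<dots> = (S * A) $$ (i - p, j)" using mult_entry[OF assms(2,3) i' ij(2)] by simp
    finally show ?thesis using False ij assms by (simp add: stack_def)
  qed
qed (use assms in \<open>auto simp: stack_def\<close>)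

lemma stack_eq_block:
  assumes "R \<in> carrier_mat p n" "S \<in> carrier_mat q n"
  shows "stack R S = four_block_mat R (0\<^sub>m p 0) S (0\<^sub>m q 0)"
  using assms by (intro eq_matI) (auto simp: stack_def)

lemma stack_mult_left:
  assumes "R \<in> carrier_mat p n" "S \<in> carrier_mat q n"
    and "A \<in> carrier_mat p' p" "B \<in> carrier_mat p' q" "C \<in> carrier_mat q' p" "D \<in> carrier_mat q' q"
  shows "four_block_mat A B C D * stack R S = stack (A * R + B * S) (C * R + D * S)"
proof -
  have "four_block_mat A B C D * stack R S
    = four_block_mat (A * R + B * S) (A * 0\<^sub>m p 0 + B * 0\<^sub>m q 0) (C * R + D * S) (C * 0\<^sub>m p 0 + D * 0\<^sub>m q 0)"
    unfolding stack_eq_block[OF assms(1,2)]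
    by (rule mult_four_block_mat[OF assms(3-6,1) _ assms(2)]) auto
  moreover have "A * 0\<^sub>m p 0 + B * 0\<^sub>m q 0 = 0\<^sub>m p' 0" "C * 0\<^sub>m p 0 + D * 0\<^sub>m q 0 = 0\<^sub>m q' 0"
    using assms by (auto intro!: eq_matI)
  moreover have "A * R + B * S \<in> carrier_mat p' n" "C * R + D * S \<in> carrier_mat q' n" using assms by auto
  ultimately show ?thesis using stack_eq_block by metis
qed

lemma GL_mult: "A \<in> carrier (GL m) \<Longrightarrow> B \<in> carrier (GL m) \<Longrightarrow> A * B \<in> carrier (GL m)" for A :: "'f::field mat"
  using det_mult[of A m B] by (auto simp: GL_carrier)

lemma GL_block:
  fixes A :: "'f::field mat"
  assumes "A \<in> carrier (GL p)" "B \<in> carrier_mat p q" "D \<in> carrier (GL q)"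
  shows "four_block_mat A B (0\<^sub>m q p) D \<in> carrier (GL (p + q))"
  using assms det_four_block_mat_lower_left_zero[of A p B q "0\<^sub>m q p" D] by (auto simp: GL_carrier)

context abs_field
begin

definition equivalent :: "nat \<Rightarrow> nat \<Rightarrow> 'f mat \<Rightarrow> 'f mat \<Rightarrow> bool" where
  "equivalent m n X Y \<longleftrightarrow> (\<exists>D\<in>carrier (GL m). \<exists>A\<in>GLO n. D * X * A = Y)"

lemma equivalent_trans:
  assumes X: "X \<in> carrier_mat m n" and "equivalent m n X Y" "equivalent m n Y Z"
  shows "equivalent m n X Z"
proof -
  obtain D A where 1: "D \<in> carrier (GL m)" "A \<in> GLO n" "D * X * A = Y" using assms(2) unfolding equivalent_def by blast
  obtain D' A' where 2: "D' \<in> carrier (GL m)" "A' \<in> GLO n" "D' * Y * A' = Z" using assms(3) unfolding equivalent_def by blast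
  have c: "D \<in> carrier_mat m m" "D' \<in> carrier_mat m m" "A \<in> carrier_mat n n" "A' \<in> carrier_mat n n"
    using 1 2 GL_mat unfolding GLO_def by auto
  have "(D' * D) * X = D' * (D * X)" using c X by (intro assoc_mult_mat) auto
  moreover have "D' * (D * X) * A = D' * (D * X * A)" using c X by (intro assoc_mult_mat) auto
  moreover have "((D' * D) * X * A) * A' = (D' * D) * X * (A * A')"
    using c X by (intro assoc_mult_mat[of _ m n _ n _ n]) auto
  ultimately have "(D' * D) * X * (A * A') = Z" using 1(3) 2(3) by simp
  then show ?thesis unfolding equivalent_def
    by (intro bexI[of _ "D' * D"] bexI[of _ "A * A'"] GL_mult GLO_mult 1 2)
qed

lemma GL_one: "1\<^sub>m m \<in> carrier (GL m :: 'f mat monoid)" by (simp add: GL_carrier)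

lemma equivalent_left:
  "X \<in> carrier_mat m n \<Longrightarrow> D \<in> carrier (GL m) \<Longrightarrow> D * X = Y \<Longrightarrow> equivalent m n X Y"
  unfolding equivalent_def using GLO_one[of n] GL_mat[of D m]
  by (intro bexI[of _ D] bexI[of _ "1\<^sub>m n"]) auto

lemma equivalent_right:
  "X \<in> carrier_mat m n \<Longrightarrow> A \<in> GLO n \<Longrightarrow> X * A = Y \<Longrightarrow> equivalent m n X Y"
  unfolding equivalent_def using GL_one[of m]
  by (intro bexI[of _ A] bexI[of _ "1\<^sub>m m"]) auto

text \<open>One row can be reduced to a single entry by integral column operations: the entry of largest
  absolute value clears the others.\<close>

lemma row_reduce:
  assumes R: "R \<in> carrier_mat 1 n" and b: "b \<le> n" and z: "\<And>j. b \<le> j \<Longrightarrow> j < n \<Longrightarrow> R $$ (0, j) = 0"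
    and nz: "\<exists>j<b. R $$ (0, j) \<noteq> 0"
  shows "\<exists>A\<in>GLO n. \<exists>c. c \<noteq> 0 \<and> (\<forall>j<n. (R * A) $$ (0, j) = (if j = b - 1 then c else 0)) \<and>
    (\<forall>m. \<forall>X :: 'f mat. X \<in> carrier_mat m n \<longrightarrow> (\<forall>i<m. \<forall>j<b. X $$ (i, j) = 0) \<longrightarrow> X * A = X)"
proof -
  obtain j0 where j0: "j0 < b" "R $$ (0, j0) \<noteq> 0" using nz by blast
  have "\<exists>q\<in>{..<b}. \<forall>j\<in>{..<b}. v (R $$ (0, j)) \<le> v (R $$ (0, q))"
  proof -
    have ne: "(\<lambda>j. v (R $$ (0, j))) ` {..<b} \<noteq> {}" using j0 by auto
    have "Max ((\<lambda>j. v (R $$ (0, j))) ` {..<b}) \<in> (\<lambda>j. v (R $$ (0, j))) ` {..<b}" using ne by (intro Max_in) auto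
    then obtain q where q: "q \<in> {..<b}" "Max ((\<lambda>j. v (R $$ (0, j))) ` {..<b}) = v (R $$ (0, q))" by auto
    have "v (R $$ (0, j)) \<le> v (R $$ (0, q))" if "j \<in> {..<b}" for j
      unfolding q(2)[symmetric] using that by (intro Max_ge) auto
    then show ?thesis using q(1) by blast
  qed
  then obtain q where q: "q < b" "\<And>j. j < b \<Longrightarrow> v (R $$ (0, j)) \<le> v (R $$ (0, q))" by auto
  define c where "c = R $$ (0, q)"
  have c0: "c \<noteq> 0" using q(2)[OF j0(1)] pos[OF j0(2)] unfolding c_def by auto
  define w where "w j = (if j < b \<and> j \<noteq> q then R $$ (0, j) / c else 0)" for j
  have wv: "v (w j) \<le> 1" for j
  proof (cases "j < b \<and> j \<noteq> q")
    case True
    have "w j * c = R $$ (0, j)" unfolding w_def using True c0 by simp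
    then have "v (w j) * v c \<le> 1 * v c" using q(2)[of j] True mult[of "w j" c] unfolding c_def by simp
    then show ?thesis using pos[OF c0] by (rule mult_right_le_imp_le)
  qed (auto simp: w_def)
  have wq: "w q = 0" unfolding w_def by simp
  define T where "T e = Matrix.mat n n (\<lambda>(i, j). (if i = j then 1 else 0) + (if i = q then e * w j else 0))" for e :: 'f
  have Tc: "T e \<in> carrier_mat n n" for e unfolding T_def by simp
  have qn: "q < n" using q b by simp
  have XT: "(X * T e) $$ (i, j) = X $$ (i, j) + X $$ (i, q) * (e * w j)"
    if "X \<in> carrier_mat m n" "i < m" "j < n" for X m i j e
  proof -
    have "(X * T e) $$ (i, j) = (\<Sum>t<n. (if t = j then X $$ (i, t) else 0) + (if t = q then X $$ (i, t) * (e * w j) else 0))"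
      by (rule trans[OF mult_entry[OF that(1) Tc that(2,3)] sum.cong[OF refl]]) (use that in \<open>auto simp: T_def algebra_simps\<close>)
    then show ?thesis using that qn by (simp add: sum.distrib sum.delta)
  qed
  have TT: "T e * T (- e) = 1\<^sub>m n" for e
  proof (rule eq_matI)
    fix i j assume "i < dim_row (1\<^sub>m n :: 'f mat)" "j < dim_col (1\<^sub>m n :: 'f mat)"
    then have ij: "i < n" "j < n" by auto
    show "(T e * T (- e)) $$ (i, j) = 1\<^sub>m n $$ (i, j)"
      unfolding XT[OF Tc ij] using ij qn wq by (auto simp: T_def)
  qed (use Tc in auto)
  have Tm: "entries_le 1 (T e)" if "v e = 1" for e
  proof (rule entries_leI[OF Tc])
    fix i j assume "i < n" "j < n"
    then show "v (T e $$ (i, j)) \<le> 1" unfolding T_def using wv[of j] that by (auto simp: mult intro!: add_bound)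
  qed
  have TG: "T (-1) \<in> GLO n" using GLO_I[OF Tc Tc Tm Tm, of "-1" 1] TT[of "-1"] by simp
  define s where "s = Transposition.transpose q (b - 1)"
  have b1: "b - 1 < n" using j0 b by linarith
  have s: "inv_pair n s s" unfolding inv_pair_def s_def using qn b1
    by (auto simp: Transposition.transpose_def)
  define A where "A = T (-1) * perm_mat n s"
  have A: "A \<in> GLO n" unfolding A_def using GLO_mult[OF TG perm_mat_GLO[OF s]] .
  have XA: "(X * A) $$ (i, j) = X $$ (i, s j) - X $$ (i, q) * w (s j)"
    if "X \<in> carrier_mat m n" "i < m" "j < n" for X m i j
  proof -
    have sj: "s j < n" using s that(3) unfolding inv_pair_def by simp
    have "X * A = (X * T (-1)) * perm_mat n s" unfolding A_def using that(1) Tc[of "-1"] by (simp add: assoc_mult_mat[of _ m n _ n _ n])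
    also have "\<dots> $$ (i, j) = (X * T (-1)) $$ (i, s j)"
      using perm_mult_right[of "X * T (-1)" m n s s] s that Tc[of "-1"] by simp
    finally show ?thesis using XT[OF that(1,2) sj, of "-1"] by simp
  qed
  show ?thesis
  proof (intro bexI[OF _ A] exI[of _ c] conjI allI impI c0)
    fix j assume j: "j < n"
    have sj: "s j < n" using s j unfolding inv_pair_def by simp
    show "(R * A) $$ (0, j) = (if j = b - 1 then c else 0)"
    proof (cases "s j = q")
      case True
      then have "j = b - 1" unfolding s_def Transposition.transpose_def by (auto split: if_splits)
      then show ?thesis using XA[OF R _ j] True wq by (simp add: c_def)
    next
      case False
      then have "j \<noteq> b - 1" unfolding s_def Transposition.transpose_def by (auto split: if_splits)
      moreover have "R $$ (0, s j) - R $$ (0, q) * w (s j) = 0"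
        using False z[of "s j"] sj c0 unfolding w_def c_def[symmetric] by auto
      ultimately show ?thesis using XA[OF R _ j] by simp
    qed
  next
    fix m and X :: "'f mat" assume X: "X \<in> carrier_mat m n" "\<forall>i<m. \<forall>j<b. X $$ (i, j) = 0"
    show "X * A = X"
    proof (rule eq_matI)
      fix i j assume "i < dim_row X" "j < dim_col X"
      then have ij: "i < m" "j < n" using X by auto
      have "X $$ (i, s j) = X $$ (i, j)"
        using X(2) ij q(1) j0 unfolding s_def Transposition.transpose_def by auto
      then show "(X * A) $$ (i, j) = X $$ (i, j)" using XA[OF X(1) ij] X(2) ij q(1) by simp
    qed (use X A in \<open>auto simp: GLO_def\<close>)
  qed
qed

text \<open>Gaussian elimination row by row. General row operations are harmless because P contains them; the column
  operations are kept integral so that they range over a compact set.\<close>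

lemma rank_normal_form:
  "L \<in> carrier_mat m n \<Longrightarrow> \<exists>a. a \<le> m \<and> a \<le> n \<and> equivalent m n L (norm_form m n a)"
proof (induction m arbitrary: L)
  case 0
  have "L = norm_form 0 n 0" using 0 by (intro eq_matI) (auto simp: norm_form_def)
  then have "equivalent 0 n L (norm_form 0 n 0)"
    using equivalent_right[OF 0 GLO_one] 0 by simp
  then show ?case by auto
next
  case (Suc m)
  define R where "R = Matrix.mat 1 n (\<lambda>(i, j). L $$ (0, j))"
  define S where "S = Matrix.mat m n (\<lambda>(i, j). L $$ (Suc i, j))"
  have R: "R \<in> carrier_mat 1 n" and S: "S \<in> carrier_mat m n" unfolding R_def S_def by auto
  have L: "L = stack R S" using Suc.prems unfolding R_def S_def by (intro eq_matI) (auto simp: stack_def)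
  obtain a where a: "a \<le> m" "a \<le> n" "equivalent m n S (norm_form m n a)" using Suc.IH[OF S] by blast
  then obtain D A where DA: "D \<in> carrier (GL m)" "A \<in> GLO n" "D * S * A = norm_form m n a" unfolding equivalent_def by blast
  have Dc: "D \<in> carrier_mat m m" and Ac: "A \<in> carrier_mat n n" using DA GL_mat unfolding GLO_def by auto
  let ?E = "norm_form m n a :: 'f mat"
  have E: "?E \<in> carrier_mat m n" unfolding norm_form_def by simp
  define y0 where "y0 = Matrix.mat 1 m (\<lambda>(i, t). if t < a then - (R * A) $$ (0, n - a + t) else 0)"
  have y0: "y0 \<in> carrier_mat 1 m" unfolding y0_def by simp
  define B where "B = four_block_mat (1\<^sub>m 1) (y0 * D) (0\<^sub>m m 1) D"
  have B: "B \<in> carrier (GL (1 + m))" unfolding B_def using GL_block[OF GL_one _ DA(1), where p = 1 and B = "y0 * D"] y0 Dc by simp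
  define \<rho> where "\<rho> = R * A + y0 * ?E"
  have \<rho>: "\<rho> \<in> carrier_mat 1 n" unfolding \<rho>_def by (rule add_carrier_mat[OF mult_carrier_mat[OF y0 E]])
  have y0E: "(y0 * ?E) $$ (0, j) = (if n - a \<le> j then - (R * A) $$ (0, j) else 0)" if j: "j < n" for j
  proof -
    have "(y0 * ?E) $$ (0, j) = (\<Sum>t<m. if t = j - (n - a) then (if n - a \<le> j then - (R * A) $$ (0, j) else 0) else 0)"
      unfolding mult_entry[OF y0 E nat_zero_less_one j]
      using j a by (intro sum.cong) (auto simp: y0_def norm_form_def)
    also have "\<dots> = (if n - a \<le> j then - (R * A) $$ (0, j) else 0)"
      using j a by (auto simp: sum.delta)
    finally show ?thesis .
  qed
  have \<rho>0: "\<rho> $$ (0, j) = 0" if "n - a \<le> j" "j < n" for j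
    unfolding \<rho>_def using y0E[OF that(2)] that R Ac y0 E by simp
  have step1: "equivalent (Suc m) n L (stack \<rho> ?E)"
  proof -
    have "B * L = stack (R + y0 * D * S) (D * S)"
      unfolding B_def L using stack_mult_left[OF R S one_carrier_mat _ zero_carrier_mat Dc, of "y0 * D"] y0 Dc R S by simp
    then have "B * L * A = stack ((R + y0 * D * S) * A) (D * S * A)"
      using stack_mult_right[of "R + y0 * D * S" 1 n "D * S" m A n] R S y0 Dc Ac by simp
    also have "(R + y0 * D * S) * A = R * A + y0 * (D * S * A)"
      using R S y0 Dc Ac by (simp add: add_mult_distrib_mat[of _ 1 n] assoc_mult_mat[of _ 1 m _ m _ n] assoc_mult_mat[of _ 1 m _ n _ n])
    finally have "B * L * A = stack \<rho> ?E" unfolding DA(3) \<rho>_def .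
    then show ?thesis unfolding equivalent_def using B DA(2) by auto
  qed
  have sc: "stack \<rho> ?E \<in> carrier_mat (Suc m) n" using stack_carrier[OF \<rho> E] by simp
  show ?case
  proof (cases "\<exists>j<n - a. \<rho> $$ (0, j) \<noteq> 0")
    case False
    define s where "s i = (if i < m then Suc i else if i = m then 0 else i)" for i :: nat
    define t where "t i = (if i = 0 then m else i - 1)" for i :: nat
    have st: "inv_pair (Suc m) s t" unfolding inv_pair_def s_def t_def by auto
    have z: "\<rho> $$ (0, j) = 0" if "j < n" for j using False \<rho>0[of j] that by (cases "j < n - a") auto
    have "perm_mat (Suc m) s * stack \<rho> ?E = norm_form (Suc m) n a"
      unfolding perm_mult_left[OF sc st]
      by (rule eq_matI) (use z \<rho> E a in \<open>auto simp: stack_def norm_form_def s_def\<close>)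
    then have "equivalent (Suc m) n (stack \<rho> ?E) (norm_form (Suc m) n a)"
      using equivalent_left[OF sc] perm_mat_GLO[OF st] GLO_GL by blast
    then show ?thesis using equivalent_trans[OF Suc.prems step1] a by (intro exI[of _ a]) auto
  next
    case True
    have an: "a < n" using True by auto
    obtain A' c where A': "A' \<in> GLO n" "c \<noteq> 0" "\<And>j. j < n \<Longrightarrow> (\<rho> * A') $$ (0, j) = (if j = n - a - 1 then c else 0)"
      "\<And>m. \<And>X :: 'f mat. X \<in> carrier_mat m n \<Longrightarrow> \<forall>i<m. \<forall>j<n - a. X $$ (i, j) = 0 \<Longrightarrow> X * A' = X"
      using row_reduce[OF \<rho> _ \<rho>0 True] by auto
    have A'c: "A' \<in> carrier_mat n n" using A' unfolding GLO_def by auto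
    have EA': "?E * A' = ?E" by (rule A'(4)[OF E]) (use a in \<open>auto simp: norm_form_def\<close>)
    have s2: "equivalent (Suc m) n (stack \<rho> ?E) (stack (\<rho> * A') ?E)"
      using equivalent_right[OF sc A'(1)] stack_mult_right[OF \<rho> E A'c] EA' by simp
    define C where "C = Matrix.mat 1 1 (\<lambda>_. inverse c)"
    have C: "C \<in> carrier (GL 1)"
      using A'(2) det_single[of C] unfolding C_def by (simp add: GL_carrier)
    define D' where "D' = four_block_mat C (0\<^sub>m 1 m) (0\<^sub>m m 1) (1\<^sub>m m)"
    have D': "D' \<in> carrier (GL (1 + m))" unfolding D'_def by (rule GL_block[OF C _ GL_one]) simp
    have Cc: "C \<in> carrier_mat 1 1" unfolding C_def by simp
    have rA: "\<rho> * A' \<in> carrier_mat 1 n" using \<rho> A'c by simp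
    have "D' * stack (\<rho> * A') ?E = stack (C * (\<rho> * A')) ?E"
    proof -
      have "C * (\<rho> * A') \<in> carrier_mat 1 n" by (rule mult_carrier_mat[OF Cc rA])
      then have "C * (\<rho> * A') + 0\<^sub>m 1 m * ?E = C * (\<rho> * A')"
        using left_mult_zero_mat[OF E, of 1] right_add_zero_mat[of "C * (\<rho> * A')" 1 n] by simp
      moreover have "0\<^sub>m m 1 * (\<rho> * A') + 1\<^sub>m m * ?E = ?E"
        using left_mult_zero_mat[OF rA, of m] left_mult_one_mat[OF E] left_add_zero_mat[OF E] by simp
      ultimately show ?thesis
        unfolding D'_def using stack_mult_left[OF rA E Cc zero_carrier_mat[of 1 m] zero_carrier_mat[of m 1] one_carrier_mat] by simp
    qed
    also have "\<dots> = norm_form (Suc m) n (Suc a)"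
    proof (rule eq_matI)
      fix i j assume "i < dim_row (norm_form (Suc m) n (Suc a) :: 'f mat)" "j < dim_col (norm_form (Suc m) n (Suc a) :: 'f mat)"
      then have ij: "i < Suc m" "j < n" unfolding norm_form_def by auto
      have "(C * (\<rho> * A')) $$ (0, j) = (if j = n - a - 1 then 1 else 0)"
        using mult_entry[OF Cc rA nat_zero_less_one ij(2)] A'(2,3) ij by (simp add: C_def)
      then show "stack (C * (\<rho> * A')) ?E $$ (i, j) = norm_form (Suc m) n (Suc a) $$ (i, j)"
        using ij Cc rA E an by (cases i) (auto simp: stack_def norm_form_def)
    qed (use rA E Cc in \<open>auto simp: stack_def norm_form_def\<close>)
    finally have "equivalent (Suc m) n (stack (\<rho> * A') ?E) (norm_form (Suc m) n (Suc a))"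
      using equivalent_left[of "stack (\<rho> * A') ?E" "Suc m" n D'] D' stack_carrier[OF rA E] by simp
    then have "equivalent (Suc m) n L (norm_form (Suc m) n (Suc a))"
      using equivalent_trans[OF Suc.prems step1] equivalent_trans[OF sc s2] by blast
    then show ?thesis using a an by (intro exI[of _ "Suc a"]) auto
  qed
qed

end

section \<open>The parabolic subgroup, its Levi part, and the unipotent radical\<close>

lemma block_cases:
  assumes "p \<in> carrier_mat (r + m) (r + m)"
  obtains A B C D where "p = four_block_mat A B C D" "A \<in> carrier_mat r r" "B \<in> carrier_mat r m"
    "C \<in> carrier_mat m r" "D \<in> carrier_mat m m"
proof -
  obtain A B C D where s: "split_block p r r = (A, B, C, D)" by (cases "split_block p r r") auto
  show ?thesis using split_block[OF s, of m m] assms that by auto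
qed

lemma parabolic_iff:
  fixes p :: "'f::field mat"
  shows "p \<in> parabolic r m \<longleftrightarrow> p \<in> carrier (GL (r + m)) \<and> (\<forall>i<r + m. \<forall>j<r + m. r \<le> i \<and> j < r \<longrightarrow> p $$ (i, j) = 0)"
proof
  assume "p \<in> parabolic r m"
  then obtain A B D where p: "p = four_block_mat A B (0\<^sub>m m r) D"
    "A \<in> carrier (GL r)" "B \<in> carrier_mat r m" "D \<in> carrier (GL m)"
    unfolding parabolic_def by blast
  have c: "A \<in> carrier_mat r r" "D \<in> carrier_mat m m" using p GL_mat by auto
  show "p \<in> carrier (GL (r + m)) \<and> (\<forall>i<r + m. \<forall>j<r + m. r \<le> i \<and> j < r \<longrightarrow> p $$ (i, j) = 0)"
    using GL_block[OF p(2-4)] p c by auto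
next
  assume a: "p \<in> carrier (GL (r + m)) \<and> (\<forall>i<r + m. \<forall>j<r + m. r \<le> i \<and> j < r \<longrightarrow> p $$ (i, j) = 0)"
  then have pc: "p \<in> carrier_mat (r + m) (r + m)" using GL_mat by auto
  obtain A B C D where p: "p = four_block_mat A B C D" and c: "A \<in> carrier_mat r r" "B \<in> carrier_mat r m"
    "C \<in> carrier_mat m r" "D \<in> carrier_mat m m" using block_cases[OF pc] .
  have C0: "C = 0\<^sub>m m r"
  proof (rule eq_matI)
    fix i j assume "i < dim_row (0\<^sub>m m r :: 'f mat)" "j < dim_col (0\<^sub>m m r :: 'f mat)"
    then have ij: "i < m" "j < r" by auto
    have "p $$ (r + i, j) = 0" using a ij by auto
    then show "C $$ (i, j) = 0\<^sub>m m r $$ (i, j)" unfolding p using ij c by simp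
  qed (use c in auto)
  have "det p = det A * det D" unfolding p using det_four_block_mat_lower_left_zero[OF c(1,2) C0 c(4)] .
  moreover have "det p \<noteq> 0" using a by (simp add: GL_carrier)
  ultimately have "A \<in> carrier (GL r)" "D \<in> carrier (GL m)" using c by (auto simp: GL_carrier)
  then show "p \<in> parabolic r m" unfolding parabolic_def p C0 using c by blast
qed

lemma levi_part_block:
  assumes "A \<in> carrier_mat r r" "B \<in> carrier_mat r m" "C \<in> carrier_mat m r" "D \<in> carrier_mat m m"
  shows "levi_part r m (four_block_mat A B C D) = four_block_mat A (0\<^sub>m r m) (0\<^sub>m m r) D"
proof -
  let ?p = "four_block_mat A B C D"
  obtain A' B' C' D' where s: "split_block ?p r r = (A', B', C', D')" by (cases "split_block ?p r r") auto
  have d: "dim_row ?p = r + m" "dim_col ?p = r + m" using assms by auto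
  note sb = split_block[OF s d]
  have "A' = A"
  proof (rule eq_matI)
    fix i j assume "i < dim_row A" "j < dim_col A"
    then have ij: "i < r" "j < r" using assms by auto
    have "?p $$ (i, j) = A' $$ (i, j)" unfolding sb(5) using ij sb by simp
    then show "A' $$ (i, j) = A $$ (i, j)" using ij assms by simp
  qed (use sb assms in auto)
  moreover have "D' = D"
  proof (rule eq_matI)
    fix i j assume "i < dim_row D" "j < dim_col D"
    then have ij: "i < m" "j < m" using assms by auto
    have "?p $$ (r + i, r + j) = D' $$ (i, j)" unfolding sb(5) using ij sb by simp
    then show "D' $$ (i, j) = D $$ (i, j)" using ij assms by simp
  qed (use sb assms in auto)
  ultimately show ?thesis unfolding levi_part_def s by simp
qed

lemma levi_part_carrier:
  assumes "p \<in> carrier_mat (r + m) (r + m)"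
  shows "levi_part r m p \<in> carrier_mat (r + m) (r + m)"
proof -
  obtain A B C D where p: "p = four_block_mat A B C D" and c: "A \<in> carrier_mat r r" "B \<in> carrier_mat r m"
    "C \<in> carrier_mat m r" "D \<in> carrier_mat m m" using block_cases[OF assms(1)] .
  show ?thesis unfolding p levi_part_block[OF c] using c by auto
qed

lemma levi_part_entry:
  assumes "p \<in> carrier_mat (r + m) (r + m)" "i < r + m" "j < r + m"
  shows "levi_part r m p $$ (i, j) = (if (i < r) = (j < r) then p $$ (i, j) else 0)"
proof -
  obtain A B C D where p: "p = four_block_mat A B C D" and c: "A \<in> carrier_mat r r" "B \<in> carrier_mat r m"
    "C \<in> carrier_mat m r" "D \<in> carrier_mat m m" using block_cases[OF assms(1)] .
  show "levi_part r m p $$ (i, j) = (if (i < r) = (j < r) then p $$ (i, j) else 0)"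
    unfolding p levi_part_block[OF c] using c assms(2,3) by auto
qed

lemma parabolic_D:
  fixes p :: "'f::field mat"
  assumes "p \<in> parabolic r m"
  obtains A B D where "p = four_block_mat A B (0\<^sub>m m r) D"
    "A \<in> carrier (GL r)" "B \<in> carrier_mat r m" "D \<in> carrier (GL m)" "A \<in> carrier_mat r r" "D \<in> carrier_mat m m"
    "levi_part r m p = four_block_mat A (0\<^sub>m r m) (0\<^sub>m m r) D"
proof -
  obtain A B D where p: "p = four_block_mat A B (0\<^sub>m m r) D"
    "A \<in> carrier (GL r)" "B \<in> carrier_mat r m" "D \<in> carrier (GL m)"
    using assms unfolding parabolic_def by blast
  have c: "A \<in> carrier_mat r r" "D \<in> carrier_mat m m" using p GL_mat by auto
  show ?thesis using that[OF p c] levi_part_block[OF c(1) p(3) _ c(2), of "0\<^sub>m m r"] p(1) by simp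
qed

lemma levi_part_levi:
  assumes "p \<in> parabolic r m" shows "levi_part r m p \<in> levi r m"
  using assms by (rule parabolic_D) (auto simp: levi_def)

lemma levi_part_mult:
  fixes p q :: "'f::field mat"
  assumes "p \<in> parabolic r m" "q \<in> parabolic r m"
  shows "levi_part r m (p * q) = levi_part r m p * levi_part r m q" "p * q \<in> parabolic r m"
proof -
  obtain A B D where p: "p = four_block_mat A B (0\<^sub>m m r) D"
    "A \<in> carrier (GL r)" "B \<in> carrier_mat r m" "D \<in> carrier (GL m)" "A \<in> carrier_mat r r" "D \<in> carrier_mat m m"
    "levi_part r m p = four_block_mat A (0\<^sub>m r m) (0\<^sub>m m r) D" using parabolic_D[OF assms(1)] .
  obtain A' B' D' where q: "q = four_block_mat A' B' (0\<^sub>m m r) D'"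
    "A' \<in> carrier (GL r)" "B' \<in> carrier_mat r m" "D' \<in> carrier (GL m)" "A' \<in> carrier_mat r r" "D' \<in> carrier_mat m m"
    "levi_part r m q = four_block_mat A' (0\<^sub>m r m) (0\<^sub>m m r) D'" using parabolic_D[OF assms(2)] .
  have z: "0\<^sub>m m r * A' + D * 0\<^sub>m m r = 0\<^sub>m m r" "A * A' + B * 0\<^sub>m m r = A * A'" "0\<^sub>m m r * B' + D * D' = D * D'"
    "A * A' + 0\<^sub>m r m * 0\<^sub>m m r = A * A'" "A * 0\<^sub>m r m + 0\<^sub>m r m * D' = 0\<^sub>m r m" "0\<^sub>m m r * 0\<^sub>m r m + D * D' = D * D'"
    using p q by auto
  have pq: "p * q = four_block_mat (A * A') (A * B' + B * D') (0\<^sub>m m r) (D * D')"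
    unfolding p(1) q(1) mult_four_block_mat[OF p(5,3) zero_carrier_mat p(6) q(5,3) zero_carrier_mat q(6)] z ..
  have c: "A * A' \<in> carrier_mat r r" "A * B' + B * D' \<in> carrier_mat r m" "D * D' \<in> carrier_mat m m"
    using p q by (auto intro: add_carrier_mat)
  have "levi_part r m (p * q) = four_block_mat (A * A') (0\<^sub>m r m) (0\<^sub>m m r) (D * D')"
    unfolding pq using levi_part_block[OF c(1,2) zero_carrier_mat c(3)] .
  moreover have "levi_part r m p * levi_part r m q = four_block_mat (A * A') (0\<^sub>m r m) (0\<^sub>m m r) (D * D')"
    unfolding p(7) q(7) mult_four_block_mat[OF p(5) zero_carrier_mat zero_carrier_mat p(6) q(5) zero_carrier_mat zero_carrier_mat q(6)] z ..
  ultimately show "levi_part r m (p * q) = levi_part r m p * levi_part r m q" by simp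
  show "p * q \<in> parabolic r m" unfolding pq parabolic_def using GL_mult[OF p(2) q(2)] GL_mult[OF p(4) q(4)] c by blast
qed

lemma levi_part_one: "levi_part r m (1\<^sub>m (r + m)) = 1\<^sub>m (r + m)"
  using levi_part_block[OF one_carrier_mat zero_carrier_mat zero_carrier_mat one_carrier_mat, of r m] by simp

lemma parabolic_subgroup: "subgroup (parabolic r m) (GL (r + m) :: 'f::field mat monoid)"
proof -
  interpret group "GL (r + m) :: 'f mat monoid" by (rule GL_group)
  show ?thesis
  proof (rule subgroupI)
    show "parabolic r m \<subseteq> carrier (GL (r + m))" by (auto simp: parabolic_iff)
    show "parabolic r m \<noteq> {}"
    proof -
      have "1\<^sub>m (r + m) \<in> parabolic r m" unfolding parabolic_iff by (auto simp: GL_carrier)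
      then show ?thesis by auto
    qed
    fix p :: "'f mat" assume p': "p \<in> parabolic r m"
    obtain A B D where p: "p = four_block_mat A B (0\<^sub>m m r) D"
      "A \<in> carrier (GL r)" "B \<in> carrier_mat r m" "D \<in> carrier (GL m)" "A \<in> carrier_mat r r" "D \<in> carrier_mat m m"
      "levi_part r m p = four_block_mat A (0\<^sub>m r m) (0\<^sub>m m r) D" using parabolic_D[OF p'] .
    let ?A = "inv\<^bsub>GL r\<^esub> A" and ?D = "inv\<^bsub>GL m\<^esub> D"
    note A = GL_inv[OF p(2)] and D = GL_inv[OF p(4)]
    let ?B = "- (?A * B * ?D)"
    have Bc: "?B \<in> carrier_mat r m" using A D p by auto
    let ?q = "four_block_mat ?A ?B (0\<^sub>m m r) ?D"
    have "A * ?B + B * ?D = 0\<^sub>m r m"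
    proof -
      have "A * (?A * B * ?D) = A * (?A * B) * ?D" using A D p by (intro assoc_mult_mat[symmetric]) auto
      also have "A * (?A * B) = A * ?A * B" using A D p by (intro assoc_mult_mat[symmetric]) auto
      finally have "A * (?A * B * ?D) = B * ?D" using A p by simp
      moreover have "A * ?B = - (A * (?A * B * ?D))" using A D p by auto
      ultimately show ?thesis using D p by (intro eq_matI) auto
    qed
    moreover have "0\<^sub>m m r * ?B = 0\<^sub>m m m" using Bc by (rule left_mult_zero_mat)
    ultimately have "p * ?q = 1\<^sub>m (r + m)"
      unfolding p(1) mult_four_block_mat[OF p(5,3) zero_carrier_mat p(6) A(1) Bc zero_carrier_mat D(1)]
      using A D p(3,5,6) by (simp del: uminus_mult_right_mat)
    then have "inv\<^bsub>GL (r + m)\<^esub> p = ?q" 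
      using GL_I(2)[of p "r + m" ?q] four_block_carrier_mat[OF p(5,6), of B "0\<^sub>m m r"] p(1)
        four_block_carrier_mat[OF A(1) D(1), of ?B "0\<^sub>m m r"] by simp
    then show "inv\<^bsub>GL (r + m)\<^esub> p \<in> parabolic r m" unfolding parabolic_def
      by (intro CollectI exI[of _ ?A] exI[of _ ?B] exI[of _ ?D] conjI A(4) D(4) Bc)
  qed (use levi_part_mult(2) in auto)
qed

lemma (in abs_field) parabolic_closed: "closedin (GL_topology (r + m)) (parabolic r m :: 'f mat set)"
proof -
  have "parabolic r m = {g \<in> carrier (GL (r + m)). \<forall>i<r + m. \<forall>j<r + m. r \<le> i \<and> j < r \<longrightarrow> g $$ (i, j) = (0::'f)}"
    using parabolic_iff by blast
  then show ?thesis using closed_entries_zero[of "r + m" "\<lambda>i j. r \<le> i \<and> j < r"] by simp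
qed

lemma (in abs_field) levi_part_Congr:
  assumes "p \<in> Congr e (r + m)" "0 \<le> e" shows "levi_part r m p \<in> Congr e (r + m)"
proof -
  have p: "p \<in> carrier_mat (r + m) (r + m)" "entries_le e (p - 1\<^sub>m (r + m))" using assms unfolding Congr_def by auto
  have lc: "levi_part r m p \<in> carrier_mat (r + m) (r + m)" using levi_part_carrier[OF p(1)] .
  have "entries_le e (levi_part r m p - 1\<^sub>m (r + m))"
  proof (rule entries_leI[OF minus_carrier_mat[OF one_carrier_mat]])
    fix i j assume ij: "i < r + m" "j < r + m"
    have "v ((p - 1\<^sub>m (r + m)) $$ (i, j)) \<le> e" using entries_leD[OF p(2) minus_carrier_mat[OF one_carrier_mat] ij] .
    then show "v ((levi_part r m p - 1\<^sub>m (r + m)) $$ (i, j)) \<le> e"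
      using ij p(1) lc levi_part_entry[OF p(1) ij] assms(2) by auto
  qed
  then show ?thesis unfolding Congr_def using lc by simp
qed

text \<open>The unipotent radical of type (n, n), parametrized by n by n matrices.\<close>

definition un :: "nat \<Rightarrow> 'f::field mat \<Rightarrow> 'f mat" where
  "un n x = four_block_mat (1\<^sub>m n) x (0\<^sub>m n n) (1\<^sub>m n)"

lemma unip_eq: "unip n n = un n ` carrier_mat n n"
  unfolding unip_def un_def by auto

lemma un_carrier [simp]: "x \<in> carrier_mat n n \<Longrightarrow> un n x \<in> carrier_mat (n + n) (n + n)"
  unfolding un_def by auto

lemma un_mult:
  assumes "x \<in> carrier_mat n n" "y \<in> carrier_mat n n"
  shows "un n x * un n y = un n (x + y)"
  unfolding un_def mult_four_block_mat[OF one_carrier_mat assms(1) zero_carrier_mat one_carrier_mat one_carrier_mat assms(2) zero_carrier_mat one_carrier_mat]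
  using assms by (simp add: comm_add_mat)

lemma un_zero: "un n (0\<^sub>m n n) = 1\<^sub>m (n + n)"
  unfolding un_def by simp

lemma un_entry:
  assumes "x \<in> carrier_mat n n" "i < n + n" "j < n + n"
  shows "un n x $$ (i, j) = (if i < n \<and> n \<le> j then x $$ (i, j - n) else if i = j then 1 else 0)"
  using assms unfolding un_def by auto

lemma un_inv:
  fixes x :: "'f::field mat"
  assumes "x \<in> carrier_mat n n"
  shows "un n x * un n (- x) = 1\<^sub>m (n + n)" "un n x \<in> carrier (GL (n + n))" "inv\<^bsub>GL (n + n)\<^esub> (un n x) = un n (- x)"
proof -
  have "x + - x = 0\<^sub>m n n" using assms by (intro eq_matI) auto
  then show 1: "un n x * un n (- x) = 1\<^sub>m (n + n)" using un_mult[OF assms, of "- x"] assms un_zero[of n] by simp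
  show "un n x \<in> carrier (GL (n + n))" "inv\<^bsub>GL (n + n)\<^esub> (un n x) = un n (- x)"
    using GL_I[OF un_carrier[OF assms] un_carrier[of "- x"] 1] assms by auto
qed

lemma unip_subgroup: "subgroup (unip n n) (GL (n + n) :: 'f::field mat monoid)"
proof -
  interpret group "GL (n + n) :: 'f mat monoid" by (rule GL_group)
  show ?thesis unfolding unip_eq
  proof (rule subgroupI)
    show "un n ` carrier_mat n n \<subseteq> carrier (GL (n + n) :: 'f mat monoid)" using un_inv(2) by auto
    show "un n ` carrier_mat n n \<noteq> {}" using zero_carrier_mat by blast
    show "inv\<^bsub>GL (n + n)\<^esub> a \<in> un n ` carrier_mat n n" if "a \<in> un n ` carrier_mat n n" for a :: "'f mat"
    proof -
      obtain x where x: "a = un n x" "x \<in> carrier_mat n n" using \<open>a \<in> un n ` carrier_mat n n\<close> by auto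
      then show ?thesis using un_inv(3)[OF x(2)] by (intro image_eqI[of _ _ "- x"]) auto
    qed
    show "a \<otimes>\<^bsub>GL (n + n)\<^esub> b \<in> un n ` carrier_mat n n" if "a \<in> un n ` carrier_mat n n" "b \<in> un n ` carrier_mat n n" for a b :: "'f mat"
    proof -
      obtain x where x: "a = un n x" "x \<in> carrier_mat n n" using \<open>a \<in> un n ` carrier_mat n n\<close> by auto
      obtain y where y: "b = un n y" "y \<in> carrier_mat n n" using \<open>b \<in> un n ` carrier_mat n n\<close> by auto
      show ?thesis using un_mult[OF x(2) y(2)] x y by (intro image_eqI[of _ _ "x + y"]) auto
    qed
  qed
qed

lemma mat_trace_add:
  assumes "x \<in> carrier_mat n n" "y \<in> carrier_mat n n"
  shows "mat_trace (x + y) = mat_trace x + (mat_trace y :: 'f::field)"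
  using assms unfolding mat_trace_def by (simp add: sum.distrib)

lemma mat_trace_mult_commute:
  assumes "x \<in> carrier_mat n k" "y \<in> carrier_mat k n"
  shows "mat_trace (x * y) = (mat_trace (y * x) :: 'f::field)"
proof -
  have "mat_trace (x * y) = (\<Sum>i<n. \<Sum>t<k. x $$ (i, t) * y $$ (t, i))"
    using assms unfolding mat_trace_def by (intro sum.cong) (auto simp: mult_entry[OF assms] simp del: index_mult_mat(1))
  also have "\<dots> = (\<Sum>t<k. \<Sum>i<n. y $$ (t, i) * x $$ (i, t))" by (subst sum.swap) (simp add: mult.commute)
  also have "\<dots> = mat_trace (y * x)"
    using assms unfolding mat_trace_def by (intro sum.cong) (auto simp: mult_entry[OF assms(2,1)] simp del: index_mult_mat(1))
  finally show ?thesis .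
qed

lemma psi_N_un: "x \<in> carrier_mat n n \<Longrightarrow> psi_N \<psi>\<^sub>0 n (un n x) = \<psi>\<^sub>0 (mat_trace x)"
  unfolding un_def by (rule psi_N_unip)

context abs_field
begin

definition ball_N :: "nat \<Rightarrow> real \<Rightarrow> 'f mat set" where
  "ball_N n R = un n ` {x \<in> carrier_mat n n. entries_le R x}"

lemma ball_N_unip: "ball_N n R \<subseteq> unip n n"
  unfolding ball_N_def unip_eq by auto

lemma ball_N_mono: "R \<le> S \<Longrightarrow> ball_N n R \<subseteq> ball_N n S"
  unfolding ball_N_def using entries_le_mono by blast

lemma ball_N_subgroup:
  assumes "0 \<le> R" shows "subgroup (ball_N n R) (GL (n + n))"
proof -
  interpret group "GL (n + n) :: 'f mat monoid" by (rule GL_group)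
  show ?thesis
  proof (rule subgroupI)
    show "ball_N n R \<subseteq> carrier (GL (n + n))" unfolding ball_N_def using un_inv(2) by auto
    have "entries_le R (0\<^sub>m n n)" using assms unfolding entries_le_def by simp
    then show "ball_N n R \<noteq> {}" unfolding ball_N_def using zero_carrier_mat by blast
    show "inv\<^bsub>GL (n + n)\<^esub> a \<in> ball_N n R" if "a \<in> ball_N n R" for a
    proof -
      obtain x where x: "a = un n x" "x \<in> carrier_mat n n" "entries_le R x" using \<open>a \<in> ball_N n R\<close> unfolding ball_N_def by auto
      then show ?thesis using un_inv(3)[OF x(2)] entries_le_uminus[OF x(3)] unfolding ball_N_def by (intro image_eqI[of _ _ "- x"]) auto
    qed
    show "a \<otimes>\<^bsub>GL (n + n)\<^esub> b \<in> ball_N n R" if "a \<in> ball_N n R" "b \<in> ball_N n R" for a b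
    proof -
      obtain x where x: "a = un n x" "x \<in> carrier_mat n n" "entries_le R x" using \<open>a \<in> ball_N n R\<close> unfolding ball_N_def by auto
      obtain y where y: "b = un n y" "y \<in> carrier_mat n n" "entries_le R y" using \<open>b \<in> ball_N n R\<close> unfolding ball_N_def by auto
      show ?thesis using un_mult[OF x(2) y(2)] entries_le_add[OF x(3) y(3) x(2) y(2)] x y
        unfolding ball_N_def by (intro image_eqI[of _ _ "x + y"]) auto
    qed
  qed
qed

lemma det_un:
  assumes "x \<in> carrier_mat n n" shows "det (un n x) = (1 :: 'f)"
  unfolding un_def using det_four_block_mat_lower_left_zero[OF one_carrier_mat assms refl one_carrier_mat] by simp

lemma ball_N_compact:
  assumes R: "0 \<le> R" shows "compactin (GL_topology (n + n)) (ball_N n R)"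
proof -
  let ?E = "\<lambda>i j. if i < n \<and> n \<le> j then R else 0"
  have "ball_N n R = {g \<in> carrier_mat (n + n) (n + n). (\<forall>i<n + n. \<forall>j<n + n. v (g $$ (i, j) - 1\<^sub>m (n + n) $$ (i, j)) \<le> ?E i j) \<and> v (det g) = 1}"
  proof (intro equalityI subsetI)
    fix g assume "g \<in> ball_N n R"
    then obtain x where x: "g = un n x" "x \<in> carrier_mat n n" "entries_le R x" unfolding ball_N_def by auto
    have "v (g $$ (i, j) - 1\<^sub>m (n + n) $$ (i, j)) \<le> ?E i j" if ij: "i < n + n" "j < n + n" for i j
      using un_entry[OF x(2) ij] ij entries_leD[OF x(3,2), of i "j - n"] unfolding x(1) by auto
    then show "g \<in> {g \<in> carrier_mat (n + n) (n + n). (\<forall>i<n + n. \<forall>j<n + n. v (g $$ (i, j) - 1\<^sub>m (n + n) $$ (i, j)) \<le> ?E i j) \<and> v (det g) = 1}"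
      using det_un[OF x(2)] x by auto
  next
    fix g assume "g \<in> {g \<in> carrier_mat (n + n) (n + n). (\<forall>i<n + n. \<forall>j<n + n. v (g $$ (i, j) - 1\<^sub>m (n + n) $$ (i, j)) \<le> ?E i j) \<and> v (det g) = 1}"
    then have g: "g \<in> carrier_mat (n + n) (n + n)" "\<And>i j. i < n + n \<Longrightarrow> j < n + n \<Longrightarrow> v (g $$ (i, j) - 1\<^sub>m (n + n) $$ (i, j)) \<le> ?E i j" by auto
    define x where "x = Matrix.mat n n (\<lambda>(i, j). g $$ (i, n + j))"
    have xc: "x \<in> carrier_mat n n" unfolding x_def by simp
    have "entries_le R x"
    proof (rule entries_leI[OF xc])
      fix i j assume "i < n" "j < n"
      then show "v (x $$ (i, j)) \<le> R" using g(2)[of i "n + j"] unfolding x_def by auto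
    qed
    moreover have "g = un n x"
    proof (rule eq_matI)
      fix i j assume "i < dim_row (un n x)" "j < dim_col (un n x)"
      then have ij: "i < n + n" "j < n + n" using un_carrier[OF xc] by auto
      show "g $$ (i, j) = un n x $$ (i, j)"
      proof (cases "i < n \<and> n \<le> j")
        case True then show ?thesis unfolding un_entry[OF xc ij] using ij by (simp add: x_def)
      next
        case False
        then have "v (g $$ (i, j) - 1\<^sub>m (n + n) $$ (i, j)) \<le> 0" using g(2)[OF ij] by auto
        then have "g $$ (i, j) - 1\<^sub>m (n + n) $$ (i, j) = 0" using nonneg zero_iff by (metis antisym)
        then show ?thesis unfolding un_entry[OF xc ij] using False ij by auto
      qed
    qed (use g un_carrier[OF xc] in auto)
    ultimately show "g \<in> ball_N n R" unfolding ball_N_def using xc by blast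
  qed
  then show ?thesis using compact_pattern[of "1\<^sub>m (n + n)" "n + n" ?E] by simp
qed

lemma ball_N_exhausts:
  assumes "finite S" "S \<subseteq> unip n n"
  shows "\<exists>R\<ge>R0. 0 \<le> R \<and> S \<subseteq> ball_N n R"
  using assms
proof (induction S rule: finite_induct)
  case empty then show ?case by (intro exI[of _ "max R0 0"]) auto
next
  case (insert s S)
  then obtain R where R: "R \<ge> R0" "0 \<le> R" "S \<subseteq> ball_N n R" by auto
  obtain x where x: "x \<in> carrier_mat n n" "s = un n x" using insert(4) unfolding unip_eq by auto
  obtain R' where R': "1 \<le> R'" "entries_le R' x" using ex_entries_le by blast
  have "entries_le (max R R') x" by (rule entries_le_mono[OF R'(2)]) simp
  then have "s \<in> ball_N n (max R R')" unfolding ball_N_def x(2) using x(1) by blast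
  then show ?case using R ball_N_mono[of R "max R R'" n] by (intro exI[of _ "max R R'"]) auto
qed

lemma un_Congr:
  assumes "x \<in> carrier_mat n n" "0 \<le> e" shows "un n x \<in> Congr e (n + n) \<longleftrightarrow> entries_le e x"
proof
  assume "un n x \<in> Congr e (n + n)"
  then have m: "entries_le e (un n x - 1\<^sub>m (n + n))" unfolding Congr_def by auto
  show "entries_le e x"
  proof (rule entries_leI[OF assms(1)])
    fix i j assume ij: "i < n" "j < n"
    have "v ((un n x - 1\<^sub>m (n + n)) $$ (i, n + j)) \<le> e" using entries_leD[OF m minus_carrier_mat[OF one_carrier_mat], of i "n + j"] ij by simp
    then show "v (x $$ (i, j)) \<le> e" using un_entry[OF assms(1), of i "n + j"] ij un_carrier[OF assms(1)] by simp
  qed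
next
  assume m: "entries_le e x"
  have "entries_le e (un n x - 1\<^sub>m (n + n))"
  proof (rule entries_leI[OF minus_carrier_mat[OF one_carrier_mat]])
    fix i j assume ij: "i < n + n" "j < n + n"
    show "v ((un n x - 1\<^sub>m (n + n)) $$ (i, j)) \<le> e"
      using un_entry[OF assms(1) ij] ij entries_leD[OF m assms(1), of i "j - n"] assms(2) by auto
  qed
  then show "un n x \<in> Congr e (n + n)" unfolding Congr_def using un_carrier[OF assms(1)] by simp
qed

text \<open>An additive character is trivial near zero, because no nontrivial subgroup of the
  multiplicative group lies close to one: squaring pushes an element away from one.\<close>

lemma no_small_subgroup:
  fixes z :: complex
  assumes "\<And>k :: nat. norm (z ^ (2 ^ k) - 1) \<le> 1 / 2" shows "z = 1"
proof (rule ccontr)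
  assume "z \<noteq> 1"
  then have d: "0 < norm (z - 1)" by simp
  have "(3 / 2) ^ k * norm (z - 1) \<le> norm (z ^ (2 ^ k) - 1)" for k :: nat
  proof (induction k)
    case (Suc k)
    let ?w = "z ^ (2 ^ k)"
    have "z ^ (2 ^ Suc k) - 1 = (?w - 1) * (?w + 1)" by (simp add: power_mult[symmetric] algebra_simps power2_eq_square power_add[symmetric] mult_2)
    then have e: "norm (z ^ (2 ^ Suc k) - 1) = norm (?w - 1) * norm (?w + 1)" by (simp add: norm_mult)
    have "2 = norm ((?w + 1) - (?w - 1))" by simp
    also have "\<dots> \<le> norm (?w + 1) + norm (?w - 1)" by (rule norm_triangle_ineq4)
    finally have "3 / 2 \<le> norm (?w + 1)" using assms[of k] by simp
    then have "norm (?w - 1) * (3 / 2) \<le> norm (?w - 1) * norm (?w + 1)" by (intro mult_left_mono) auto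
    then show ?case using Suc e by simp
  qed simp
  moreover obtain k where "1 / norm (z - 1) < (3 / 2 :: real) ^ k" using real_arch_pow[of "3 / 2"] by auto
  then have "1 < (3 / 2) ^ k * norm (z - 1)" using d by (simp add: field_simps)
  ultimately show False using assms[of k] by (smt (verit) field_sum_of_halves)
qed

lemma character_locally_trivial:
  assumes "nontrivial_additive_character \<psi>"
  shows "\<exists>e>0. \<forall>x. v x \<le> e \<longrightarrow> \<psi> x = 1"
proof -
  have add: "\<And>x y. \<psi> (x + y) = \<psi> x * \<psi> y" and nz: "\<And>x. \<psi> x \<noteq> 0" and cont: "continuous_on UNIV \<psi>"
    using assms unfolding nontrivial_additive_character_def by auto
  have p0: "\<psi> 0 = 1" using add[of 0 0] nz[of 0] by simp
  have "open (\<psi> -` ball 1 (1 / 2) \<inter> UNIV)"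
    using iffD1[OF continuous_on_open_vimage[OF open_UNIV] cont] by simp
  then have "open (\<psi> -` ball 1 (1 / 2))" by simp
  moreover have "0 \<in> \<psi> -` ball 1 (1 / 2)" using p0 by simp
  ultimately obtain e where e: "e > 0" "\<And>y. v y < e \<Longrightarrow> \<psi> y \<in> ball 1 (1 / 2)"
    unfolding open_iff by (metis diff_zero vimageD)
  have "\<psi> x = 1" if x: "v x \<le> e / 2" for x
  proof (rule no_small_subgroup)
    fix k :: nat
    have pw: "\<psi> (of_nat j * x) = \<psi> x ^ j" for j :: nat
      by (induction j) (simp_all add: p0 add algebra_simps)
    have "v (of_nat j * x) \<le> e / 2" for j :: nat
    proof (induction j)
      case 0 then show ?case using e(1) by simp
    next
      case (Suc j) then show ?case using add_bound[OF x Suc] by (simp add: algebra_simps)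
    qed
    then have "\<psi> (of_nat (2 ^ k) * x) \<in> ball 1 (1 / 2)" using e by (intro e(2)) (smt (verit) field_sum_of_halves)
    then show "norm (\<psi> x ^ (2 ^ k) - 1) \<le> 1 / 2" unfolding pw by (simp add: dist_norm norm_minus_commute)
  qed
  then show ?thesis using e(1) by (intro exI[of _ "e / 2"]) auto
qed

end

section \<open>The induced representation and the orbit representatives\<close>

text \<open>With m in place of \<open>2n - r\<close> and \<open>n + n\<close> in place of \<open>2n\<close>, block decompositions match without
  arithmetic.\<close>

locale induced_setting = abs_field v for v :: "'f::{field,topological_space} \<Rightarrow> real" +
  fixes \<psi> :: "'f \<Rightarrow> complex" and n r m :: nat and \<rho> :: "('f mat, 'w::ab_group_add) rep"
  assumes \<psi>: "nontrivial_additive_character \<psi>"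
    and rm: "r + m = n + n"
    and \<rho>: "smooth_rep (subgrp (GL (n + n)) (levi r m)) (subtopology (GL_topology (n + n)) (levi r m)) \<rho>"
begin

lemmas assoc_n = assoc_mult_mat[of _ n n _ n _ n]
  and assoc_2n = assoc_mult_mat[of _ "n + n" "n + n" _ "n + n" _ "n + n"]

abbreviation P where "P \<equiv> parabolic r m :: 'f mat set"

lemma P_iff: "p \<in> P \<longleftrightarrow> p \<in> carrier (GL (n + n)) \<and> (\<forall>i<n + n. \<forall>j<n + n. r \<le> i \<and> j < r \<longrightarrow> p $$ (i, j) = 0)"
  using parabolic_iff[of p r m] rm by simp

lemma P_carrier: "p \<in> P \<Longrightarrow> p \<in> carrier_mat (n + n) (n + n)"
  unfolding P_iff using GL_mat by auto

lemma \<psi>_add: "\<psi> (x + y) = \<psi> x * \<psi> y" and \<psi>_nz: "\<psi> x \<noteq> 0" and \<psi>_nontrivial: "\<exists>x. \<psi> x \<noteq> 1"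
  using \<psi> unfolding nontrivial_additive_character_def by auto

lemma inflate_simps [simp]: "rep_scale (inflate r m \<rho>) = rep_scale \<rho>" "rep_space (inflate r m \<rho>) = rep_space \<rho>"
  "rep_act (inflate r m \<rho>) p = rep_act \<rho> (levi_part r m p)"
  unfolding inflate_def by simp_all

lemma \<rho>_linear: "linear_rep (subgrp (GL (n + n)) (levi r m)) \<rho>"
  using smooth_rep_linear[OF \<rho>] .

lemma levi_one: "levi_part r m (1\<^sub>m (n + n)) = (1\<^sub>m (n + n) :: 'f mat)"
  using levi_part_one[of r m] rm by metis

lemma inflate_linear: "linear_rep (subgrp (GL (n + n)) P) (inflate r m \<rho>)"
  unfolding linear_rep_def
proof (intro conjI ballI allI)
  show "vector_space (rep_scale (inflate r m \<rho>))" "module.subspace (rep_scale (inflate r m \<rho>)) (rep_space (inflate r m \<rho>))"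
    using linear_repD(1,3)[OF \<rho>_linear] by auto
  fix w assume w: "w \<in> rep_space (inflate r m \<rho>)"
  show "rep_act (inflate r m \<rho>) \<one>\<^bsub>subgrp (GL (n + n)) P\<^esub> w = w"
    using linear_repD(7)[OF \<rho>_linear, of w] w by (simp add: levi_one)
  fix p assume p: "p \<in> carrier (subgrp (GL (n + n)) P)"
  then have l: "levi_part r m p \<in> levi r m" using levi_part_levi by auto
  show "rep_act (inflate r m \<rho>) p w \<in> rep_space (inflate r m \<rho>)"
    using linear_repD(4)[OF \<rho>_linear] l w by simp
  show "rep_act (inflate r m \<rho>) p (rep_scale (inflate r m \<rho>) c w) = rep_scale (inflate r m \<rho>) c (rep_act (inflate r m \<rho>) p w)" for c
    using linear_repD(6)[OF \<rho>_linear] l w by simp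
  show "rep_act (inflate r m \<rho>) p (w + w') = rep_act (inflate r m \<rho>) p w + rep_act (inflate r m \<rho>) p w'"
    if "w' \<in> rep_space (inflate r m \<rho>)" for w'
    using linear_repD(5)[OF \<rho>_linear] l w that by simp
  show "rep_act (inflate r m \<rho>) (p \<otimes>\<^bsub>subgrp (GL (n + n)) P\<^esub> q) w = rep_act (inflate r m \<rho>) p (rep_act (inflate r m \<rho>) q w)"
    if q: "q \<in> carrier (subgrp (GL (n + n)) P)" for q
  proof -
    have "levi_part r m q \<in> levi r m" using q levi_part_levi by auto
    then show ?thesis using linear_repD(8)[OF \<rho>_linear, of "levi_part r m p" "levi_part r m q" w] l w
        levi_part_mult(1)[of p r m q] p q by simp
  qed
qed

lemma smooth_small:
  assumes w: "w \<in> rep_space \<rho>"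
  shows "\<exists>e. 0 < e \<and> e < 1 \<and> (\<forall>p\<in>P \<inter> Congr e (n + n). rep_act \<rho> (levi_part r m p) w = w)"
proof -
  have "openin (subtopology (GL_topology (n + n)) (levi r m)) {g \<in> levi r m. rep_act \<rho> g w = w}"
    using \<rho> w unfolding smooth_rep_def by simp
  then obtain W where W: "openin (GL_topology (n + n)) W" "{g \<in> levi r m. rep_act \<rho> g w = w} = W \<inter> levi r m"
    unfolding openin_subtopology by blast
  have "1\<^sub>m (n + n) \<in> P" by (auto simp: P_iff GL_carrier)
  then have "(1\<^sub>m (n + n) :: 'f mat) \<in> levi r m"
    using levi_part_levi[of "1\<^sub>m (n + n) :: 'f mat" r m] by (simp add: levi_one)
  moreover have "rep_act \<rho> (1\<^sub>m (n + n)) w = w" using linear_repD(7)[OF \<rho>_linear w] by simp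
  ultimately have "1\<^sub>m (n + n) \<in> W" using W(2) by blast
  then obtain e where e: "0 < e" "e < 1" "Congr e (n + n) \<subseteq> W" using Congr_small[OF W(1)] by blast
  have "rep_act \<rho> (levi_part r m p) w = w" if p: "p \<in> P" "p \<in> Congr e (n + n)" for p
  proof -
    have "levi_part r m p \<in> Congr e (n + n)" using levi_part_Congr[of p e r m] p e(1) rm by simp
    then have "levi_part r m p \<in> W \<inter> levi r m" using e(3) levi_part_levi[OF p(1)] by blast
    then show ?thesis using W(2) by blast
  qed
  then show ?thesis using e by blast
qed

lemma trace_bound: "x \<in> carrier_mat n n \<Longrightarrow> entries_le e x \<Longrightarrow> 0 \<le> e \<Longrightarrow> v (mat_trace x) \<le> e"
  unfolding mat_trace_def by (intro sum_bound) (auto intro: entries_leD)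

lemma \<psi>_small: "\<exists>e. 0 < e \<and> e < 1 \<and> (\<forall>x. v x \<le> e \<longrightarrow> \<psi> x = 1)"
proof -
  obtain d where d: "d > 0" "\<forall>x. v x \<le> d \<longrightarrow> \<psi> x = 1" using character_locally_trivial[OF \<psi>] by blast
  then show ?thesis by (intro exI[of _ "min d (1 / 2)"]) auto
qed

lemma psi_N_Congr:
  assumes "\<forall>x. v x \<le> e \<longrightarrow> \<psi> x = 1" "0 \<le> e" "u \<in> unip n n" "u \<in> Congr e (n + n)"
  shows "psi_N \<psi> n u = 1"
proof -
  obtain x where x: "x \<in> carrier_mat n n" "u = un n x" using assms(3) unfolding unip_eq by auto
  then show ?thesis using un_Congr[OF x(1) assms(2)] assms trace_bound[OF x(1)] psi_N_un[OF x(1)] by auto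
qed

sublocale td: twisted_datum "GL (n + n)" "GL_topology (n + n)" P "inflate r m \<rho>" "unip n n" "psi_N \<psi> n"
proof (intro twisted_datum.intro induction_datum.intro twisted_datum_axioms.intro induction_datum_axioms.intro)
  show "lgroup (GL (n + n)) (GL_topology (n + n) :: 'f mat topology)" by (rule GL_lgroup)
  show "subgroup P (GL (n + n))" using parabolic_subgroup[of r m] rm by simp
  show "closedin (GL_topology (n + n)) P" using parabolic_closed[of r m] rm by simp
  show "linear_rep (subgrp (GL (n + n)) P) (inflate r m \<rho>)" by (rule inflate_linear)
  show "subgroup (unip n n) (GL (n + n) :: 'f mat monoid)" by (rule unip_subgroup)
next
  fix x y :: "'f mat" assume "x \<in> unip n n" "y \<in> unip n n"
  then obtain a b where ab: "a \<in> carrier_mat n n" "x = un n a" "b \<in> carrier_mat n n" "y = un n b" unfolding unip_eq by auto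
  show "x \<otimes>\<^bsub>GL (n + n)\<^esub> y = y \<otimes>\<^bsub>GL (n + n)\<^esub> x"
    using un_mult[OF ab(1,3)] un_mult[OF ab(3,1)] ab comm_add_mat[OF ab(1,3)] by simp
  show "psi_N \<psi> n (x \<otimes>\<^bsub>GL (n + n)\<^esub> y) = psi_N \<psi> n x * psi_N \<psi> n y"
    using un_mult[OF ab(1,3)] ab by (simp add: psi_N_un mat_trace_add \<psi>_add)
  show "psi_N \<psi> n x \<noteq> 0" using ab \<psi>_nz by (simp add: psi_N_un)
next
  fix S :: "'f mat set" assume "finite S" "S \<subseteq> unip n n"
  then obtain R where "0 \<le> R" "S \<subseteq> ball_N n R" using ball_N_exhausts[of S n 0] by blast
  then show "\<exists>A. subgroup A (GL (n + n)) \<and> compactin (GL_topology (n + n)) A \<and> S \<subseteq> A \<and> A \<subseteq> unip n n"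
    using ball_N_subgroup ball_N_compact ball_N_unip by blast
next
  obtain e where e: "0 < e" "e < 1" "\<forall>x. v x \<le> e \<longrightarrow> \<psi> x = 1" using \<psi>_small by blast
  show "\<exists>K. subgroup K (GL (n + n)) \<and> openin (GL_topology (n + n)) K \<and> (\<forall>x\<in>unip n n \<inter> K. psi_N \<psi> n x = 1)"
    using Congr_subgroup[of e "n + n"] Congr_open[of e "n + n"] psi_N_Congr[OF e(3)] e(1,2)
    by (intro exI[of _ "Congr e (n + n)"]) auto
next
  fix w assume "w \<in> rep_space (inflate r m \<rho>)"
  then obtain e where e: "0 < e" "e < 1" "\<forall>p\<in>P \<inter> Congr e (n + n). rep_act \<rho> (levi_part r m p) w = w"
    using smooth_small[of w] by auto
  then show "\<exists>K. subgroup K (GL (n + n)) \<and> openin (GL_topology (n + n)) K \<and> (\<forall>p\<in>P \<inter> K. rep_act (inflate r m \<rho>) p w = w)"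
    using Congr_subgroup[of e "n + n"] Congr_open[of e "n + n"] by (intro exI[of _ "Congr e (n + n)"]) auto
qed

text \<open>The permutation that exchanges the two adjacent middle blocks of sizes r - k and n - k. The rows
  of \<open>g\<^sub>0\<close> from r on span the direct sum of A, the last n - k coordinates of the first copy of
  \<open>F\<^sup>n\<close>, and B, the last n + k - r coordinates of the second copy.\<close>

definition sg :: "nat \<Rightarrow> nat \<Rightarrow> nat" where
  "sg k i = (if i < k \<or> r + n - k \<le> i then i else if i < r then n + (i - k) else k + (i - r))"

definition tg :: "nat \<Rightarrow> nat \<Rightarrow> nat" where
  "tg k j = (if j < k \<or> r + n - k \<le> j then j else if j < n then r + (j - k) else k + (j - n))"

definition admissible :: "nat \<Rightarrow> bool" where
  "admissible k \<longleftrightarrow> k \<le> n \<and> k \<le> r \<and> r \<le> n + k"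

definition g0 :: "nat \<Rightarrow> 'f mat" where "g0 k = perm_mat (n + n) (sg k)"

lemma sg_tg:
  assumes "admissible k" shows "inv_pair (n + n) (sg k) (tg k)"
  unfolding inv_pair_def
proof (intro allI impI)
  fix i assume i: "i < n + n"
  have k: "k \<le> n" "k \<le> r" "r \<le> n + k" using assms unfolding admissible_def by auto
  have s: "sg k i < n + n \<and> tg k (sg k i) = i"
  proof -
    consider (a) "i < k \<or> r + n - k \<le> i" | (b) "k \<le> i" "i < r" "i < r + n - k" | (c) "r \<le> i" "k \<le> i" "i < r + n - k"
      using k by linarith
    then show ?thesis
    proof cases
      case a then show ?thesis using i unfolding sg_def tg_def by simp
    next
      case b
      then have e: "sg k i = n + (i - k)" unfolding sg_def by simp
      have d: "\<not> n + (i - k) < k" "\<not> r + n - k \<le> n + (i - k)" "\<not> n + (i - k) < n" "n + (i - k) < n + n" using b k i by linarith+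
      then have "tg k (n + (i - k)) = k + (n + (i - k) - n)" unfolding tg_def by (simp only: if_False disj_not1) simp
      then show ?thesis unfolding e using d b by simp
    next
      case c
      then have e: "sg k i = k + (i - r)" unfolding sg_def by simp
      have d: "\<not> k + (i - r) < k" "\<not> r + n - k \<le> k + (i - r)" "k + (i - r) < n" "k + (i - r) < n + n" using c k i by linarith+
      then have "tg k (k + (i - r)) = r + (k + (i - r) - k)" unfolding tg_def by simp
      then show ?thesis unfolding e using d c by simp
    qed
  qed
  have t: "tg k i < n + n \<and> sg k (tg k i) = i"
  proof -
    consider (a) "i < k \<or> r + n - k \<le> i" | (b) "k \<le> i" "i < n" "i < r + n - k" | (c) "n \<le> i" "k \<le> i" "i < r + n - k"
      using k by linarith
    then show ?thesis
    proof cases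
      case a then show ?thesis using i unfolding sg_def tg_def by simp
    next
      case b
      then have e: "tg k i = r + (i - k)" unfolding tg_def by simp
      have d: "\<not> r + (i - k) < k" "\<not> r + n - k \<le> r + (i - k)" "\<not> r + (i - k) < r" "r + (i - k) < n + n" using b k i by linarith+
      then have "sg k (r + (i - k)) = k + (r + (i - k) - r)" unfolding sg_def by (simp only: if_False disj_not1) simp
      then show ?thesis unfolding e using d b by simp
    next
      case c
      then have e: "tg k i = k + (i - n)" unfolding tg_def by simp
      have d: "\<not> k + (i - n) < k" "\<not> r + n - k \<le> k + (i - n)" "k + (i - n) < r" "k + (i - n) < n + n" using c k i by linarith+
      then have "sg k (k + (i - n)) = n + (k + (i - n) - k)" unfolding sg_def by simp
      then show ?thesis unfolding e using d c by simp
    qed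
  qed
  show "sg k i < n + n \<and> tg k i < n + n \<and> tg k (sg k i) = i \<and> sg k (tg k i) = i" using s t by simp
qed

lemma g0_inverse:
  assumes "admissible k"
  shows "g0 k \<in> carrier_mat (n + n) (n + n)" "g0 k \<in> GLO (n + n)" "perm_mat (n + n) (tg k) \<in> GLO (n + n)"
    "g0 k * perm_mat (n + n) (tg k) = 1\<^sub>m (n + n)"
    "g0 k \<in> carrier (GL (n + n))" "inv\<^bsub>GL (n + n)\<^esub> (g0 k) = perm_mat (n + n) (tg k)"
  using GL_I[OF perm_mat_carrier perm_mat_carrier perm_mat_inverse[OF sg_tg[OF assms]]]
    perm_mat_GLO[OF sg_tg[OF assms]] perm_mat_GLO[OF inv_pair_sym[OF sg_tg[OF assms]]]
    perm_mat_inverse[OF sg_tg[OF assms]]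
  unfolding g0_def by auto

lemma g0_conj:
  assumes k: "admissible k" and X: "X \<in> carrier_mat (n + n) (n + n)"
  shows "g0 k * X * inv\<^bsub>GL (n + n)\<^esub> (g0 k) = Matrix.mat (n + n) (n + n) (\<lambda>(i, j). X $$ (sg k i, sg k j))"
proof -
  note s = sg_tg[OF k]
  let ?Y = "Matrix.mat (n + n) (n + n) (\<lambda>(i, j). X $$ (sg k i, j))"
  have Y: "g0 k * X = ?Y" unfolding g0_def by (rule perm_mult_left[OF X s])
  have "?Y * perm_mat (n + n) (tg k) = Matrix.mat (n + n) (n + n) (\<lambda>(i, j). ?Y $$ (i, sg k j))"
    by (rule perm_mult_right[OF _ inv_pair_sym[OF s]]) simp
  also have "\<dots> = Matrix.mat (n + n) (n + n) (\<lambda>(i, j). X $$ (sg k i, sg k j))"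
    using s unfolding inv_pair_def by (intro eq_matI) auto
  finally show ?thesis unfolding Y g0_inverse(6)[OF k] .
qed

text \<open>The x with \<open>A x \<subseteq> B\<close>, which parametrize the stabilizer of the orbit representative.\<close>

definition Dk :: "nat \<Rightarrow> 'f mat set" where
  "Dk k = {x \<in> carrier_mat n n. \<forall>l<n. \<forall>c<n. k \<le> l \<and> c < r - k \<longrightarrow> x $$ (l, c) = 0}"

definition cj :: "nat \<Rightarrow> 'f mat \<Rightarrow> 'f mat" where
  "cj k x = g0 k * un n x * inv\<^bsub>GL (n + n)\<^esub> (g0 k)"

lemma cj_entry:
  assumes k: "admissible k" and x: "x \<in> carrier_mat n n" and ij: "i < n + n" "j < n + n"
  shows "cj k x $$ (i, j) = (if sg k i < n \<and> n \<le> sg k j then x $$ (sg k i, sg k j - n) else if i = j then 1 else 0)"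
proof -
  have s: "sg k i < n + n" "sg k j < n + n" "sg k i = sg k j \<longleftrightarrow> i = j"
    using sg_tg[OF k] ij unfolding inv_pair_def by metis+
  show ?thesis unfolding cj_def g0_conj[OF k un_carrier[OF x]] using ij un_entry[OF x s(1,2)] s(3)
    by (cases "sg k i < n \<and> n \<le> sg k j") auto
qed

lemma cj_GL: "admissible k \<Longrightarrow> x \<in> carrier_mat n n \<Longrightarrow> cj k x \<in> carrier (GL (n + n))"
  unfolding cj_def using g0_inverse(5)[of k] un_inv(2)[of x n] by (intro GL_mult GL_inv(4))

lemma cj_P:
  assumes k: "admissible k" and x: "x \<in> carrier_mat n n"
  shows "cj k x \<in> P \<longleftrightarrow> x \<in> Dk k"
proof
  assume a: "cj k x \<in> P"
  have "x $$ (l, c) = 0" if lc: "l < n" "c < n" "k \<le> l" "c < r - k" for l c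
  proof -
    let ?i = "r + (l - k)" and ?j = "k + c"
    have i: "sg k ?i = l" "?i < n + n" "r \<le> ?i" and j: "sg k ?j = n + c" "?j < n + n" "?j < r"
      using k lc unfolding sg_def admissible_def by auto
    have "cj k x $$ (?i, ?j) = x $$ (l, c)" unfolding cj_entry[OF k x i(2) j(2)] i(1) j(1) using lc by simp
    then show ?thesis using a i j unfolding P_iff by auto
  qed
  then show "x \<in> Dk k" unfolding Dk_def using x by blast
next
  assume a: "x \<in> Dk k"
  have "cj k x $$ (i, j) = 0" if ij: "i < n + n" "j < n + n" "r \<le> i" "j < r" for i j
  proof (cases "sg k i < n \<and> n \<le> sg k j")
    case True
    then have "sg k i = k + (i - r)" "sg k j = n + (j - k)" "k + (i - r) < n" "j - k < r - k"
      using k ij unfolding sg_def admissible_def by (auto split: if_splits)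
    moreover have "j - k < n" using calculation k ij unfolding admissible_def by auto
    ultimately have "x $$ (sg k i, sg k j - n) = 0" using a unfolding Dk_def by auto
    then show ?thesis unfolding cj_entry[OF k x ij(1,2)] using True by simp
  qed (use ij in \<open>auto simp: cj_entry[OF k x ij(1,2)]\<close>)
  then show "cj k x \<in> P" unfolding P_iff using cj_GL[OF k x] by auto
qed

lemma Stab_g0:
  assumes k: "admissible k" shows "td.Stab (g0 k) = un n ` Dk k"
proof -
  have "un n x \<in> td.Stab (g0 k) \<longleftrightarrow> x \<in> Dk k" if x: "x \<in> carrier_mat n n" for x
  proof -
    have "un n x \<in> unip n n" using x unfolding unip_eq by blast
    then show ?thesis unfolding td.Stab_def using cj_P[OF k x] unfolding cj_def by simp
  qed
  moreover have "td.Stab (g0 k) \<subseteq> unip n n" unfolding td.Stab_def by auto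
  then have "td.Stab (g0 k) \<subseteq> un n ` carrier_mat n n" unfolding unip_eq .
  moreover have "Dk k \<subseteq> carrier_mat n n" unfolding Dk_def by auto
  ultimately show ?thesis by blast
qed

end

section \<open>The stalks that contribute\<close>

lemma unit_block_entry:
  assumes "B \<in> carrier_mat p q" "i < p + q" "j < p + q"
  shows "four_block_mat (1\<^sub>m p) B (0\<^sub>m q p) (1\<^sub>m q) $$ (i, j)
    = (if i < p \<and> p \<le> j then B $$ (i, j - p) else if i = j then 1 else 0)"
  using assms by auto

lemma append_cols_entry:
  assumes "x \<in> carrier_mat k p" "y \<in> carrier_mat k q" "i < k" "j < p + q"
  shows "append_cols x y $$ (i, j) = (if j < p then x $$ (i, j) else y $$ (i, j - p))"
    "append_cols x y \<in> carrier_mat k (p + q)"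
  using assms unfolding append_cols_def by auto

lemma append_rows_entry:
  assumes "w \<in> carrier_mat p t" "z \<in> carrier_mat q t" "i < p + q" "j < t"
  shows "append_rows w z $$ (i, j) = (if i < p then w $$ (i, j) else z $$ (i - p, j))"
  using assms unfolding append_rows_def by auto

context induced_setting
begin

lemma nk_carrier:
  assumes k: "2 * k \<le> r" "r \<le> n + k"
    and x: "x \<in> carrier_mat k k" and y: "y \<in> carrier_mat k (r - 2*k)"
    and w: "w \<in> carrier_mat (r - 2*k) (n + k - r)" and z: "z \<in> carrier_mat (n + k - r) (n + k - r)"
  shows "nk_mat n r k x y w z \<in> carrier_mat (n + n) (n + n)"
proof -
  have a: "k + (r - k) = r" "n - k + (n + k - r) = 2 * n - r" "r + (2 * n - r) = n + n"
    using k rm by auto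
  let ?T = "four_block_mat (1\<^sub>m k) (append_cols x y) (0\<^sub>m (r - k) k) (1\<^sub>m (r - k))"
  let ?B = "four_block_mat (1\<^sub>m (n - k)) (append_rows w z) (0\<^sub>m (n + k - r) (n - k)) (1\<^sub>m (n + k - r))"
  have "?T \<in> carrier_mat (k + (r - k)) (k + (r - k))" "?B \<in> carrier_mat (n - k + (n + k - r)) (n - k + (n + k - r))"
    by (rule four_block_carrier_mat; simp)+
  then have T: "?T \<in> carrier_mat r r" and B: "?B \<in> carrier_mat (2*n - r) (2*n - r)" unfolding a(1,2) by auto
  show ?thesis unfolding nk_mat_def using four_block_carrier_mat[OF T B] unfolding a(3) .
qed

lemma nk_entry:
  assumes k: "2 * k \<le> r" "r \<le> n + k"
    and x: "x \<in> carrier_mat k k" and y: "y \<in> carrier_mat k (r - 2*k)"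
    and w: "w \<in> carrier_mat (r - 2*k) (n + k - r)" and z: "z \<in> carrier_mat (n + k - r) (n + k - r)"
    and ij: "i < n + n" "j < n + n"
  shows "nk_mat n r k x y w z $$ (i, j) =
    (if i < k \<and> k \<le> j \<and> j < r then if j - k < k then x $$ (i, j - k) else y $$ (i, j - k - k)
     else if r \<le> i \<and> i < r + (n - k) \<and> r + (n - k) \<le> j then
       if i - r < r - 2*k then w $$ (i - r, j - r - (n - k)) else z $$ (i - r - (r - 2*k), j - r - (n - k))
     else if i = j then 1 else 0)"
proof -
  have a: "k + (r - k) = r" "n - k + (n + k - r) = 2 * n - r" "r + (2 * n - r) = n + n"
    using k rm by auto
  let ?T = "four_block_mat (1\<^sub>m k) (append_cols x y) (0\<^sub>m (r - k) k) (1\<^sub>m (r - k))"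
  let ?B = "four_block_mat (1\<^sub>m (n - k)) (append_rows w z) (0\<^sub>m (n + k - r) (n - k)) (1\<^sub>m (n + k - r))"
  have b: "k + (r - 2*k) = r - k" "(r - 2*k) + (n + k - r) = n - k" using k by auto
  have ac: "append_cols x y \<in> carrier_mat k (r - k)" unfolding append_cols_def b(1)[symmetric] using x y by auto
  have ar: "append_rows w z \<in> carrier_mat (n - k) (n + k - r)" unfolding b(2)[symmetric] using w z by (rule carrier_append_rows)
  have "?T \<in> carrier_mat (k + (r - k)) (k + (r - k))" "?B \<in> carrier_mat (n - k + (n + k - r)) (n - k + (n + k - r))"
    by (rule four_block_carrier_mat; simp)+
  then have T: "?T \<in> carrier_mat r r" and B: "?B \<in> carrier_mat (2*n - r) (2*n - r)" unfolding a(1,2) by auto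
  have Te: "?T $$ (i, j) = (if i < k \<and> k \<le> j then if j - k < k then x $$ (i, j - k) else y $$ (i, j - k - k) else if i = j then 1 else 0)"
    if ij: "i < r" "j < r" for i j
  proof -
    have "?T $$ (i, j) = (if i < k \<and> k \<le> j then append_cols x y $$ (i, j - k) else if i = j then 1 else 0)"
      by (rule unit_block_entry[OF ac]) (use ij a(1) in simp_all)
    moreover have "append_cols x y $$ (i, j - k) = (if j - k < k then x $$ (i, j - k) else y $$ (i, j - k - k))" if "i < k" "k \<le> j"
      by (rule append_cols_entry(1)[OF x y that(1)]) (use that ij b(1) in linarith)
    ultimately show ?thesis by (cases "i < k \<and> k \<le> j") auto
  qed
  have Be: "?B $$ (i, j) = (if i < n - k \<and> n - k \<le> j then if i < r - 2*k then w $$ (i, j - (n - k)) else z $$ (i - (r - 2*k), j - (n - k)) else if i = j then 1 else 0)"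
    if ij: "i < 2*n - r" "j < 2*n - r" for i j
  proof -
    have "?B $$ (i, j) = (if i < n - k \<and> n - k \<le> j then append_rows w z $$ (i, j - (n - k)) else if i = j then 1 else 0)"
      by (rule unit_block_entry[OF ar]) (use ij a(2) in simp_all)
    moreover have "append_rows w z $$ (i, j - (n - k)) = (if i < r - 2*k then w $$ (i, j - (n - k)) else z $$ (i - (r - 2*k), j - (n - k)))" if "i < n - k" "n - k \<le> j"
      by (rule append_rows_entry[OF w z]) (use that ij b(2) a(2) in linarith)+
    ultimately show ?thesis by (cases "i < n - k \<and> n - k \<le> j") auto
  qed
  have e: "nk_mat n r k x y w z $$ (i, j) = (if i < r then if j < r then ?T $$ (i, j) else 0
      else if j < r then 0 else ?B $$ (i - r, j - r))"
  proof -
    have d: "dim_row ?T = r" "dim_col ?T = r" "dim_row ?B = 2*n - r" "dim_col ?B = 2*n - r" using T B by (simp_all only: carrier_matD)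
    have l: "i < dim_row ?T + dim_row ?B" "j < dim_col ?T + dim_col ?B" unfolding d a(3) using ij by auto
    have "i - r < 2*n - r" "j - r < 2*n - r" if "\<not> i < r \<or> \<not> j < r" "r \<le> i" "r \<le> j" using that ij by auto
    then show ?thesis unfolding nk_mat_def index_mat_four_block(1)[OF l] d
      using ij by (auto simp del: index_mat_four_block)
  qed
  show "nk_mat n r k x y w z $$ (i, j) =
    (if i < k \<and> k \<le> j \<and> j < r then if j - k < k then x $$ (i, j - k) else y $$ (i, j - k - k)
     else if r \<le> i \<and> i < r + (n - k) \<and> r + (n - k) \<le> j then
       if i - r < r - 2*k then w $$ (i - r, j - r - (n - k)) else z $$ (i - r - (r - 2*k), j - r - (n - k))
     else if i = j then 1 else 0)"
  proof (cases "i < r")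
    case True
    show ?thesis
    proof (cases "j < r")
      case j: True
      show ?thesis unfolding e Te[OF True j] using True j by (cases "i < k \<and> k \<le> j") auto
    next
      case False
      have "i \<noteq> j" "\<not> r \<le> i" using True False by auto
      then show ?thesis unfolding e using True False by simp
    qed
  next
    case False
    show ?thesis
    proof (cases "j < r")
      case True
      have "i \<noteq> j" "\<not> i < k" "\<not> r + (n - k) \<le> j" using False True k by auto
      then show ?thesis unfolding e using True False by simp
    next
      case j: False
      have l: "i - r < 2*n - r" "j - r < 2*n - r" using False j ij by auto
      have c: "i - r < n - k \<longleftrightarrow> i < r + (n - k)" "n - k \<le> j - r \<longleftrightarrow> r + (n - k) \<le> j" "i - r = j - r \<longleftrightarrow> i = j" "r \<le> i" "\<not> i < k"
        using False j k by linarith+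
      show ?thesis unfolding e Be[OF l] c(1-3) using False j c(4,5)
        by (cases "i < r + (n - k) \<and> r + (n - k) \<le> j") auto
    qed
  qed
qed

text \<open>The four blocks of x that survive in the Levi component of the conjugate are the four blocks of an element
  of \<open>N'\<^sub>k\<close>; the remaining one ends up in the unipotent radical.\<close>

lemma levi_cj_nk:
  assumes k: "2 * k \<le> r" "r \<le> n + k" and X: "X \<in> Dk k"
  shows "levi_part r m (cj k X) = nk_mat n r k
    (Matrix.mat k k (\<lambda>(i, j). X $$ (i, j))) (Matrix.mat k (r - 2*k) (\<lambda>(i, j). X $$ (i, k + j)))
    (Matrix.mat (r - 2*k) (n + k - r) (\<lambda>(i, j). X $$ (k + i, r - k + j)))
    (Matrix.mat (n + k - r) (n + k - r) (\<lambda>(i, j). X $$ (r - k + i, r - k + j)))" (is "_ = ?R")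
proof -
  have ad: "admissible k" using k unfolding admissible_def by auto
  have Xc: "X \<in> carrier_mat n n" using X unfolding Dk_def by auto
  have c: "cj k X \<in> carrier_mat (r + m) (r + m)" using cj_GL[OF ad Xc] GL_mat rm by auto
  have R: "?R \<in> carrier_mat (n + n) (n + n)" and Re: "\<And>i j. i < n + n \<Longrightarrow> j < n + n \<Longrightarrow> ?R $$ (i, j) = 
    (if i < k \<and> k \<le> j \<and> j < r then if j - k < k then Matrix.mat k k (\<lambda>(i, j). X $$ (i, j)) $$ (i, j - k) else Matrix.mat k (r - 2*k) (\<lambda>(i, j). X $$ (i, k + j)) $$ (i, j - k - k)
     else if r \<le> i \<and> i < r + (n - k) \<and> r + (n - k) \<le> j then
       if i - r < r - 2*k then Matrix.mat (r - 2*k) (n + k - r) (\<lambda>(i, j). X $$ (k + i, r - k + j)) $$ (i - r, j - r - (n - k)) else Matrix.mat (n + k - r) (n + k - r) (\<lambda>(i, j). X $$ (r - k + i, r - k + j)) $$ (i - r - (r - 2*k), j - r - (n - k))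
     else if i = j then 1 else 0)"
    by (rule nk_carrier[OF k mat_carrier mat_carrier mat_carrier mat_carrier],
        rule nk_entry[OF k mat_carrier mat_carrier mat_carrier mat_carrier])
  show ?thesis
  proof (rule eq_matI)
    fix i j assume "i < dim_row ?R" "j < dim_col ?R"
    then have ij: "i < n + n" "j < n + n" using R by auto
    have L: "levi_part r m (cj k X) $$ (i, j) = (if (i < r) = (j < r) then cj k X $$ (i, j) else 0)"
      using levi_part_entry[OF c] ij rm by simp
    consider (a) "i < k" "k \<le> j" "j < r" | (b) "r \<le> i" "i < r + (n - k)" "r + (n - k) \<le> j"
      | (c) "\<not> (i < k \<and> k \<le> j \<and> j < r)" "\<not> (r \<le> i \<and> i < r + (n - k) \<and> r + (n - k) \<le> j)" by blast
    then show "levi_part r m (cj k X) $$ (i, j) = ?R $$ (i, j)"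
    proof cases
      case a
      have s: "sg k i = i" "sg k j = n + (j - k)" "i < n" using a k ad unfolding sg_def admissible_def by auto
      have i: "i < r" using a k by simp
      have "levi_part r m (cj k X) $$ (i, j) = X $$ (i, j - k)"
        unfolding L cj_entry[OF ad Xc ij] s using a i s(3) by simp
      then show ?thesis unfolding Re[OF ij] using a by (cases "j - k < k") auto
    next
      case b
      have s: "sg k i = k + (i - r)" "sg k j = j" "k + (i - r) < n" "n \<le> j" using b k ad unfolding sg_def admissible_def by auto
      have i: "\<not> i < r" "\<not> j < r" using b k by auto
      have "levi_part r m (cj k X) $$ (i, j) = X $$ (k + (i - r), j - n)"
        unfolding L cj_entry[OF ad Xc ij] s using b i s(3,4) by simp
      moreover have "r - k + (j - r - (n - k)) = j - n" using b k by auto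
      moreover have "j - r - (n - k) < n + k - r" using b ij k by auto
      moreover have "i - r - (r - 2*k) < n + k - r" "r - k + (i - r - (r - 2*k)) = k + (i - r)" if "\<not> i - r < r - 2*k"
        using that b k by auto
      ultimately show ?thesis unfolding Re[OF ij] using b k by (cases "i - r < r - 2*k") auto
    next
      case c
      have "levi_part r m (cj k X) $$ (i, j) = (if i = j then 1 else 0)"
      proof (cases "(i < r) = (j < r) \<and> sg k i < n \<and> n \<le> sg k j")
        case True
        then have s: "(i < r) = (j < r)" "sg k i < n" "n \<le> sg k j" by auto
        have "i < k \<or> (r \<le> i \<and> i < r + (n - k))" using s(2) k ad ij unfolding sg_def admissible_def by (auto split: if_splits)
        moreover have "(k \<le> j \<and> j < r) \<or> r + (n - k) \<le> j" using s(3) k ad ij unfolding sg_def admissible_def by (auto split: if_splits)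
        ultimately have False using c s(1) k by auto
        then show ?thesis ..
      next
        case False then show ?thesis unfolding L cj_entry[OF ad Xc ij] by auto
      qed
      then show ?thesis unfolding Re[OF ij] using c by auto
    qed
  qed (use R levi_part_carrier[OF c] rm in auto)
qed

lemma trace_Dk:
  assumes k: "2 * k \<le> r" "r \<le> n + k" and X: "X \<in> Dk k"
  shows "mat_trace X = mat_trace (Matrix.mat k k (\<lambda>(i, j). X $$ (i, j)))
    + mat_trace (Matrix.mat (n + k - r) (n + k - r) (\<lambda>(i, j). X $$ (r - k + i, r - k + j)))"
proof -
  have Xc: "X \<in> carrier_mat n n" using X unfolding Dk_def by auto
  have "mat_trace X = (\<Sum>i\<in>{0..<n}. X $$ (i, i))" using Xc unfolding mat_trace_def by (simp add: atLeast0LessThan)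
  also have "\<dots> = (\<Sum>i\<in>{0..<k}. X $$ (i, i)) + ((\<Sum>i\<in>{k..<r - k}. X $$ (i, i)) + (\<Sum>i\<in>{r - k..<n}. X $$ (i, i)))"
    using k by (simp add: sum.atLeastLessThan_concat)
  also have "(\<Sum>i\<in>{k..<r - k}. X $$ (i, i)) = 0"
    using X k unfolding Dk_def by (intro sum.neutral) auto
  also have "(\<Sum>i\<in>{r - k..<n}. X $$ (i, i)) = (\<Sum>i\<in>{0..<n + k - r}. X $$ (r - k + i, r - k + i))"
    using sum.shift_bounds_nat_ivl[of "\<lambda>i. X $$ (i, i)" 0 "r - k" "n + k - r"] k by (simp add: add.commute)
  finally show ?thesis unfolding mat_trace_def by (simp add: atLeast0LessThan)
qed

lemma psi_Nk_cj:
  assumes k: "2 * k \<le> r" "r \<le> n + k" and X: "X \<in> Dk k"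
  shows "psi_Nk \<psi> n r k (levi_part r m (cj k X)) = psi_N \<psi> n (un n X)"
proof -
  have Xc: "X \<in> carrier_mat n n" using X unfolding Dk_def by auto
  have "r \<le> 2 * n" using rm by simp
  then show ?thesis unfolding levi_cj_nk[OF assms] psi_N_un[OF Xc] trace_Dk[OF assms]
    using k by (intro psi_Nk_nk_mat) auto
qed

lemma Nk_eq:
  assumes k: "2 * k \<le> r" "r \<le> n + k"
  shows "(Nk n r k :: 'f mat set) = (\<lambda>X. levi_part r m (cj k X)) ` Dk k"
proof (intro equalityI subsetI)
  fix g assume "g \<in> (\<lambda>X. levi_part r m (cj k X)) ` Dk k"
  then obtain X where X: "X \<in> Dk k" "g = levi_part r m (cj k X)" by auto
  show "g \<in> Nk n r k" unfolding X(2) levi_cj_nk[OF k X(1)] Nk_def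
    by (rule CollectI, intro exI, rule conjI[OF refl], intro conjI mat_carrier)
next
  fix g :: "'f mat" assume "g \<in> Nk n r k"
  then obtain x y w z where g: "g = nk_mat n r k x y w z" and c: "x \<in> carrier_mat k k" "y \<in> carrier_mat k (r - 2*k)"
     "w \<in> carrier_mat (r - 2*k) (n + k - r)" "z \<in> carrier_mat (n + k - r) (n + k - r)" unfolding Nk_def by blast
  define X where "X = Matrix.mat n n (\<lambda>(i, j). if i < k then if j < k then x $$ (i, j) else if j < r - k then y $$ (i, j - k) else 0
    else if j < r - k then 0 else if i < r - k then w $$ (i - k, j - (r - k)) else z $$ (i - (r - k), j - (r - k)))"
  have X: "X \<in> Dk k" unfolding Dk_def X_def by auto
  have "Matrix.mat k k (\<lambda>(i, j). X $$ (i, j)) = x" unfolding X_def using c k by (intro eq_matI) auto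
  moreover have "Matrix.mat k (r - 2*k) (\<lambda>(i, j). X $$ (i, k + j)) = y" unfolding X_def using c k by (intro eq_matI) auto
  moreover have "Matrix.mat (r - 2*k) (n + k - r) (\<lambda>(i, j). X $$ (k + i, r - k + j)) = w" unfolding X_def using c k by (intro eq_matI) auto
  moreover have "Matrix.mat (n + k - r) (n + k - r) (\<lambda>(i, j). X $$ (r - k + i, r - k + j)) = z" unfolding X_def using c k by (intro eq_matI) auto
  ultimately have "g = levi_part r m (cj k X)" unfolding g levi_cj_nk[OF k X] by simp
  then show "g \<in> (\<lambda>X. levi_part r m (cj k X)) ` Dk k" using X by blast
qed

lemma conj_g0_act:
  "rep_act (conj_rep (GL (n + n)) (g0 k) (inflate r m \<rho>)) (un n x) = rep_act \<rho> (levi_part r m (cj k x))"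
  unfolding cj_def by simp

lemma kernel_eq:
  assumes k: "2 * k \<le> r" "r \<le> n + k"
  shows "twisted_kernel (conj_rep (GL (n + n)) (g0 k) (inflate r m \<rho>)) (td.Stab (g0 k)) (psi_N \<psi> n)
    = twisted_kernel \<rho> (Nk n r k) (psi_Nk \<psi> n r k)"
proof -
  have ad: "admissible k" using k unfolding admissible_def by auto
  let ?A = "conj_rep (GL (n + n)) (g0 k) (inflate r m \<rho>)"
  have "{rep_act ?A u w - rep_scale \<rho> (psi_N \<psi> n u) w | u w. u \<in> td.Stab (g0 k) \<and> w \<in> rep_space \<rho>}
    = (\<lambda>(X, w). rep_act ?A (un n X) w - rep_scale \<rho> (psi_N \<psi> n (un n X)) w) ` (Dk k \<times> rep_space \<rho>)"
    unfolding Stab_g0[OF ad] by (auto simp: image_iff simp del: conj_rep_simps(3); blast)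
  also have "\<dots> = (\<lambda>(X, w). rep_act \<rho> (levi_part r m (cj k X)) w - rep_scale \<rho> (psi_Nk \<psi> n r k (levi_part r m (cj k X))) w) ` (Dk k \<times> rep_space \<rho>)"
    by (intro image_cong refl) (auto simp: conj_g0_act psi_Nk_cj[OF k] simp del: conj_rep_simps(3))
  also have "\<dots> = {rep_act \<rho> u w - rep_scale \<rho> (psi_Nk \<psi> n r k u) w | u w. u \<in> Nk n r k \<and> w \<in> rep_space \<rho>}"
    unfolding Nk_eq[OF k] by (auto simp: image_iff; blast)
  finally show ?thesis unfolding twisted_kernel_def by (simp del: conj_rep_simps(3))
qed

lemma Nk_levi:
  assumes k: "2 * k \<le> r" "r \<le> n + k" shows "(Nk n r k :: 'f mat set) \<subseteq> levi r m"
proof -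
  have ad: "admissible k" using k unfolding admissible_def by auto
  have "cj k X \<in> P" if "X \<in> Dk k" for X using cj_P[OF ad, of X] that unfolding Dk_def by auto
  then show ?thesis unfolding Nk_eq[OF k] using levi_part_levi by auto
qed

lemma Nk_nonzero_iff:
  assumes k: "2 * k \<le> r" "r \<le> n + k"
  shows "twisted_jacquet_nonzero \<rho> (Nk n r k) (psi_Nk \<psi> n r k) \<longleftrightarrow>
    (\<exists>w\<in>rep_space \<rho>. w \<notin> twisted_kernel \<rho> (Nk n r k) (psi_Nk \<psi> n r k))"
proof -
  have "linear_rep (subgrp (GL (n + n)) (Nk n r k)) \<rho>"
    using linear_rep_subgrp[OF \<rho>_linear, of "Nk n r k"] Nk_levi[OF k] by simp
  then show ?thesis by (rule twisted_jacquet_nonzero_iff)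
qed

text \<open>The opposite unipotent radical meets \<open>P K\<close> only in K: the lower blocks of \<open>p k\<close> show that the lower
  Levi block of p is inverse to a block of k and hence integral.\<close>

lemma opposite_bound:
  assumes e: "0 \<le> e" "e < 1" and X: "X \<in> carrier_mat m r" and p: "p \<in> P" and k: "\<kappa> \<in> Congr e (n + n)"
    and eq: "four_block_mat (1\<^sub>m r) (0\<^sub>m r m) X (1\<^sub>m m) = p * \<kappa>"
  shows "entries_le e X"
proof -
  obtain A B D where p': "p = four_block_mat A B (0\<^sub>m m r) D"
    "A \<in> carrier (GL r)" "B \<in> carrier_mat r m" "D \<in> carrier (GL m)" "A \<in> carrier_mat r r" "D \<in> carrier_mat m m"
    using parabolic_D[OF p] .
  have kc: "\<kappa> \<in> carrier_mat (r + m) (r + m)" "entries_le e (\<kappa> - 1\<^sub>m (n + n))" using k rm unfolding Congr_def by auto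
  obtain K1 K2 K3 K4 where K: "\<kappa> = four_block_mat K1 K2 K3 K4" "K1 \<in> carrier_mat r r" "K2 \<in> carrier_mat r m"
    "K3 \<in> carrier_mat m r" "K4 \<in> carrier_mat m m" using block_cases[OF kc(1)] .
  have pk: "p * \<kappa> = four_block_mat (A * K1 + B * K3) (A * K2 + B * K4) (0\<^sub>m m r * K1 + D * K3) (0\<^sub>m m r * K2 + D * K4)"
    unfolding p'(1) K(1) by (rule mult_four_block_mat[OF p'(5,3) zero_carrier_mat p'(6) K(2-5)])
  have z: "0\<^sub>m m r * K1 + D * K3 = D * K3" "0\<^sub>m m r * K2 + D * K4 = D * K4"
    using K p' by auto
  have XD: "X = D * K3"
  proof (rule eq_matI)
    fix i j assume "i < dim_row (D * K3)" "j < dim_col (D * K3)"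
    then have ij: "i < m" "j < r" using p' K by auto
    have "X $$ (i, j) = (p * \<kappa>) $$ (r + i, j)" unfolding eq[symmetric] using ij X by simp
    also have "\<dots> = (D * K3) $$ (i, j)" unfolding pk z using ij p' K by (simp del: index_mult_mat(1))
    finally show "X $$ (i, j) = (D * K3) $$ (i, j)" .
  qed (use X p' K in auto)
  have DK: "D * K4 = 1\<^sub>m m"
  proof (rule eq_matI)
    fix i j assume "i < dim_row (1\<^sub>m m :: 'f mat)" "j < dim_col (1\<^sub>m m :: 'f mat)"
    then have ij: "i < m" "j < m" by auto
    have "(D * K4) $$ (i, j) = (p * \<kappa>) $$ (r + i, r + j)" unfolding pk z using ij p' K by (simp del: index_mult_mat(1))
    also have "\<dots> = 1\<^sub>m m $$ (i, j)" unfolding eq[symmetric] using ij X by simp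
    finally show "(D * K4) $$ (i, j) = 1\<^sub>m m $$ (i, j)" .
  qed (use p' K in auto)
  have "K4 * D = 1\<^sub>m m" using mat_mult_left_right_inverse[OF p'(6) K(5) DK] .
  have ke: "v ((\<kappa> - 1\<^sub>m (n + n)) $$ (i, j)) \<le> e" if "i < r + m" "j < r + m" for i j
    using entries_leD[OF kc(2) minus_carrier_mat[OF one_carrier_mat]] that rm by simp
  have "K4 \<in> Congr e m"
  proof -
    have "entries_le e (K4 - 1\<^sub>m m)"
    proof (rule entries_leI[OF minus_carrier_mat[OF one_carrier_mat]])
      fix i j assume ij: "i < m" "j < m"
      show "v ((K4 - 1\<^sub>m m) $$ (i, j)) \<le> e" using ke[of "r + i" "r + j"] ij K rm by auto
    qed
    then show ?thesis unfolding Congr_def using K by simp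
  qed
  then have "D \<in> Congr e m" using Congr_inverse[OF e _ p'(6) \<open>K4 * D = 1\<^sub>m m\<close>] by simp
  then have D1: "entries_le 1 D" using Congr_GLO[OF e] unfolding GLO_def by auto
  have "entries_le e K3"
  proof (rule entries_leI[OF K(4)])
    fix i j assume ij: "i < m" "j < r"
    show "v (K3 $$ (i, j)) \<le> e" using ke[of "r + i" j] ij K rm by auto
  qed
  then show ?thesis unfolding XD using entries_le_mult[OF D1 _ p'(6) K(4), of e] e by simp
qed

lemma cj_mult:
  assumes "admissible k" "x \<in> carrier_mat n n" "y \<in> carrier_mat n n"
  shows "cj k (x + y) = cj k x * cj k y"
  using td.conj_mult[OF g0_inverse(5)[OF assms(1)] un_inv(2)[OF assms(2)] un_inv(2)[OF assms(3)]] un_mult[OF assms(2,3)]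
  unfolding cj_def by simp

lemma split_Dk:
  assumes x: "x \<in> carrier_mat n n"
  obtains xs xo where "xs \<in> Dk k" "xo \<in> carrier_mat n n" "x = xs + xo"
    "\<And>l c. l < n \<Longrightarrow> c < n \<Longrightarrow> xo $$ (l, c) = (if k \<le> l \<and> c < r - k then x $$ (l, c) else 0)"
proof -
  define xs where "xs = Matrix.mat n n (\<lambda>(l, c). if k \<le> l \<and> c < r - k then 0 else x $$ (l, c))"
  define xo where "xo = Matrix.mat n n (\<lambda>(l, c). if k \<le> l \<and> c < r - k then x $$ (l, c) else 0)"
  show ?thesis
  proof (rule that[of xs xo])
    show "xs \<in> Dk k" unfolding Dk_def xs_def by auto
    show "x = xs + xo" unfolding xs_def xo_def using x by (intro eq_matI) auto
  qed (auto simp: xo_def)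
qed

text \<open>Split x into a part in the stabilizer and a complement. Conjugation by \<open>g\<^sub>0\<close> moves the complement into
  the opposite unipotent radical, where it must be small.\<close>

lemma orbit_near:
  assumes ad: "admissible k" and e: "0 \<le> e" "e < 1" and u: "u \<in> unip n n" and p: "p \<in> P" and \<kappa>: "\<kappa> \<in> Congr e (n + n)"
    and eq: "g0 k * u = p * g0 k * \<kappa>"
  shows "\<exists>s\<in>td.Stab (g0 k). \<exists>t\<in>unip n n \<inter> Congr e (n + n). u = s * t"
proof -
  obtain x where x: "x \<in> carrier_mat n n" "u = un n x" using u unfolding unip_eq by auto
  obtain xs xo where s: "xs \<in> Dk k" "xo \<in> carrier_mat n n" "x = xs + xo"
    "\<And>l c. l < n \<Longrightarrow> c < n \<Longrightarrow> xo $$ (l, c) = (if k \<le> l \<and> c < r - k then x $$ (l, c) else 0)" using split_Dk[where k = k, OF x(1)] by blast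
  have xs: "xs \<in> carrier_mat n n" using s(1) unfolding Dk_def by auto
  have nxs: "- xs \<in> Dk k" using s(1) unfolding Dk_def by auto
  note g = g0_inverse[OF ad]
  let ?h = "perm_mat (n + n) (tg k) :: 'f mat"
  have hc: "?h \<in> carrier_mat (n + n) (n + n)" by simp
  have \<kappa>c: "\<kappa> \<in> carrier_mat (n + n) (n + n)" using \<kappa> unfolding Congr_def by auto
  have pc: "p \<in> carrier_mat (n + n) (n + n)" using P_carrier[OF p] .
  let ?k' = "g0 k * \<kappa> * ?h"
  have k': "?k' \<in> Congr e (n + n)" using Congr_conj[OF e(1) \<kappa> g(2,3,4)] .
  have "cj k x = p * g0 k * \<kappa> * ?h" unfolding cj_def x(2)[symmetric] eq g(6) ..
  also have "\<dots> = p * ?k'" using pc g(1) \<kappa>c hc by (simp add: assoc_2n)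
  finally have c1: "cj k x = p * ?k'" .
  have "xo = - xs + x" using s(3) s(2) xs by (intro eq_matI) auto
  then have "cj k xo = cj k (- xs) * (p * ?k')" using cj_mult[OF ad, of "- xs" x] xs x c1 by simp
  also have "\<dots> = (cj k (- xs) * p) * ?k'"
    using GL_mat[OF cj_GL[OF ad, of "- xs"]] xs pc k' unfolding Congr_def by (simp add: assoc_2n)
  finally have c2: "cj k xo = (cj k (- xs) * p) * ?k'" .
  have pP: "cj k (- xs) * p \<in> P" using levi_part_mult(2)[OF _ p] cj_P[OF ad, of "- xs"] nxs xs by simp
  define X where "X = Matrix.mat m r (\<lambda>(i, j). cj k xo $$ (r + i, j))"
  have Xc: "X \<in> carrier_mat m r" unfolding X_def by simp
  have "four_block_mat (1\<^sub>m r) (0\<^sub>m r m) X (1\<^sub>m m) = cj k xo"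
  proof (rule eq_matI)
    fix i j assume "i < dim_row (cj k xo)" "j < dim_col (cj k xo)"
    then have ij: "i < n + n" "j < n + n" using GL_mat[OF cj_GL[OF ad s(2)]] by auto
    have off: "cj k xo $$ (i, j) = (if i = j then 1 else 0)" if "\<not> (r \<le> i \<and> j < r)"
    proof (cases "sg k i < n \<and> n \<le> sg k j")
      case True
      have d: "sg k i < n + n" "sg k j < n + n" using sg_tg[OF ad] ij unfolding inv_pair_def by blast+
      have "\<not> (k \<le> sg k i \<and> sg k j - n < r - k)" using that True ad ij unfolding sg_def admissible_def by (auto split: if_splits)
      moreover have "sg k i < n" "sg k j - n < n" using True d(2) by linarith+
      ultimately have "xo $$ (sg k i, sg k j - n) = 0" using s(4)[of "sg k i" "sg k j - n"] by (simp only: if_False)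
      moreover have "i \<noteq> j" using True by auto
      ultimately show ?thesis unfolding cj_entry[OF ad s(2) ij] using True by simp
    qed (auto simp: cj_entry[OF ad s(2) ij])
    show "four_block_mat (1\<^sub>m r) (0\<^sub>m r m) X (1\<^sub>m m) $$ (i, j) = cj k xo $$ (i, j)"
      using off ij rm unfolding X_def by auto
  qed (use GL_mat[OF cj_GL[OF ad s(2)]] rm in auto)
  then have Xe: "entries_le e X" using opposite_bound[OF e Xc pP k'] c2 by simp
  have "entries_le e xo"
  proof (rule entries_leI[OF s(2)])
    fix l c assume lc: "l < n" "c < n"
    show "v (xo $$ (l, c)) \<le> e"
    proof (cases "k \<le> l \<and> c < r - k")
      case True
      let ?i = "r + (l - k)" and ?j = "k + c"
      have i: "sg k ?i = l" "?i < n + n" "l - k < m" and j: "sg k ?j = n + c" "?j < n + n" "?j < r"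
        using ad lc True rm unfolding sg_def admissible_def by auto
      have "X $$ (l - k, ?j) = xo $$ (l, c)" unfolding X_def using i(3) j(3) cj_entry[OF ad s(2) i(2) j(2)] i(1) j(1) lc by simp
      then show ?thesis using entries_leD[OF Xe Xc i(3) j(3)] by simp
    qed (use s(4)[OF lc] e in auto)
  qed
  then have "un n xo \<in> Congr e (n + n)" using un_Congr[OF s(2) e(1)] by simp
  moreover have "un n xs \<in> td.Stab (g0 k)" unfolding Stab_g0[OF ad] using s(1) by blast
  moreover have "u = un n xs * un n xo" unfolding x(2) s(3) using un_mult[OF xs s(2)] by simp
  ultimately show ?thesis using s(2) unfolding unip_eq by blast
qed

text \<open>The congruence subgroup is chosen so small that it fixes w and that \<open>\<psi>\<close> is trivial on its intersection with N.\<close>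

theorem stalk_imp_nonzero:
  assumes k: "2 * k \<le> r" "r \<le> n + k" and nz: "twisted_jacquet_nonzero \<rho> (Nk n r k) (psi_Nk \<psi> n r k)"
  shows "twisted_jacquet_nonzero td.V (unip n n) (psi_N \<psi> n)"
proof -
  have ad: "admissible k" using k unfolding admissible_def by auto
  note g = g0_inverse[OF ad]
  obtain w where w: "w \<in> rep_space \<rho>" "w \<notin> twisted_kernel \<rho> (Nk n r k) (psi_Nk \<psi> n r k)"
    using nz unfolding Nk_nonzero_iff[OF k] by blast
  obtain e1 where e1: "0 < e1" "e1 < 1" "\<forall>x. v x \<le> e1 \<longrightarrow> \<psi> x = 1" using \<psi>_small by blast
  obtain e2 where e2: "0 < e2" "e2 < 1" "\<forall>p\<in>P \<inter> Congr e2 (n + n). rep_act \<rho> (levi_part r m p) w = w"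
    using smooth_small[OF w(1)] by blast
  define e where "e = min e1 e2"
  have e: "0 < e" "e < 1" "e \<le> e1" "e \<le> e2" using e1 e2 unfolding e_def by auto
  show ?thesis
  proof (rule td.stalk_nonzero_imp_nonzero[OF g(5)])
    show "subgroup (Congr e (n + n)) (GL (n + n))" "openin (GL_topology (n + n)) (Congr e (n + n))"
      "compactin (GL_topology (n + n)) (Congr e (n + n))"
      using Congr_subgroup[of e] Congr_open[of e] Congr_compact[of e] e by auto
    show "w \<in> rep_space (inflate r m \<rho>)" using w by simp
    show "w \<notin> twisted_kernel (conj_rep (GL (n + n)) (g0 k) (inflate r m \<rho>)) (td.Stab (g0 k)) (psi_N \<psi> n)"
      unfolding kernel_eq[OF k] by (rule w(2))
    show "rep_act (inflate r m \<rho>) p w = w"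
      if "p \<in> P" "\<kappa> \<in> Congr e (n + n)" "p = g0 k \<otimes>\<^bsub>GL (n + n)\<^esub> \<kappa> \<otimes>\<^bsub>GL (n + n)\<^esub> inv\<^bsub>GL (n + n)\<^esub> g0 k" for p \<kappa>
    proof -
      have "p \<in> Congr e (n + n)" using that(3) Congr_conj[OF _ that(2) g(2,3,4)] e(1) g(6) by simp
      then have "p \<in> P \<inter> Congr e2 (n + n)" using that(1) Congr_mono[OF e(4)] by blast
      then show ?thesis using e2(3) by simp
    qed
    show "psi_N \<psi> n x = 1" if "x \<in> unip n n" "x \<in> Congr e (n + n)" for x
      using psi_N_Congr[of e x] e1(3) e that by auto
    show "\<exists>s\<in>td.Stab (g0 k). \<exists>t\<in>unip n n \<inter> Congr e (n + n). u = s \<otimes>\<^bsub>GL (n + n)\<^esub> t"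
      if "u \<in> unip n n" "p \<in> P" "\<kappa> \<in> Congr e (n + n)" "g0 k \<otimes>\<^bsub>GL (n + n)\<^esub> u = p \<otimes>\<^bsub>GL (n + n)\<^esub> g0 k \<otimes>\<^bsub>GL (n + n)\<^esub> \<kappa>" for u p \<kappa>
      using orbit_near[OF ad _ e(2) that(1-3)] that(4) e(1) by simp
  qed
qed

end

section \<open>The stratification by the rank of the lower left block\<close>

lemma sum_lessThan_add: "(\<Sum>t<a + b. f t) = (\<Sum>t<a. f t) + (\<Sum>t<b. f (a + t :: nat) :: 'a::comm_monoid_add)"
  by (induction b) (simp_all add: add.assoc)

lemma det_zero_row:
  assumes "A \<in> carrier_mat n n" "i < n" "\<And>j. j < n \<Longrightarrow> A $$ (i, j) = 0"
  shows "det A = (0 :: 'a::comm_ring_1)"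
  unfolding det_def'[OF assms(1)]
proof (rule sum.neutral, rule ballI)
  fix p assume "p \<in> {p. p permutes {0..<n}}"
  then have "p i < n" using permutes_in_image[of p "{0..<n}" i] assms(2) by auto
  then have "(\<Prod>i = 0..<n. A $$ (i, p i)) = 0" using assms(2,3) by (intro prod_zero bexI[of _ i]) auto
  then show "of_int (sign p) * (\<Prod>i = 0..<n. A $$ (i, p i)) = 0" by simp
qed

context induced_setting
begin

text \<open>The dimension of A is less than a. Stating it by a factorization makes it stable under products.\<close>

definition rank_lt :: "nat \<Rightarrow> 'f mat \<Rightarrow> bool" where
  "rank_lt a g \<longleftrightarrow> (\<exists>I :: nat set. finite I \<and> card I < a \<and>
    (\<exists>R Y. \<forall>i<m. \<forall>c<n. g $$ (r + i, c) = (\<Sum>t\<in>I. R i t * Y t c)))"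

lemma rank_ltE:
  assumes "rank_lt a g"
  obtains I :: "nat set" and R Y where "finite I" "card I < a" "\<forall>i<m. \<forall>c<n. g $$ (r + i, c) = (\<Sum>t\<in>I. R i t * Y t c)"
proof -
  from assms obtain I :: "nat set" where I: "finite I \<and> card I < a \<and>
    (\<exists>R Y. \<forall>i<m. \<forall>c<n. g $$ (r + i, c) = (\<Sum>t\<in>I. R i t * Y t c))" unfolding rank_lt_def ..
  then have "\<exists>R Y. \<forall>i<m. \<forall>c<n. g $$ (r + i, c) = (\<Sum>t\<in>I. R i t * Y t c)" by (elim conjE)
  then obtain R where "\<exists>Y. \<forall>i<m. \<forall>c<n. g $$ (r + i, c) = (\<Sum>t\<in>I. R i t * Y t c)" ..
  then obtain Y where "\<forall>i<m. \<forall>c<n. g $$ (r + i, c) = (\<Sum>t\<in>I. R i t * Y t c)" ..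
  then show ?thesis using I using that by blast
qed

lemma rank_ltI:
  fixes I :: "nat set"
  assumes "finite I" "card I < a" "\<And>i c. i < m \<Longrightarrow> c < n \<Longrightarrow> g $$ (r + i, c) = (\<Sum>t\<in>I. R i t * Y t c)"
  shows "rank_lt a g"
proof -
  have "\<forall>i<m. \<forall>c<n. g $$ (r + i, c) = (\<Sum>t\<in>I. R i t * Y t c)" using assms(3) by simp
  then have "\<exists>Y. \<forall>i<m. \<forall>c<n. g $$ (r + i, c) = (\<Sum>t\<in>I. R i t * Y t c)" by (rule exI[of _ Y])
  then have "\<exists>R Y. \<forall>i<m. \<forall>c<n. g $$ (r + i, c) = (\<Sum>t\<in>I. R i t * Y t c)" by (rule exI[of _ R])
  then show ?thesis unfolding rank_lt_def using assms(1,2) by (intro exI[of _ I] conjI)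
qed

lemma rank_lt_mono: "rank_lt a g \<Longrightarrow> a \<le> b \<Longrightarrow> rank_lt b g"
  unfolding rank_lt_def by (meson less_le_trans)

lemma rank_lt_zero: "\<not> rank_lt 0 g" unfolding rank_lt_def by simp

lemma rank_lt_full: "rank_lt (Suc n) g"
proof (rule rank_ltI[of "{..<n}" _ _ "\<lambda>i t. g $$ (r + i, t)" "\<lambda>t c. if t = c then 1 else 0"])
  fix i c assume c: "c < n"
  have "(\<Sum>t<n. g $$ (r + i, t) * (if t = c then 1 else 0)) = (\<Sum>t<n. if t = c then g $$ (r + i, t) else 0)"
    by (intro sum.cong) auto
  then show "g $$ (r + i, c) = (\<Sum>t<n. g $$ (r + i, t) * (if t = c then 1 else 0))" using c by simp
qed auto

lemma rank_lt_left:
  assumes p: "p \<in> P" and g: "g \<in> carrier_mat (n + n) (n + n)" and a: "rank_lt a g"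
  shows "rank_lt a (p * g)"
proof -
  obtain I :: "nat set" and R Y where I: "finite I" "card I < a" and e: "\<forall>i<m. \<forall>c<n. g $$ (r + i, c) = (\<Sum>t\<in>I. R i t * Y t c)"
    using rank_ltE[OF a] .
  have pc: "p \<in> carrier_mat (n + n) (n + n)" using P_carrier[OF p] .
  show ?thesis
  proof (rule rank_ltI[OF I, of _ "\<lambda>i t. \<Sum>s<m. p $$ (r + i, r + s) * R s t" "Y"])
    fix i c assume ic: "i < m" "c < n"
    have d: "r + i < n + n" "c < n + n" using ic rm by auto
    have "(p * g) $$ (r + i, c) = (\<Sum>t<r + m. p $$ (r + i, t) * g $$ (t, c))"
      using mult_entry[OF pc g d] rm by simp
    also have "\<dots> = (\<Sum>t<r. p $$ (r + i, t) * g $$ (t, c)) + (\<Sum>s<m. p $$ (r + i, r + s) * g $$ (r + s, c))"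
      by (rule sum_lessThan_add)
    also have "(\<Sum>t<r. p $$ (r + i, t) * g $$ (t, c)) = 0"
      using p d rm unfolding P_iff by (intro sum.neutral) auto
    also have "(\<Sum>s<m. p $$ (r + i, r + s) * g $$ (r + s, c)) = (\<Sum>s<m. \<Sum>t\<in>I. p $$ (r + i, r + s) * R s t * Y t c)"
    proof (rule sum.cong[OF refl])
      fix s assume "s \<in> {..<m}"
      then have "g $$ (r + s, c) = (\<Sum>t\<in>I. R s t * Y t c)" using e ic(2) by blast
      then show "p $$ (r + i, r + s) * g $$ (r + s, c) = (\<Sum>t\<in>I. p $$ (r + i, r + s) * R s t * Y t c)"
        by (simp only: sum_distrib_left mult.assoc)
    qed
    also have "\<dots> = (\<Sum>t\<in>I. (\<Sum>s<m. p $$ (r + i, r + s) * R s t) * Y t c)"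
      by (subst sum.swap) (simp only: sum_distrib_right)
    finally show "(p * g) $$ (r + i, c) = (\<Sum>t\<in>I. (\<Sum>s<m. p $$ (r + i, r + s) * R s t) * Y t c)" by simp
  qed
qed

lemma rank_lt_right:
  assumes q: "q \<in> carrier_mat (n + n) (n + n)" "\<And>t c. t < n \<Longrightarrow> c < n \<Longrightarrow> q $$ (n + t, c) = 0"
    and g: "g \<in> carrier_mat (n + n) (n + n)" and a: "rank_lt a g"
  shows "rank_lt a (g * q)"
proof -
  obtain I :: "nat set" and R Y where I: "finite I" "card I < a" and e: "\<forall>i<m. \<forall>c<n. g $$ (r + i, c) = (\<Sum>t\<in>I. R i t * Y t c)"
    using rank_ltE[OF a] .
  show ?thesis
  proof (rule rank_ltI[OF I, of _ "R" "\<lambda>t c. \<Sum>s<n. Y t s * q $$ (s, c)"])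
    fix i c assume ic: "i < m" "c < n"
    have d: "r + i < n + n" "c < n + n" using ic rm by auto
    have "(g * q) $$ (r + i, c) = (\<Sum>t<n. g $$ (r + i, t) * q $$ (t, c)) + (\<Sum>t<n. g $$ (r + i, n + t) * q $$ (n + t, c))"
      unfolding mult_entry[OF g q(1) d] by (rule sum_lessThan_add)
    also have "(\<Sum>t<n. g $$ (r + i, n + t) * q $$ (n + t, c)) = 0" using q(2) ic by (intro sum.neutral) auto
    also have "(\<Sum>s<n. g $$ (r + i, s) * q $$ (s, c)) = (\<Sum>s<n. \<Sum>t\<in>I. R i t * (Y t s * q $$ (s, c)))"
    proof (rule sum.cong[OF refl])
      fix s assume "s \<in> {..<n}"
      then have "g $$ (r + i, s) = (\<Sum>t\<in>I. R i t * Y t s)" using e ic(1) by blast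
      then show "g $$ (r + i, s) * q $$ (s, c) = (\<Sum>t\<in>I. R i t * (Y t s * q $$ (s, c)))"
        by (simp only: sum_distrib_right mult.assoc)
    qed
    also have "\<dots> = (\<Sum>t\<in>I. R i t * (\<Sum>s<n. Y t s * q $$ (s, c)))"
      by (subst sum.swap) (simp only: sum_distrib_left)
    finally show "(g * q) $$ (r + i, c) = (\<Sum>t\<in>I. R i t * (\<Sum>s<n. Y t s * q $$ (s, c)))" by simp
  qed
qed

lemma g0_entry: "i < n + n \<Longrightarrow> j < n + n \<Longrightarrow> g0 k $$ (i, j) = (if j = sg k i then 1 else 0)"
  unfolding g0_def perm_mat_def by simp

lemma sg_lower:
  assumes "admissible k" "i < m"
  shows "sg k (r + i) = (if i < n - k then k + i else r + i)"
  using assms unfolding sg_def admissible_def by auto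

lemma g0_rank:
  assumes k: "admissible k" shows "rank_lt (Suc (n - k)) (g0 k)"
proof (rule rank_ltI[of "{..<n - k}" _ _ "\<lambda>i t. if t = i then 1 else 0" "\<lambda>t c. if c = k + t then 1 else 0"])
  fix i c assume ic: "i < m" "c < n"
  have d: "r + i < n + n" "c < n + n" using ic rm by auto
  have "(\<Sum>t<n - k. (if t = i then 1 else 0) * (if c = k + t then 1 else (0::'f)))
      = (\<Sum>t<n - k. if t = i then (if c = k + i then 1 else 0) else 0)"
    by (intro sum.cong) auto
  also have "\<dots> = (if i < n - k \<and> c = k + i then 1 else 0)" by simp
  also have "\<dots> = g0 k $$ (r + i, c)"
    unfolding g0_entry[OF d] sg_lower[OF k ic(1)] using ic k unfolding admissible_def by auto
  finally show "g0 k $$ (r + i, c) = (\<Sum>t<n - k. (if t = i then 1 else 0) * (if c = k + t then 1 else 0))" by simp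
qed auto

text \<open>An identity matrix of size n - k does not factor through fewer dimensions.\<close>

lemma g0_not_rank:
  assumes k: "admissible k" shows "\<not> rank_lt (n - k) (g0 k)"
proof
  assume "rank_lt (n - k) (g0 k)"
  from rank_ltE[OF this]
  obtain I :: "nat set" and R Y where I: "finite I" "card I < n - k" and e: "\<forall>i<m. \<forall>c<n. g0 k $$ (r + i, c) = (\<Sum>t\<in>I. R i t * Y t c)" .
  obtain h where h: "bij_betw h {..<card I} I" using ex_bij_betw_nat_finite[OF I(1)] by (auto simp: atLeast0LessThan)
  let ?a = "n - k"
  define A where "A = Matrix.mat ?a ?a (\<lambda>(i, t). if t < card I then R i (h t) else 0)"
  define B where "B = Matrix.mat ?a ?a (\<lambda>(t, c). if t < card I then Y (h t) (k + c) else 0)"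
  have Ac: "A \<in> carrier_mat ?a ?a" and Bc: "B \<in> carrier_mat ?a ?a" unfolding A_def B_def by auto
  have am: "?a \<le> m" using k rm unfolding admissible_def by auto
  have "A * B = 1\<^sub>m ?a"
  proof (rule eq_matI)
    fix i c assume "i < dim_row (1\<^sub>m ?a :: 'f mat)" "c < dim_col (1\<^sub>m ?a :: 'f mat)"
    then have ic: "i < ?a" "c < ?a" by auto
    have d: "r + i < n + n" "k + c < n + n" "i < m" "k + c < n" using ic am rm by auto
    have "(A * B) $$ (i, c) = (\<Sum>t<?a. if t < card I then R i (h t) * Y (h t) (k + c) else 0)"
      by (rule trans[OF mult_entry[OF Ac Bc ic] sum.cong[OF refl]]) (use ic in \<open>auto simp: A_def B_def\<close>)
    also have "\<dots> = (\<Sum>t<card I. R i (h t) * Y (h t) (k + c))"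
      using I(2) by (intro sum.mono_neutral_cong_right) auto
    also have "\<dots> = (\<Sum>t\<in>I. R i t * Y t (k + c))" by (rule sum.reindex_bij_betw[OF h])
    also have "\<dots> = g0 k $$ (r + i, k + c)" using e d by simp
    also have "\<dots> = 1\<^sub>m ?a $$ (i, c)" unfolding g0_entry[OF d(1,2)] sg_lower[OF k d(3)] using ic by auto
    finally show "(A * B) $$ (i, c) = 1\<^sub>m ?a $$ (i, c)" .
  qed (use Ac Bc in auto)
  then have "det A * det B = 1" using det_mult[OF Ac Bc] by simp
  moreover have "det B = 0" by (rule det_zero_row[OF Bc, of "?a - 1"]) (use I(2) in \<open>auto simp: B_def\<close>)
  ultimately show False by simp
qed

definition dg :: "'f mat \<Rightarrow> 'f mat \<Rightarrow> 'f mat" where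
  "dg a d = four_block_mat a (0\<^sub>m n n) (0\<^sub>m n n) d"

lemma dg_carrier [simp]: "a \<in> carrier_mat n n \<Longrightarrow> d \<in> carrier_mat n n \<Longrightarrow> dg a d \<in> carrier_mat (n + n) (n + n)"
  unfolding dg_def by auto

lemma dg_mult:
  assumes "a \<in> carrier_mat n n" "d \<in> carrier_mat n n" "a' \<in> carrier_mat n n" "d' \<in> carrier_mat n n"
  shows "dg a d * dg a' d' = dg (a * a') (d * d')"
  unfolding dg_def mult_four_block_mat[OF assms(1) zero_carrier_mat zero_carrier_mat assms(2) assms(3) zero_carrier_mat zero_carrier_mat assms(4)]
  using assms by simp

lemma dg_one: "dg (1\<^sub>m n) (1\<^sub>m n) = 1\<^sub>m (n + n)" unfolding dg_def by simp

lemma dg_GL: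
  assumes "a \<in> carrier_mat n n" "d \<in> carrier_mat n n" "a' \<in> carrier_mat n n" "d' \<in> carrier_mat n n" "a * a' = 1\<^sub>m n" "d * d' = 1\<^sub>m n"
  shows "dg a d \<in> carrier (GL (n + n))" "inv\<^bsub>GL (n + n)\<^esub> (dg a d) = dg a' d'"
  using GL_I[OF dg_carrier[OF assms(1,2)] dg_carrier[OF assms(3,4)]] dg_mult[OF assms(1-4)] assms(5,6) dg_one by auto

lemma GLO_carrier: "a \<in> GLO k \<Longrightarrow> a \<in> carrier_mat k k" unfolding GLO_def by auto

lemma dg_GLO:
  assumes "a \<in> GLO n" "d \<in> GLO n" shows "dg a d \<in> GLO (n + n)"
proof -
  have c: "a \<in> carrier_mat n n" "d \<in> carrier_mat n n" "entries_le 1 a" "entries_le 1 d" "v (det a) = 1" "v (det d) = 1"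
    using assms unfolding GLO_def by auto
  have "det (dg a d) = det a * det d" unfolding dg_def by (rule det_four_block_mat_lower_left_zero[OF c(1) _ refl c(2)]) simp
  moreover have "entries_le 1 (dg a d)"
  proof (rule entries_leI[OF dg_carrier[OF c(1,2)]])
    fix i j assume "i < n + n" "j < n + n"
    then show "v (dg a d $$ (i, j)) \<le> 1"
      using c entries_leD[OF c(3,1), of i j] entries_leD[OF c(4,2), of "i - n" "j - n"] unfolding dg_def by auto
  qed
  ultimately show ?thesis unfolding GLO_def using c by (auto simp: mult)
qed

lemma dg_un:
  assumes "a \<in> carrier_mat n n" "d \<in> carrier_mat n n" "d' \<in> carrier_mat n n" "d' * d = 1\<^sub>m n" "x \<in> carrier_mat n n"
  shows "dg a d * un n x = un n (a * x * d') * dg a d"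
proof -
  have ax: "a * x * d' \<in> carrier_mat n n" using assms by auto
  have "dg a d * un n x = four_block_mat a (a * x) (0\<^sub>m n n) d"
    unfolding dg_def un_def mult_four_block_mat[OF assms(1) zero_carrier_mat zero_carrier_mat assms(2) one_carrier_mat assms(5) zero_carrier_mat one_carrier_mat]
    using assms by simp
  moreover have "a * x * d' * d = a * x"
    using assms by (simp add: assoc_n)
  then have "un n (a * x * d') * dg a d = four_block_mat a (a * x) (0\<^sub>m n n) d"
    unfolding dg_def un_def mult_four_block_mat[OF one_carrier_mat ax zero_carrier_mat one_carrier_mat assms(1) zero_carrier_mat zero_carrier_mat assms(2)]
    using assms by simp
  ultimately show ?thesis by simp
qed

text \<open>Moving the base point by a block diagonal matrix twists the coordinate of the stabilizer.\<close>

lemma conj_dg: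
  assumes k: "admissible k" and c: "a \<in> carrier_mat n n" "d \<in> carrier_mat n n" "a' \<in> carrier_mat n n" "d' \<in> carrier_mat n n"
    "a * a' = 1\<^sub>m n" "d * d' = 1\<^sub>m n" and x: "x \<in> carrier_mat n n"
  shows "(g0 k * dg a d) * un n x * inv\<^bsub>GL (n + n)\<^esub> (g0 k * dg a d) = cj k (a * x * d')"
    "g0 k * dg a d \<in> carrier (GL (n + n))"
proof -
  note D = dg_GL[OF c]
  note g = g0_inverse[OF k]
  show G: "g0 k * dg a d \<in> carrier (GL (n + n))" using GL_mult[OF g(5) D(1)] .
  have iv: "inv\<^bsub>GL (n + n)\<^esub> (g0 k * dg a d) = dg a' d' * inv\<^bsub>GL (n + n)\<^esub> (g0 k)"
    using td.inv_mult_group[OF g(5) D(1)] D(2) by simp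
  let ?i = "inv\<^bsub>GL (n + n)\<^esub> (g0 k)" and ?y = "un n (a * x * d')"
  have cc: "g0 k \<in> carrier_mat (n + n) (n + n)" "?i \<in> carrier_mat (n + n) (n + n)" "dg a d \<in> carrier_mat (n + n) (n + n)"
    "dg a' d' \<in> carrier_mat (n + n) (n + n)" "un n x \<in> carrier_mat (n + n) (n + n)" "?y \<in> carrier_mat (n + n) (n + n)"
    using g GL_inv[OF g(5)] c x by auto
  have dd: "d' * d = 1\<^sub>m n" using mat_mult_left_right_inverse[OF c(2,4,6)] .
    have "(g0 k * dg a d) * un n x * (dg a' d' * ?i) = g0 k * ((dg a d * un n x) * dg a' d') * ?i"
    using cc by (simp add: assoc_2n)
  also have "(dg a d * un n x) * dg a' d' = ?y * (dg a d * dg a' d')"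
    unfolding dg_un[OF c(1,2,4) dd x] using cc by (simp add: assoc_2n)
  also have "\<dots> = ?y" using dg_mult[OF c(1-4)] c(5,6) dg_one cc by simp
  finally show "(g0 k * dg a d) * un n x * inv\<^bsub>GL (n + n)\<^esub> (g0 k * dg a d) = cj k (a * x * d')"
    unfolding iv cj_def .
qed

lemma Stab_dg:
  assumes k: "admissible k" and c: "a \<in> carrier_mat n n" "d \<in> carrier_mat n n" "a' \<in> carrier_mat n n" "d' \<in> carrier_mat n n"
    "a * a' = 1\<^sub>m n" "d * d' = 1\<^sub>m n" and x: "x \<in> carrier_mat n n"
  shows "un n x \<in> td.Stab (g0 k * dg a d) \<longleftrightarrow> a * x * d' \<in> Dk k"
proof -
  have "un n x \<in> unip n n" using x unfolding unip_eq by blast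
  moreover have "a * x * d' \<in> carrier_mat n n" using c x by auto
  ultimately show ?thesis
    unfolding td.Stab_def using conj_dg(1)[OF k c x] cj_P[OF k, of "a * x * d'"] by simp
qed

text \<open>Every element lies in one of the double cosets of the orbit representatives, with integral
  Levi component: reduce the lower left block to rank normal form, then the remaining rows of the
  lower right block, and clear the rest with the unipotent radical.\<close>

lemma decomposition:
  assumes g: "g \<in> carrier (GL (n + n))"
  shows "\<exists>k p a d x. admissible k \<and> p \<in> P \<and> a \<in> GLO n \<and> d \<in> GLO n \<and> x \<in> carrier_mat n n \<and>
    p * g * dg a d * un n x = g0 k"
proof -
  have gc: "g \<in> carrier_mat (n + n) (n + n)" using GL_mat[OF g] .
  define T1 where "T1 = Matrix.mat r n (\<lambda>(i, j). g $$ (i, j))"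
  define T2 where "T2 = Matrix.mat r n (\<lambda>(i, j). g $$ (i, n + j))"
  define L where "L = Matrix.mat m n (\<lambda>(i, j). g $$ (r + i, j))"
  define M where "M = Matrix.mat m n (\<lambda>(i, j). g $$ (r + i, n + j))"
  have c: "T1 \<in> carrier_mat r n" "T2 \<in> carrier_mat r n" "L \<in> carrier_mat m n" "M \<in> carrier_mat m n"
    unfolding T1_def T2_def L_def M_def by auto
  have gb: "g = four_block_mat T1 T2 L M"
    using gc rm unfolding T1_def T2_def L_def M_def by (intro eq_matI) auto
  obtain a where a: "a \<le> m" "a \<le> n" "equivalent m n L (norm_form m n a)" using rank_normal_form[OF c(3)] by blast
  then obtain D A where DA: "D \<in> carrier (GL m)" "A \<in> GLO n" "D * L * A = norm_form m n a" unfolding equivalent_def by blast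
  have Dc: "D \<in> carrier_mat m m" and Ac: "A \<in> carrier_mat n n" using DA GL_mat GLO_carrier by auto
  define M1 where "M1 = Matrix.mat a n (\<lambda>(i, j). (D * M) $$ (i, j))"
  define M2 where "M2 = Matrix.mat (m - a) n (\<lambda>(i, j). (D * M) $$ (a + i, j))"
  have M1: "M1 \<in> carrier_mat a n" and M2: "M2 \<in> carrier_mat (m - a) n" unfolding M1_def M2_def by auto
  have DMc: "D * M \<in> carrier_mat m n" using Dc c by simp
  have DM: "D * M = stack M1 M2"
    by (rule eq_matI) (use a(1) DMc in \<open>auto simp: stack_def M1_def M2_def simp del: index_mult_mat(1)\<close>)
  obtain b where b: "b \<le> m - a" "b \<le> n" "equivalent (m - a) n M2 (norm_form (m - a) n b)" using rank_normal_form[OF M2] by blast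
  then obtain D' A' where DA': "D' \<in> carrier (GL (m - a))" "A' \<in> GLO n" "D' * M2 * A' = norm_form (m - a) n b" unfolding equivalent_def by blast
  have D'c: "D' \<in> carrier_mat (m - a) (m - a)" and A'c: "A' \<in> carrier_mat n n" using DA' GL_mat GLO_carrier by auto
  define F where "F = four_block_mat (1\<^sub>m a) (0\<^sub>m a (m - a)) (0\<^sub>m (m - a) a) D'"
  have F: "F \<in> carrier (GL m)" using GL_block[OF GL_one _ DA'(1), of "0\<^sub>m a (m - a)" a] a(1) unfolding F_def by simp
  have Fc: "F \<in> carrier_mat m m" using GL_mat[OF F] .
  have FS: "F * stack X Y = stack X (D' * Y)" if "X \<in> carrier_mat a n" "Y \<in> carrier_mat (m - a) n" for X Y
  proof -
    have "F * stack X Y = stack (1\<^sub>m a * X + 0\<^sub>m a (m - a) * Y) (0\<^sub>m (m - a) a * X + D' * Y)"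
      unfolding F_def by (rule stack_mult_left[OF that one_carrier_mat zero_carrier_mat zero_carrier_mat D'c])
    moreover have "1\<^sub>m a * X + 0\<^sub>m a (m - a) * Y = X" "0\<^sub>m (m - a) a * X + D' * Y = D' * Y" using that D'c by auto
    ultimately show ?thesis by simp
  qed
  define N1 where "N1 = (norm_form a n a :: 'f mat)"
  have N1c: "N1 \<in> carrier_mat a n" unfolding N1_def norm_form_def by simp
  have NF: "norm_form m n a = stack N1 (0\<^sub>m (m - a) n)"
    unfolding N1_def by (rule eq_matI) (use a(1) in \<open>auto simp: stack_def norm_form_def\<close>)
  have FL: "F * D * L * A = norm_form m n a"
  proof -
    have "F * D * L * A = F * (D * L * A)" using Fc Dc Ac c by (simp add: assoc_mult_mat[of _ m m _ m _ n] assoc_mult_mat[of _ m m _ n _ n])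
    also have "\<dots> = stack N1 (D' * 0\<^sub>m (m - a) n)" unfolding DA(3) NF by (rule FS[OF N1c zero_carrier_mat])
    also have "D' * 0\<^sub>m (m - a) n = 0\<^sub>m (m - a) n" using D'c by simp
    finally show ?thesis unfolding NF .
  qed
  have M1A: "M1 * A' \<in> carrier_mat a n" using M1 A'c by simp
  have FM: "F * D * M * A' = stack (M1 * A') (norm_form (m - a) n b)"
  proof -
    have "F * D * M * A' = (F * (D * M)) * A'" using Fc Dc c by (simp add: assoc_mult_mat[of _ m m _ m _ n])
    also have "\<dots> = stack M1 (D' * M2) * A'" unfolding DM FS[OF M1 M2] ..
    also have "\<dots> = stack (M1 * A') (D' * M2 * A')" by (rule stack_mult_right[OF M1 _ A'c]) (use D'c M2 in auto)
    finally show ?thesis unfolding DA'(3) .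
  qed
  have FD: "F * D \<in> carrier (GL m)" using GL_mult[OF F DA(1)] .
  have FDc: "F * D \<in> carrier_mat m m" using GL_mat[OF FD] .
  define p where "p = four_block_mat (1\<^sub>m r) (0\<^sub>m r m) (0\<^sub>m m r) (F * D)"
  have p: "p \<in> P" unfolding p_def parabolic_def using FD GL_one[of r] by (intro CollectI exI[of _ "1\<^sub>m r"] exI[of _ "0\<^sub>m r m"] exI[of _ "F * D"] conjI refl zero_carrier_mat)
  \<comment> \<open>The unipotent factor clears the block to the right of the pivots in the first a of the lower rows.\<close>
  define x where "x = Matrix.mat n n (\<lambda>(l, c). if n - a \<le> l then - (M1 * A') $$ (l - (n - a), c) else 0)"
  have xc: "x \<in> carrier_mat n n" unfolding x_def by simp
  let ?h = "p * g * dg A A' * un n x"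
  have pg: "p * g = four_block_mat T1 T2 (F * D * L) (F * D * M)"
  proof -
    have "p * g = four_block_mat (1\<^sub>m r * T1 + 0\<^sub>m r m * L) (1\<^sub>m r * T2 + 0\<^sub>m r m * M) (0\<^sub>m m r * T1 + (F * D) * L) (0\<^sub>m m r * T2 + (F * D) * M)"
      unfolding p_def gb by (rule mult_four_block_mat[OF one_carrier_mat zero_carrier_mat zero_carrier_mat FDc c])
    moreover have "1\<^sub>m r * T1 + 0\<^sub>m r m * L = T1" "1\<^sub>m r * T2 + 0\<^sub>m r m * M = T2"
      "0\<^sub>m m r * T1 + (F * D) * L = F * D * L" "0\<^sub>m m r * T2 + (F * D) * M = F * D * M" using c FDc by auto
    ultimately show ?thesis by simp
  qed
  have FLc: "F * D * L \<in> carrier_mat m n" "F * D * M \<in> carrier_mat m n" using FDc c by auto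
  have pgA: "p * g * dg A A' = four_block_mat (T1 * A) (T2 * A') (norm_form m n a) (stack (M1 * A') (norm_form (m - a) n b))"
  proof -
    have "p * g * dg A A' = four_block_mat (T1 * A + T2 * 0\<^sub>m n n) (T1 * 0\<^sub>m n n + T2 * A') (F * D * L * A + F * D * M * 0\<^sub>m n n) (F * D * L * 0\<^sub>m n n + F * D * M * A')"
      unfolding pg dg_def by (rule mult_four_block_mat[OF c(1,2) FLc Ac zero_carrier_mat zero_carrier_mat A'c])
    moreover have "T1 * A + T2 * 0\<^sub>m n n = T1 * A" "T1 * 0\<^sub>m n n + T2 * A' = T2 * A'" using c Ac A'c by auto
    moreover have "X * A + Y * 0\<^sub>m n n = X * A" "X * 0\<^sub>m n n + Y * A' = Y * A'"
      if "X \<in> carrier_mat m n" "Y \<in> carrier_mat m n" for X Y using that Ac A'c by auto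
    note this[OF FLc]
    ultimately show ?thesis unfolding FL FM by simp
  qed
  let ?NF = "norm_form m n a :: 'f mat" and ?S = "stack (M1 * A') (norm_form (m - a) n b)"
  have NFc: "?NF \<in> carrier_mat m n" unfolding norm_form_def by simp
  have Sc: "?S \<in> carrier_mat m n" using stack_carrier[OF M1A, of "norm_form (m - a) n b" "m - a"] a(1) unfolding norm_form_def by simp
  have hb: "?h = four_block_mat (T1 * A) (T1 * A * x + T2 * A') ?NF (?NF * x + ?S)"
  proof -
    have tc: "T1 * A \<in> carrier_mat r n" "T2 * A' \<in> carrier_mat r n" using c Ac A'c by auto
    have "?h = four_block_mat (T1 * A * 1\<^sub>m n + T2 * A' * 0\<^sub>m n n) (T1 * A * x + T2 * A' * 1\<^sub>m n) (?NF * 1\<^sub>m n + ?S * 0\<^sub>m n n) (?NF * x + ?S * 1\<^sub>m n)"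
      unfolding pgA un_def by (rule mult_four_block_mat[OF tc NFc Sc one_carrier_mat xc zero_carrier_mat one_carrier_mat])
    moreover have "X * 1\<^sub>m n + Y * 0\<^sub>m n n = X" "Z + Y * 1\<^sub>m n = Z + Y"
      if "X \<in> carrier_mat l n" "Y \<in> carrier_mat l n" for X Y Z :: "'f mat" and l using that by auto
    note this(1)[OF tc] this(2)[OF tc] this(1)[OF NFc Sc] this(2)[OF NFc Sc]
    ultimately show ?thesis by simp
  qed
  have low: "(?NF * x + ?S) $$ (i, j) = (if a \<le> i \<and> i - a < b \<and> j = n - b + (i - a) then 1 else 0)"
    if ij: "i < m" "j < n" for i j
  proof -
    have Nx: "(?NF * x) $$ (i, j) = (if i < a then x $$ (n - a + i, j) else 0)"
    proof -
      have "(?NF * x) $$ (i, j) = (\<Sum>t<n. if t = n - a + i then (if i < a then x $$ (n - a + i, j) else 0) else 0)"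
        by (rule trans[OF mult_entry[OF NFc xc ij] sum.cong[OF refl]]) (use ij in \<open>auto simp: norm_form_def\<close>)
      also have "\<dots> = (if i < a then x $$ (n - a + i, j) else 0)" using a(2) by auto
      finally show ?thesis .
    qed
    have s: "(?NF * x + ?S) $$ (i, j) = (?NF * x) $$ (i, j) + ?S $$ (i, j)" using ij Sc by (simp del: index_mult_mat(1))
    show ?thesis
    proof (cases "i < a")
      case True
      have "x $$ (n - a + i, j) = - (M1 * A') $$ (i, j)" unfolding x_def using True ij a(2) by (simp del: index_mult_mat(1))
      moreover have "?S $$ (i, j) = (M1 * A') $$ (i, j)" unfolding stack_def using True ij M1 A'c by (simp del: index_mult_mat(1))
      ultimately show ?thesis unfolding s Nx using True by simp
    next
      case False
      have "?S $$ (i, j) = norm_form (m - a) n b $$ (i - a, j)" unfolding stack_def using False ij M1 A'c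
        by (simp del: index_mult_mat(1) add: norm_form_def)
      then show ?thesis unfolding s Nx using False ij by (auto simp: norm_form_def)
    qed
  qed
  have hGL: "?h \<in> carrier (GL (n + n))"
  proof -
    have "p \<in> carrier (GL (n + n))" using p unfolding P_iff by auto
    moreover have "dg A A' \<in> carrier (GL (n + n))" using dg_GLO[OF DA(2) DA'(2)] GLO_GL by blast
    ultimately show ?thesis using g un_inv(2)[OF xc] by (intro GL_mult)
  qed
  have hc: "?h \<in> carrier_mat (n + n) (n + n)" using GL_mat[OF hGL] .
  have hlow: "?h $$ (r + i, j) = (if j < n then ?NF $$ (i, j) else (?NF * x + ?S) $$ (i, j - n))"
    if ij: "i < m" "j < n + n" for i j
  proof -
    have d: "dim_row (T1 * A) = r" "dim_col (T1 * A) = n" "dim_row (?NF * x + ?S) = m" "dim_col (?NF * x + ?S) = n"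
      using c Ac Sc by auto
    have l: "r + i < dim_row (T1 * A) + dim_row (?NF * x + ?S)" "j < dim_col (T1 * A) + dim_col (?NF * x + ?S)"
      unfolding d using ij by auto
    show ?thesis unfolding hb index_mat_four_block(1)[OF l] d by simp
  qed
  have bm: "b = m - a"
  proof (rule ccontr)
    assume "b \<noteq> m - a"
    then have bl: "b < m - a" using b by simp
    have m1: "m - 1 < m" using bl by simp
    have "det ?h = 0"
    proof (rule det_zero_row[OF hc])
      show "r + (m - 1) < n + n" using rm bl by linarith
      fix j assume j: "j < n + n"
      show "?h $$ (r + (m - 1), j) = 0"
        unfolding hlow[OF m1 j] using low[OF m1, of "j - n"] bl j by (auto simp: norm_form_def)
    qed
    then show False using hGL by (simp add: GL_carrier)
  qed
  define k where "k = n - a"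
  have ad: "admissible k" using a b bm rm unfolding k_def admissible_def by auto
  have ka: "n - k = a" "k + a = n" using a unfolding k_def by auto
  have rows: "?h $$ (r + i, j) = g0 k $$ (r + i, j)" if ij: "i < m" "j < n + n" for i j
  proof -
    have d: "r + i < n + n" using ij rm by simp
    have g0e: "g0 k $$ (r + i, j) = (if j = (if i < a then k + i else r + i) then 1 else 0)"
      unfolding g0_entry[OF d ij(2)] sg_lower[OF ad ij(1)] ka ..
    show ?thesis
    proof (cases "j < n")
      case True
      have "\<not> i < a \<Longrightarrow> r + i \<noteq> j" using True ka ad unfolding admissible_def by auto
      then show ?thesis unfolding hlow[OF ij] g0e using True ij by (auto simp: norm_form_def k_def)
    next
      case False
      have jn: "j - n < n" using ij False by auto
      have e: "i < a \<Longrightarrow> k + i \<noteq> j" using False ka by auto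
      have e2: "\<not> i < a \<Longrightarrow> (j - n = n - b + (i - a)) = (j = r + i)" "\<not> i < a \<Longrightarrow> i - a < b"
        using False bm b a rm ij by linarith+
      show ?thesis unfolding hlow[OF ij] g0e low[OF ij(1) jn] using False e e2 by auto
    qed
  qed
  note gg = g0_inverse[OF ad]
  let ?i = "inv\<^bsub>GL (n + n)\<^esub> (g0 k)"
  note gi = GL_inv[OF gg(5)]
  define q where "q = ?h * ?i"
  have qGL: "q \<in> carrier (GL (n + n))" unfolding q_def using GL_mult[OF hGL gi(4)] .
  have "q $$ (r + i, j) = 0" if ij: "i < m" "j < r" for i j
  proof -
    have d: "r + i < n + n" "j < n + n" using ij rm by auto
    have "q $$ (r + i, j) = (\<Sum>t<n + n. g0 k $$ (r + i, t) * ?i $$ (t, j))"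
      unfolding q_def by (rule trans[OF mult_entry[OF hc gi(1) d] sum.cong[OF refl]]) (use rows ij in auto)
    also have "\<dots> = (g0 k * ?i) $$ (r + i, j)" using mult_entry[OF gg(1) gi(1) d] by simp
    also have "\<dots> = 0" unfolding gi(2) using ij d by simp
    finally show ?thesis .
  qed
  then have "q \<in> P" unfolding P_iff using qGL rm by (metis add_less_cancel_left le_add_diff_inverse)
  have "inv\<^bsub>GL (n + n)\<^esub> q \<in> P" using subgroup.m_inv_closed[OF td.H(1) \<open>q \<in> P\<close>] .
  moreover have "inv\<^bsub>GL (n + n)\<^esub> q * p \<in> P" using levi_part_mult(2)[OF calculation p] .
  moreover have "(inv\<^bsub>GL (n + n)\<^esub> q * p) * g * dg A A' * un n x = g0 k"
  proof -
        have cc: "inv\<^bsub>GL (n + n)\<^esub> q \<in> carrier_mat (n + n) (n + n)" "p \<in> carrier_mat (n + n) (n + n)" "dg A A' \<in> carrier_mat (n + n) (n + n)"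
      "un n x \<in> carrier_mat (n + n) (n + n)" using GL_inv[OF qGL] P_carrier[OF p] Ac A'c xc by auto
    have "(inv\<^bsub>GL (n + n)\<^esub> q * p) * g * dg A A' * un n x = inv\<^bsub>GL (n + n)\<^esub> q * ?h" using cc gc by (simp add: assoc_2n)
    also have "?h = q * g0 k" unfolding q_def assoc_2n[OF hc gi(1) gg(1)] gi(3) right_mult_one_mat[OF hc] ..
    also have "inv\<^bsub>GL (n + n)\<^esub> q * (q * g0 k) = (inv\<^bsub>GL (n + n)\<^esub> q * q) * g0 k" using GL_inv[OF qGL] GL_mat[OF qGL] gg(1) by (intro assoc_2n[symmetric]) auto
    finally show ?thesis using GL_inv(3)[OF qGL] gg(1) by simp
  qed
  ultimately show ?thesis using ad DA(2) DA'(2) xc by blast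
qed

text \<open>Integral column operations preserving A move the entries of h in the rows of B into the last b columns, so
  that the result stabilizes B. If b exceeded n - k, row operations would produce a zero row.\<close>

lemma flag_factorization:
  assumes h: "h \<in> carrier (GL n)" and kb: "k \<le> n" "b \<le> n"
    and z: "\<And>j i. n - b \<le> j \<Longrightarrow> j < n \<Longrightarrow> i < k \<Longrightarrow> h $$ (j, i) = (0::'f)"
  shows "b \<le> n - k" "\<exists>q1\<in>parabolic (n - b) b. \<exists>q2\<in>parabolic k (n - k). h = q1 * q2"
proof -
  have hc: "h \<in> carrier_mat n n" using GL_mat[OF h] .
  define h1 where "h1 = Matrix.mat (n - b) k (\<lambda>(i, j). h $$ (i, j))"
  define h2 where "h2 = Matrix.mat (n - b) (n - k) (\<lambda>(i, j). h $$ (i, k + j))"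
  define H where "H = Matrix.mat b (n - k) (\<lambda>(i, j). h $$ (n - b + i, k + j))"
  have c: "h1 \<in> carrier_mat (n - b) k" "h2 \<in> carrier_mat (n - b) (n - k)" "H \<in> carrier_mat b (n - k)"
    unfolding h1_def h2_def H_def by auto
  have hb: "h = four_block_mat h1 h2 (0\<^sub>m b k) H"
    unfolding h1_def h2_def H_def by (rule eq_matI) (use hc kb z in auto)
  obtain a where a: "a \<le> b" "a \<le> n - k" "equivalent b (n - k) H (norm_form b (n - k) a)" using rank_normal_form[OF c(3)] by blast
  then obtain D A where DA: "D \<in> carrier (GL b)" "A \<in> GLO (n - k)" "D * H * A = norm_form b (n - k) a" unfolding equivalent_def by blast
  have Dc: "D \<in> carrier_mat b b" and Ac: "A \<in> carrier_mat (n - k) (n - k)" using DA GL_mat GLO_carrier by auto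
  have AGL: "A \<in> carrier (GL (n - k))" using DA(2) GLO_GL by blast
  define Q where "Q = four_block_mat (1\<^sub>m k) (0\<^sub>m k (n - k)) (0\<^sub>m (n - k) k) A"
  have QP: "Q \<in> parabolic k (n - k)" unfolding Q_def parabolic_def using AGL GL_one[of k]
    by (intro CollectI exI[of _ "1\<^sub>m k"] exI[of _ "0\<^sub>m k (n - k)"] exI[of _ A] conjI refl zero_carrier_mat)
  have nk: "k + (n - k) = n" "n - b + b = n" using kb by auto
  have QGL: "Q \<in> carrier (GL n)" using QP unfolding parabolic_iff nk by blast
  have Qc: "Q \<in> carrier_mat n n" using GL_mat[OF QGL] .
  have h2A: "h2 * A \<in> carrier_mat (n - b) (n - k)" "H * A \<in> carrier_mat b (n - k)" using c Ac by auto
  have hQ: "h * Q = four_block_mat h1 (h2 * A) (0\<^sub>m b k) (H * A)"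
  proof -
    have "h * Q = four_block_mat (h1 * 1\<^sub>m k + h2 * 0\<^sub>m (n - k) k) (h1 * 0\<^sub>m k (n - k) + h2 * A) (0\<^sub>m b k * 1\<^sub>m k + H * 0\<^sub>m (n - k) k) (0\<^sub>m b k * 0\<^sub>m k (n - k) + H * A)"
      unfolding hb Q_def by (rule mult_four_block_mat[OF c(1,2) zero_carrier_mat c(3) one_carrier_mat zero_carrier_mat zero_carrier_mat Ac])
    moreover have "h1 * 1\<^sub>m k + h2 * 0\<^sub>m (n - k) k = h1" "h1 * 0\<^sub>m k (n - k) + h2 * A = h2 * A"
      "0\<^sub>m b k * 1\<^sub>m k + H * 0\<^sub>m (n - k) k = 0\<^sub>m b k" "0\<^sub>m b k * 0\<^sub>m k (n - k) + H * A = H * A" using c Ac by auto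
    ultimately show ?thesis by simp
  qed
  have hQGL: "h * Q \<in> carrier (GL n)" using GL_mult[OF h QGL] .
  show bnk: "b \<le> n - k"
  proof (rule ccontr)
    assume "\<not> b \<le> n - k"
    then have ab: "a < b" using a by simp
    define F where "F = four_block_mat (1\<^sub>m (n - b)) (0\<^sub>m (n - b) b) (0\<^sub>m b (n - b)) D"
    have F: "F \<in> carrier (GL n)" unfolding F_def using GL_block[OF GL_one zero_carrier_mat DA(1), of "n - b"] nk by simp
    have "F * (h * Q) = four_block_mat h1 (h2 * A) (0\<^sub>m b k) (norm_form b (n - k) a)"
    proof -
      have "F * (h * Q) = four_block_mat (1\<^sub>m (n - b) * h1 + 0\<^sub>m (n - b) b * 0\<^sub>m b k) (1\<^sub>m (n - b) * (h2 * A) + 0\<^sub>m (n - b) b * (H * A))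
         (0\<^sub>m b (n - b) * h1 + D * 0\<^sub>m b k) (0\<^sub>m b (n - b) * (h2 * A) + D * (H * A))"
        unfolding hQ F_def by (rule mult_four_block_mat[OF one_carrier_mat zero_carrier_mat zero_carrier_mat Dc c(1) h2A(1) zero_carrier_mat h2A(2)])
      moreover have "1\<^sub>m (n - b) * h1 + 0\<^sub>m (n - b) b * 0\<^sub>m b k = h1" "1\<^sub>m (n - b) * (h2 * A) + 0\<^sub>m (n - b) b * (H * A) = h2 * A"
        "0\<^sub>m b (n - b) * h1 + D * 0\<^sub>m b k = 0\<^sub>m b k" "0\<^sub>m b (n - b) * (h2 * A) + D * (H * A) = D * (H * A)"
        using c h2A Dc by auto
      moreover have "D * (H * A) = norm_form b (n - k) a" using DA(3) Dc c Ac by (simp add: assoc_mult_mat[of _ b b _ "n - k" _ "n - k"])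
      ultimately show ?thesis by simp
    qed
    moreover have FhQ: "F * (h * Q) \<in> carrier (GL n)" using GL_mult[OF F hQGL] .
    ultimately have Gc: "four_block_mat h1 (h2 * A) (0\<^sub>m b k) (norm_form b (n - k) a) \<in> carrier (GL n)" by simp
    have "det (four_block_mat h1 (h2 * A) (0\<^sub>m b k) (norm_form b (n - k) a)) = (0::'f)"
    proof (rule det_zero_row[OF GL_mat[OF Gc], of "n - 1"])
      show n1: "n - 1 < n" using ab kb by linarith
      fix j assume j: "j < n"
      have d: "dim_row h1 = n - b" "dim_col h1 = k" "dim_row (norm_form b (n - k) a :: 'f mat) = b" "dim_col (norm_form b (n - k) a :: 'f mat) = n - k"
        using c unfolding norm_form_def by auto
      have l: "n - 1 < dim_row h1 + dim_row (norm_form b (n - k) a :: 'f mat)" "j < dim_col h1 + dim_col (norm_form b (n - k) a :: 'f mat)"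
        unfolding d nk using n1 j by auto
      have s: "\<not> n - 1 < n - b" "n - 1 - (n - b) = b - 1" "b - 1 < b" using ab kb by linarith+
      show "four_block_mat h1 (h2 * A) (0\<^sub>m b k) (norm_form b (n - k) a) $$ (n - 1, j) = 0"
        unfolding index_mat_four_block(1)[OF l] d using s ab j by (auto simp: norm_form_def)
    qed
    then show False using Gc by (simp add: GL_carrier)
  qed
  have HA0: "(H * A) $$ (i, j) = 0" if ij: "i < b" "j < n - k - a" for i j
  proof -
    note Di = GL_inv[OF DA(1)]
    let ?N = "norm_form b (n - k) a :: 'f mat"
    have Nc: "?N \<in> carrier_mat b (n - k)" unfolding norm_form_def by simp
    have "inv\<^bsub>GL b\<^esub> D * (D * H * A) = inv\<^bsub>GL b\<^esub> D * (D * (H * A))"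
      using Dc c Ac by (simp add: assoc_mult_mat[of _ b b _ "n - k" _ "n - k"])
    also have "\<dots> = (inv\<^bsub>GL b\<^esub> D * D) * (H * A)" by (rule assoc_mult_mat[OF Di(1) Dc h2A(2), symmetric])
    finally have "inv\<^bsub>GL b\<^esub> D * (D * H * A) = (inv\<^bsub>GL b\<^esub> D * D) * (H * A)" .
    then have "H * A = inv\<^bsub>GL b\<^esub> D * ?N" unfolding DA(3) Di(3) left_mult_one_mat[OF h2A(2)] by (rule sym)
    moreover have "(inv\<^bsub>GL b\<^esub> D * ?N) $$ (i, j) = 0"
      unfolding mult_entry[OF Di(1) Nc ij(1) less_le_trans[OF ij(2) diff_le_self]]
      using ij by (intro sum.neutral) (auto simp: norm_form_def)
    ultimately show ?thesis by simp
  qed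
  have q1: "h * Q \<in> parabolic (n - b) b"
    unfolding parabolic_iff nk(2)
  proof (intro conjI hQGL allI impI)
    fix i j assume i: "i < n" and j: "j < n" and ij: "n - b \<le> i \<and> j < n - b"
    have d: "dim_row h1 = n - b" "dim_col h1 = k" "dim_row (H * A) = b" "dim_col (H * A) = n - k" using c Ac by auto
    have l: "i < dim_row h1 + dim_row (H * A)" "j < dim_col h1 + dim_col (H * A)" unfolding d nk using i j by auto
    have s: "i - (n - b) < b" "\<not> i < n - b" using i ij kb by linarith+
    show "(h * Q) $$ (i, j) = 0"
    proof (cases "j < k")
      case True then show ?thesis unfolding hQ index_mat_four_block(1)[OF l] d using s by simp
    next
      case False
      have "j - k < n - k - a" using False ij a by linarith
      then show ?thesis unfolding hQ index_mat_four_block(1)[OF l] d using s False HA0[OF s(1)] by simp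
    qed
  qed
  have Qi: "inv\<^bsub>GL n\<^esub> Q \<in> parabolic k (n - k)"
    using subgroup.m_inv_closed[OF parabolic_subgroup QP] nk(1) by simp
  have "h = (h * Q) * inv\<^bsub>GL n\<^esub> Q" using hc Qc GL_inv[OF QGL] by (simp add: assoc_n)
  then show "\<exists>q1\<in>parabolic (n - b) b. \<exists>q2\<in>parabolic k (n - k). h = q1 * q2" using q1 Qi by blast
qed

end

section \<open>Stalks and supports on a single stratum\<close>

context induced_setting
begin

lemma un_lower_left: "x \<in> carrier_mat n n \<Longrightarrow> t < n \<Longrightarrow> c < n \<Longrightarrow> un n x $$ (n + t, c) = (0::'f)"
  by (simp add: un_entry)

lemma dg_lower_left: "a \<in> carrier_mat n n \<Longrightarrow> d \<in> carrier_mat n n \<Longrightarrow> t < n \<Longrightarrow> c < n \<Longrightarrow> dg a d $$ (n + t, c) = 0"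
  unfolding dg_def by simp

lemma rank_lt_iff:
  assumes p: "p \<in> P" and h: "h \<in> carrier_mat (n + n) (n + n)"
    and c: "a \<in> carrier_mat n n" "d \<in> carrier_mat n n" "a' \<in> carrier_mat n n" "d' \<in> carrier_mat n n"
      "a * a' = 1\<^sub>m n" "d * d' = 1\<^sub>m n" and x: "x \<in> carrier_mat n n"
  shows "rank_lt b (p * (h * dg a d) * un n x) \<longleftrightarrow> rank_lt b h"
proof
  note pc = P_carrier[OF p]
  have D: "dg a d \<in> carrier_mat (n + n) (n + n)" "dg a' d' \<in> carrier_mat (n + n) (n + n)" using c by auto
  have hD: "h * dg a d \<in> carrier_mat (n + n) (n + n)" using h D by auto
  have phD: "p * (h * dg a d) \<in> carrier_mat (n + n) (n + n)" using pc hD by auto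
  have U: "un n x \<in> carrier_mat (n + n) (n + n)" "un n (- x) \<in> carrier_mat (n + n) (n + n)" "- x \<in> carrier_mat n n" using x by auto
  show "rank_lt b (p * (h * dg a d) * un n x)" if r: "rank_lt b h"
  proof -
    have "rank_lt b (h * dg a d)" by (rule rank_lt_right[OF D(1) dg_lower_left[OF c(1,2)] h r])
    from rank_lt_left[OF p hD this] have 1: "rank_lt b (p * (h * dg a d))" .
    show ?thesis by (rule rank_lt_right[OF U(1) un_lower_left[OF x] phD 1])
  qed
  show "rank_lt b h" if r: "rank_lt b (p * (h * dg a d) * un n x)"
  proof -
        have "rank_lt b (p * (h * dg a d) * un n x * un n (- x))"
      by (rule rank_lt_right[OF U(2) un_lower_left[OF U(3)] mult_carrier_mat[OF phD U(1)] r])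
    then have 1: "rank_lt b (p * (h * dg a d))" unfolding assoc_2n[OF phD U(1,2)] un_inv(1)[OF x] right_mult_one_mat[OF phD] .
    have pGL: "p \<in> carrier (GL (n + n))" using p unfolding P_iff by blast
    note gi = GL_inv[OF pGL]
    have "inv\<^bsub>GL (n + n)\<^esub> p \<in> P" using subgroup.m_inv_closed[OF td.H(1) p] .
    from rank_lt_left[OF this phD 1]
    have 2: "rank_lt b (h * dg a d)" unfolding assoc_2n[OF gi(1) pc hD, symmetric] gi(3) left_mult_one_mat[OF hD] .
    have "rank_lt b (h * dg a d * dg a' d')" by (rule rank_lt_right[OF D(2) dg_lower_left[OF c(3,4)] hD 2])
    then show ?thesis unfolding assoc_2n[OF h D] dg_mult[OF c(1-4)] c(5,6) dg_one right_mult_one_mat[OF h] .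
  qed
qed

lemma GLO_inverse':
  assumes "a \<in> GLO n"
  obtains a' where "a' \<in> GLO n" "a' \<in> carrier_mat n n" "a \<in> carrier_mat n n" "a * a' = 1\<^sub>m n" "a' * a = 1\<^sub>m n"
  using GLO_inverse[OF assms] GLO_carrier assms by blast

lemma conj_cancel:
  assumes "a \<in> carrier_mat n n" "d \<in> carrier_mat n n" "a' \<in> carrier_mat n n" "d' \<in> carrier_mat n n"
    "a * a' = 1\<^sub>m n" "d' * d = 1\<^sub>m n" "w \<in> carrier_mat n n"
  shows "a * (a' * w * d') * d = (w :: 'f mat)"
proof -
  have "a * (a' * w * d') * d = (a * a') * w * (d' * d)" using assms(1-4,7) by (simp add: assoc_n)
  then show ?thesis using assms by simp
qed

lemma double_coset:
  assumes g: "g \<in> carrier (GL (n + n))"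
  obtains k p a d x where "admissible k" "p \<in> P" "a \<in> GLO n" "d \<in> GLO n" "x \<in> carrier_mat n n"
    "g = p * (g0 k * dg a d) * un n x"
proof -
  obtain k p a d x where k: "admissible k" "p \<in> P" "a \<in> GLO n" "d \<in> GLO n" "x \<in> carrier_mat n n"
    "p * g * dg a d * un n x = g0 k" using decomposition[OF g] by blast
  obtain a' where a': "a' \<in> GLO n" "a' \<in> carrier_mat n n" "a \<in> carrier_mat n n" "a * a' = 1\<^sub>m n" "a' * a = 1\<^sub>m n"
    using GLO_inverse'[OF k(3)] .
  obtain d' where d': "d' \<in> GLO n" "d' \<in> carrier_mat n n" "d \<in> carrier_mat n n" "d * d' = 1\<^sub>m n" "d' * d = 1\<^sub>m n"
    using GLO_inverse'[OF k(4)] .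
  define y where "y = a * (- x) * d'"
  have y: "y \<in> carrier_mat n n" unfolding y_def using a' d' k(5) by auto
  let ?q = "inv\<^bsub>GL (n + n)\<^esub> p"
  have q: "?q \<in> P" using subgroup.m_inv_closed[OF td.H(1) k(2)] .
  have pGL: "p \<in> carrier (GL (n + n))" using k(2) unfolding P_iff by blast
  note pi = GL_inv[OF pGL] and pc = GL_mat[OF pGL] and gc = GL_mat[OF g]
  have D: "dg a d \<in> carrier_mat (n + n) (n + n)" "dg a' d' \<in> carrier_mat (n + n) (n + n)" using a' d' by auto
  have U: "un n x \<in> carrier_mat (n + n) (n + n)" "un n (- x) \<in> carrier_mat (n + n) (n + n)" "un n y \<in> carrier_mat (n + n) (n + n)"
    "- x \<in> carrier_mat n n" using k(5) y by auto
    have ma: "a' * y * d = - x"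
    unfolding y_def by (rule conj_cancel[OF a'(2) d'(3) a'(3) d'(2) a'(5) d'(5) U(4)])
  have c1: "dg a' d' * un n y = un n (- x) * dg a' d'"
    using dg_un[OF a'(2) d'(2,3,4) y] unfolding ma .
  have "?q * (g0 k * dg a' d') * un n y = ?q * (g0 k * (dg a' d' * un n y))"
    using pi D U g0_inverse(1)[OF k(1)] by (simp add: assoc_2n)
  also have "\<dots> = ?q * ((p * g * dg a d * un n x) * (un n (- x) * dg a' d'))" unfolding c1 k(6) ..
  also have "(p * g * dg a d * un n x) * (un n (- x) * dg a' d') = p * g * (dg a d * ((un n x * un n (- x)) * dg a' d'))"
  proof -
    have "(Q * A * B) * (C * E) = Q * (A * ((B * C) * E))"
      if "Q \<in> carrier_mat (n + n) (n + n)" "A \<in> carrier_mat (n + n) (n + n)" "B \<in> carrier_mat (n + n) (n + n)"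
        "C \<in> carrier_mat (n + n) (n + n)" "E \<in> carrier_mat (n + n) (n + n)" for Q A B C E :: "'f mat"
      using that by (simp add: assoc_2n)
    from this[OF mult_carrier_mat[OF pc gc] D(1) U(1,2) D(2)] show ?thesis .
  qed
  also have "\<dots> = p * g" unfolding un_inv(1)[OF k(5)] left_mult_one_mat[OF D(2)] dg_mult[OF a'(3) d'(3) a'(2) d'(2)] a'(4) d'(4) dg_one
    using pc gc by simp
  also have "?q * (p * g) = g" unfolding assoc_2n[OF pi(1) pc gc, symmetric] pi(3) using gc by simp
  finally show ?thesis using that[OF k(1) q a'(1) d'(1) y] by simp
qed

text \<open>A large coordinate transversal to the stabilizer could be used to clear a row of the rank n - k block by an
  element of the congruence subgroup that fixes f, leading to a point where f vanishes.\<close>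

lemma orbit_bounded:
  assumes k: "admissible k" and a: "a \<in> GLO n" and d: "d \<in> GLO n" and e: "0 < e" "e < 1"
    and Kf: "\<And>\<kappa> g. \<kappa> \<in> Congr e (n + n) \<Longrightarrow> g \<in> carrier (GL (n + n)) \<Longrightarrow> f (g * \<kappa>) = f g"
    and z: "\<And>g. g \<in> carrier (GL (n + n)) \<Longrightarrow> rank_lt (n - k) g \<Longrightarrow> f g = 0"
    and u: "u \<in> unip n n" and nz: "f (g0 k * dg a d * u) \<noteq> 0"
  shows "\<exists>s\<in>td.Stab (g0 k * dg a d). \<exists>b\<in>ball_N n (1 / e). u = s * b"
proof -
  obtain a' where a': "a' \<in> GLO n" "a' \<in> carrier_mat n n" "a \<in> carrier_mat n n" "a * a' = 1\<^sub>m n" "a' * a = 1\<^sub>m n"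
    using GLO_inverse'[OF a] .
  obtain d' where d': "d' \<in> GLO n" "d' \<in> carrier_mat n n" "d \<in> carrier_mat n n" "d * d' = 1\<^sub>m n" "d' * d = 1\<^sub>m n"
    using GLO_inverse'[OF d] .
  obtain x where x: "x \<in> carrier_mat n n" "u = un n x" using u unfolding unip_eq by auto
  define y where "y = a * x * d'"
  have y: "y \<in> carrier_mat n n" unfolding y_def using a' d' x by auto
  note g = g0_inverse[OF k]
    have D: "dg a d \<in> carrier_mat (n + n) (n + n)" "dg a' d' \<in> carrier_mat (n + n) (n + n)" using a' d' by auto
  have U: "un n y \<in> carrier_mat (n + n) (n + n)" using y by auto
  have yb: "v (y $$ (l, c)) \<le> 1 / e" if lc: "l < n" "c < n" "k \<le> l" "c < r - k" for l c
  proof (rule ccontr)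
    assume "\<not> v (y $$ (l, c)) \<le> 1 / e"
    then have big: "1 / e < v (y $$ (l, c))" by simp
    moreover have "0 < 1 / e" using e by simp
    ultimately have y0: "y $$ (l, c) \<noteq> 0" by (metis less_trans less_irrefl zero_iff)
    define t where "t = - inverse (y $$ (l, c))"
    have vt: "v t \<le> e"
    proof -
      have "1 < v (y $$ (l, c)) * e" using big e by (simp add: field_simps)
      then have "1 / v (y $$ (l, c)) \<le> e" using pos[OF y0] by (simp add: field_simps)
      moreover have "v t = 1 / v (y $$ (l, c))" unfolding t_def using mult[of "-1" "inverse (y $$ (l, c))"] inverse_eq[OF y0] by simp
      ultimately show ?thesis by simp
    qed
    \<comment> \<open>Right multiplication by E clears column l of row l - k of the identity block, which lowers the rank.\<close>
    define E where "E = Matrix.mat (n + n) (n + n) (\<lambda>(i, j). if i = j then 1 else if i = n + c \<and> j = l then t else 0)"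
    have Ec: "E \<in> carrier_mat (n + n) (n + n)" unfolding E_def by simp
    have EK: "E \<in> Congr e (n + n)"
    proof -
      have "entries_le e (E - 1\<^sub>m (n + n))"
      proof (rule entries_leI[OF minus_carrier_mat[OF one_carrier_mat]])
        fix i j assume "i < n + n" "j < n + n"
        then show "v ((E - 1\<^sub>m (n + n)) $$ (i, j)) \<le> e" unfolding E_def using vt e by auto
      qed
      then show ?thesis unfolding Congr_def using Ec by simp
    qed
    define h where "h = dg a' d' * E * dg a d"
    have dd: "dg a' d' * dg a d = 1\<^sub>m (n + n)" "dg a d * dg a' d' = 1\<^sub>m (n + n)"
      using dg_mult a' d' dg_one by auto
    have hK: "h \<in> Congr e (n + n)" unfolding h_def
      by (rule Congr_conj[OF _ EK dg_GLO[OF a'(1) d'(1)] dg_GLO[OF a d] dd(1)]) (use e in simp)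
    have hc: "h \<in> carrier_mat (n + n) (n + n)" unfolding h_def using D Ec by auto
    have eq: "g0 k * dg a d * u * h = g0 k * un n y * E * dg a d"
    proof -
      have "g0 k * dg a d * u * h = g0 k * (dg a d * un n x) * h"
        unfolding x(2) using g(1) D x(1) hc by (simp add: assoc_2n)
      also have "dg a d * un n x = un n y * dg a d" unfolding y_def by (rule dg_un[OF a'(3) d'(3,2,5) x(1)])
      also have "g0 k * (un n y * dg a d) * h = g0 k * un n y * ((dg a d * dg a' d') * E * dg a d)"
        unfolding h_def using g(1) D U Ec by (simp add: assoc_2n)
      also have "\<dots> = g0 k * un n y * E * dg a d" unfolding dd using g(1) D U Ec by (simp add: assoc_2n)
      finally show ?thesis .
    qed
    have gu: "g0 k * un n y \<in> carrier_mat (n + n) (n + n)" using g(1) U by auto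
    have gUE: "g0 k * un n y * E \<in> carrier_mat (n + n) (n + n)" using gu Ec by auto
    have e1: "(g0 k * un n y) $$ (i, j) = un n y $$ (sg k i, j)" if "i < n + n" "j < n + n" for i j
      unfolding g0_def perm_mult_left[OF U sg_tg[OF k]] using that by simp
    have "rank_lt (n - k) (g0 k * un n y * E)"
    proof (rule rank_ltI[of "{..<n - k} - {l - k}" _ _ "\<lambda>i \<tau>. if \<tau> = i then 1 else 0"
          "\<lambda>i c'. (if k + i = c' then 1 else 0) + (if c' = l then y $$ (k + i, c) * t else 0)"])
      show "finite ({..<n - k} - {l - k})" by simp
      have "l - k \<in> {..<n - k}" using lc by auto
      then show "card ({..<n - k} - {l - k}) < n - k" by (simp add: card_Diff_singleton)
      fix i c' assume ic: "i < m" "c' < n"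
      have ri: "r + i < n + n" "c' < n + n" using ic rm by auto
      let ?s = "sg k (r + i)"
      have s: "?s = (if i < n - k then k + i else r + i)" by (rule sg_lower[OF k ic(1)])
      have sn: "?s < n + n" using s k ri unfolding admissible_def by auto
      have "(g0 k * un n y * E) $$ (r + i, c') = (\<Sum>j<n + n. un n y $$ (?s, j) * E $$ (j, c'))"
        by (rule trans[OF mult_entry[OF gu Ec ri] sum.cong[OF refl]]) (use e1 ri in simp)
      also have "\<dots> = (\<Sum>j<n + n. (if j = c' then un n y $$ (?s, c') else 0) + (if j = n + c then if c' = l then un n y $$ (?s, n + c) * t else 0 else 0))"
        by (rule sum.cong[OF refl]) (use lc ri ic in \<open>auto simp: E_def\<close>)
      also have "\<dots> = un n y $$ (?s, c') + (if c' = l then un n y $$ (?s, n + c) * t else 0)"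
        using ri lc by (simp add: sum.distrib)
      also have "un n y $$ (?s, c') = (if ?s = c' then 1 else 0)" using un_entry[OF y sn ri(2)] ic by simp
      also have "un n y $$ (?s, n + c) = (if ?s < n then y $$ (?s, c) else if ?s = n + c then 1 else 0)"
        using un_entry[OF y sn, of "n + c"] lc by simp
      finally have L: "(g0 k * un n y * E) $$ (r + i, c') = (if ?s = c' then 1 else 0) +
        (if c' = l then (if ?s < n then y $$ (?s, c) else if ?s = n + c then 1 else 0) * t else 0)" .
      have R: "(\<Sum>\<tau>\<in>{..<n - k} - {l - k}. (if \<tau> = i then 1 else 0) * ((if k + \<tau> = c' then 1 else 0) + (if c' = l then y $$ (k + \<tau>, c) * t else 0)))
        = (if i \<in> {..<n - k} - {l - k} then (if k + i = c' then 1 else 0) + (if c' = l then y $$ (k + i, c) * t else 0) else 0)"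
      proof -
        have "(\<Sum>\<tau>\<in>{..<n - k} - {l - k}. (if \<tau> = i then 1 else 0) * ((if k + \<tau> = c' then 1 else 0) + (if c' = l then y $$ (k + \<tau>, c) * t else 0)))
          = (\<Sum>\<tau>\<in>{..<n - k} - {l - k}. if \<tau> = i then (if k + i = c' then 1 else 0) + (if c' = l then y $$ (k + i, c) * t else 0) else 0)"
          by (rule sum.cong[OF refl]) simp
        then show ?thesis by simp
      qed
      show "(g0 k * un n y * E) $$ (r + i, c') = (\<Sum>\<tau>\<in>{..<n - k} - {l - k}. (if \<tau> = i then 1 else 0) * ((if k + \<tau> = c' then 1 else 0) + (if c' = l then y $$ (k + \<tau>, c) * t else 0)))"
      proof (cases "i < n - k")
        case True
        then have sk: "?s = k + i" "k + i < n" using s by auto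
        show ?thesis
        proof (cases "i = l - k")
          case True
          then have "k + i = l" using lc by simp
          then show ?thesis unfolding L R sk(1) using sk(2) y0 True by (auto simp: t_def)
        next
          case False
          then show ?thesis unfolding L R sk(1) using sk(2) True by auto
        qed
      next
        case False
        then have "?s = r + i" "n + (r - k) \<le> ?s" using s k unfolding admissible_def by auto
        then have "?s \<noteq> c'" "?s \<noteq> n + c" "\<not> ?s < n" using ic lc by linarith+
        then show ?thesis unfolding L R using False by simp
      qed
    qed
    note rkE = this
    have "rank_lt (n - k) (g0 k * un n y * E * dg a d)" by (rule rank_lt_right[OF D(1) dg_lower_left[OF a'(3) d'(3)] gUE rkE])
    then have rk: "rank_lt (n - k) (g0 k * dg a d * u * h)" unfolding eq .
    have G: "g0 k * dg a d * u \<in> carrier (GL (n + n))"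
      unfolding x(2) using conj_dg(2)[OF k a'(3) d'(3) a'(2) d'(2) a'(4) d'(4) x(1)] un_inv(2)[OF x(1)] by (rule GL_mult)
    have "h \<in> carrier (GL (n + n))" using hK Congr_GLO[of e "n + n"] GLO_GL e by fastforce
    then have "f (g0 k * dg a d * u * h) = 0" using z[OF GL_mult[OF G] rk] by simp
    then show False using Kf[OF hK G] nz by simp
  qed
  obtain ys yo where s: "ys \<in> Dk k" "yo \<in> carrier_mat n n" "y = ys + yo"
    "\<And>l c. l < n \<Longrightarrow> c < n \<Longrightarrow> yo $$ (l, c) = (if k \<le> l \<and> c < r - k then y $$ (l, c) else 0)" using split_Dk[where k = k, OF y] by blast
  have ys: "ys \<in> carrier_mat n n" using s(1) unfolding Dk_def by auto
  have rc: "a * (a' * w * d) * d' = w" "a' * (a * w * d') * d = w" "a' * w * d \<in> carrier_mat n n" if w: "w \<in> carrier_mat n n" for w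
    using conj_cancel[OF a'(3) d'(2) a'(2) d'(3) a'(4) d'(4) w] conj_cancel[OF a'(2) d'(3) a'(3) d'(2) a'(5) d'(5) w] a' d' w by auto
  have "un n (a' * ys * d) \<in> td.Stab (g0 k * dg a d)"
    unfolding Stab_dg[OF k a'(3) d'(3) a'(2) d'(2) a'(4) d'(4) rc(3)[OF ys]] rc(1)[OF ys] by (rule s(1))
  moreover have "un n (a' * yo * d) \<in> ball_N n (1 / e)"
  proof -
    have "entries_le (1 / e) yo"
    proof (rule entries_leI[OF s(2)])
      fix l c assume lc: "l < n" "c < n"
      then show "v (yo $$ (l, c)) \<le> 1 / e" unfolding s(4)[OF lc] using yb[OF lc] e by auto
    qed
    moreover have "entries_le 1 a'" "entries_le 1 d" using a'(1) d unfolding GLO_def by auto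
    ultimately have "entries_le (1 * (1 / e) * 1) (a' * yo * d)"
      using a'(2) d'(3) s(2) e by (intro entries_le_mult[of _ _ _ _ n n n] mult_carrier_mat) auto
    then show ?thesis unfolding ball_N_def using rc(3)[OF s(2)] by auto
  qed
  moreover have "u = un n (a' * ys * d) * un n (a' * yo * d)"
  proof -
    have "x = a' * y * d" unfolding y_def using rc(2)[OF x(1)] by simp
    also have "\<dots> = a' * ys * d + a' * yo * d" unfolding s(3)
      using a' d' ys s(2) by (simp add: mult_add_distrib_mat[of _ n n _ n] add_mult_distrib_mat[of _ n n _ _ n])
    finally show ?thesis unfolding x(2) un_mult[OF rc(3)[OF ys] rc(3)[OF s(2)]] by simp
  qed
  ultimately show ?thesis by blast
qed

text \<open>In the coordinate y of the stabilizer and with \<open>h = d a\<^sup>-\<^sup>1\<close>, the character becomes \<open>\<psi>(tr(y h))\<close>. If h does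
  not map B into A, this is non-trivial on elements whose Levi component is trivial. Otherwise h is the product
  of elements stabilizing B and A, and conjugation by these turns \<open>tr(y h)\<close> into \<open>tr y\<close>.\<close>

lemma stalk_vanishes:
  assumes hyp: "\<And>k. 2 * k \<le> r \<Longrightarrow> r \<le> n + k \<Longrightarrow> rep_space \<rho> \<subseteq> twisted_kernel \<rho> (Nk n r k) (psi_Nk \<psi> n r k)"
    and k: "admissible k" and a: "a \<in> GLO n" and d: "d \<in> GLO n"
  shows "rep_space \<rho> \<subseteq> twisted_kernel (conj_rep (GL (n + n)) (g0 k * dg a d) (inflate r m \<rho>))
    (td.Stab (g0 k * dg a d)) (psi_N \<psi> n)" (is "_ \<subseteq> ?ker")
proof -
  obtain a' where a': "a' \<in> GLO n" "a' \<in> carrier_mat n n" "a \<in> carrier_mat n n" "a * a' = 1\<^sub>m n" "a' * a = 1\<^sub>m n"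
    using GLO_inverse'[OF a] .
  obtain d' where d': "d' \<in> GLO n" "d' \<in> carrier_mat n n" "d \<in> carrier_mat n n" "d * d' = 1\<^sub>m n" "d' * d = 1\<^sub>m n"
    using GLO_inverse'[OF d] .
  have kr: "k \<le> n" "k \<le> r" "r \<le> n + k" using k unfolding admissible_def by auto
  interpret R: vector_space "rep_scale \<rho>" using linear_repD(1)[OF \<rho>_linear] .
  note G = conj_dg(2)[OF k a'(3) d'(3) a'(2) d'(2) a'(4) d'(4) zero_carrier_mat]
  define ker where "ker = ?ker"
  note tk = twisted_kernel_subspace[OF td.conj_linear_rep[OF G], where \<theta> = "psi_N \<psi> n"]
  have ks: "R.subspace ker" using tk(1) unfolding ker_def by simp
  define h where "h = d * a'"
  have h: "h \<in> carrier (GL n)"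
    unfolding h_def using a'(1) d GLO_GL[of n] by (intro GL_mult) auto
  have hc: "h \<in> carrier_mat n n" using GL_mat[OF h] .
  have gen: "rep_act \<rho> (levi_part r m (cj k y)) w - rep_scale \<rho> (\<psi> (mat_trace (y * h))) w \<in> ker"
    if y: "y \<in> Dk k" and w: "w \<in> rep_space \<rho>" for y w
  proof -
    have yc: "y \<in> carrier_mat n n" using y unfolding Dk_def by auto
    define x where "x = a' * y * d"
    have x: "x \<in> carrier_mat n n" unfolding x_def using a' d' yc by auto
    have ax: "a * x * d' = y" unfolding x_def by (rule conj_cancel[OF a'(3) d'(2) a'(2) d'(3) a'(4) d'(4) yc])
    have "un n x \<in> td.Stab (g0 k * dg a d)"
      unfolding Stab_dg[OF k a'(3) d'(3) a'(2) d'(2) a'(4) d'(4) x] ax by (rule y)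
    from tk(3)[OF this, of w] w
    have "rep_act \<rho> (levi_part r m (g0 k * dg a d * un n x * inv\<^bsub>GL (n + n)\<^esub> (g0 k * dg a d))) w - rep_scale \<rho> (psi_N \<psi> n (un n x)) w \<in> ker"
      unfolding ker_def by simp
    moreover have "mat_trace x = mat_trace (y * h)"
    proof -
      have "mat_trace x = mat_trace (a' * (y * d))" unfolding x_def using a' d' yc by (simp add: assoc_n)
      also have "\<dots> = mat_trace ((y * d) * a')" by (rule mat_trace_mult_commute[of _ n n]) (use a' d' yc in auto)
      finally show ?thesis unfolding h_def using a' d' yc by (simp add: assoc_n)
    qed
    ultimately show ?thesis unfolding conj_dg(1)[OF k a'(3) d'(3) a'(2) d'(2) a'(4) d'(4) x] ax psi_N_un[OF x] by simp
  qed
  have "w \<in> ker" if w: "w \<in> rep_space \<rho>" for w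
  proof (cases "\<exists>i<k. \<exists>j<n. r - k \<le> j \<and> h $$ (j, i) \<noteq> 0")
    case True
    then obtain i j where ij: "i < k" "j < n" "r - k \<le> j" "h $$ (j, i) \<noteq> 0" by blast
    obtain c where c: "\<psi> c \<noteq> 1" using \<psi>_nontrivial by blast
    \<comment> \<open>An elementary matrix in row i < k and column j of B has trivial Levi component.\<close>
    define y where "y = Matrix.mat n n (\<lambda>(p, q). if p = i \<and> q = j then c / h $$ (j, i) else 0)"
    have yc: "y \<in> carrier_mat n n" unfolding y_def by simp
    have y: "y \<in> Dk k" unfolding Dk_def y_def using ij by auto
    have i: "i < n" using ij kr by simp
    have tr: "mat_trace (y * h) = c"
    proof -
      have "(y * h) $$ (p, p) = (if p = i then c else 0)" if p: "p < n" for p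
      proof -
        have "(y * h) $$ (p, p) = (\<Sum>q<n. if q = j then if p = i then c else 0 else 0)"
          by (rule trans[OF mult_entry[OF yc hc p p] sum.cong[OF refl]]) (use p ij in \<open>auto simp: y_def\<close>)
        then show ?thesis using ij by simp
      qed
      then have "mat_trace (y * h) = (\<Sum>p<n. if p = i then c else 0)" unfolding mat_trace_def using yc by (simp del: index_mult_mat(1))
      then show ?thesis using i by simp
    qed
    have cc: "cj k y \<in> carrier_mat (r + m) (r + m)" using GL_mat[OF cj_GL[OF k yc]] rm by simp
    have "levi_part r m (cj k y) = 1\<^sub>m (n + n)"
    proof (rule eq_matI)
      fix p q assume "p < dim_row (1\<^sub>m (n + n) :: 'f mat)" "q < dim_col (1\<^sub>m (n + n) :: 'f mat)"
      then have pq: "p < n + n" "q < n + n" by auto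
      have "y $$ (sg k p, sg k q - n) = 0" if s: "sg k p < n" "n \<le> sg k q" and pr: "(p < r) = (q < r)"
      proof (rule ccontr)
        assume nz: "y $$ (sg k p, sg k q - n) \<noteq> 0"
        have "sg k q < n + n" using sg_tg[OF k] pq unfolding inv_pair_def by blast
        then have "sg k q - n < n" using s(2) by linarith
        then have e: "sg k p = i" "sg k q - n = j" using nz s(1) unfolding y_def by (auto split: if_splits)
        have "p < r" using e(1) ij(1) kr s(1) unfolding sg_def by (auto split: if_splits)
        moreover have "\<not> q < r" using e(2) s(2) ij(3) kr unfolding sg_def by (auto split: if_splits)
        ultimately show False using pr by simp
      qed
      then show "levi_part r m (cj k y) $$ (p, q) = 1\<^sub>m (n + n) $$ (p, q)"
        using levi_part_entry[OF cc, of p q] cj_entry[OF k yc pq] pq rm by (auto split: if_splits)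
    qed (use levi_part_carrier[OF cc] rm in auto)
    then have "w - rep_scale \<rho> (\<psi> c) w \<in> ker"
      using gen[OF y w] linear_repD(7)[OF \<rho>_linear w] unfolding tr by simp
    from R.subspace_scale[OF ks this, of "inverse (1 - \<psi> c)"]
    have "rep_scale \<rho> (inverse (1 - \<psi> c)) (rep_scale \<rho> (1 - \<psi> c) w) \<in> ker" by (simp add: R.scale_left_diff_distrib)
    then show ?thesis using c by simp
  next
    case False
    define b where "b = n + k - r"
    have b: "b \<le> n" "n - b = r - k" unfolding b_def using kr by auto
    have z: "h $$ (j, i) = 0" if "n - b \<le> j" "j < n" "i < k" for i j using False that b(2) by auto
    have "b \<le> n - k" by (rule flag_factorization(1)[OF h kr(1) b(1) z])
    then have k2: "2 * k \<le> r" unfolding b_def using kr by linarith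
    obtain q1 q2 where q: "q1 \<in> parabolic (n - b) b" "q2 \<in> parabolic k (n - k)" "h = q1 * q2"
      using flag_factorization(2)[OF h kr(1) b(1) z] by blast
    have nb: "n - b + b = n" "k + (n - k) = n" using b(1) kr by auto
    have qG: "q1 \<in> carrier (GL n)" "q2 \<in> carrier (GL n)" using q(1,2) unfolding parabolic_iff nb by blast+
    define p1 where "p1 = inv\<^bsub>GL n\<^esub> q1"
    define p2 where "p2 = inv\<^bsub>GL n\<^esub> q2"
    note qi1 = GL_inv[OF qG(1), folded p1_def] and qi2 = GL_inv[OF qG(2), folded p2_def]
    have p1P: "p1 \<in> parabolic (n - b) b" unfolding p1_def
      using subgroup.m_inv_closed[OF parabolic_subgroup q(1)] unfolding nb .
    have p2P: "p2 \<in> parabolic k (n - k)" unfolding p2_def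
      using subgroup.m_inv_closed[OF parabolic_subgroup q(2)] unfolding nb .
    note qc = GL_mat[OF qG(1)] GL_mat[OF qG(2)] qi1(1) qi2(1)
    \<comment> \<open>L is the inverse of M; conjugation by L turns the coordinate y of the stabilizer into \<open>q2\<^sup>-\<^sup>1 y q1\<^sup>-\<^sup>1\<close>.\<close>
    define M where "M = g0 k * dg q2 p1 * inv\<^bsub>GL (n + n)\<^esub> (g0 k)"
    define L where "L = g0 k * dg p2 q1 * inv\<^bsub>GL (n + n)\<^esub> (g0 k)"
    note D2 = dg_GL[OF qc(2,3,4,1) qi2(2) qi1(3)] and D1 = dg_GL[OF qc(4,1,2,3) qi2(3) qi1(2)]
    have inP: "g0 k * dg s t * inv\<^bsub>GL (n + n)\<^esub> (g0 k) \<in> P"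
      if s: "s \<in> parabolic k (n - k)" and t: "t \<in> parabolic (n - b) b" for s t
    proof -
      have sG: "s \<in> carrier (GL n)" and s0: "\<And>i j. i < n \<Longrightarrow> j < n \<Longrightarrow> k \<le> i \<and> j < k \<Longrightarrow> s $$ (i, j) = 0"
        using s unfolding parabolic_iff nb by auto
      have tG: "t \<in> carrier (GL n)" and t0: "\<And>i j. i < n \<Longrightarrow> j < n \<Longrightarrow> r - k \<le> i \<and> j < r - k \<Longrightarrow> t $$ (i, j) = 0"
        using t unfolding parabolic_iff nb unfolding b(2) by auto
      note sc = GL_mat[OF sG] and tc = GL_mat[OF tG]
      have DG: "dg s t \<in> carrier (GL (n + n))"
        by (rule dg_GL(1)[OF sc tc GL_inv(1)[OF sG] GL_inv(1)[OF tG] GL_inv(2)[OF sG] GL_inv(2)[OF tG]])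
      note gi = g0_inverse(5)[OF k]
      have e: "(g0 k * dg s t * inv\<^bsub>GL (n + n)\<^esub> (g0 k)) $$ (i, j) = 0" if ij: "i < n + n" "j < n + n" "r \<le> i" "j < r" for i j
      proof -
        have sgn: "sg k i < n + n" "sg k j < n + n" using sg_tg[OF k] ij unfolding inv_pair_def by blast+
        have i: "(k \<le> sg k i \<and> sg k i < n) \<or> n + (r - k) \<le> sg k i" using ij kr unfolding sg_def by auto
        have j: "sg k j < k \<or> (n \<le> sg k j \<and> sg k j < n + (r - k))" using ij kr unfolding sg_def by auto
        have "dg s t $$ (sg k i, sg k j) = 0"
        proof (cases "sg k i < n")
          case True
          then show ?thesis unfolding dg_def using sc tc sgn i j s0[of "sg k i" "sg k j"] kr by auto
        next
          case False
          then have "r - k \<le> sg k i - n" "sg k i - n < n" using i sgn by linarith+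
          moreover have "\<not> sg k j < n \<Longrightarrow> sg k j - n < r - k \<and> sg k j - n < n" using j sgn kr by linarith
          ultimately show ?thesis unfolding dg_def using False sc tc sgn t0[of "sg k i - n" "sg k j - n"] by auto
        qed
        then show ?thesis unfolding g0_conj[OF k GL_mat[OF DG]] using ij by simp
      qed
      show ?thesis unfolding P_iff using GL_mult[OF GL_mult[OF gi DG] GL_inv(4)[OF gi]] e by blast
    qed
    have MP: "M \<in> P" unfolding M_def by (rule inP[OF q(2) p1P])
    have LP: "L \<in> P" unfolding L_def by (rule inP[OF p2P q(1)])
    note gi = g0_inverse(5)[OF k] and cj2 = td.conj_mult[OF g0_inverse(5)[OF k]]
    have LM: "L * M = 1\<^sub>m (n + n)"
    proof -
      have "L * M = g0 k * (dg p2 q1 * dg q2 p1) * inv\<^bsub>GL (n + n)\<^esub> (g0 k)"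
        unfolding L_def M_def using cj2[OF D1(1) D2(1)] by simp
      then show ?thesis using dg_mult[OF qc(4,1,2,3)] qi1(2) qi2(3) dg_one GL_inv[OF gi] GL_mat[OF gi] by simp
    qed
    have Lcj: "L * cj k y' = cj k (p2 * y' * p1) * L" if y': "y' \<in> carrier_mat n n" for y'
    proof -
      have yc: "p2 * y' * p1 \<in> carrier_mat n n" using qc y' by auto
      have "L * cj k y' = g0 k * (dg p2 q1 * un n y') * inv\<^bsub>GL (n + n)\<^esub> (g0 k)"
        unfolding L_def cj_def using cj2[OF D1(1) un_inv(2)[OF y']] by simp
      also have "dg p2 q1 * un n y' = un n (p2 * y' * p1) * dg p2 q1" by (rule dg_un[OF qc(4,1,3) qi1(3) y'])
      also have "g0 k * (un n (p2 * y' * p1) * dg p2 q1) * inv\<^bsub>GL (n + n)\<^esub> (g0 k) = cj k (p2 * y' * p1) * L"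
        unfolding L_def cj_def using cj2[OF un_inv(2)[OF yc] D1(1)] by simp
      finally show ?thesis .
    qed
    let ?A = "\<lambda>p. rep_act \<rho> (levi_part r m p)"
    note H = td.H_act[unfolded inflate_simps GL_simps]
    have A: "?A p (x - y) = ?A p x - ?A p y" if "p \<in> P" "x \<in> rep_space \<rho>" "y \<in> rep_space \<rho>" for p x y
      using H(3)[OF that(1), of "x - y" y] linear_rep_subspace(4)[OF \<rho>_linear that(2,3)] that(3) by simp
    \<comment> \<open>The action of L carries the twisted kernel for \<open>N'\<^sub>k\<close> into the twisted kernel of the stalk.\<close>
    define S where "S = {w \<in> rep_space \<rho>. ?A L w \<in> ker}"
    have Sub: "R.subspace S"
    proof (rule R.subspaceI)
      show "0 \<in> S" unfolding S_def using H(5)[OF LP] R.subspace_0[OF ks] linear_rep_subspace(1)[OF \<rho>_linear] by simp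
      show "x + y \<in> S" if "x \<in> S" "y \<in> S" for x y
        using that H(3)[OF LP, of x y] R.subspace_add[OF ks] linear_rep_subspace(3)[OF \<rho>_linear] unfolding S_def by simp
      show "rep_scale \<rho> c x \<in> S" if "x \<in> S" for c x
        using that H(4)[OF LP, of x c] R.subspace_scale[OF ks] linear_rep_subspace(2)[OF \<rho>_linear] unfolding S_def by simp
    qed
    have gS: "rep_act \<rho> u w0 - rep_scale \<rho> (psi_Nk \<psi> n r k u) w0 \<in> S" if u: "u \<in> Nk n r k" and w0: "w0 \<in> rep_space \<rho>" for u w0
    proof -
      obtain y' where y': "y' \<in> Dk k" "u = levi_part r m (cj k y')" using u unfolding Nk_eq[OF k2 kr(3)] by auto
      have yc': "y' \<in> carrier_mat n n" using y'(1) unfolding Dk_def by auto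
      have psi: "psi_Nk \<psi> n r k u = \<psi> (mat_trace y')" unfolding y'(2) psi_Nk_cj[OF k2 kr(3) y'(1)] psi_N_un[OF yc'] ..
      define y where "y = p2 * y' * p1"
      have yc: "y \<in> carrier_mat n n" unfolding y_def using qc yc' by auto
      have cP: "cj k y' \<in> P" using cj_P[OF k yc'] y'(1) by simp
      have LC: "L * cj k y' = cj k y * L" unfolding y_def by (rule Lcj[OF yc'])
      have "cj k y * L * M \<in> P" using levi_part_mult(2)[OF levi_part_mult(2)[OF LP cP] MP] unfolding LC .
      moreover have "cj k y * L * M = cj k y"
        using assoc_mult_mat[OF GL_mat[OF cj_GL[OF k yc]] P_carrier[OF LP] P_carrier[OF MP]] LM GL_mat[OF cj_GL[OF k yc]] by simp
      ultimately have cyP: "cj k y \<in> P" by simp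
      then have yD: "y \<in> Dk k" using cj_P[OF k yc] by simp
      have tr: "mat_trace (y * h) = mat_trace y'"
      proof -
        have "y * h = p2 * y' * (p1 * q1) * q2" unfolding y_def q(3) using qc yc' by (simp add: assoc_n)
        also have "\<dots> = p2 * (y' * q2)" unfolding qi1(3) using qc yc' by (simp add: assoc_n)
        finally have "mat_trace (y * h) = mat_trace (y' * q2 * p2)"
          using mat_trace_mult_commute[of p2 n n "y' * q2"] qc yc' by simp
        also have "y' * q2 * p2 = y'" using qi2(2) qc yc' by (simp add: assoc_n)
        finally show ?thesis .
      qed
      have w1: "?A L w0 \<in> rep_space \<rho>" using H(1)[OF LP w0] .
      have uw: "?A (cj k y') w0 \<in> rep_space \<rho>" using H(1)[OF cP w0] .
      have "?A L (?A (cj k y') w0) = ?A (cj k y) (?A L w0)"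
        using H(2)[OF LP cP w0] H(2)[OF cyP LP w0] LC by simp
      then have "?A L (rep_act \<rho> u w0 - rep_scale \<rho> (psi_Nk \<psi> n r k u) w0)
        = ?A (cj k y) (?A L w0) - rep_scale \<rho> (\<psi> (mat_trace (y * h))) (?A L w0)"
        unfolding psi tr unfolding y'(2) using A[OF LP uw linear_rep_subspace(2)[OF \<rho>_linear w0]] H(4)[OF LP w0] by simp
      moreover have "\<dots> \<in> ker" by (rule gen[OF yD w1])
      moreover have "rep_act \<rho> u w0 - rep_scale \<rho> (psi_Nk \<psi> n r k u) w0 \<in> rep_space \<rho>"
        unfolding y'(2) using linear_rep_subspace(2,4)[OF \<rho>_linear] uw w0 by simp
      ultimately show ?thesis unfolding S_def by simp
    qed
    have "twisted_kernel \<rho> (Nk n r k) (psi_Nk \<psi> n r k) \<subseteq> S"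
      unfolding twisted_kernel_def by (rule R.span_minimal[OF _ Sub]) (use gS in blast)
    moreover have Mw: "?A M w \<in> rep_space \<rho>" using H(1)[OF MP w] .
    ultimately have "?A M w \<in> S" using hyp[OF k2 kr(3)] by blast
    then have "?A L (?A M w) \<in> ker" unfolding S_def by simp
    moreover have "?A L (?A M w) = w" using H(2)[OF LP MP w] H(6)[OF w] unfolding LM by simp
    ultimately show ?thesis by simp
  qed
  then show ?thesis unfolding ker_def by blast
qed

end

section \<open>From vanishing stalks to vanishing coinvariants\<close>

context induced_setting
begin

text \<open>An average is right invariant under an open subgroup, so its vanishing at one point \<open>g\<^sub>0 dg a d\<close> extends to
  a neighbourhood. Finitely many of these cover the compact set of all integral a, d, and larger averages
  still vanish.\<close>

lemma uniform_average:
  assumes hyp: "\<And>k. 2 * k \<le> r \<Longrightarrow> r \<le> n + k \<Longrightarrow> rep_space \<rho> \<subseteq> twisted_kernel \<rho> (Nk n r k) (psi_Nk \<psi> n r k)"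
    and k: "admissible k" and f: "f \<in> rep_space td.V" and e: "0 < e" "e < 1"
    and Kf: "\<And>\<kappa> g. \<kappa> \<in> Congr e (n + n) \<Longrightarrow> g \<in> carrier (GL (n + n)) \<Longrightarrow> f (g * \<kappa>) = f g"
    and \<psi>e: "\<forall>x. v x \<le> e \<longrightarrow> \<psi> x = 1"
    and z: "\<And>g. g \<in> carrier (GL (n + n)) \<Longrightarrow> rank_lt (n - k) g \<Longrightarrow> f g = 0"
  shows "\<exists>R\<ge>0. \<forall>a\<in>GLO n. \<forall>d\<in>GLO n. \<forall>x\<in>carrier_mat n n.
    twisted_sum (GL (n + n)) td.V (psi_N \<psi> n) (ball_N n R) (ball_N n R \<inter> Congr e (n + n)) f (g0 k * dg a d * un n x) = 0"
proof -
  have K: "subgroup (Congr e (n + n)) (GL (n + n))" "openin (GL_topology (n + n)) (Congr e (n + n))"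
    using Congr_subgroup[of e "n + n"] Congr_open[of e "n + n"] e by auto
  have Kf': "\<And>\<kappa> g. \<kappa> \<in> Congr e (n + n) \<Longrightarrow> g \<in> carrier (GL (n + n)) \<Longrightarrow> f (g \<otimes>\<^bsub>GL (n + n)\<^esub> \<kappa>) = f g"
    using Kf by simp
  have \<theta>K: "\<And>x. x \<in> unip n n \<Longrightarrow> x \<in> Congr e (n + n) \<Longrightarrow> psi_N \<psi> n x = 1" using psi_N_Congr[OF \<psi>e] e by auto
  define av where "av R = twisted_sum (GL (n + n)) td.V (psi_N \<psi> n) (ball_N n R) (ball_N n R \<inter> Congr e (n + n)) f" for R
  have e0: "0 \<le> 1 / e" using e by simp
  note BN = ball_N_subgroup ball_N_compact ball_N_unip
  define C where "C = {dg a d | a d. a \<in> GLO n \<and> d \<in> GLO n}"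
  have C_GL: "g0 k * \<kappa> \<in> carrier (GL (n + n))" "\<kappa> \<in> carrier (GL (n + n))" if \<kappa>: "\<kappa> \<in> C" for \<kappa>
  proof -
    obtain a d where ad: "\<kappa> = dg a d" "a \<in> GLO n" "d \<in> GLO n" using \<kappa> unfolding C_def by blast
    then have "\<kappa> \<in> GLO (n + n)" using dg_GLO by simp
    then show "\<kappa> \<in> carrier (GL (n + n))" using GLO_GL by blast
    then show "g0 k * \<kappa> \<in> carrier (GL (n + n))" using g0_inverse(5)[OF k] by (intro GL_mult)
  qed
  have bnd: "\<exists>s\<in>td.Stab (g0 k * \<kappa>). \<exists>b\<in>ball_N n (1 / e). u = s \<otimes>\<^bsub>GL (n + n)\<^esub> b"
    if \<kappa>: "\<kappa> \<in> C" "u \<in> unip n n" "f ((g0 k * \<kappa>) \<otimes>\<^bsub>GL (n + n)\<^esub> u) \<noteq> 0" for \<kappa> u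
  proof -
    obtain a d where ad: "\<kappa> = dg a d" "a \<in> GLO n" "d \<in> GLO n" using \<kappa>(1) unfolding C_def by blast
    have nz: "f (g0 k * dg a d * u) \<noteq> 0" using \<kappa>(3) unfolding ad by simp
    show ?thesis using orbit_bounded[OF k ad(2,3) e Kf z \<kappa>(2) nz] unfolding ad by simp
  qed
  \<comment> \<open>Pointwise vanishing of large averages, from the vanishing of the stalk.\<close>
  have large: "\<exists>R\<ge>1 / e. av R (g0 k * \<kappa>) = 0" if \<kappa>: "\<kappa> \<in> C" for \<kappa>
  proof -
    obtain a d where ad: "\<kappa> = dg a d" "a \<in> GLO n" "d \<in> GLO n" using \<kappa> unfolding C_def by blast
    have "rep_space (inflate r m \<rho>) \<subseteq> twisted_kernel (conj_rep (GL (n + n)) (g0 k * \<kappa>) (inflate r m \<rho>)) (td.Stab (g0 k * \<kappa>)) (psi_N \<psi> n)"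
      using stalk_vanishes[OF hyp k ad(2,3)] unfolding ad by simp
    from td.avg_zero_of_stalk[OF f K Kf' \<theta>K C_GL(1)[OF \<kappa>] BN(1)[OF e0] BN(2)[OF e0] BN(3) bnd[OF \<kappa>] this]
    obtain S where S: "finite S" "S \<subseteq> unip n n" "\<forall>A. subgroup A (GL (n + n)) \<longrightarrow> compactin (GL_topology (n + n)) A \<longrightarrow> A \<subseteq> unip n n \<longrightarrow>
      ball_N n (1 / e) \<subseteq> A \<longrightarrow> S \<subseteq> A \<longrightarrow> twisted_sum (GL (n + n)) td.V (psi_N \<psi> n) A (A \<inter> Congr e (n + n)) f (g0 k * \<kappa>) = 0"
      by blast
    obtain R where R: "R \<ge> 1 / e" "0 \<le> R" "S \<subseteq> ball_N n R" using ball_N_exhausts[OF S(1,2)] by blast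
    have "av R (g0 k * \<kappa>) = 0" unfolding av_def
      using S(3) BN(1)[OF R(2)] BN(2)[OF R(2)] BN(3) ball_N_mono[OF R(1)] R(3) by simp
    then show ?thesis using R(1) by blast
  qed
  then obtain R where R: "\<And>\<kappa>. \<kappa> \<in> C \<Longrightarrow> 1 / e \<le> R \<kappa>" "\<And>\<kappa>. \<kappa> \<in> C \<Longrightarrow> av (R \<kappa>) (g0 k * \<kappa>) = 0" by metis
  have R0: "0 \<le> R \<kappa>" if "\<kappa> \<in> C" for \<kappa> using R(1)[OF that] e0 by linarith
  have avV: "av t \<in> rep_space td.V" if "0 \<le> t" for t
    unfolding av_def by (rule td.avg_V(1)[OF f K Kf' \<theta>K BN(1)[OF that] BN(2)[OF that] BN(3)])
  have "\<exists>J. subgroup J (GL (n + n)) \<and> openin (GL_topology (n + n)) J \<and> (\<forall>l\<in>J. \<forall>g\<in>carrier (GL (n + n)). av (R \<kappa>) (g * l) = av (R \<kappa>) g)"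
    if "\<kappa> \<in> C" for \<kappa> using td.V_D(4)[OF avV[OF R0[OF that]]] by simp
  then obtain J where J: "\<And>\<kappa>. \<kappa> \<in> C \<Longrightarrow> subgroup (J \<kappa>) (GL (n + n))" "\<And>\<kappa>. \<kappa> \<in> C \<Longrightarrow> openin (GL_topology (n + n)) (J \<kappa>)"
    "\<And>\<kappa> l g. \<kappa> \<in> C \<Longrightarrow> l \<in> J \<kappa> \<Longrightarrow> g \<in> carrier (GL (n + n)) \<Longrightarrow> av (R \<kappa>) (g * l) = av (R \<kappa>) g" by metis
  have "compactin (GL_topology (n + n)) C"
  proof -
    let ?E = "\<lambda>i j. if (i < n) = (j < n) then 1 else (0::real)"
    have "C = {g \<in> carrier_mat (n + n) (n + n). (\<forall>i<n + n. \<forall>j<n + n. v (g $$ (i, j) - 0\<^sub>m (n + n) (n + n) $$ (i, j)) \<le> ?E i j) \<and> v (det g) = 1}" (is "_ = ?S")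
    proof (intro equalityI subsetI)
      fix g assume "g \<in> C"
      then obtain a d where ad: "g = dg a d" "a \<in> GLO n" "d \<in> GLO n" unfolding C_def by blast
      have c: "a \<in> carrier_mat n n" "d \<in> carrier_mat n n" using ad GLO_carrier by auto
      have G: "dg a d \<in> carrier_mat (n + n) (n + n)" "entries_le 1 (dg a d)" "v (det (dg a d)) = 1"
        using dg_GLO[OF ad(2,3)] unfolding GLO_def by auto
      have "v (dg a d $$ (i, j) - 0\<^sub>m (n + n) (n + n) $$ (i, j)) \<le> ?E i j" if ij: "i < n + n" "j < n + n" for i j
      proof (cases "(i < n) = (j < n)")
        case True then show ?thesis using entries_leD[OF G(2,1) ij] ij by simp
      next
        case False then show ?thesis using ij c unfolding dg_def by auto
      qed
      then show "g \<in> ?S" using G unfolding ad by simp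
    next
      fix g assume "g \<in> ?S"
      then have g: "g \<in> carrier_mat (n + n) (n + n)" "v (det g) = 1" and ge: "\<And>i j. i < n + n \<Longrightarrow> j < n + n \<Longrightarrow> v (g $$ (i, j)) \<le> ?E i j"
        by auto
      obtain a b c d where gb: "g = four_block_mat a b c d" "a \<in> carrier_mat n n" "b \<in> carrier_mat n n"
        "c \<in> carrier_mat n n" "d \<in> carrier_mat n n" using block_cases[OF g(1)] .
      have bz: "b = 0\<^sub>m n n"
      proof (rule eq_matI)
        fix i j assume "i < dim_row (0\<^sub>m n n :: 'f mat)" "j < dim_col (0\<^sub>m n n :: 'f mat)"
        then have ij: "i < n" "j < n" by auto
        have "g $$ (i, n + j) = b $$ (i, j)" unfolding gb(1) using ij gb(2-5) by simp
        then show "b $$ (i, j) = 0\<^sub>m n n $$ (i, j)" using ge[of i "n + j"] ij nonneg[of "b $$ (i, j)"] by (simp del: nonneg)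
      qed (use gb in auto)
      have cz: "c = 0\<^sub>m n n"
      proof (rule eq_matI)
        fix i j assume "i < dim_row (0\<^sub>m n n :: 'f mat)" "j < dim_col (0\<^sub>m n n :: 'f mat)"
        then have ij: "i < n" "j < n" by auto
        have "g $$ (n + i, j) = c $$ (i, j)" unfolding gb(1) using ij gb(2-5) by simp
        then show "c $$ (i, j) = 0\<^sub>m n n $$ (i, j)" using ge[of "n + i" j] ij nonneg[of "c $$ (i, j)"] by (simp del: nonneg)
      qed (use gb in auto)
      have gd: "g = dg a d" unfolding dg_def gb(1) bz cz ..
      have "det g = det a * det d" unfolding gb(1) bz cz by (rule det_four_block_mat_lower_left_zero[OF gb(2) _ refl gb(5)]) simp
      then have dt: "v (det a) * v (det d) = 1" using g(2) by (simp add: mult)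
      have m1: "entries_le 1 a"
      proof (rule entries_leI[OF gb(2)])
        fix i j assume ij: "i < n" "j < n"
        have "g $$ (i, j) = a $$ (i, j)" unfolding gb(1) using ij gb(2-5) by simp
        then show "v (a $$ (i, j)) \<le> 1" using ge[of i j] ij by simp
      qed
      have m2: "entries_le 1 d"
      proof (rule entries_leI[OF gb(5)])
        fix i j assume ij: "i < n" "j < n"
        have "g $$ (n + i, n + j) = d $$ (i, j)" unfolding gb(1) using ij gb(2-5) by simp
        then show "v (d $$ (i, j)) \<le> 1" using ge[of "n + i" "n + j"] ij by simp
      qed
      have le: "v (det a) \<le> 1" "v (det d) \<le> 1" using det_bound gb(2,5) m1 m2 by auto
      have "v (det a) * v (det d) \<le> v (det a)" "v (det a) * v (det d) \<le> v (det d)"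
        using mult_left_mono[OF le(2) nonneg[of "det a"]] mult_right_mono[OF le(1) nonneg[of "det d"]] by auto
      then have "v (det a) = 1" "v (det d) = 1" using dt le by linarith+
      then show "g \<in> C" unfolding C_def using gd gb(2,5) m1 m2 unfolding GLO_def by blast
    qed
    then show ?thesis using compact_pattern[of "0\<^sub>m (n + n) (n + n)" "n + n" ?E] by simp
  qed
  have "\<exists>\<F>. finite \<F> \<and> \<F> \<subseteq> (\<lambda>\<kappa>. \<kappa> <#\<^bsub>GL (n + n)\<^esub> J \<kappa>) ` C \<and> C \<subseteq> \<Union>\<F>"
  proof (rule compactinD[OF \<open>compactin (GL_topology (n + n)) C\<close>])
    show "openin (GL_topology (n + n)) U" if U: "U \<in> (\<lambda>\<kappa>. \<kappa> <#\<^bsub>GL (n + n)\<^esub> J \<kappa>) ` C" for U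
    proof -
      obtain \<kappa> where "\<kappa> \<in> C" "U = \<kappa> <#\<^bsub>GL (n + n)\<^esub> J \<kappa>" using U by blast
      then show ?thesis using td.left_open[OF J(2) C_GL(2)] by simp
    qed
    show "C \<subseteq> \<Union>((\<lambda>\<kappa>. \<kappa> <#\<^bsub>GL (n + n)\<^esub> J \<kappa>) ` C)"
    proof
      fix \<kappa> assume \<kappa>: "\<kappa> \<in> C"
      have "\<kappa> * 1\<^sub>m (n + n) \<in> \<kappa> <#\<^bsub>GL (n + n)\<^esub> J \<kappa>" unfolding l_coset_def
        using subgroup.one_closed[OF J(1)[OF \<kappa>]] by (auto intro: bexI[of _ "1\<^sub>m (n + n)"])
      then show "\<kappa> \<in> \<Union>((\<lambda>\<kappa>. \<kappa> <#\<^bsub>GL (n + n)\<^esub> J \<kappa>) ` C)" using \<kappa> GL_mat[OF C_GL(2)[OF \<kappa>]] by auto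
    qed
  qed
  then obtain \<F> where \<F>: "finite \<F>" "\<F> \<subseteq> (\<lambda>\<kappa>. \<kappa> <#\<^bsub>GL (n + n)\<^esub> J \<kappa>) ` C" "C \<subseteq> \<Union>\<F>" by blast
  obtain C' where C': "C' \<subseteq> C" "finite C'" "\<F> = (\<lambda>\<kappa>. \<kappa> <#\<^bsub>GL (n + n)\<^esub> J \<kappa>) ` C'" using finite_subset_image[OF \<F>(1,2)] by blast
  define Q where "Q = Max (insert (1 / e) (R ` C'))"
  have Q: "1 / e \<le> Q" "\<And>\<kappa>. \<kappa> \<in> C' \<Longrightarrow> R \<kappa> \<le> Q" unfolding Q_def using C'(2) by auto
  have Q0: "0 \<le> Q" using Q(1) e0 by linarith
  have "av Q (g0 k * dg a d * un n x) = 0" if ad: "a \<in> GLO n" "d \<in> GLO n" and x: "x \<in> carrier_mat n n" for a d x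
  proof -
    have \<kappa>: "dg a d \<in> C" unfolding C_def using ad by blast
    then obtain \<kappa>' where \<kappa>': "\<kappa>' \<in> C'" "dg a d \<in> \<kappa>' <#\<^bsub>GL (n + n)\<^esub> J \<kappa>'" using \<F>(3) unfolding C'(3) by blast
    have \<kappa>'C: "\<kappa>' \<in> C" using \<kappa>'(1) C'(1) by blast
    obtain l where l: "l \<in> J \<kappa>'" "dg a d = \<kappa>' * l" using \<kappa>'(2) unfolding l_coset_def by auto
    have lc: "l \<in> carrier (GL (n + n))" using subgroup.subset[OF J(1)[OF \<kappa>'C]] l(1) by blast
    have "g0 k * dg a d = g0 k * \<kappa>' * l" unfolding l(2)
      using assoc_mult_mat[OF g0_inverse(1)[OF k] GL_mat[OF C_GL(2)[OF \<kappa>'C]] GL_mat[OF lc]] by simp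
    then have z1: "av (R \<kappa>') (g0 k * dg a d) = 0" using J(3)[OF \<kappa>'C l(1) C_GL(1)[OF \<kappa>'C]] R(2)[OF \<kappa>'C] by simp
    note R' = R0[OF \<kappa>'C]
    have z2: "av Q (g0 k * dg a d) = 0" unfolding av_def
      by (rule td.avg_zero_orbit(2)[OF f K Kf' \<theta>K BN(1)[OF R'] BN(2)[OF R'] BN(3) C_GL(1)[OF \<kappa>]
          ball_N_mono[OF R(1)[OF \<kappa>'C]] bnd[OF \<kappa>] z1[unfolded av_def] BN(1)[OF Q0] BN(2)[OF Q0] BN(3) ball_N_mono[OF Q(2)[OF \<kappa>'(1)]]])
    have "un n x \<in> unip n n" unfolding unip_eq using x by blast
    from td.avg_zero_orbit(1)[OF f K Kf' \<theta>K BN(1)[OF Q0] BN(2)[OF Q0] BN(3) C_GL(1)[OF \<kappa>]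
          ball_N_mono[OF Q(1)] bnd[OF \<kappa>] z2[unfolded av_def] this]
    show ?thesis unfolding av_def by simp
  qed
  then show ?thesis unfolding av_def using Q0 by blast
qed

text \<open>Downward induction on the rank stratum: averaging kills a section on the lowest stratum that meets its
  support and does not change its class modulo the twisted kernel.\<close>

lemma stalks_vanish_imp_vanish:
  assumes hyp: "\<And>k. 2 * k \<le> r \<Longrightarrow> r \<le> n + k \<Longrightarrow> rep_space \<rho> \<subseteq> twisted_kernel \<rho> (Nk n r k) (psi_Nk \<psi> n r k)"
    and f: "f \<in> rep_space td.V"
  shows "f \<in> twisted_kernel td.V (unip n n) (psi_N \<psi> n)"
proof -
  interpret W: vector_space "rep_scale td.V" by (rule td.V_vector_space)
  note ker = twisted_kernel_subspace(1)[OF td.V_N, where \<theta> = "psi_N \<psi> n"]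
  have claim: "f \<in> twisted_kernel td.V (unip n n) (psi_N \<psi> n)"
    if "f \<in> rep_space td.V" "a + j = Suc n" "\<And>g. g \<in> carrier (GL (n + n)) \<Longrightarrow> rank_lt a g \<Longrightarrow> f g = 0" for f a j
    using that
  proof (induction j arbitrary: f a)
    case 0
    have "f g = 0" for g
    proof (cases "g \<in> carrier (GL (n + n))")
      case True then show ?thesis using "0"(3)[OF True] "0"(2) rank_lt_full by simp
    next
      case False then show ?thesis using td.V_D(2)[OF "0"(1)] by simp
    qed
    then have "f = 0" by (auto simp: fun_eq_iff)
    then show ?case using W.subspace_0[OF ker] by (simp only:)
  next
    case (Suc j)
    define k where "k = n - a"
    have a: "n - k = a" "a \<le> n" unfolding k_def using Suc(3) by auto
    note f = Suc(2) and z = Suc(4)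
    obtain J where J: "subgroup J (GL (n + n))" "openin (GL_topology (n + n)) J" "\<forall>l\<in>J. \<forall>g\<in>carrier (GL (n + n)). f (g * l) = f g"
      using td.V_D(4)[OF f] by auto
    have "1\<^sub>m (n + n) \<in> J" using subgroup.one_closed[OF J(1)] by simp
    then obtain e1 where e1: "0 < e1" "e1 < 1" "Congr e1 (n + n) \<subseteq> J" using Congr_small[OF J(2)] by blast
    obtain e2 where e2: "0 < e2" "e2 < 1" "\<forall>x. v x \<le> e2 \<longrightarrow> \<psi> x = 1" using \<psi>_small by blast
    define e where "e = min e1 e2"
    have e: "0 < e" "e < 1" "e \<le> e1" "e \<le> e2" using e1 e2 unfolding e_def by auto
    have Kf: "f (g * \<kappa>) = f g" if "\<kappa> \<in> Congr e (n + n)" "g \<in> carrier (GL (n + n))" for \<kappa> g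
      using Congr_mono[OF e(3)] e1(3) J(3) that by blast
    have \<psi>e: "\<forall>x. v x \<le> e \<longrightarrow> \<psi> x = 1" using e2(3) e(4) by (meson order_trans)
    have K: "subgroup (Congr e (n + n)) (GL (n + n))" "openin (GL_topology (n + n)) (Congr e (n + n))"
      using Congr_subgroup[of e "n + n"] Congr_open[of e "n + n"] e by auto
    have Kf': "\<And>\<kappa> g. \<kappa> \<in> Congr e (n + n) \<Longrightarrow> g \<in> carrier (GL (n + n)) \<Longrightarrow> f (g \<otimes>\<^bsub>GL (n + n)\<^esub> \<kappa>) = f g"
      using Kf by simp
    have \<theta>K: "\<And>x. x \<in> unip n n \<Longrightarrow> x \<in> Congr e (n + n) \<Longrightarrow> psi_N \<psi> n x = 1" using psi_N_Congr[OF \<psi>e] e by auto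
    \<comment> \<open>A point where the rank is at most a lies on the stratum of k, or f vanishes on its whole N-orbit.\<close>
    have small: "(k' = k \<and> admissible k) \<or> (\<forall>y\<in>carrier_mat n n. f (p * (g0 k' * dg b d) * un n x * un n y) = 0)"
      if k': "admissible k'" "p \<in> P" "b \<in> GLO n" "d \<in> GLO n" "x \<in> carrier_mat n n"
        and rk: "rank_lt (Suc a) (p * (g0 k' * dg b d) * un n x)" for k' p b d x
    proof (cases "k' = k")
      case False
      obtain b' where b': "b' \<in> GLO n" "b' \<in> carrier_mat n n" "b \<in> carrier_mat n n" "b * b' = 1\<^sub>m n" "b' * b = 1\<^sub>m n"
        using GLO_inverse'[OF k'(3)] .
      obtain d' where d': "d' \<in> GLO n" "d' \<in> carrier_mat n n" "d \<in> carrier_mat n n" "d * d' = 1\<^sub>m n" "d' * d = 1\<^sub>m n"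
        using GLO_inverse'[OF k'(4)] .
      note g = g0_inverse[OF k'(1)]
      note iff = rank_lt_iff[OF k'(2) g(1) b'(3) d'(3) b'(2) d'(2) b'(4) d'(4)]
      have "rank_lt (Suc a) (g0 k')" using rk unfolding iff[OF k'(5)] .
      then have "\<not> Suc a \<le> n - k'" using rank_lt_mono g0_not_rank[OF k'(1)] by blast
      then have "Suc (n - k') \<le> a" using False a k'(1) unfolding admissible_def k_def by linarith
      then have "rank_lt a (g0 k')" using rank_lt_mono[OF g0_rank[OF k'(1)]] by blast
      then have r: "rank_lt a (p * (g0 k' * dg b d) * un n y)" if "y \<in> carrier_mat n n" for y unfolding iff[OF that] .
      have pG: "p * (g0 k' * dg b d) \<in> carrier (GL (n + n))"
        using GL_mult[OF _ conj_dg(2)[OF k'(1) b'(3) d'(3) b'(2) d'(2) b'(4) d'(4) k'(5)], of p] k'(2) unfolding P_iff by blast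
      have "f (p * (g0 k' * dg b d) * un n x * un n y) = 0" if y: "y \<in> carrier_mat n n" for y
      proof -
        have "p * (g0 k' * dg b d) * un n x * un n y = p * (g0 k' * dg b d) * un n (x + y)"
          using assoc_mult_mat[OF GL_mat[OF pG] un_carrier[OF k'(5)] un_carrier[OF y]] un_mult[OF k'(5) y] by simp
        then show ?thesis using z[OF GL_mult[OF pG un_inv(2)[of "x + y" n]] r[of "x + y"]] k'(5) y by simp
      qed
      then show ?thesis by blast
    qed (use that in blast)
    have "\<exists>f1\<in>rep_space td.V. (f1 \<in> twisted_kernel td.V (unip n n) (psi_N \<psi> n) \<longrightarrow> f \<in> twisted_kernel td.V (unip n n) (psi_N \<psi> n)) \<and>
      (\<forall>g\<in>carrier (GL (n + n)). rank_lt (Suc a) g \<longrightarrow> f1 g = 0)"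
    proof (cases "admissible k")
      case True
      have z': "f g = 0" if "g \<in> carrier (GL (n + n))" "rank_lt (n - k) g" for g using z that unfolding a(1) by blast
      obtain R where R: "0 \<le> R" and Rz: "\<forall>b\<in>GLO n. \<forall>d\<in>GLO n. \<forall>x\<in>carrier_mat n n.
        twisted_sum (GL (n + n)) td.V (psi_N \<psi> n) (ball_N n R) (ball_N n R \<inter> Congr e (n + n)) f (g0 k * dg b d * un n x) = 0"
        using uniform_average[OF hyp True f e(1,2) Kf \<psi>e z'] by blast
      define f1 where "f1 = twisted_sum (GL (n + n)) td.V (psi_N \<psi> n) (ball_N n R) (ball_N n R \<inter> Congr e (n + n)) f"
      note A = ball_N_subgroup[OF R, of n] ball_N_compact[OF R, of n] ball_N_unip[of n R]
      note avV = td.avg_V[OF f K Kf' \<theta>K A, folded f1_def]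
      have "f1 g = 0" if g: "g \<in> carrier (GL (n + n))" "rank_lt (Suc a) g" for g
      proof -
        obtain k' p b d x where k': "admissible k'" "p \<in> P" "b \<in> GLO n" "d \<in> GLO n" "x \<in> carrier_mat n n"
          and ge: "g = p * (g0 k' * dg b d) * un n x" using double_coset[OF g(1)] .
        from small[OF k' g(2)[unfolded ge]] show ?thesis
        proof (elim disjE conjE)
          assume kk: "k' = k"
          have DG: "g0 k' * dg b d \<in> carrier (GL (n + n))"
            using g0_inverse(5)[OF k'(1)] dg_GLO[OF k'(3,4)] GLO_GL by (intro GL_mult) auto
          have pG: "p \<in> carrier (GL (n + n))" using k'(2) unfolding P_iff by blast
          have gg: "g = p * (g0 k' * dg b d * un n x)"
            unfolding ge by (rule assoc_mult_mat[OF GL_mat[OF pG] GL_mat[OF DG] un_carrier[OF k'(5)]])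
          have "f1 (g0 k' * dg b d * un n x) = 0" unfolding f1_def kk using Rz k'(3-5) by blast
          from td.H_conj_zero[OF avV(1) k'(2) GL_mult[OF DG un_inv(2)[OF k'(5)]] this]
          show "f1 g = 0" unfolding gg by simp
        next
          assume nz: "\<forall>y\<in>carrier_mat n n. f (p * (g0 k' * dg b d) * un n x * un n y) = 0"
          show "f1 g = 0"
          proof (rule ccontr)
            assume "f1 g \<noteq> 0"
            from td.avg_zero_at_supp[OF f K Kf' \<theta>K A g(1) this[unfolded f1_def]]
            obtain u where u: "u \<in> ball_N n R" "f (g * u) \<noteq> 0" by auto
            then obtain y where "y \<in> carrier_mat n n" "u = un n y" unfolding ball_N_def by auto
            then show False using nz u(2) unfolding ge by simp
          qed
        qed
      qed
      then show ?thesis using avV by blast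
    next
      case False
      have "f g = 0" if g: "g \<in> carrier (GL (n + n))" "rank_lt (Suc a) g" for g
      proof -
        obtain k' p b d x where k': "admissible k'" "p \<in> P" "b \<in> GLO n" "d \<in> GLO n" "x \<in> carrier_mat n n"
          and ge: "g = p * (g0 k' * dg b d) * un n x" using double_coset[OF g(1)] .
        have "f (g * un n (0\<^sub>m n n)) = 0" using small[OF k' g(2)[unfolded ge]] False unfolding ge by auto
        then show ?thesis unfolding un_zero using GL_mat[OF g(1)] by simp
      qed
      then show ?thesis using f by blast
    qed
    then obtain f1 where f1: "f1 \<in> rep_space td.V" "f1 \<in> twisted_kernel td.V (unip n n) (psi_N \<psi> n) \<Longrightarrow> f \<in> twisted_kernel td.V (unip n n) (psi_N \<psi> n)"
      "\<And>g. g \<in> carrier (GL (n + n)) \<Longrightarrow> rank_lt (Suc a) g \<Longrightarrow> f1 g = 0" by blast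
    have "Suc a + j = Suc n" using Suc(3) by simp
    from Suc(1)[OF f1(1) this f1(3)] show ?case by (rule f1(2))
  qed
  show ?thesis by (rule claim[OF f, of 0 "Suc n"]) (use rank_lt_zero in auto)
qed

lemma nonzero_iff:
  "twisted_jacquet_nonzero td.V (unip n n) (psi_N \<psi> n) \<longleftrightarrow>
    (\<exists>k. 2 * k \<le> r \<and> r \<le> n + k \<and> twisted_jacquet_nonzero \<rho> (Nk n r k) (psi_Nk \<psi> n r k))"
proof
  show "twisted_jacquet_nonzero td.V (unip n n) (psi_N \<psi> n)"
    if "\<exists>k. 2 * k \<le> r \<and> r \<le> n + k \<and> twisted_jacquet_nonzero \<rho> (Nk n r k) (psi_Nk \<psi> n r k)"
    using that stalk_imp_nonzero by blast
  assume nz: "twisted_jacquet_nonzero td.V (unip n n) (psi_N \<psi> n)"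
  show "\<exists>k. 2 * k \<le> r \<and> r \<le> n + k \<and> twisted_jacquet_nonzero \<rho> (Nk n r k) (psi_Nk \<psi> n r k)"
  proof (rule ccontr)
    assume no: "\<not> ?thesis"
    have "rep_space \<rho> \<subseteq> twisted_kernel \<rho> (Nk n r k) (psi_Nk \<psi> n r k)" if "2 * k \<le> r" "r \<le> n + k" for k
    proof -
      have "\<not> twisted_jacquet_nonzero \<rho> (Nk n r k) (psi_Nk \<psi> n r k)" using no that by blast
      then show ?thesis unfolding Nk_nonzero_iff[OF that] by blast
    qed
    from stalks_vanish_imp_vanish[OF this] show False using nz unfolding twisted_jacquet_nonzero_iff[OF td.V_N] by blast
  qed
qed

end

theorem theorem1p1:
  fixes \<psi>\<^sub>0 :: "'f::{field,topological_space} \<Rightarrow> complex"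
    and \<rho> :: "('f mat, 'w::ab_group_add) rep"
    and n r :: nat
  assumes "nonarch_local_field TYPE('f) \<or> finite_discrete_field TYPE('f)"
    and "nontrivial_additive_character \<psi>\<^sub>0"
    and "1 \<le> n" and "1 \<le> r" and "r < 2 * n"
    and "smooth_rep (subgrp (GL (2*n)) (levi r (2*n - r)))
           (subtopology (GL_topology (2*n)) (levi r (2*n - r))) \<rho>"
  shows "twisted_jacquet_nonzero (parabolic_induction r (2*n - r) \<rho>) (unip n n) (psi_N \<psi>\<^sub>0 n) \<longleftrightarrow>
    (\<exists>k::nat. max 0 (int r - int n) \<le> int k \<and> int k \<le> \<lfloor>real r / 2\<rfloor> \<and>
       twisted_jacquet_nonzero \<rho> (Nk n r k) (psi_Nk \<psi>\<^sub>0 n r k))"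
proof -
  obtain v :: "'f \<Rightarrow> real" where "abs_field v" using ex_abs_field[OF assms(1)] by blast
  have rm: "r + (2*n - r) = n + n" using assms(5) by simp
  interpret abs_field v by fact
  interpret induced_setting v \<psi>\<^sub>0 n r "2*n - r" \<rho>
    using assms(2,6) rm by unfold_locales (simp_all add: mult_2)
  have range: "max 0 (int r - int n) \<le> int k \<and> int k \<le> \<lfloor>real r / 2\<rfloor> \<longleftrightarrow> 2 * k \<le> r \<and> r \<le> n + k" for k :: nat
  proof -
    have "int k \<le> \<lfloor>real r / 2\<rfloor> \<longleftrightarrow> 2 * k \<le> r" by (auto simp: le_floor_iff)
    then show ?thesis by auto
  qed
  have "parabolic_induction r (2*n - r) \<rho> = td.V" unfolding parabolic_induction_def rm ..
  then show ?thesis using nonzero_iff by (simp only: range conj_assoc[symmetric])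
qed

end
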